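(* The categories $\mathrm{MHS}$ and $\mathrm{SHS}$ are equivalent. This equivalence is additive, and compatible with tensor products and duals.
   Context: $\mathrm{MHS}$ is the category of finite-dimensional real mixed Hodge structures: finite-dimensional real vector spaces $V$ with an exhaustive Hausdorff increasing filtration $W$ on $V$ and an exhaustive decreasing filtration $F$ on $V\otimes\mathbb C$ such that $\mathrm{gr}_F^i\mathrm{gr}_{\bar F}^j\mathrm{gr}^W_n(V\otimes\mathbb C)=0$ for $i+j\ne n$. $S=\prod_{\mathbb C/\mathbb R}\mathbb G_m$ is the Deligne torus; $S$-representations are real Hodge structures, $\lambda$ acting on $V^{pq}$ by $\lambda^p\bar\lambda^q$. $\mathrm{SL}_2$ has coordinates $\left(\begin{smallmatrix}u&v\\ x&y\end{smallmatrix}\right)$ and $S$-action $(\lambda,A)\mapsto\left(\begin{smallmatrix}1&0\\0&\lambda\bar\lambda\end{smallmatrix}\right)A\left(\begin{smallmatrix}\Re\lambda&\Im\lambda\\-\Im\lambda&\Re\lambda\end{smallmatrix}\right)^{-1}$. $\mathrm{row}_2\colon\mathrm{SL}_2\to\mathbb A^2$ is projection to the second row, so $\mathrm{row}_2^\sharp O(\mathbb A^2)=\mathbb R[x,y]\subset O(\mathrm{SL}_2)$ is an $S$-equivariant subring, in which (after complexifying) $x-iy$ has type $(1,0)$ and $x+iy$ has type $(0,1)$. $(-1)$ denotes the Tate twist by $\mathbb R(-1)$, of type $(1,1)$. $\mathrm{SHS}$ is the category of pairs $(V,\beta)$, where $V$ is a finite-dimensional $S$-representation in real vector spaces and $\beta\colon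 V\to V\otimes\mathrm{row}_2^\sharp O(\mathbb A^2)(-1)$ is $S$-equivariant. A morphism $(V,\beta)\to(V',\beta')$ is an $S$-equivariant map $f\colon V\to V'$ with $\beta'\circ f=(f\otimes\mathrm{id})\circ\beta$. The tensor product is $(U,\alpha)\otimes(V,\beta)=(U\otimes V,\alpha\otimes\mathrm{id}+\mathrm{id}\otimes\beta)$. The dual is $(V,\beta)^\vee=(V^\vee,\beta^\vee)$, where $\beta^\vee\colon V^\vee\to V^\vee\otimes\mathrm{row}_2^\sharp O(\mathbb A^2)(-1)$ is the map arising from $\beta$ by taking duals (with the sign for which $\mathrm{Hom}_{\mathrm{SHS}}((V,\beta),(V',\beta'))\cong\mathrm{Hom}_{\mathrm{SHS}}((\mathbb R,0),(V,\beta)^\vee\otimes(V',\beta'))$).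
   Formalization: The Hodge filtration F is required to be Hausdorff as well as exhaustive; otherwise V=R in weight 0 with F^p=V⊗C for all p would be in MHS, giving a mono-epi from the unit that is not invertible, whereas SHS is abelian. *)

theory Defs
  imports
    "Jordan_Normal_Form.Matrix"
    "Jordan_Normal_Form.VS_Connect"
    "HOL-Computational_Algebra.Polynomial"
begin

section \<open>Categories, tensor categories, functors\<close>

text \<open>
  Morphisms do not determine their source and target (below they are matrices), so the hom-sets
  need not be disjoint, and the action of a functor on a morphism is also given the source and
  the target.
\<close>

record ('o, 'm) cat =
  Obj :: "'o set"
  Hom :: "'o \<Rightarrow> 'o \<Rightarrow> 'm set"
  Id :: "'o \<Rightarrow> 'm"
  Cmp :: "'m \<Rightarrow> 'm \<Rightarrow> 'm"  (infixl \<open>\<odot>\<index>\<close> 70)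

record ('o, 'm) preadditive_cat = "('o, 'm) cat" +
  HAdd :: "'m \<Rightarrow> 'm \<Rightarrow> 'm"
  HZero :: "'o \<Rightarrow> 'o \<Rightarrow> 'm"

record ('o, 'm) tensor_cat = "('o, 'm) preadditive_cat" +
  TensO :: "'o \<Rightarrow> 'o \<Rightarrow> 'o"  (infixr \<open>\<boxtimes>\<index>\<close> 75)
  TensM :: "'m \<Rightarrow> 'm \<Rightarrow> 'm"  (infixr \<open>\<boxdot>\<index>\<close> 75)
  UnitO :: "'o"
  Assoc :: "'o \<Rightarrow> 'o \<Rightarrow> 'o \<Rightarrow> 'm"
  LUnit :: "'o \<Rightarrow> 'm"
  RUnit :: "'o \<Rightarrow> 'm"
  Braid :: "'o \<Rightarrow> 'o \<Rightarrow> 'm"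
  DualO :: "'o \<Rightarrow> 'o"
  DualM :: "'m \<Rightarrow> 'm"
  Ev :: "'o \<Rightarrow> 'm"
  Coev :: "'o \<Rightarrow> 'm"

definition inverse_arrows :: "('o, 'm, 'z) cat_scheme \<Rightarrow> 'o \<Rightarrow> 'o \<Rightarrow> 'm \<Rightarrow> 'm \<Rightarrow> bool" where
  "inverse_arrows C X Y f g \<longleftrightarrow> f \<in> Hom C X Y \<and> g \<in> Hom C Y X
     \<and> g \<odot>\<^bsub>C\<^esub> f = Id C X \<and> f \<odot>\<^bsub>C\<^esub> g = Id C Y"

definition is_iso :: "('o, 'm, 'z) cat_scheme \<Rightarrow> 'o \<Rightarrow> 'o \<Rightarrow> 'm \<Rightarrow> bool" where
  "is_iso C X Y f \<longleftrightarrow> (\<exists>g. inverse_arrows C X Y f g)"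

locale category =
  fixes C :: "('o, 'm, 'z) cat_scheme" (structure)
  assumes Id_hom: "X \<in> Obj C \<Longrightarrow> Id C X \<in> Hom C X X"
    and Cmp_hom: "\<lbrakk>X \<in> Obj C; Y \<in> Obj C; Z \<in> Obj C; f \<in> Hom C X Y; g \<in> Hom C Y Z\<rbrakk>
          \<Longrightarrow> g \<odot> f \<in> Hom C X Z"
    and Id_left: "\<lbrakk>X \<in> Obj C; Y \<in> Obj C; f \<in> Hom C X Y\<rbrakk> \<Longrightarrow> Id C Y \<odot> f = f"
    and Id_right: "\<lbrakk>X \<in> Obj C; Y \<in> Obj C; f \<in> Hom C X Y\<rbrakk> \<Longrightarrow> f \<odot> Id C X = f"
    and Cmp_assoc: "\<lbrakk>X \<in> Obj C; Y \<in> Obj C; Z \<in> Obj C; U \<in> Obj C;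
          f \<in> Hom C X Y; g \<in> Hom C Y Z; h \<in> Hom C Z U\<rbrakk>
          \<Longrightarrow> (h \<odot> g) \<odot> f = h \<odot> (g \<odot> f)"

locale preadditive_category = category C
  for C :: "('o, 'm, 'z) preadditive_cat_scheme" (structure) +
  assumes Hom_group: "\<lbrakk>X \<in> Obj C; Y \<in> Obj C\<rbrakk>
          \<Longrightarrow> comm_group \<lparr>carrier = Hom C X Y, monoid.mult = HAdd C, one = HZero C X Y\<rparr>"
    and Cmp_add_right: "\<lbrakk>X \<in> Obj C; Y \<in> Obj C; Z \<in> Obj C;
          f \<in> Hom C X Y; f' \<in> Hom C X Y; g \<in> Hom C Y Z\<rbrakk>
          \<Longrightarrow> g \<odot> HAdd C f f' = HAdd C (g \<odot> f) (g \<odot> f')"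
    and Cmp_add_left: "\<lbrakk>X \<in> Obj C; Y \<in> Obj C; Z \<in> Obj C;
          f \<in> Hom C X Y; g \<in> Hom C Y Z; g' \<in> Hom C Y Z\<rbrakk>
          \<Longrightarrow> HAdd C g g' \<odot> f = HAdd C (g \<odot> f) (g' \<odot> f)"

locale symmetric_monoidal_category = category C
  for C :: "('o, 'm, 'z) tensor_cat_scheme" (structure) +
  assumes Unit_obj: "UnitO C \<in> Obj C"
    and Tens_obj: "\<lbrakk>X \<in> Obj C; Y \<in> Obj C\<rbrakk> \<Longrightarrow> X \<boxtimes> Y \<in> Obj C"
    and Tens_hom: "\<lbrakk>X \<in> Obj C; Y \<in> Obj C; X' \<in> Obj C; Y' \<in> Obj C;
          f \<in> Hom C X X'; g \<in> Hom C Y Y'\<rbrakk> \<Longrightarrow> f \<boxdot> g \<in> Hom C (X \<boxtimes> Y) (X' \<boxtimes> Y')"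
    and Tens_Id: "\<lbrakk>X \<in> Obj C; Y \<in> Obj C\<rbrakk> \<Longrightarrow> Id C X \<boxdot> Id C Y = Id C (X \<boxtimes> Y)"
    and Tens_Cmp: "\<lbrakk>X \<in> Obj C; Y \<in> Obj C; X' \<in> Obj C; Y' \<in> Obj C; X'' \<in> Obj C; Y'' \<in> Obj C;
          f \<in> Hom C X X'; g \<in> Hom C Y Y'; f' \<in> Hom C X' X''; g' \<in> Hom C Y' Y''\<rbrakk>
          \<Longrightarrow> (f' \<odot> f) \<boxdot> (g' \<odot> g) = (f' \<boxdot> g') \<odot> (f \<boxdot> g)"
    and Assoc_iso: "\<lbrakk>X \<in> Obj C; Y \<in> Obj C; Z \<in> Obj C\<rbrakk>
          \<Longrightarrow> is_iso C ((X \<boxtimes> Y) \<boxtimes> Z) (X \<boxtimes> (Y \<boxtimes> Z)) (Assoc C X Y Z)"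
    and Assoc_natural: "\<lbrakk>X \<in> Obj C; Y \<in> Obj C; Z \<in> Obj C; X' \<in> Obj C; Y' \<in> Obj C; Z' \<in> Obj C;
          f \<in> Hom C X X'; g \<in> Hom C Y Y'; h \<in> Hom C Z Z'\<rbrakk>
          \<Longrightarrow> Assoc C X' Y' Z' \<odot> ((f \<boxdot> g) \<boxdot> h) = (f \<boxdot> (g \<boxdot> h)) \<odot> Assoc C X Y Z"
    and LUnit_iso: "X \<in> Obj C \<Longrightarrow> is_iso C (UnitO C \<boxtimes> X) X (LUnit C X)"
    and LUnit_natural: "\<lbrakk>X \<in> Obj C; X' \<in> Obj C; f \<in> Hom C X X'\<rbrakk>
          \<Longrightarrow> LUnit C X' \<odot> (Id C (UnitO C) \<boxdot> f) = f \<odot> LUnit C X"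
    and RUnit_iso: "X \<in> Obj C \<Longrightarrow> is_iso C (X \<boxtimes> UnitO C) X (RUnit C X)"
    and RUnit_natural: "\<lbrakk>X \<in> Obj C; X' \<in> Obj C; f \<in> Hom C X X'\<rbrakk>
          \<Longrightarrow> RUnit C X' \<odot> (f \<boxdot> Id C (UnitO C)) = f \<odot> RUnit C X"
    and Braid_iso: "\<lbrakk>X \<in> Obj C; Y \<in> Obj C\<rbrakk> \<Longrightarrow> is_iso C (X \<boxtimes> Y) (Y \<boxtimes> X) (Braid C X Y)"
    and Braid_natural: "\<lbrakk>X \<in> Obj C; Y \<in> Obj C; X' \<in> Obj C; Y' \<in> Obj C;
          f \<in> Hom C X X'; g \<in> Hom C Y Y'\<rbrakk>
          \<Longrightarrow> Braid C X' Y' \<odot> (f \<boxdot> g) = (g \<boxdot> f) \<odot> Braid C X Y"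
    and Pentagon: "\<lbrakk>X \<in> Obj C; Y \<in> Obj C; Z \<in> Obj C; U \<in> Obj C\<rbrakk>
          \<Longrightarrow> Assoc C X Y (Z \<boxtimes> U) \<odot> Assoc C (X \<boxtimes> Y) Z U
            = (Id C X \<boxdot> Assoc C Y Z U) \<odot> Assoc C X (Y \<boxtimes> Z) U \<odot> (Assoc C X Y Z \<boxdot> Id C U)"
    and Triangle: "\<lbrakk>X \<in> Obj C; Y \<in> Obj C\<rbrakk>
          \<Longrightarrow> (Id C X \<boxdot> LUnit C Y) \<odot> Assoc C X (UnitO C) Y = RUnit C X \<boxdot> Id C Y"
    and Hexagon: "\<lbrakk>X \<in> Obj C; Y \<in> Obj C; Z \<in> Obj C\<rbrakk>
          \<Longrightarrow> Assoc C Y Z X \<odot> Braid C X (Y \<boxtimes> Z) \<odot> Assoc C X Y Z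
            = (Id C Y \<boxdot> Braid C X Z) \<odot> Assoc C Y X Z \<odot> (Braid C X Y \<boxdot> Id C Z)"
    and Symmetry: "\<lbrakk>X \<in> Obj C; Y \<in> Obj C\<rbrakk> \<Longrightarrow> Braid C Y X \<odot> Braid C X Y = Id C (X \<boxtimes> Y)"

locale rigid_tensor_category = preadditive_category C + symmetric_monoidal_category C
  for C :: "('o, 'm, 'z) tensor_cat_scheme" (structure) +
  assumes Tens_add_left: "\<lbrakk>X \<in> Obj C; Y \<in> Obj C; X' \<in> Obj C; Y' \<in> Obj C;
          f \<in> Hom C X X'; f' \<in> Hom C X X'; g \<in> Hom C Y Y'\<rbrakk>
          \<Longrightarrow> HAdd C f f' \<boxdot> g = HAdd C (f \<boxdot> g) (f' \<boxdot> g)"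
    and Tens_add_right: "\<lbrakk>X \<in> Obj C; Y \<in> Obj C; X' \<in> Obj C; Y' \<in> Obj C;
          f \<in> Hom C X X'; g \<in> Hom C Y Y'; g' \<in> Hom C Y Y'\<rbrakk>
          \<Longrightarrow> f \<boxdot> HAdd C g g' = HAdd C (f \<boxdot> g) (f \<boxdot> g')"
    and Dual_obj: "X \<in> Obj C \<Longrightarrow> DualO C X \<in> Obj C"
    and Dual_hom: "\<lbrakk>X \<in> Obj C; Y \<in> Obj C; f \<in> Hom C X Y\<rbrakk>
          \<Longrightarrow> DualM C f \<in> Hom C (DualO C Y) (DualO C X)"
    and Ev_hom: "X \<in> Obj C \<Longrightarrow> Ev C X \<in> Hom C (DualO C X \<boxtimes> X) (UnitO C)"
    and Coev_hom: "X \<in> Obj C \<Longrightarrow> Coev C X \<in> Hom C (UnitO C) (X \<boxtimes> DualO C X)"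
    and Ev_Coev: "X \<in> Obj C
          \<Longrightarrow> RUnit C X \<odot> (Id C X \<boxdot> Ev C X) \<odot> Assoc C X (DualO C X) X \<odot> (Coev C X \<boxdot> Id C X)
            = LUnit C X"
    and Coev_Ev: "\<lbrakk>X \<in> Obj C;
          inverse_arrows C ((DualO C X \<boxtimes> X) \<boxtimes> DualO C X) (DualO C X \<boxtimes> (X \<boxtimes> DualO C X))
            (Assoc C (DualO C X) X (DualO C X)) a\<rbrakk>
          \<Longrightarrow> LUnit C (DualO C X) \<odot> (Ev C X \<boxdot> Id C (DualO C X)) \<odot> a
                \<odot> (Id C (DualO C X) \<boxdot> Coev C X)
            = RUnit C (DualO C X)"
    and Ev_Dual: "\<lbrakk>X \<in> Obj C; Y \<in> Obj C; f \<in> Hom C X Y\<rbrakk>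
          \<Longrightarrow> Ev C X \<odot> (DualM C f \<boxdot> Id C X) = Ev C Y \<odot> (Id C (DualO C Y) \<boxdot> f)"

record ('o, 'm, 'p, 'n) ftor =
  FObj :: "'o \<Rightarrow> 'p"
  FMor :: "'o \<Rightarrow> 'o \<Rightarrow> 'm \<Rightarrow> 'n"

locale cat_functor = source: category C + target: category D
  for C :: "('o, 'm, 'y) cat_scheme" and D :: "('p, 'n, 'z) cat_scheme" +
  fixes F :: "('o, 'm, 'p, 'n) ftor"
  assumes FObj_obj: "X \<in> Obj C \<Longrightarrow> FObj F X \<in> Obj D"
    and FMor_hom: "\<lbrakk>X \<in> Obj C; Y \<in> Obj C; f \<in> Hom C X Y\<rbrakk>
          \<Longrightarrow> FMor F X Y f \<in> Hom D (FObj F X) (FObj F Y)"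
    and FMor_Id: "X \<in> Obj C \<Longrightarrow> FMor F X X (Id C X) = Id D (FObj F X)"
    and FMor_Cmp: "\<lbrakk>X \<in> Obj C; Y \<in> Obj C; Z \<in> Obj C; f \<in> Hom C X Y; g \<in> Hom C Y Z\<rbrakk>
          \<Longrightarrow> FMor F X Z (g \<odot>\<^bsub>C\<^esub> f) = FMor F Y Z g \<odot>\<^bsub>D\<^esub> FMor F X Y f"

definition id_ftor :: "('o, 'm, 'o, 'm) ftor" where
  "id_ftor = \<lparr>FObj = (\<lambda>X. X), FMor = (\<lambda>X Y f. f)\<rparr>"

definition comp_ftor ::
  "('p, 'n, 'q, 'l) ftor \<Rightarrow> ('o, 'm, 'p, 'n) ftor \<Rightarrow> ('o, 'm, 'q, 'l) ftor" where
  "comp_ftor G F = \<lparr>FObj = (\<lambda>X. FObj G (FObj F X)),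
     FMor = (\<lambda>X Y f. FMor G (FObj F X) (FObj F Y) (FMor F X Y f))\<rparr>"

locale natural_iso = F: cat_functor C D F + G: cat_functor C D G
  for C :: "('o, 'm, 'y) cat_scheme" and D :: "('p, 'n, 'z) cat_scheme" and F G +
  fixes t :: "'o \<Rightarrow> 'n"
  assumes component_iso: "X \<in> Obj C \<Longrightarrow> is_iso D (FObj F X) (FObj G X) (t X)"
    and natural: "\<lbrakk>X \<in> Obj C; Y \<in> Obj C; f \<in> Hom C X Y\<rbrakk>
          \<Longrightarrow> t Y \<odot>\<^bsub>D\<^esub> FMor F X Y f = FMor G X Y f \<odot>\<^bsub>D\<^esub> t X"

locale equivalence_of_categories =
    F: cat_functor C D F + G: cat_functor D C G
    + unit: natural_iso C C id_ftor "comp_ftor G F" \<eta>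
    + counit: natural_iso D D "comp_ftor F G" id_ftor \<epsilon>
  for C :: "('o, 'm, 'y) cat_scheme" and D :: "('p, 'n, 'z) cat_scheme" and F G \<eta> \<epsilon>

locale additive_functor =
    source: preadditive_category C + target: preadditive_category D + cat_functor C D F
  for C :: "('o, 'm, 'y) preadditive_cat_scheme"
    and D :: "('p, 'n, 'z) preadditive_cat_scheme" and F +
  assumes FMor_add: "\<lbrakk>X \<in> Obj C; Y \<in> Obj C; f \<in> Hom C X Y; g \<in> Hom C X Y\<rbrakk>
          \<Longrightarrow> FMor F X Y (HAdd C f g) = HAdd D (FMor F X Y f) (FMor F X Y g)"

text \<open>Strong symmetric monoidal functors, i.e.\ tensor functors in the sense of Deligne--Milne.\<close>

locale tensor_functor =
    source: symmetric_monoidal_category C + target: symmetric_monoidal_category D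
    + cat_functor C D F
  for C :: "('o, 'm, 'y) tensor_cat_scheme" and D :: "('p, 'n, 'z) tensor_cat_scheme" and F +
  fixes \<mu> :: "'o \<Rightarrow> 'o \<Rightarrow> 'n" and \<iota> :: 'n
  assumes mu_iso: "\<lbrakk>X \<in> Obj C; Y \<in> Obj C\<rbrakk>
          \<Longrightarrow> is_iso D (FObj F X \<boxtimes>\<^bsub>D\<^esub> FObj F Y) (FObj F (X \<boxtimes>\<^bsub>C\<^esub> Y)) (\<mu> X Y)"
    and mu_natural: "\<lbrakk>X \<in> Obj C; Y \<in> Obj C; X' \<in> Obj C; Y' \<in> Obj C;
          f \<in> Hom C X X'; g \<in> Hom C Y Y'\<rbrakk>
          \<Longrightarrow> \<mu> X' Y' \<odot>\<^bsub>D\<^esub> (FMor F X X' f \<boxdot>\<^bsub>D\<^esub> FMor F Y Y' g)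
            = FMor F (X \<boxtimes>\<^bsub>C\<^esub> Y) (X' \<boxtimes>\<^bsub>C\<^esub> Y') (f \<boxdot>\<^bsub>C\<^esub> g) \<odot>\<^bsub>D\<^esub> \<mu> X Y"
    and iota_iso: "is_iso D (UnitO D) (FObj F (UnitO C)) \<iota>"
    and mu_assoc: "\<lbrakk>X \<in> Obj C; Y \<in> Obj C; Z \<in> Obj C\<rbrakk>
          \<Longrightarrow> FMor F ((X \<boxtimes>\<^bsub>C\<^esub> Y) \<boxtimes>\<^bsub>C\<^esub> Z) (X \<boxtimes>\<^bsub>C\<^esub> (Y \<boxtimes>\<^bsub>C\<^esub> Z)) (Assoc C X Y Z)
                \<odot>\<^bsub>D\<^esub> \<mu> (X \<boxtimes>\<^bsub>C\<^esub> Y) Z \<odot>\<^bsub>D\<^esub> (\<mu> X Y \<boxdot>\<^bsub>D\<^esub> Id D (FObj F Z))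
            = \<mu> X (Y \<boxtimes>\<^bsub>C\<^esub> Z) \<odot>\<^bsub>D\<^esub> (Id D (FObj F X) \<boxdot>\<^bsub>D\<^esub> \<mu> Y Z)
                \<odot>\<^bsub>D\<^esub> Assoc D (FObj F X) (FObj F Y) (FObj F Z)"
    and mu_braid: "\<lbrakk>X \<in> Obj C; Y \<in> Obj C\<rbrakk>
          \<Longrightarrow> FMor F (X \<boxtimes>\<^bsub>C\<^esub> Y) (Y \<boxtimes>\<^bsub>C\<^esub> X) (Braid C X Y) \<odot>\<^bsub>D\<^esub> \<mu> X Y
            = \<mu> Y X \<odot>\<^bsub>D\<^esub> Braid D (FObj F X) (FObj F Y)"
    and mu_lunit: "X \<in> Obj C
          \<Longrightarrow> FMor F (UnitO C \<boxtimes>\<^bsub>C\<^esub> X) X (LUnit C X) \<odot>\<^bsub>D\<^esub> \<mu> (UnitO C) X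
                \<odot>\<^bsub>D\<^esub> (\<iota> \<boxdot>\<^bsub>D\<^esub> Id D (FObj F X))
            = LUnit D (FObj F X)"
    and mu_runit: "X \<in> Obj C
          \<Longrightarrow> FMor F (X \<boxtimes>\<^bsub>C\<^esub> UnitO C) X (RUnit C X) \<odot>\<^bsub>D\<^esub> \<mu> X (UnitO C)
                \<odot>\<^bsub>D\<^esub> (Id D (FObj F X) \<boxdot>\<^bsub>D\<^esub> \<iota>)
            = RUnit D (FObj F X)"

locale dual_preserving_functor =
    source: rigid_tensor_category C + target: rigid_tensor_category D
    + tensor_functor C D F \<mu> \<iota>
  for C :: "('o, 'm, 'y) tensor_cat_scheme" and D :: "('p, 'n, 'z) tensor_cat_scheme"
    and F \<mu> \<iota> +
  fixes \<nu> :: "'o \<Rightarrow> 'n"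
  assumes nu_iso: "X \<in> Obj C
          \<Longrightarrow> is_iso D (FObj F (DualO C X)) (DualO D (FObj F X)) (\<nu> X)"
    and nu_natural: "\<lbrakk>X \<in> Obj C; Y \<in> Obj C; f \<in> Hom C X Y\<rbrakk>
          \<Longrightarrow> \<nu> X \<odot>\<^bsub>D\<^esub> FMor F (DualO C Y) (DualO C X) (DualM C f)
            = DualM D (FMor F X Y f) \<odot>\<^bsub>D\<^esub> \<nu> Y"
    and nu_ev: "X \<in> Obj C
          \<Longrightarrow> \<iota> \<odot>\<^bsub>D\<^esub> Ev D (FObj F X) \<odot>\<^bsub>D\<^esub> (\<nu> X \<boxdot>\<^bsub>D\<^esub> Id D (FObj F X))
            = FMor F (DualO C X \<boxtimes>\<^bsub>C\<^esub> X) (UnitO C) (Ev C X) \<odot>\<^bsub>D\<^esub> \<mu> (DualO C X) X"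

section \<open>Finite-dimensional vector spaces\<close>

text \<open>
  A finite-dimensional real vector space is taken in coordinates, as \<open>carrier_vec n\<close> over \<open>real\<close>;
  its complexification is \<open>carrier_vec n\<close> over \<open>complex\<close> and linear maps are matrices.
  The basis element \<open>e_i \<otimes> f_j\<close> of a tensor product has index \<open>i * m + j\<close>, where \<open>m\<close> is the
  dimension of the second factor, so that the tensor product is strictly associative and unital.
  The dual space has the dual basis, so that the dual of a map is its transpose and the
  evaluation of a functional is the (bilinear) scalar product.
\<close>

abbreviation is_subspace :: "nat \<Rightarrow> 'a :: field vec set \<Rightarrow> bool" where
  "is_subspace n U \<equiv> VectorSpace.subspace class_ring U (module_vec TYPE('a) n)"

abbreviation lin_span :: "nat \<Rightarrow> 'a :: field vec set \<Rightarrow> 'a vec set" where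
  "lin_span n S \<equiv> LinearCombinations.module.span class_ring (module_vec TYPE('a) n) S"

abbreviation subspace_complexification :: "nat \<Rightarrow> real vec set \<Rightarrow> complex vec set" where
  "subspace_complexification n U \<equiv> lin_span n (map_vec complex_of_real ` U)"

definition kron_vec :: "'a :: semiring_1 vec \<Rightarrow> 'a vec \<Rightarrow> 'a vec" where
  "kron_vec v w = vec (dim_vec v * dim_vec w)
     (\<lambda>i. v $ (i div dim_vec w) * w $ (i mod dim_vec w))"

definition kron_mat :: "'a :: semiring_1 mat \<Rightarrow> 'a mat \<Rightarrow> 'a mat" where
  "kron_mat A B = mat (dim_row A * dim_row B) (dim_col A * dim_col B)
     (\<lambda>(i, j). A $$ (i div dim_row B, j div dim_col B) * B $$ (i mod dim_row B, j mod dim_col B))"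

text \<open>The swap \<open>v \<otimes> w \<mapsto> w \<otimes> v\<close> for \<open>v\<close> of dimension \<open>n\<close> and \<open>w\<close> of dimension \<open>m\<close>.\<close>

definition swap_mat :: "nat \<Rightarrow> nat \<Rightarrow> real mat" where
  "swap_mat n m = mat (m * n) (n * m) (\<lambda>(i, j). if i = (j mod m) * n + j div m then 1 else 0)"

text \<open>The evaluation \<open>\<phi> \<otimes> v \<mapsto> \<phi> v\<close> and the coevaluation \<open>1 \<mapsto> \<Sum>i. e_i \<otimes> e_i\<^sup>*\<close>.\<close>

definition ev_mat :: "nat \<Rightarrow> real mat" where
  "ev_mat n = mat 1 (n * n) (\<lambda>(i, j). if j div n = j mod n then 1 else 0)"

definition coev_mat :: "nat \<Rightarrow> real mat" where
  "coev_mat n = mat (n * n) 1 (\<lambda>(i, j). if i div n = i mod n then 1 else 0)"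

section \<open>Mixed Hodge structures\<close>

record mhs =
  mhs_dim :: nat
  weight_fil :: "int \<Rightarrow> real vec set"
  hodge_fil :: "int \<Rightarrow> complex vec set"

text \<open>
  A subquotient \<open>A / B\<close> of a vector space is encoded as the pair \<open>(A, B)\<close>; it vanishes iff
  \<open>A = B\<close>. A decreasing filtration \<open>\<Phi>\<close> of the ambient space induces the filtration
  \<open>(\<Phi> p \<inter> A + B) / B\<close> of \<open>A / B\<close>, whose graded piece in degree \<open>p\<close> is again a subquotient.
\<close>

definition gr_subquotient ::
  "nat \<Rightarrow> (int \<Rightarrow> complex vec set) \<Rightarrow> int \<Rightarrow> complex vec set \<times> complex vec set
     \<Rightarrow> complex vec set \<times> complex vec set" where
  "gr_subquotient n \<Phi> p = (\<lambda>(A, B).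
     (lin_span n ((\<Phi> p \<inter> A) \<union> B), lin_span n ((\<Phi> (p + 1) \<inter> A) \<union> B)))"

definition gr_weight :: "nat \<Rightarrow> (int \<Rightarrow> real vec set) \<Rightarrow> int \<Rightarrow> complex vec set \<times> complex vec set"
  where
  "gr_weight n W k =
     (subspace_complexification n (W k), subspace_complexification n (W (k - 1)))"

definition conj_fil :: "(int \<Rightarrow> complex vec set) \<Rightarrow> int \<Rightarrow> complex vec set" where
  "conj_fil \<Phi> p = conjugate ` \<Phi> p"

text \<open>
  The Hodge filtration is required to be Hausdorff (separated) as well as exhaustive: filtrations
  of Hodge structures are finite. Vanishing of the graded pieces does not force this, since they
  all vanish for a constant filtration.
\<close>

definition is_mhs :: "mhs \<Rightarrow> bool" where
  "is_mhs V \<longleftrightarrow> (let n = mhs_dim V; W = weight_fil V; F = hodge_fil V in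
     (\<forall>k. is_subspace n (W k)) \<and> (\<forall>k l. k \<le> l \<longrightarrow> W k \<subseteq> W l)
     \<and> (\<Union>k. W k) = carrier_vec n \<and> (\<Inter>k. W k) = {0\<^sub>v n}
     \<and> (\<forall>p. is_subspace n (F p)) \<and> (\<forall>p q. p \<le> q \<longrightarrow> F q \<subseteq> F p)
     \<and> (\<Union>p. F p) = carrier_vec n \<and> (\<Inter>p. F p) = {0\<^sub>v n}
     \<and> (\<forall>i j k. i + j \<noteq> k \<longrightarrow>
          (case gr_subquotient n F i (gr_subquotient n (conj_fil F) j (gr_weight n W k)) of
             (A, B) \<Rightarrow> A = B)))"

definition mhs_hom :: "mhs \<Rightarrow> mhs \<Rightarrow> real mat set" where
  "mhs_hom V V' = {f \<in> carrier_mat (mhs_dim V') (mhs_dim V).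
     (\<forall>k. \<forall>v \<in> weight_fil V k. f *\<^sub>v v \<in> weight_fil V' k)
     \<and> (\<forall>p. \<forall>v \<in> hodge_fil V p. map_mat complex_of_real f *\<^sub>v v \<in> hodge_fil V' p)}"

definition mhs_tensor :: "mhs \<Rightarrow> mhs \<Rightarrow> mhs" where
  "mhs_tensor V V' = (let n = mhs_dim V * mhs_dim V' in
     \<lparr>mhs_dim = n,
      weight_fil = (\<lambda>k. lin_span n
        {kron_vec v w | v w i j. i + j = k \<and> v \<in> weight_fil V i \<and> w \<in> weight_fil V' j}),
      hodge_fil = (\<lambda>p. lin_span n
        {kron_vec v w | v w i j. i + j = p \<and> v \<in> hodge_fil V i \<and> w \<in> hodge_fil V' j})\<rparr>)"

definition mhs_unit :: mhs where
  "mhs_unit = \<lparr>mhs_dim = 1,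
     weight_fil = (\<lambda>k. if k \<ge> 0 then carrier_vec 1 else {0\<^sub>v 1}),
     hodge_fil = (\<lambda>p. if p \<le> 0 then carrier_vec 1 else {0\<^sub>v 1})\<rparr>"

text \<open>
  The filtrations of the internal Hom into the unit: \<open>\<phi>\<close> has weight at most \<open>k\<close> iff it maps
  \<open>W l\<close> to weight \<open>l + k\<close> for all \<open>l\<close>, i.e.\ iff it kills \<open>W (- k - 1)\<close>, and it
  lies in Hodge level \<open>p\<close> iff it kills \<open>F (1 - p)\<close>.
\<close>

definition mhs_dual :: "mhs \<Rightarrow> mhs" where
  "mhs_dual V = \<lparr>mhs_dim = mhs_dim V,
     weight_fil = (\<lambda>k. {\<phi> \<in> carrier_vec (mhs_dim V). \<forall>v \<in> weight_fil V (- k - 1). \<phi> \<bullet> v = 0}),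
     hodge_fil = (\<lambda>p. {\<phi> \<in> carrier_vec (mhs_dim V). \<forall>v \<in> hodge_fil V (1 - p). \<phi> \<bullet> v = 0})\<rparr>"

definition MHS :: "(mhs, real mat) tensor_cat" where
  "MHS = \<lparr>Obj = {V. is_mhs V}, Hom = mhs_hom, Id = (\<lambda>V. 1\<^sub>m (mhs_dim V)), Cmp = (*),
     HAdd = (+), HZero = (\<lambda>V V'. 0\<^sub>m (mhs_dim V') (mhs_dim V)),
     TensO = mhs_tensor, TensM = kron_mat, UnitO = mhs_unit,
     Assoc = (\<lambda>U V W. 1\<^sub>m (mhs_dim U * mhs_dim V * mhs_dim W)),
     LUnit = (\<lambda>V. 1\<^sub>m (mhs_dim V)), RUnit = (\<lambda>V. 1\<^sub>m (mhs_dim V)),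
     Braid = (\<lambda>V V'. swap_mat (mhs_dim V) (mhs_dim V')),
     DualO = mhs_dual, DualM = transpose_mat,
     Ev = (\<lambda>V. ev_mat (mhs_dim V)), Coev = (\<lambda>V. coev_mat (mhs_dim V))\<rparr>"

section \<open>The ring \<open>\<real>[x,y]\<close> and representations of the Deligne torus\<close>

text \<open>
  \<open>\<real>[x,y]\<close> is \<open>real poly poly\<close>, with \<open>x\<close> the inner and \<open>y\<close> the outer variable.
\<close>

definition const2 :: "real \<Rightarrow> real poly poly" where
  "const2 c = [:[:c:]:]"

definition X2 :: "real poly poly" where
  "X2 = [:[:0, 1:]:]"

definition Y2 :: "real poly poly" where
  "Y2 = [:0, 1:]"

definition eval2 :: "real poly poly \<Rightarrow> real \<Rightarrow> real \<Rightarrow> real" where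
  "eval2 p a b = poly (poly p [:b:]) a"

definition subst2 :: "real poly poly \<Rightarrow> real poly poly \<Rightarrow> real poly poly \<Rightarrow> real poly poly" where
  "subst2 P Q p = poly (map_poly (\<lambda>q. poly (map_poly const2 q) P) p) Q"

text \<open>
  \<open>S(\<real>)\<close> is the set of nonzero complex numbers and is Zariski dense in \<open>S\<close>; regular
  functions on \<open>S\<close> are the elements of \<open>\<real>[a, b, (a\<^sup>2 + b\<^sup>2)\<^sup>-\<^sup>1]\<close> with \<open>a, b\<close> the real and
  imaginary part. The value of a representation at \<open>0\<close> is irrelevant.
\<close>

definition regular_on_S :: "(complex \<Rightarrow> real) \<Rightarrow> bool" where
  "regular_on_S f \<longleftrightarrow> (\<exists>p k. \<forall>l. l \<noteq> 0 \<longrightarrow>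
     f l = eval2 p (Re l) (Im l) / ((Re l)\<^sup>2 + (Im l)\<^sup>2) ^ k)"

definition S_representation :: "nat \<Rightarrow> (complex \<Rightarrow> real mat) \<Rightarrow> bool" where
  "S_representation n \<rho> \<longleftrightarrow>
     (\<forall>l. l \<noteq> 0 \<longrightarrow> \<rho> l \<in> carrier_mat n n)
     \<and> \<rho> 1 = 1\<^sub>m n
     \<and> (\<forall>l l'. l \<noteq> 0 \<longrightarrow> l' \<noteq> 0 \<longrightarrow> \<rho> (l * l') = \<rho> l * \<rho> l')
     \<and> (\<forall>i<n. \<forall>j<n. regular_on_S (\<lambda>l. \<rho> l $$ (i, j)))"

text \<open>
  The action of \<open>S\<close> on \<open>\<real>[x,y]\<close> is \<open>(l \<cdot> f) A = f (l \<cdot> A)\<close>, where the second row of \<open>l \<cdot> A\<close> is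
  \<open>\<bar>l\<bar>\<^sup>2 (x, y) M\<^sup>-\<^sup>1\<close> for \<open>M = (Re l, Im l; - Im l, Re l)\<close>, i.e.\ \<open>(a x + b y, a y - b x)\<close>
  if \<open>l = a + \<i> b\<close>. In particular \<open>l \<cdot> (x - \<i> y) = l (x - \<i> y)\<close>, so \<open>x - \<i> y\<close> has type \<open>(1,0)\<close>.
  Lemma \<open>S_act_poly_SL2\<close> below checks this against the action of \<open>S\<close> on \<open>SL\<^sub>2\<close>.
\<close>

definition S_act_poly :: "complex \<Rightarrow> real poly poly \<Rightarrow> real poly poly" where
  "S_act_poly l = subst2 (const2 (Re l) * X2 + const2 (Im l) * Y2)
     (const2 (Re l) * Y2 - const2 (Im l) * X2)"

text \<open>
  The action of \<open>S\<close> on \<open>V \<otimes> \<real>[x,y](-1)\<close>; the Tate twist \<open>\<real>(-1)\<close> has type \<open>(1,1)\<close>, so it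
  contributes the factor \<open>\<bar>l\<bar>\<^sup>2\<close>.
\<close>

definition S_act_twisted ::
  "(complex \<Rightarrow> real mat) \<Rightarrow> complex \<Rightarrow> real poly poly vec \<Rightarrow> real poly poly vec" where
  "S_act_twisted \<rho> l w =
     const2 ((cmod l)\<^sup>2) \<cdot>\<^sub>v (map_mat const2 (\<rho> l) *\<^sub>v map_vec (S_act_poly l) w)"

section \<open>The category SHS\<close>

text \<open>
  The linear map \<open>\<beta> : V \<rightarrow> V \<otimes> \<real>[x,y](-1)\<close> is given by its matrix, with entries in \<open>\<real>[x,y]\<close>.
\<close>

record shs =
  shs_dim :: nat
  shs_rep :: "complex \<Rightarrow> real mat"
  shs_beta :: "real poly poly mat"

definition is_shs :: "shs \<Rightarrow> bool" where
  "is_shs V \<longleftrightarrow> (let n = shs_dim V; \<rho> = shs_rep V; B = shs_beta V in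
     S_representation n \<rho> \<and> B \<in> carrier_mat n n
     \<and> (\<forall>l v. l \<noteq> 0 \<longrightarrow> v \<in> carrier_vec n \<longrightarrow>
          B *\<^sub>v map_vec const2 (\<rho> l *\<^sub>v v) = S_act_twisted \<rho> l (B *\<^sub>v map_vec const2 v)))"

definition shs_hom :: "shs \<Rightarrow> shs \<Rightarrow> real mat set" where
  "shs_hom V V' = {f \<in> carrier_mat (shs_dim V') (shs_dim V).
     (\<forall>l. l \<noteq> 0 \<longrightarrow> f * shs_rep V l = shs_rep V' l * f)
     \<and> shs_beta V' * map_mat const2 f = map_mat const2 f * shs_beta V}"

definition shs_tensor :: "shs \<Rightarrow> shs \<Rightarrow> shs" where
  "shs_tensor U V = \<lparr>shs_dim = shs_dim U * shs_dim V,
     shs_rep = (\<lambda>l. kron_mat (shs_rep U l) (shs_rep V l)),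
     shs_beta = kron_mat (shs_beta U) (1\<^sub>m (shs_dim V)) + kron_mat (1\<^sub>m (shs_dim U)) (shs_beta V)\<rparr>"

definition shs_unit :: shs where
  "shs_unit = \<lparr>shs_dim = 1, shs_rep = (\<lambda>l. 1\<^sub>m 1), shs_beta = 0\<^sub>m 1 1\<rparr>"

text \<open>
  The sign makes \<open>\<beta>\<close> of an internal Hom \<open>V\<^sup>\<or> \<otimes> V'\<close> equal to \<open>f \<mapsto> \<beta>' \<circ> f - (f \<otimes> id) \<circ> \<beta>\<close>, whose
  \<open>S\<close>-invariant kernel consists of the morphisms \<open>V \<rightarrow> V'\<close>.
\<close>

definition shs_dual :: "shs \<Rightarrow> shs" where
  "shs_dual V = \<lparr>shs_dim = shs_dim V,
     shs_rep = (\<lambda>l. transpose_mat (shs_rep V (inverse l))),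
     shs_beta = - transpose_mat (shs_beta V)\<rparr>"

definition SHS :: "(shs, real mat) tensor_cat" where
  "SHS = \<lparr>Obj = {V. is_shs V}, Hom = shs_hom, Id = (\<lambda>V. 1\<^sub>m (shs_dim V)), Cmp = (*),
     HAdd = (+), HZero = (\<lambda>V V'. 0\<^sub>m (shs_dim V') (shs_dim V)),
     TensO = shs_tensor, TensM = kron_mat, UnitO = shs_unit,
     Assoc = (\<lambda>U V W. 1\<^sub>m (shs_dim U * shs_dim V * shs_dim W)),
     LUnit = (\<lambda>V. 1\<^sub>m (shs_dim V)), RUnit = (\<lambda>V. 1\<^sub>m (shs_dim V)),
     Braid = (\<lambda>V V'. swap_mat (shs_dim V) (shs_dim V')),
     DualO = shs_dual, DualM = transpose_mat,
     Ev = (\<lambda>V. ev_mat (shs_dim V)), Coev = (\<lambda>V. coev_mat (shs_dim V))\<rparr>"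

section \<open>Check of the action on \<open>\<real>[x,y]\<close>\<close>

lemma eval2_simps [simp]:
  "eval2 (const2 c) a b = c" "eval2 X2 a b = a" "eval2 Y2 a b = b"
  "eval2 (p + q) a b = eval2 p a b + eval2 q a b"
  "eval2 (p - q) a b = eval2 p a b - eval2 q a b"
  "eval2 (p * q) a b = eval2 p a b * eval2 q a b"
  "eval2 0 a b = 0"
  by (simp_all add: eval2_def const2_def X2_def Y2_def)

lemma eval2_subst2:
  "eval2 (subst2 P Q p) a b = eval2 p (eval2 P a b) (eval2 Q a b)"
proof -
  have inner: "eval2 (poly (map_poly const2 q) P) a b = poly q (eval2 P a b)" for q
    by (induction q) (simp_all add: map_poly_pCons const2_def [of 0])
  show ?thesis unfolding subst2_def
    by (induction p) (simp_all add: map_poly_pCons inner, simp_all add: eval2_def)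
qed

lemma S_act_poly_SL2:
  fixes A A' :: "real mat"
  assumes l: "l \<noteq> 0" and A: "A \<in> carrier_mat 2 2" and A': "A' \<in> carrier_mat 2 2"
    and act: "A' * mat_of_rows_list 2 [[Re l, Im l], [- Im l, Re l]]
      = mat_of_rows_list 2 [[1, 0], [0, (cmod l)\<^sup>2]] * A"
  shows "eval2 (S_act_poly l p) (A $$ (1, 0)) (A $$ (1, 1)) = eval2 p (A' $$ (1, 0)) (A' $$ (1, 1))"
proof -
  have "(A' * mat_of_rows_list 2 [[Re l, Im l], [- Im l, Re l]]) $$ (1, j)
      = (mat_of_rows_list 2 [[1, 0], [0, (cmod l)\<^sup>2]] * A) $$ (1, j)" for j
    using act by simp
  from this [of 0] this [of 1]
  have e: "A' $$ (1, 0) * Re l - A' $$ (1, 1) * Im l = (cmod l)\<^sup>2 * A $$ (1, 0)"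
    "A' $$ (1, 0) * Im l + A' $$ (1, 1) * Re l = (cmod l)\<^sup>2 * A $$ (1, 1)"
    using A A' by (simp_all add: mat_of_rows_list_def scalar_prod_def numeral_2_eq_2)
  have n: "(cmod l)\<^sup>2 = Re l * Re l + Im l * Im l" "(cmod l)\<^sup>2 \<noteq> 0"
    using l cmod_power2 [of l] by (simp_all add: complex_eq_iff flip: power2_eq_square)
  have "(cmod l)\<^sup>2 * A' $$ (1, 0)
      = Re l * (A' $$ (1, 0) * Re l - A' $$ (1, 1) * Im l)
        + Im l * (A' $$ (1, 0) * Im l + A' $$ (1, 1) * Re l)"
    unfolding n(1) by (simp add: algebra_simps)
  also have "\<dots> = (cmod l)\<^sup>2 * (Re l * A $$ (1, 0) + Im l * A $$ (1, 1))"
    unfolding e by (simp add: algebra_simps)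
  finally have x: "A' $$ (1, 0) = Re l * A $$ (1, 0) + Im l * A $$ (1, 1)"
    using n(2) by (metis mult_left_cancel)
  have "(cmod l)\<^sup>2 * A' $$ (1, 1)
      = Re l * (A' $$ (1, 0) * Im l + A' $$ (1, 1) * Re l)
        - Im l * (A' $$ (1, 0) * Re l - A' $$ (1, 1) * Im l)"
    unfolding n(1) by (simp add: algebra_simps)
  also have "\<dots> = (cmod l)\<^sup>2 * (Re l * A $$ (1, 1) - Im l * A $$ (1, 0))"
    unfolding e by (simp add: algebra_simps)
  finally have y: "A' $$ (1, 1) = Re l * A $$ (1, 1) - Im l * A $$ (1, 0)"
    using n(2) by (metis mult_left_cancel)
  show ?thesis
    unfolding x y by (simp add: S_act_poly_def eval2_subst2)
qed

end

theory Submission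
  imports Defs "Jordan_Normal_Form.DL_Rank" "HOL-Computational_Algebra.Polynomial_FPS" "HOL-Library.Product_Plus"
begin

text \<open>
  Both categories consist of the same linear algebra. A Hodge datum is a bigrading of the
  complexification of a real vector space by types \<open>(p, q)\<close>, exchanged with \<open>(q, p)\<close> by complex
  conjugation, together with a real endomorphism \<open>D\<close> whose components all lower both \<open>p\<close> and \<open>q\<close>.

  On the side of SHS, a representation of \<open>S\<close> is such a bigrading, into its eigenspaces for the
  characters \<open>\<lambda>\<^sup>p (cnj \<lambda>)\<^sup>q\<close> (\<open>S_representation_adapted\<close>, \<open>adapted_exists\<close>). The orbit of
  \<open>(x, y) = (1, 0)\<close> is dense in the plane, so that \<open>\<beta>\<close> is determined by its value \<open>D\<close> there
  (\<open>is_shs_iff\<close>). In an eigenbasis, an entry of \<open>\<beta>\<close> at the point with \<open>x - \<i> y = m\<close> is the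
  entry of \<open>D\<close> times a character of \<open>m\<close>. This is a polynomial in \<open>x\<close> and \<open>y\<close> iff the exponents
  of the character are nonnegative, and by the Tate twist this means that the entry of \<open>D\<close> lowers
  both degrees (\<open>shs_datum\<close>, \<open>datum_shs\<close>).

  On the side of MHS, a Hodge datum gives a mixed Hodge structure (\<open>datum.is_mhs\<close>): the weight
  filtration is the one of the bigrading, and the Hodge filtration is \<open>exp (\<i> D)\<close> applied to the
  one of the bigrading. All mixed Hodge structures arise in this way (\<open>mhs_has_datum\<close>). Indeed,
  opposedness gives a basis that splits both filtrations and in which conjugation exchanges \<open>p\<close>
  and \<open>q\<close> up to lower weights (\<open>conj_basis\<close>). Changes of basis that preserve the filtrations then
  remove from the conjugation all lower components except those that lower both degrees
  (\<open>straighten\<close>), and the logarithm of what remains is \<open>- 2 \<i> D\<close> (\<open>datum_of_straight\<close>).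

  In both categories the morphisms are the real maps that respect the bigradings and commute with
  \<open>D\<close>. For SHS this is clear; for MHS it is \<open>mhs_hom_iff\<close>, where one compares the matrix of a map
  in the bases that split the Hodge filtration and its conjugate. So the equivalence is the
  identity on vector spaces and linear maps, and identity matrices serve as its structure
  isomorphisms (locale \<open>matrix_correspondence\<close>). Tensor products and duals agree: on both sides
  the tensor product has the endomorphism \<open>D \<otimes> 1 + 1 \<otimes> D'\<close>, whose exponential is the tensor
  product of the exponentials, and the dual has minus the transpose of \<open>D\<close>
  (\<open>corresponds_tensor\<close>, \<open>corresponds_dual\<close>).
\<close>

section \<open>Subspaces and adapted bases\<close>

lemma is_subspace_iff:
  "is_subspace n U \<longleftrightarrow> U \<subseteq> carrier_vec n \<and> 0\<^sub>v n \<in> U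
     \<and> (\<forall>u\<in>U. \<forall>v\<in>U. u + v \<in> U) \<and> (\<forall>c. \<forall>v\<in>U. c \<cdot>\<^sub>v v \<in> U)"
proof -
  interpret vec_space "TYPE('a)" n .
  show ?thesis
    using vec_vs[of n, where ?'a = 'a] vec_module[of n, where ?'a = 'a]
    by (auto simp: VectorSpace.subspace_def submodule_def module_vec_simps)
qed

lemma lin_span_superset: "S \<subseteq> carrier_vec n \<Longrightarrow> S \<subseteq> lin_span n S"
proof -
  interpret vec_space "TYPE('a)" n .
  show "S \<subseteq> carrier_vec n \<Longrightarrow> S \<subseteq> lin_span n S"
    using in_own_span by simp
qed

lemma lin_span_subspace: "S \<subseteq> carrier_vec n \<Longrightarrow> is_subspace n (lin_span n S)"
proof -
  interpret vec_space "TYPE('a)" n .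
  show "S \<subseteq> carrier_vec n \<Longrightarrow> is_subspace n (lin_span n S)"
    using span_is_subspace by simp
qed

lemma lin_span_least: "is_subspace n U \<Longrightarrow> S \<subseteq> U \<Longrightarrow> lin_span n S \<subseteq> U"
proof -
  interpret vec_space "TYPE('a)" n .
  show "is_subspace n U \<Longrightarrow> S \<subseteq> U \<Longrightarrow> lin_span n S \<subseteq> U"
    using span_is_subset[of S U] by (simp add: VectorSpace.subspace_def)
qed

lemma is_subspaceD:
  assumes "is_subspace n U"
  shows "U \<subseteq> carrier_vec n" "0\<^sub>v n \<in> U" "u \<in> U \<Longrightarrow> v \<in> U \<Longrightarrow> u + v \<in> U"
    "v \<in> U \<Longrightarrow> c \<cdot>\<^sub>v v \<in> U" "u \<in> U \<Longrightarrow> v \<in> U \<Longrightarrow> u - v \<in> U"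
proof -
  show A: "U \<subseteq> carrier_vec n" "0\<^sub>v n \<in> U" "u \<in> U \<Longrightarrow> v \<in> U \<Longrightarrow> u + v \<in> U"
    "v \<in> U \<Longrightarrow> c \<cdot>\<^sub>v v \<in> U" for u v c
    using assms unfolding is_subspace_iff by blast+
  assume uv: "u \<in> U" "v \<in> U"
  have "u - v = u + (-1) \<cdot>\<^sub>v v"
    using uv A(1) by (intro eq_vecI) auto
  then show "u - v \<in> U" using A(3,4) uv by simp
qed

lemma is_subspaceI:
  assumes "U \<subseteq> carrier_vec n" "0\<^sub>v n \<in> U" "\<And>u v. u \<in> U \<Longrightarrow> v \<in> U \<Longrightarrow> u + v \<in> U"
    "\<And>c v. v \<in> U \<Longrightarrow> c \<cdot>\<^sub>v v \<in> U"
  shows "is_subspace n U"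
  using assms unfolding is_subspace_iff by blast

lemma is_subspace_sum:
  assumes "is_subspace n U" "finite I" "\<And>i. i \<in> I \<Longrightarrow> f i \<in> U"
  shows "vec n (\<lambda>k. \<Sum>i\<in>I. f i $ k) \<in> U"
  using assms(2,3)
proof (induction I)
  case empty
  have "vec n (\<lambda>k. \<Sum>i\<in>{}. f i $ k) = 0\<^sub>v n" by (intro eq_vecI) auto
  then show ?case by (subst \<open>vec n _ = _\<close>) (rule is_subspaceD(2)[OF assms(1)])
next
  case (insert a I)
  have "f a \<in> carrier_vec n" using insert is_subspaceD(1)[OF assms(1)] by auto
  then have "vec n (\<lambda>k. \<Sum>i\<in>insert a I. f i $ k) = f a + vec n (\<lambda>k. \<Sum>i\<in>I. f i $ k)"
    using insert by (intro eq_vecI) auto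
  then show ?case using insert is_subspaceD(3)[OF assms(1)] by simp
qed

lemma lin_span_Un_mem:
  assumes "is_subspace n U" "is_subspace n V"
  shows "v \<in> lin_span n (U \<union> V) \<longleftrightarrow> (\<exists>a\<in>U. \<exists>b\<in>V. v = a + b)"
proof
  let ?S = "{v. \<exists>a\<in>U. \<exists>b\<in>V. v = a + b}"
  note U = is_subspaceD[OF assms(1)] and V = is_subspaceD[OF assms(2)]
  have sub: "is_subspace n ?S"
  proof (rule is_subspaceI)
    show "?S \<subseteq> carrier_vec n" using U(1) V(1) by (auto intro!: add_carrier_vec)
    show "0\<^sub>v n \<in> ?S" using U(2) V(2) by (auto intro!: bexI[of _ "0\<^sub>v n"])
  next
    fix u v assume "u \<in> ?S" "v \<in> ?S"
    then obtain a b a' b' where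
      h: "a \<in> U" "b \<in> V" "a' \<in> U" "b' \<in> V" "u = a + b" "v = a' + b'" by auto
    have "u + v = (a + a') + (b + b')"
      unfolding h(5,6) using subsetD[OF U(1) h(1)] subsetD[OF U(1) h(3)]
        subsetD[OF V(1) h(2)] subsetD[OF V(1) h(4)] by (intro eq_vecI) auto
    then show "u + v \<in> ?S"
      using bexI[OF bexI[OF _ V(3)[OF h(2,4)]] U(3)[OF h(1,3)]] by simp
  next
    fix c v assume "v \<in> ?S"
    then obtain a b where h: "a \<in> U" "b \<in> V" "v = a + b" by auto
    have "c \<cdot>\<^sub>v v = c \<cdot>\<^sub>v a + c \<cdot>\<^sub>v b"
      using h U(1) V(1) by (auto intro!: smult_add_distrib_vec)
    then show "c \<cdot>\<^sub>v v \<in> ?S"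
      using bexI[OF bexI[OF _ V(4)[OF h(2)]] U(4)[OF h(1)]] h(3) by simp
  qed
  have "U \<union> V \<subseteq> ?S"
  proof
    fix x assume "x \<in> U \<union> V"
    then consider "x \<in> U" | "x \<in> V" by auto
    then show "x \<in> ?S"
    proof cases
      case 1
      then have "x = x + 0\<^sub>v n" using U(1) by auto
      then show ?thesis using 1 V(2) by auto
    next
      case 2
      then have "x = 0\<^sub>v n + x" using V(1) by auto
      then show ?thesis using 2 U(2) by auto
    qed
  qed
  then have "lin_span n (U \<union> V) \<subseteq> ?S" by (rule lin_span_least[OF sub])
  then have "v \<in> lin_span n (U \<union> V) \<Longrightarrow> v \<in> ?S" by (rule subsetD)
  then show "v \<in> lin_span n (U \<union> V) \<Longrightarrow> \<exists>a\<in>U. \<exists>b\<in>V. v = a + b" by simp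
  assume "\<exists>a\<in>U. \<exists>b\<in>V. v = a + b"
  then obtain a b where h: "a \<in> U" "b \<in> V" "v = a + b" by auto
  have c: "U \<union> V \<subseteq> carrier_vec n" using U(1) V(1) by auto
  show "v \<in> lin_span n (U \<union> V)"
    using h lin_span_superset[OF c] is_subspaceD(3)[OF lin_span_subspace[OF c]] by auto
qed

definition indep :: "nat \<Rightarrow> 'a :: field vec set \<Rightarrow> bool" where
  "indep n B \<longleftrightarrow> B \<subseteq> carrier_vec n
     \<and> \<not> LinearCombinations.module.lin_dep class_ring (module_vec TYPE('a) n) B"

lemma indep_empty: "indep n {}"
proof -
  interpret vec_space "TYPE('a)" n .
  show "indep n ({} :: 'a vec set)" by (auto simp: indep_def lin_dep_def)
qed

lemma indep_finite: "indep n (B :: 'a :: field vec set) \<Longrightarrow> finite B \<and> card B \<le> n"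
proof -
  interpret vec_space "TYPE('a)" n .
  show "indep n B \<Longrightarrow> finite B \<and> card B \<le> n"
    using li_le_dim[of B] dim_is_n by (auto simp: indep_def)
qed

lemma indep_insert:
  assumes "indep n (B :: 'a :: field vec set)" "v \<in> carrier_vec n" "v \<notin> lin_span n B"
  shows "indep n (insert v B)"
proof -
  interpret vec_space "TYPE('a)" n .
  show ?thesis
    using lin_dep_iff_in_span[of B v] assms lin_span_superset[of B n] by (auto simp: indep_def)
qed

lemma indep_extend:
  assumes "indep n (B :: 'a :: field vec set)" "S \<subseteq> carrier_vec n"
  shows "\<exists>B'. B \<subseteq> B' \<and> B' \<subseteq> B \<union> S \<and> indep n B' \<and> S \<subseteq> lin_span n B'"
proof -
  let ?P = "\<lambda>B'. B \<subseteq> B' \<and> B' \<subseteq> B \<union> S \<and> indep n B'"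
  have "\<exists>B'. ?P B' \<and> (\<forall>B''. ?P B'' \<longrightarrow> card B'' \<le> card B')"
    by (rule ex_has_greatest_nat[of ?P B card "Suc n"])
       (use assms indep_finite in \<open>auto simp: less_Suc_eq_le\<close>)
  then obtain B' where B': "?P B'" "\<And>B''. ?P B'' \<Longrightarrow> card B'' \<le> card B'" by blast
  have "S \<subseteq> lin_span n B'"
  proof
    fix v assume v: "v \<in> S"
    show "v \<in> lin_span n B'"
    proof (rule ccontr)
      assume nv: "v \<notin> lin_span n B'"
      then have "indep n (insert v B')" using B' v assms(2) by (intro indep_insert) auto
      then have "?P (insert v B')" using B'(1) v by blast
      then have "card (insert v B') \<le> card B'" by (rule B'(2))
      moreover have "v \<notin> B'" using nv lin_span_superset[of B' n] B' by (auto simp: indep_def)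
      ultimately show False using indep_finite[of n B'] B'(1) by simp
    qed
  qed
  then show ?thesis using B' by auto
qed

text \<open>
  Finite dimension makes a separated decreasing filtration reach zero: the maximal size of an
  independent subset of a step is eventually minimal, and from there on the steps are equal.
\<close>

lemma decreasing_subspaces_zero:
  fixes U :: "int \<Rightarrow> 'a :: field vec set"
  assumes sub: "\<And>k. is_subspace n (U k)" and anti: "\<And>k l. k \<le> l \<Longrightarrow> U l \<subseteq> U k"
    and sep: "(\<Inter>k. U k) = {0\<^sub>v n}"
  shows "\<exists>k. U k = {0\<^sub>v n}"
proof -
  let ?P = "\<lambda>k B. B \<subseteq> U k \<and> indep n B"
  have "\<exists>B. ?P k B \<and> (\<forall>B'. ?P k B' \<longrightarrow> card B' \<le> card B)" for k
    by (rule ex_has_greatest_nat[of "?P k" "{}" card "Suc n"])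
       (use indep_empty indep_finite in \<open>auto simp: less_Suc_eq_le\<close>)
  then obtain B where B: "\<And>k. ?P k (B k)" "\<And>k B'. ?P k B' \<Longrightarrow> card B' \<le> card (B k)" by metis
  obtain k where k: "\<And>l. card (B k) \<le> card (B l)"
    using ex_has_least_nat[of "\<lambda>_. True" 0 "\<lambda>k. card (B k)"] by blast
  have eq: "U k \<subseteq> U l" for l
  proof (cases "k \<le> l")
    case True
    have "U k \<subseteq> lin_span n (B l)"
    proof
      fix v assume v: "v \<in> U k"
      show "v \<in> lin_span n (B l)"
      proof (rule ccontr)
        assume nv: "v \<notin> lin_span n (B l)"
        have "indep n (insert v (B l))"
          using B(1)[of l] v nv is_subspaceD(1)[OF sub] by (intro indep_insert) auto
        moreover have "insert v (B l) \<subseteq> U k" using v B(1)[of l] anti[OF True] by auto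
        ultimately have "card (insert v (B l)) \<le> card (B k)" using B(2) by auto
        moreover have "v \<notin> B l" using nv lin_span_superset[of "B l" n] B(1)[of l] by (auto simp: indep_def)
        ultimately show False using indep_finite[of n "B l"] B(1)[of l] k[of l] by simp
      qed
    qed
    also have "\<dots> \<subseteq> U l" using B(1)[of l] by (intro lin_span_least[OF sub]) simp
    finally show ?thesis .
  qed (use anti[of l k] in auto)
  then have "U k \<subseteq> (\<Inter>k. U k)" by auto
  then have "U k = {0\<^sub>v n}" unfolding sep using is_subspaceD(2)[OF sub, of k] by auto
  then show ?thesis by (rule exI)
qed

lemma increasing_subspaces_exhaust:
  fixes U :: "int \<Rightarrow> 'a :: field vec set"
  assumes sub: "\<And>k. is_subspace n (U k)" and mono: "\<And>k l. k \<le> l \<Longrightarrow> U k \<subseteq> U l"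
    and exh: "(\<Union>k. U k) = carrier_vec n"
  shows "\<exists>k. U k = carrier_vec n"
proof -
  have "\<forall>j. \<exists>k. unit_vec n j \<in> U k" using exh by auto
  then obtain f where f: "\<And>j. unit_vec n j \<in> U (f j)" by metis
  obtain k where k: "\<And>j. j < n \<Longrightarrow> f j \<le> k"
    using Max_ge[of "f ` {..<n}"] by (meson finite_imageI finite_lessThan imageI lessThan_iff)
  interpret vec_space "TYPE('a)" n .
  have "lin_span n (set (unit_vecs n)) \<subseteq> U k"
    by (rule lin_span_least[OF sub]) (auto simp: unit_vecs_def dest: k intro!: subsetD[OF mono f])
  then have "carrier_vec n \<subseteq> U k" using span_unit_vecs_is_carrier by simp
  then show ?thesis using is_subspaceD(1)[OF sub] by blast
qed

definition colspan :: "'a :: field mat \<Rightarrow> (nat \<Rightarrow> bool) \<Rightarrow> 'a vec set" where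
  "colspan T P = {T *\<^sub>v x | x. x \<in> carrier_vec (dim_col T) \<and> (\<forall>i < dim_col T. x $ i \<noteq> 0 \<longrightarrow> P i)}"

definition inverse_mats :: "nat \<Rightarrow> 'a :: field mat \<Rightarrow> 'a mat \<Rightarrow> bool" where
  "inverse_mats n T T' \<longleftrightarrow> T \<in> carrier_mat n n \<and> T' \<in> carrier_mat n n \<and> T * T' = 1\<^sub>m n \<and> T' * T = 1\<^sub>m n"

lemma inverse_matsD:
  assumes "inverse_mats n T T'"
  shows "T \<in> carrier_mat n n" "T' \<in> carrier_mat n n" "T * T' = 1\<^sub>m n" "T' * T = 1\<^sub>m n"
  using assms by (auto simp: inverse_mats_def)

lemma inverse_mats_sym: "inverse_mats n T T' \<Longrightarrow> inverse_mats n T' T"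
  by (auto simp: inverse_mats_def)

lemma inverse_matsI:
  assumes "T \<in> carrier_mat n n" "T' \<in> carrier_mat n n" "T * T' = 1\<^sub>m n"
  shows "inverse_mats n T (T' :: 'a :: field mat)"
  using assms mat_mult_left_right_inverse[of T n T'] by (auto simp: inverse_mats_def)

lemma inverse_mats_vec:
  assumes "inverse_mats n T T'" "v \<in> carrier_vec n"
  shows "T *\<^sub>v (T' *\<^sub>v v) = v" "T' *\<^sub>v (T *\<^sub>v v) = v"
  using assms by (auto simp: inverse_mats_def simp flip: assoc_mult_mat_vec)

lemma inverse_mats_mult:
  assumes "inverse_mats n A A'" "inverse_mats n B B'"
  shows "inverse_mats n (A * B) (B' * A')"
proof (rule inverse_matsI)
  note a = inverse_matsD[OF assms(1)] and b = inverse_matsD[OF assms(2)]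
  show "A * B \<in> carrier_mat n n" "B' * A' \<in> carrier_mat n n" using a b by auto
  have "A * B * (B' * A') = A * (B * (B' * A'))" using a b by (intro assoc_mult_mat) auto
  also have "B * (B' * A') = B * B' * A'" using a b by (intro assoc_mult_mat[symmetric]) auto
  finally show "A * B * (B' * A') = 1\<^sub>m n" using a b by simp
qed

lemma inverse_mats_unique:
  assumes "inverse_mats n A B" "inverse_mats n A B'"
  shows "B' = B"
proof -
  note a = inverse_matsD[OF assms(1)] and b = inverse_matsD[OF assms(2)]
  have "B' = B' * (A * B)" using a b by simp
  also have "\<dots> = B' * A * B" using a b by (intro assoc_mult_mat[symmetric]) auto
  finally show ?thesis using a b by simp
qed

lemma colspan_iff:
  assumes "inverse_mats n T T'"
  shows "v \<in> colspan T P \<longleftrightarrow> v \<in> carrier_vec n \<and> (\<forall>i<n. (T' *\<^sub>v v) $ i \<noteq> 0 \<longrightarrow> P i)"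
proof
  note T = inverse_matsD[OF assms]
  show "v \<in> colspan T P \<Longrightarrow> v \<in> carrier_vec n \<and> (\<forall>i<n. (T' *\<^sub>v v) $ i \<noteq> 0 \<longrightarrow> P i)"
    using T inverse_mats_vec(2)[OF assms] by (auto simp: colspan_def simp del: index_mult_mat_vec)
  assume "v \<in> carrier_vec n \<and> (\<forall>i<n. (T' *\<^sub>v v) $ i \<noteq> 0 \<longrightarrow> P i)"
  then show "v \<in> colspan T P"
    using T inverse_mats_vec(1)[OF assms] unfolding colspan_def
    by (auto intro!: exI[of _ "T' *\<^sub>v v"])
qed

lemma colspan_subspace: "T \<in> carrier_mat n m \<Longrightarrow> is_subspace n (colspan T P)"
proof (rule is_subspaceI)
  assume T: "T \<in> carrier_mat n m"
  show "colspan T P \<subseteq> carrier_vec n" using T by (auto simp: colspan_def)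
  have "T *\<^sub>v 0\<^sub>v m = 0\<^sub>v n" using T by (intro eq_vecI) auto
  then show "0\<^sub>v n \<in> colspan T P" using T unfolding colspan_def
    by (auto intro!: exI[of _ "0\<^sub>v m"])
  fix u v assume "u \<in> colspan T P" "v \<in> colspan T P"
  then obtain x y where h: "u = T *\<^sub>v x" "v = T *\<^sub>v y" "x \<in> carrier_vec m" "y \<in> carrier_vec m"
    "\<forall>i < m. x $ i \<noteq> 0 \<longrightarrow> P i" "\<forall>i < m. y $ i \<noteq> 0 \<longrightarrow> P i"
    using T by (auto simp: colspan_def)
  have "u + v = T *\<^sub>v (x + y)" using h T by (simp add: mult_add_distrib_mat_vec)
  moreover have "\<forall>i < m. (x + y) $ i \<noteq> 0 \<longrightarrow> P i" using h by (metis add.right_neutral carrier_vecD index_add_vec(1))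
  ultimately show "u + v \<in> colspan T P" unfolding colspan_def using T h by auto
next
  assume T: "T \<in> carrier_mat n m"
  fix c v assume "v \<in> colspan T P"
  then obtain x where h: "v = T *\<^sub>v x" "x \<in> carrier_vec m" "\<forall>i < m. x $ i \<noteq> 0 \<longrightarrow> P i"
    using T by (auto simp: colspan_def)
  have "c \<cdot>\<^sub>v v = T *\<^sub>v (c \<cdot>\<^sub>v x)" using h T by (simp add: mult_mat_vec)
  moreover have "\<forall>i < m. (c \<cdot>\<^sub>v x) $ i \<noteq> 0 \<longrightarrow> P i" using h by auto
  ultimately show "c \<cdot>\<^sub>v v \<in> colspan T P" unfolding colspan_def using T h by auto
qed

lemma mult_mat_unit_vec: "T \<in> carrier_mat n m \<Longrightarrow> j < m \<Longrightarrow> T *\<^sub>v unit_vec m j = col T (j::nat)"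
  for T :: "'a :: field mat"
  by (intro eq_vecI) (auto simp: scalar_prod_right_unit)

lemma col_in_colspan: "T \<in> carrier_mat n m \<Longrightarrow> j < m \<Longrightarrow> P j \<Longrightarrow> col T j \<in> colspan T P"
  unfolding colspan_def
  by (auto intro!: exI[of _ "unit_vec m j"] simp: mult_mat_unit_vec split: if_splits)

lemma mult_mat_vec_as_sum:
  "T \<in> carrier_mat n m \<Longrightarrow> x \<in> carrier_vec m \<Longrightarrow>
    T *\<^sub>v x = vec n (\<lambda>k. \<Sum>j<m. (x $ j \<cdot>\<^sub>v col T j) $ k)" for T :: "'a :: field mat"
  by (intro eq_vecI) (auto simp: scalar_prod_def atLeast0LessThan intro!: sum.cong)

lemma colspan_least:
  assumes T: "T \<in> carrier_mat n m" and U: "is_subspace n U"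
    and "\<And>j. j < m \<Longrightarrow> P j \<Longrightarrow> col T j \<in> U"
  shows "colspan T P \<subseteq> U"
proof
  fix v assume "v \<in> colspan T P"
  then obtain x where x: "v = T *\<^sub>v x" "x \<in> carrier_vec m" "\<forall>i < m. x $ i \<noteq> 0 \<longrightarrow> P i"
    using T by (auto simp: colspan_def)
  have "x $ j \<cdot>\<^sub>v col T j \<in> U" if "j \<in> {..<m}" for j
  proof (cases "x $ j = 0")
    case True
    then have "x $ j \<cdot>\<^sub>v col T j = 0\<^sub>v n" using T that by (intro eq_vecI) auto
    then show ?thesis using is_subspaceD(2)[OF U] by simp
  next
    case False
    then show ?thesis using assms(3) x that is_subspaceD(4)[OF U] by auto
  qed
  then show "v \<in> U"
    using is_subspace_sum[OF U, of "{..<m}" "\<lambda>j. x $ j \<cdot>\<^sub>v col T j"] x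
    by (simp add: mult_mat_vec_as_sum[OF T])
qed

text \<open>
  Extending an independent set along the steps of a filtration, one step after the other, gives
  a basis that is adapted to it. The new basis vectors may be chosen in any set \<open>X k\<close> that spans
  the step \<open>W k\<close> modulo the previous one.
\<close>

lemma filtered_basis:
  fixes W :: "int \<Rightarrow> 'a :: field vec set"
  assumes sub: "\<And>k. is_subspace n (W k)" and mono: "\<And>k l. k \<le> l \<Longrightarrow> W k \<subseteq> W l"
    and bot: "W lo = {0\<^sub>v n}" and top: "W hi = carrier_vec n"
    and X: "\<And>k. X k \<subseteq> W k" "\<And>k. W k \<subseteq> lin_span n (X k \<union> W (k - 1))"
  shows "\<exists>T T' w. inverse_mats n T T' \<and> (\<forall>j<n. col T j \<in> X (w j))
     \<and> (\<forall>k. W k = colspan T (\<lambda>j. w j \<le> k))"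
proof -
  have ex: "\<exists>B w. indep n B \<and> (\<forall>b\<in>B. b \<in> X (w b) \<and> w b \<le> lo + int m)
      \<and> (\<forall>l \<le> lo + int m. W l \<subseteq> lin_span n {b\<in>B. w b \<le> l})" for m
  proof (induction m)
    case 0
    have "W l \<subseteq> lin_span n {b\<in>{}. True}" if "l \<le> lo" for l
      using mono[OF that] bot is_subspaceD(2)[OF lin_span_subspace[of "{}" n]] by auto
    then show ?case using indep_empty by (intro exI[of _ "{}"]) auto
  next
    case (Suc m)
    then obtain B w where B: "indep n B" "\<forall>b\<in>B. b \<in> X (w b) \<and> w b \<le> lo + int m"
      "\<And>l. l \<le> lo + int m \<Longrightarrow> W l \<subseteq> lin_span n {b\<in>B. w b \<le> l}" by blast
    let ?k = "lo + int (Suc m)"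
    have "X ?k \<subseteq> carrier_vec n" using X(1) is_subspaceD(1)[OF sub] by blast
    then obtain B' where B': "B \<subseteq> B'" "B' \<subseteq> B \<union> X ?k" "indep n B'" "X ?k \<subseteq> lin_span n B'"
      using indep_extend[OF B(1)] by meson
    define w' where "w' b = (if b \<in> B then w b else ?k)" for b
    have "W l \<subseteq> lin_span n {b\<in>B'. w' b \<le> l}" if l: "l \<le> ?k" for l
    proof (cases "l \<le> lo + int m")
      case True
      then have "{b\<in>B'. w' b \<le> l} = {b\<in>B. w b \<le> l}" using B' by (auto simp: w'_def)
      then show ?thesis using B(3)[OF True] by simp
    next
      case False
      then have l: "l = ?k" using l by auto
      then have B'e: "{b\<in>B'. w' b \<le> l} = B'" using B'(2) B(2) by (auto simp: w'_def)
      have B'c: "B' \<subseteq> carrier_vec n" using B'(3) by (simp add: indep_def)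
      have "W (?k - 1) \<subseteq> lin_span n {b\<in>B. w b \<le> ?k - 1}" using B(3)[of "?k - 1"] by simp
      also have "\<dots> \<subseteq> lin_span n B'"
        by (rule lin_span_least[OF lin_span_subspace[OF B'c]]) (use lin_span_superset[OF B'c] B' in auto)
      finally have "X ?k \<union> W (?k - 1) \<subseteq> lin_span n B'" using B' by auto
      then have "lin_span n (X ?k \<union> W (?k - 1)) \<subseteq> lin_span n B'"
        by (rule lin_span_least[OF lin_span_subspace[OF B'c]])
      then show ?thesis using X(2)[of ?k] B'e l by auto
    qed
    moreover have "\<forall>b\<in>B'. b \<in> X (w' b) \<and> w' b \<le> ?k" using B'(2) B(2) by (force simp: w'_def)
    ultimately show ?case using B' by (intro exI[of _ B'] exI[of _ w']) auto
  qed
  define K where "K = max lo hi"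
  have K: "W K = carrier_vec n" using mono[of hi K] top is_subspaceD(1)[OF sub] by (auto simp: K_def)
  have "lo + int (nat (K - lo)) = K" by (auto simp: K_def)
  then obtain B w where B: "indep n B" "\<forall>b\<in>B. b \<in> X (w b) \<and> w b \<le> K"
      "\<And>l. l \<le> K \<Longrightarrow> W l \<subseteq> lin_span n {b\<in>B. w b \<le> l}" using ex[of "nat (K - lo)"] by auto
  interpret vec_space "TYPE('a)" n .
  have Bc: "B \<subseteq> carrier_vec n" using B(1) by (simp add: indep_def)
  have finB: "finite B" using indep_finite[OF B(1)] by auto
  have "carrier_vec n \<subseteq> lin_span n {b\<in>B. w b \<le> K}" using B(3)[of K] K by simp
  also have "{b\<in>B. w b \<le> K} = B" using B(2) by auto
  finally have spanB: "lin_span n B = carrier_vec n"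
    using is_subspaceD(1)[OF lin_span_subspace[OF Bc]] by auto
  have "basis B" unfolding basis_def using B(1) spanB by (simp add: indep_def)
  then have cardB: "card B = n" using dim_basis[OF finB] dim_is_n by simp
  obtain bs where bs: "set bs = B" "distinct bs" using finite_distinct_list[OF finB] by auto
  then have len: "length bs = n" using cardB distinct_card[OF bs(2)] by simp
  define T where "T = mat_of_cols n bs"
  have T: "T \<in> carrier_mat n n" using len by (auto simp: T_def)
  have colT: "col T j = bs ! j" if "j < n" for j
  proof -
    have "bs ! j \<in> carrier_vec n"
      using that len bs(1) Bc nth_mem[of j bs] by (simp add: subset_iff)
    then show ?thesis unfolding T_def using that len by (intro col_mat_of_cols) simp_all
  qed
  have W_sub: "W l \<subseteq> colspan T (\<lambda>j. w (bs ! j) \<le> l)" for l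
  proof -
    have "W (min l K) \<subseteq> lin_span n {b\<in>B. w b \<le> min l K}" using B(3)[of "min l K"] by auto
    also have "\<dots> \<subseteq> colspan T (\<lambda>j. w (bs ! j) \<le> l)"
    proof (rule lin_span_least[OF colspan_subspace[OF T]])
      show "{b \<in> B. w b \<le> min l K} \<subseteq> colspan T (\<lambda>j. w (bs ! j) \<le> l)"
      proof
        fix b assume b: "b \<in> {b \<in> B. w b \<le> min l K}"
        then obtain j where j: "j < n" "b = bs ! j" using bs len by (auto simp: in_set_conv_nth)
        then show "b \<in> colspan T (\<lambda>j. w (bs ! j) \<le> l)"
          using col_in_colspan[OF T, of j "\<lambda>j. w (bs ! j) \<le> l"] colT b by auto
      qed
    qed
    finally have "W (min l K) \<subseteq> colspan T (\<lambda>j. w (bs ! j) \<le> l)" .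
    moreover have "W l \<subseteq> W (min l K)" using K is_subspaceD(1)[OF sub] by (auto simp: min_def)
    ultimately show ?thesis by auto
  qed
  have "\<exists>x. x \<in> carrier_vec n \<and> T *\<^sub>v x = unit_vec n j" for j
  proof -
    have "unit_vec n j \<in> W K" using K by simp
    then have "unit_vec n j \<in> colspan T (\<lambda>j. w (bs ! j) \<le> K)" using W_sub by blast
    then show ?thesis using T unfolding colspan_def by auto
  qed
  then obtain f where "\<forall>j. f j \<in> carrier_vec n \<and> T *\<^sub>v f j = unit_vec n j"
    using choice[of "\<lambda>j x. x \<in> carrier_vec n \<and> T *\<^sub>v x = unit_vec n j"] by auto
  then have f: "\<And>j. f j \<in> carrier_vec n" "\<And>j. T *\<^sub>v f j = unit_vec n j" by auto
  define T' where "T' = mat_of_cols n (map f [0..<n])"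
  have T': "T' \<in> carrier_mat n n" by (auto simp: T'_def)
  have "T * T' = 1\<^sub>m n"
  proof (rule eq_matI)
    fix i j assume ij: "i < dim_row (1\<^sub>m n)" "j < dim_col (1\<^sub>m n)"
    have "col T' j = f j" using ij f by (auto simp: T'_def col_mat_of_cols)
    then have "(T * T') $$ (i, j) = (T *\<^sub>v f j) $ i" using ij T T' by auto
    then show "(T * T') $$ (i, j) = 1\<^sub>m n $$ (i, j)" using f ij by simp
  qed (use T T' in auto)
  then have inv: "inverse_mats n T T'" using T T' by (intro inverse_matsI)
  have "colspan T (\<lambda>j. w (bs ! j) \<le> l) \<subseteq> W l" for l
  proof (rule colspan_least[OF T sub])
    fix j assume j: "j < n" "w (bs ! j) \<le> l"
    have "bs ! j \<in> X (w (bs ! j))" using B(2) bs len j by (metis nth_mem)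
    then show "col T j \<in> W l" using X(1) mono[OF j(2)] colT[OF j(1)] by auto
  qed
  moreover have "\<forall>j<n. col T j \<in> X (w (bs ! j))" using colT B(2) bs len by (metis nth_mem)
  ultimately show ?thesis using inv W_sub by (intro exI[of _ T] exI[of _ T'] exI[of _ "\<lambda>j. w (bs ! j)"]) blast
qed

section \<open>Kronecker products\<close>

lemma sum_div_mod:
  "(\<Sum>k<n * m. f (k div m) (k mod m)) = (\<Sum>i<n. \<Sum>j<m. f i j)" for f :: "nat \<Rightarrow> nat \<Rightarrow> 'a :: comm_monoid_add"
proof (cases "m = 0")
  case False
  have "(\<Sum>k<n * m. f (k div m) (k mod m)) = (\<Sum>i<n. \<Sum>k = i * m..<i * m + m. f (k div m) (k mod m))"
    using sum.nat_group[of "\<lambda>k. f (k div m) (k mod m)" m n] by simp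
  also have "\<dots> = (\<Sum>i<n. \<Sum>j<m. f i j)"
  proof (rule sum.cong[OF refl])
    fix i
    have "(\<Sum>k = i * m..<i * m + m. f (k div m) (k mod m)) = (\<Sum>j = 0..<m. f ((j + i * m) div m) ((j + i * m) mod m))"
      using sum.shift_bounds_nat_ivl[of "\<lambda>k. f (k div m) (k mod m)" 0 "i * m" m] by (simp add: add.commute)
    also have "\<dots> = (\<Sum>j<m. f i j)" by (rule sum.cong) (use False in auto)
    finally show "(\<Sum>k = i * m..<i * m + m. f (k div m) (k mod m)) = (\<Sum>j<m. f i j)" .
  qed
  finally show ?thesis .
qed simp

lemma div_mod_bounds:
  assumes "i < n * (m :: nat)"
  shows "i div m < n" "i mod m < m" "0 < m" "0 < n"
  using assms by (auto simp: less_mult_imp_div_less intro!: mod_less_divisor gr0I)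

lemma pair_index_bound: "i < n \<Longrightarrow> j < m \<Longrightarrow> i * m + j < n * (m :: nat)"
proof -
  assume "i < n" "j < m"
  then have "i * m + j < i * m + m" "(i + 1) * m \<le> n * m"
    by (simp, intro mult_le_mono1) simp
  then show ?thesis by simp
qed

lemma pair_index_div_mod: "j < m \<Longrightarrow> (i * m + j) div m = i" "j < m \<Longrightarrow> (i * m + j) mod m = (j :: nat)"
  by auto

lemma pair_index_eq:
  "b < m \<Longrightarrow> (k :: nat) = a * m + b \<longleftrightarrow> k div m = a \<and> k mod m = b"
  by (metis div_mult_mod_eq pair_index_div_mod)

lemma kron_dims [simp]:
  "dim_row (kron_mat A B) = dim_row A * dim_row B" "dim_col (kron_mat A B) = dim_col A * dim_col B"
  "dim_vec (kron_vec v w) = dim_vec v * dim_vec w"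
  by (auto simp: kron_mat_def kron_vec_def)

lemma kron_carrier [simp, intro]:
  "A \<in> carrier_mat n m \<Longrightarrow> B \<in> carrier_mat n' m' \<Longrightarrow> kron_mat A B \<in> carrier_mat (n * n') (m * m')"
  "v \<in> carrier_vec n \<Longrightarrow> w \<in> carrier_vec n' \<Longrightarrow> kron_vec v w \<in> carrier_vec (n * n')"
proof -
  assume "A \<in> carrier_mat n m" "B \<in> carrier_mat n' m'"
  then show "kron_mat A B \<in> carrier_mat (n * n') (m * m')" by (intro carrier_matI) (metis carrier_matD kron_dims)+
next
  assume "v \<in> carrier_vec n" "w \<in> carrier_vec n'"
  then show "kron_vec v w \<in> carrier_vec (n * n')" by (intro carrier_vecI) simp
qed

lemma kron_index [simp]:
  "i < dim_row A * dim_row B \<Longrightarrow> j < dim_col A * dim_col B \<Longrightarrow>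
    kron_mat A B $$ (i, j) = A $$ (i div dim_row B, j div dim_col B) * B $$ (i mod dim_row B, j mod dim_col B)"
  "i < dim_vec v * dim_vec w \<Longrightarrow> kron_vec v w $ i = v $ (i div dim_vec w) * w $ (i mod dim_vec w)"
  by (auto simp: kron_mat_def kron_vec_def)

lemma mult_mat_index:
  "i < dim_row A \<Longrightarrow> j < dim_col B \<Longrightarrow> dim_col A = dim_row B \<Longrightarrow>
    (A * B) $$ (i, j) = (\<Sum>k<dim_row B. A $$ (i, k) * B $$ (k, j))"
  by (simp add: scalar_prod_def atLeast0LessThan)

lemma kron_mult:
  fixes A :: "'a :: comm_semiring_1 mat"
  assumes "A \<in> carrier_mat n m" "B \<in> carrier_mat m k" "C \<in> carrier_mat n' m'" "D \<in> carrier_mat m' k'"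
  shows "kron_mat (A * B) (C * D) = kron_mat A C * kron_mat B D"
proof (rule eq_matI)
  fix i j assume "i < dim_row (kron_mat A C * kron_mat B D)" "j < dim_col (kron_mat A C * kron_mat B D)"
  then have ij: "i < n * n'" "j < k * k'" using assms by auto
  note b = div_mod_bounds[OF ij(1)] div_mod_bounds[OF ij(2)]
  have "(kron_mat A C * kron_mat B D) $$ (i, j)
    = (\<Sum>l<m * m'. A $$ (i div n', l div m') * B $$ (l div m', j div k') * (C $$ (i mod n', l mod m') * D $$ (l mod m', j mod k')))"
    using assms ij by (subst mult_mat_index) (auto intro!: sum.cong simp: mult_ac)
  also have "\<dots> = (\<Sum>a<m. \<Sum>b<m'. A $$ (i div n', a) * B $$ (a, j div k') * (C $$ (i mod n', b) * D $$ (b, j mod k')))"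
    by (rule sum_div_mod)
  also have "\<dots> = kron_mat (A * B) (C * D) $$ (i, j)"
    using assms ij b by (simp add: mult_mat_index sum_product del: index_mult_mat(1))
  finally show "kron_mat (A * B) (C * D) $$ (i, j) = (kron_mat A C * kron_mat B D) $$ (i, j)" by simp
qed (use assms in auto)

lemma kron_mult_vec:
  fixes A :: "'a :: comm_semiring_1 mat"
  assumes "A \<in> carrier_mat n m" "v \<in> carrier_vec m" "C \<in> carrier_mat n' m'" "w \<in> carrier_vec m'"
  shows "kron_mat A C *\<^sub>v kron_vec v w = kron_vec (A *\<^sub>v v) (C *\<^sub>v w)"
proof (rule eq_vecI)
  fix i assume "i < dim_vec (kron_vec (A *\<^sub>v v) (C *\<^sub>v w))"
  then have i: "i < n * n'" using assms by auto
  note b = div_mod_bounds[OF i]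
  have "(kron_mat A C *\<^sub>v kron_vec v w) $ i
    = (\<Sum>l<m * m'. A $$ (i div n', l div m') * v $ (l div m') * (C $$ (i mod n', l mod m') * w $ (l mod m')))"
    using assms i by (auto simp: scalar_prod_def atLeast0LessThan intro!: sum.cong simp: mult_ac)
  also have "\<dots> = (\<Sum>a<m. \<Sum>b<m'. A $$ (i div n', a) * v $ a * (C $$ (i mod n', b) * w $ b))"
    by (rule sum_div_mod)
  also have "\<dots> = kron_vec (A *\<^sub>v v) (C *\<^sub>v w) $ i"
    using assms i b by (simp add: scalar_prod_def atLeast0LessThan sum_product)
  finally show "(kron_mat A C *\<^sub>v kron_vec v w) $ i = kron_vec (A *\<^sub>v v) (C *\<^sub>v w) $ i" .
qed (use assms in auto)

lemma col_kron:
  assumes "j < dim_col A * dim_col B"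
  shows "col (kron_mat A B) j = kron_vec (col A (j div dim_col B)) (col B (j mod dim_col B))"
proof (rule eq_vecI)
  fix i assume i: "i < dim_vec (kron_vec (col A (j div dim_col B)) (col B (j mod dim_col B)))"
  then have i: "i < dim_row A * dim_row B" by simp
  show "col (kron_mat A B) j $ i = kron_vec (col A (j div dim_col B)) (col B (j mod dim_col B)) $ i"
    using i assms div_mod_bounds[OF i] div_mod_bounds[OF assms] by simp
qed simp

lemma one_mat_index_div_mod:
  assumes "i < n * m" "j < n * m"
  shows "1\<^sub>m n $$ (i div m, j div m) * 1\<^sub>m m $$ (i mod m, j mod m) = (1\<^sub>m (n * m) $$ (i, j) :: 'a :: semiring_1)"
proof -
  have "i = j \<longleftrightarrow> i div m = j div m \<and> i mod m = j mod m"
    by (metis div_mult_mod_eq)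
  then show ?thesis using assms div_mod_bounds[OF assms(1)] div_mod_bounds[OF assms(2)] by auto
qed

lemma kron_one: "kron_mat (1\<^sub>m n) (1\<^sub>m m) = (1\<^sub>m (n * m) :: 'a :: semiring_1 mat)"
  by (rule eq_matI) (simp_all add: one_mat_index_div_mod del: index_one_mat(1))

lemma kron_one_left: "kron_mat (1\<^sub>m 1) A = A" for A :: "'a :: semiring_1 mat"
  by (rule eq_matI) auto

lemma kron_one_right: "kron_mat A (1\<^sub>m 1) = A" for A :: "'a :: semiring_1 mat"
  by (rule eq_matI) auto

lemma kron_assoc: "kron_mat (kron_mat A B) C = kron_mat A (kron_mat B C)" for A :: "'a :: comm_semiring_1 mat"
proof (rule eq_matI)
  fix i j assume "i < dim_row (kron_mat A (kron_mat B C))" "j < dim_col (kron_mat A (kron_mat B C))"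
  then have ij: "i < dim_row A * dim_row B * dim_row C" "j < dim_col A * dim_col B * dim_col C"
    by (auto simp: mult.assoc)
  note b1 = div_mod_bounds[OF ij(1)] and b2 = div_mod_bounds[OF ij(2)]
  note b3 = div_mod_bounds[OF ij(1)[unfolded mult.assoc]] and b4 = div_mod_bounds[OF ij(2)[unfolded mult.assoc]]
  have 1: "i div (b * c) = i div c div b" for i b c :: nat
    using div_mult2_eq[of i c b] by (simp add: mult.commute)
  have m: "i mod (b * c) = c * (i div c mod b) + i mod c" for i b c :: nat
    using mod_mult2_eq[of i c b] by (simp add: mult.commute)
  have 2: "i mod (b * c) mod c = i mod c" for i b c :: nat
    unfolding m by simp
  have 3: "i mod (b * c) div c = i div c mod b" for i b c :: nat
    unfolding m by (cases "c = 0") simp_all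
  note * = 1 2 3
  show "kron_mat (kron_mat A B) C $$ (i, j) = kron_mat A (kron_mat B C) $$ (i, j)"
  proof -
    have L: "kron_mat (kron_mat A B) C $$ (i, j)
      = A $$ (i div dim_row C div dim_row B, j div dim_col C div dim_col B)
        * B $$ (i div dim_row C mod dim_row B, j div dim_col C mod dim_col B)
        * C $$ (i mod dim_row C, j mod dim_col C)"
      using ij b1 b2 by simp
    have R: "kron_mat A (kron_mat B C) $$ (i, j)
      = A $$ (i div (dim_row B * dim_row C), j div (dim_col B * dim_col C))
        * (B $$ (i mod (dim_row B * dim_row C) div dim_row C, j mod (dim_col B * dim_col C) div dim_col C)
        * C $$ (i mod (dim_row B * dim_row C) mod dim_row C, j mod (dim_col B * dim_col C) mod dim_col C))"
      using ij[unfolded mult.assoc] b3 b4 by simp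
    show ?thesis unfolding L R * by (simp only: mult.assoc)
  qed
qed (auto simp: mult.assoc)

lemma kron_add_left:
  fixes A :: "'a :: comm_semiring_1 mat"
  assumes "A \<in> carrier_mat n m" "A' \<in> carrier_mat n m"
  shows "kron_mat (A + A') B = kron_mat A B + kron_mat A' B"
proof (rule eq_matI)
  fix i j assume "i < dim_row (kron_mat A B + kron_mat A' B)" "j < dim_col (kron_mat A B + kron_mat A' B)"
  then have ij: "i < n * dim_row B" "j < m * dim_col B" using assms by auto
  show "kron_mat (A + A') B $$ (i, j) = (kron_mat A B + kron_mat A' B) $$ (i, j)"
    using ij assms div_mod_bounds[OF ij(1)] div_mod_bounds[OF ij(2)] by (simp add: distrib_right)
qed (use assms in auto)

lemma kron_add_right:
  fixes A :: "'a :: comm_semiring_1 mat"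
  assumes "B \<in> carrier_mat n m" "B' \<in> carrier_mat n m"
  shows "kron_mat A (B + B') = kron_mat A B + kron_mat A B'"
proof (rule eq_matI)
  fix i j assume "i < dim_row (kron_mat A B + kron_mat A B')" "j < dim_col (kron_mat A B + kron_mat A B')"
  then have ij: "i < dim_row A * n" "j < dim_col A * m" using assms by auto
  show "kron_mat A (B + B') $$ (i, j) = (kron_mat A B + kron_mat A B') $$ (i, j)"
    using ij assms div_mod_bounds[OF ij(1)] div_mod_bounds[OF ij(2)] by (simp add: distrib_left)
qed (use assms in auto)

lemma kron_transpose: "transpose_mat (kron_mat A B) = kron_mat (transpose_mat A) (transpose_mat B)"
proof (rule eq_matI)
  fix i j assume "i < dim_row (kron_mat (transpose_mat A) (transpose_mat B))"
    "j < dim_col (kron_mat (transpose_mat A) (transpose_mat B))"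
  then have ij: "i < dim_col A * dim_col B" "j < dim_row A * dim_row B" by auto
  show "transpose_mat (kron_mat A B) $$ (i, j) = kron_mat (transpose_mat A) (transpose_mat B) $$ (i, j)"
    using ij div_mod_bounds[OF ij(1)] div_mod_bounds[OF ij(2)] by simp
qed auto

lemma kron_map:
  assumes "\<And>a b. h (a * b) = h a * h b"
  shows "map_mat h (kron_mat A B) = kron_mat (map_mat h A) (map_mat h B)"
proof (rule eq_matI)
  fix i j assume "i < dim_row (kron_mat (map_mat h A) (map_mat h B))" "j < dim_col (kron_mat (map_mat h A) (map_mat h B))"
  then have ij: "i < dim_row A * dim_row B" "j < dim_col A * dim_col B" by auto
  show "map_mat h (kron_mat A B) $$ (i, j) = kron_mat (map_mat h A) (map_mat h B) $$ (i, j)"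
    using ij div_mod_bounds[OF ij(1)] div_mod_bounds[OF ij(2)] assms by simp
qed auto

lemma kron_vec_map:
  assumes "\<And>a b. h (a * b) = h a * h b"
  shows "map_vec h (kron_vec v w) = kron_vec (map_vec h v) (map_vec h w)"
proof (rule eq_vecI)
  fix i assume "i < dim_vec (kron_vec (map_vec h v) (map_vec h w))"
  then have i: "i < dim_vec v * dim_vec w" by simp
  show "map_vec h (kron_vec v w) $ i = kron_vec (map_vec h v) (map_vec h w) $ i"
    using i div_mod_bounds[OF i] assms by simp
qed simp

lemma kron_inverse_mats:
  assumes "inverse_mats n A A'" "inverse_mats m B B'"
  shows "inverse_mats (n * m) (kron_mat A B) (kron_mat A' B')"
  using assms kron_mult[of A n n A' n B m m B' m] by (intro inverse_matsI) (auto simp: inverse_mats_def kron_one)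

subsection \<open>The symmetry, evaluation and coevaluation\<close>

lemma swap_mat_carrier [simp]: "swap_mat n m \<in> carrier_mat (m * n) (n * m)"
  by (simp add: swap_mat_def)

lemma swap_mat_dims [simp]: "dim_row (swap_mat n m) = m * n" "dim_col (swap_mat n m) = n * m"
  by (simp_all add: swap_mat_def)

lemma swap_mat_index:
  assumes "i < m * n" "j < n * m"
  shows "swap_mat n m $$ (i, j) = (if i = (j mod m) * n + j div m then 1 else 0)"
    and "swap_mat n m $$ (i, j) = (if j = (i mod n) * m + i div n then 1 else 0)"
proof -
  note b = div_mod_bounds[OF assms(1)] div_mod_bounds[OF assms(2)]
  show *: "swap_mat n m $$ (i, j) = (if i = (j mod m) * n + j div m then 1 else 0)"
    using assms by (simp add: swap_mat_def)
  show "swap_mat n m $$ (i, j) = (if j = (i mod n) * m + i div n then 1 else 0)"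
    unfolding * by (subst pair_index_eq[OF b(5)], subst pair_index_eq[OF b(1)]) auto
qed

lemma swap_mult_left:
  assumes A: "A \<in> carrier_mat (n * m) c" and i: "i < m * n" and j: "j < c"
  shows "(swap_mat n m * A) $$ (i, j) = A $$ ((i mod n) * m + i div n, j)"
proof -
  note b = div_mod_bounds[OF i]
  have "(swap_mat n m * A) $$ (i, j) = (\<Sum>k<n * m. swap_mat n m $$ (i, k) * A $$ (k, j))"
    using A i j by (subst mult_mat_index) (auto simp: swap_mat_def)
  also have "\<dots> = (\<Sum>k<n * m. if k = (i mod n) * m + i div n then A $$ (k, j) else 0)"
    by (rule sum.cong) (use i in \<open>auto simp: swap_mat_index(2)\<close>)
  also have "\<dots> = A $$ ((i mod n) * m + i div n, j)"
    using pair_index_bound[OF b(2,1)] by (simp add: sum.delta)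
  finally show ?thesis .
qed

lemma swap_mult_right:
  assumes A: "A \<in> carrier_mat r (m * n)" and i: "i < r" and j: "j < n * m"
  shows "(A * swap_mat n m) $$ (i, j) = A $$ (i, (j mod m) * n + j div m)"
proof -
  note b = div_mod_bounds[OF j]
  have "(A * swap_mat n m) $$ (i, j) = (\<Sum>k<m * n. A $$ (i, k) * swap_mat n m $$ (k, j))"
    using A i j by (subst mult_mat_index) (auto simp: swap_mat_def)
  also have "\<dots> = (\<Sum>k<m * n. if k = (j mod m) * n + j div m then A $$ (i, k) else 0)"
    by (rule sum.cong) (use j in \<open>auto simp: swap_mat_index(1)\<close>)
  also have "\<dots> = A $$ (i, (j mod m) * n + j div m)"
    using pair_index_bound[OF b(2,1)] by (simp add: sum.delta)
  finally show ?thesis .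
qed

lemma swap_natural:
  assumes f: "f \<in> carrier_mat n' n" and g: "g \<in> carrier_mat m' m"
  shows "swap_mat n' m' * kron_mat f g = kron_mat g f * swap_mat n m"
proof (rule eq_matI)
  fix i j assume "i < dim_row (kron_mat g f * swap_mat n m)" "j < dim_col (kron_mat g f * swap_mat n m)"
  then have ij: "i < m' * n'" "j < n * m" using assms by (auto simp: swap_mat_def)
  note b = div_mod_bounds[OF ij(1)] div_mod_bounds[OF ij(2)]
  show "(swap_mat n' m' * kron_mat f g) $$ (i, j) = (kron_mat g f * swap_mat n m) $$ (i, j)"
  proof -
    have "(swap_mat n' m' * kron_mat f g) $$ (i, j) = kron_mat f g $$ (i mod n' * m' + i div n', j)"
      using assms ij by (intro swap_mult_left[of _ _ _ "n * m"]) auto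
    also have "\<dots> = f $$ (i mod n', j div m) * g $$ (i div n', j mod m)"
      using assms ij b pair_index_bound[OF b(2,1)] by (simp add: pair_index_div_mod)
    also have "\<dots> = kron_mat g f $$ (i, j mod m * n + j div m)"
      using assms ij b pair_index_bound[OF b(6,5)] by (simp add: pair_index_div_mod)
    also have "\<dots> = (kron_mat g f * swap_mat n m) $$ (i, j)"
      using assms ij by (intro swap_mult_right[of _ "m' * n'", symmetric]) auto
    finally show ?thesis .
  qed
qed (use assms in \<open>auto simp: swap_mat_def\<close>)

lemma swap_swap: "swap_mat m n * swap_mat n m = 1\<^sub>m (n * m)"
proof (rule eq_matI)
  fix i j assume "i < dim_row (1\<^sub>m (n * m))" "j < dim_col (1\<^sub>m (n * m))"
  then have ij: "i < n * m" "j < n * m" by auto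
  note b = div_mod_bounds[OF ij(1)] div_mod_bounds[OF ij(2)]
  have "(swap_mat m n * swap_mat n m) $$ (i, j) = (if i mod m * n + i div m = j mod m * n + j div m then 1 else 0)"
    using ij pair_index_bound[OF b(2,1)]
    by (subst swap_mult_left[of _ _ _ "n * m"]) (auto simp: swap_mat_index)
  also have "i mod m * n + i div m = j mod m * n + j div m \<longleftrightarrow> i = j"
    using pair_index_div_mod[OF b(1)] pair_index_div_mod[OF b(5)] div_mult_mod_eq by metis
  finally show "(swap_mat m n * swap_mat n m) $$ (i, j) = 1\<^sub>m (n * m) $$ (i, j)" using ij by simp
qed (auto simp: swap_mat_def)

lemma swap_hexagon:
  "swap_mat x (y * z) = kron_mat (1\<^sub>m y) (swap_mat x z) * kron_mat (swap_mat x y) (1\<^sub>m z)"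
proof (rule eq_matI)
  let ?A = "kron_mat (1\<^sub>m y) (swap_mat x z)" and ?B = "kron_mat (swap_mat x y) (1\<^sub>m z)"
  have dims: "?A \<in> carrier_mat (y * (z * x)) (y * (x * z))" "?B \<in> carrier_mat (y * x * z) (x * y * z)"
    by (auto intro!: kron_carrier)
  fix i j assume "i < dim_row (?A * ?B)" "j < dim_col (?A * ?B)"
  then have i: "i < y * (z * x)" and j: "j < x * y * z"
    by (simp_all add: mult.assoc)
  note bj = div_mod_bounds[OF j] note bj' = div_mod_bounds[OF bj(1)]
  define a b c where abc: "a = j div z div y" "b = j div z mod y" "c = j mod z"
  have lt: "a < x" "b < y" "c < z" using bj bj' by (auto simp: abc)
  have jdec: "j div z = a * y + b" "j mod z = c" "j = (a * y + b) * z + c" by (simp_all add: abc)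
  have j2: "j = a * (y * z) + (b * z + c)" using jdec(3) by (simp add: algebra_simps)
  have lt2: "b * z + c < y * z" by (rule pair_index_bound[OF lt(2,3)])
  have j3: "j div (y * z) = a" "j mod (y * z) = b * z + c"
    unfolding j2 by (rule pair_index_div_mod[OF lt2])+
  define h where "h = (b * x + a) * z + c"
  have h: "h < y * x * z" unfolding h_def by (intro pair_index_bound lt)
  have colB: "?B $$ (k, j) = (if k = h then 1 else 0)" if k: "k < y * x * z" for k
  proof -
    note bk = div_mod_bounds[OF k]
    have "?B $$ (k, j) = swap_mat x y $$ (k div z, j div z) * 1\<^sub>m z $$ (k mod z, j mod z)"
      using k j dims by (auto simp: swap_mat_def)
    also have "\<dots> = (if k div z = b * x + a \<and> k mod z = c then 1 else 0)"
    proof -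
      have p: "swap_mat x y $$ (k div z, j div z) = (if k div z = b * x + a then 1 else 0)"
        using bk bj by (subst swap_mat_index(1)) (simp_all only: abc)
      have q: "1\<^sub>m z $$ (k mod z, j mod z) = (if k mod z = c then 1 else 0)"
        unfolding jdec(2) using bk lt by simp
      show ?thesis unfolding p q by simp
    qed
    finally show ?thesis unfolding h_def pair_index_eq[OF lt(3)] .
  qed
  have h2: "h = b * (x * z) + (a * z + c)" by (simp add: h_def algebra_simps)
  have lt3: "a * z + c < x * z" by (rule pair_index_bound[OF lt(1,3)])
  have h3: "h div (x * z) = b" "h mod (x * z) = a * z + c"
    unfolding h2 by (rule pair_index_div_mod[OF lt3])+
  note bi = div_mod_bounds[OF i]
  have "(?A * ?B) $$ (i, j) = (\<Sum>k<y * x * z. ?A $$ (i, k) * ?B $$ (k, j))"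
    using i j dims by (subst mult_mat_index) (auto simp: mult.assoc)
  also have "\<dots> = (\<Sum>k<y * x * z. if k = h then ?A $$ (i, k) else 0)"
    by (rule sum.cong) (auto simp: colB)
  also have "\<dots> = ?A $$ (i, h)" using h by simp
  also have "\<dots> = 1\<^sub>m y $$ (i div (z * x), h div (x * z)) * swap_mat x z $$ (i mod (z * x), h mod (x * z))"
    using i h dims by (auto simp: swap_mat_def mult.assoc)
  also have "\<dots> = (if i div (z * x) = b \<and> i mod (z * x) = c * x + a then 1 else 0)"
    using bi lt lt3 h3 by (simp add: swap_mat_index(1) pair_index_div_mod)
  also have "\<dots> = (if i = b * (z * x) + (c * x + a) then 1 else 0)"
    using pair_index_bound[OF lt(3,1)] by (simp only: pair_index_eq[of "c * x + a" "z * x"])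
  also have "b * (z * x) + (c * x + a) = (j mod (y * z)) * x + j div (y * z)"
    by (simp add: j3 algebra_simps)
  also have "(if i = \<dots> then 1 else 0) = swap_mat x (y * z) $$ (i, j)"
    using i j by (simp add: swap_mat_index(1) mult.assoc)
  finally show "swap_mat x (y * z) $$ (i, j) = (?A * ?B) $$ (i, j)" by simp
qed (auto simp: swap_mat_def mult.assoc)

lemma ev_coev_carrier [simp]: "ev_mat n \<in> carrier_mat 1 (n * n)" "coev_mat n \<in> carrier_mat (n * n) 1"
  by (auto simp: ev_mat_def coev_mat_def)

lemma sum_div_mod3:
  "(\<Sum>k<n * n * (n :: nat). f (k div n div n) (k div n mod n) (k mod n)) = (\<Sum>a<n. \<Sum>b<n. \<Sum>c<n. f a b c)"
  for f :: "nat \<Rightarrow> nat \<Rightarrow> nat \<Rightarrow> 'a :: comm_monoid_add"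
  using sum_div_mod[of "\<lambda>i c. f (i div n) (i mod n) c" n "n * n"]
    sum_div_mod[of "\<lambda>a b. \<Sum>c<n. f a b c" n n] by simp

lemma sum_indicator3:
  assumes "i < n" "j < n"
  shows "(\<Sum>a<n. \<Sum>b<n. \<Sum>c<(n::nat). if i = a \<and> b = c \<and> a = b \<and> c = j then 1 else 0) = (if i = j then 1 else (0::real))"
proof -
  have "(\<Sum>c<n. if i = a \<and> b = c \<and> a = b \<and> c = j then 1 else (0::real)) = (if b = j then if i = a \<and> a = b then 1 else 0 else 0)" for a b
  proof -
    have "(\<Sum>c<n. if i = a \<and> b = c \<and> a = b \<and> c = j then 1 else (0::real)) = (\<Sum>c<n. if c = j then if i = a \<and> b = j \<and> a = b then 1 else 0 else 0)"
      by (rule sum.cong) auto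
    then show ?thesis using assms by auto
  qed
  then have "(\<Sum>a<n. \<Sum>b<n. \<Sum>c<(n::nat). if i = a \<and> b = c \<and> a = b \<and> c = j then 1 else (0::real)) = (\<Sum>a<n. if i = a \<and> a = j then 1 else 0)"
    using assms by simp
  also have "\<dots> = (\<Sum>a<n. if a = j then if i = j then 1 else 0 else 0)" by (rule sum.cong) auto
  finally show ?thesis using assms by simp
qed

lemma div_mod_square:
  "(k mod (n * n)) div n = k div n mod n" "k mod (n * n) mod n = k mod n" "k div (n * n) = k div n div (n :: nat)"
proof -
  show "k div (n * n) = k div n div n" by (simp add: div_mult2_eq)
  show "k mod (n * n) mod n = k mod n" by (simp add: mod_mult2_eq)
  show "(k mod (n * n)) div n = k div n mod n" by (cases "n = 0") (simp_all add: mod_mult2_eq)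
qed

lemma ev_coev_triangle: "kron_mat (1\<^sub>m n) (ev_mat n) * kron_mat (coev_mat n) (1\<^sub>m n) = 1\<^sub>m n"
proof (rule eq_matI)
  fix i j assume "i < dim_row (1\<^sub>m n)" "j < dim_col (1\<^sub>m n)"
  then have ij: "i < n" "j < n" by auto
  have "(kron_mat (1\<^sub>m n) (ev_mat n) * kron_mat (coev_mat n) (1\<^sub>m n)) $$ (i, j)
    = (\<Sum>k<n * n * n. kron_mat (1\<^sub>m n) (ev_mat n) $$ (i, k) * kron_mat (coev_mat n) (1\<^sub>m n) $$ (k, j))"
    using ij by (subst mult_mat_index) (auto simp: ev_mat_def coev_mat_def)
  also have "\<dots> = (\<Sum>k<n * n * n. if i = k div n div n \<and> k div n mod n = k mod n \<and> k div n div n = k div n mod n \<and> k mod n = j then 1 else 0)"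
  proof (rule sum.cong[OF refl])
    fix k assume k: "k \<in> {..<n * n * n}"
    then have k1: "k < n * n * n" and k2: "k < n * (n * n)" by (auto simp: mult.assoc)
    note b = div_mod_bounds[OF k1] div_mod_bounds[OF k2]
    have 1: "kron_mat (1\<^sub>m n) (ev_mat n) $$ (i, k) = 1\<^sub>m n $$ (i, k div (n * n)) * ev_mat n $$ (0, k mod (n * n))"
      using ij k2 by (auto simp: ev_mat_def)
    have 2: "kron_mat (coev_mat n) (1\<^sub>m n) $$ (k, j) = coev_mat n $$ (k div n, 0) * 1\<^sub>m n $$ (k mod n, j)"
      using ij k1 by (auto simp: coev_mat_def)
    show "kron_mat (1\<^sub>m n) (ev_mat n) $$ (i, k) * kron_mat (coev_mat n) (1\<^sub>m n) $$ (k, j)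
      = (if i = k div n div n \<and> k div n mod n = k mod n \<and> k div n div n = k div n mod n \<and> k mod n = j then 1 else 0)"
      unfolding 1 2 using ij b by (simp add: ev_mat_def coev_mat_def div_mod_square)
  qed
  also have "\<dots> = (\<Sum>a<n. \<Sum>b<n. \<Sum>c<n. if i = a \<and> b = c \<and> a = b \<and> c = j then 1 else 0)"
    by (rule sum_div_mod3)
  also have "\<dots> = 1\<^sub>m n $$ (i, j)" using sum_indicator3[OF ij] ij by simp
  finally show "(kron_mat (1\<^sub>m n) (ev_mat n) * kron_mat (coev_mat n) (1\<^sub>m n)) $$ (i, j) = 1\<^sub>m n $$ (i, j)" .
qed (auto simp: ev_mat_def coev_mat_def)

lemma transpose_ev: "transpose_mat (ev_mat n) = coev_mat n"
  by (rule eq_matI) (auto simp: ev_mat_def coev_mat_def)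

lemma coev_ev_triangle: "kron_mat (ev_mat n) (1\<^sub>m n) * kron_mat (1\<^sub>m n) (coev_mat n) = 1\<^sub>m n"
proof -
  have c: "kron_mat (1\<^sub>m n) (ev_mat n) \<in> carrier_mat n (n * n * n)" "kron_mat (coev_mat n) (1\<^sub>m n) \<in> carrier_mat (n * n * n) n"
    using kron_carrier(1)[OF one_carrier_mat ev_coev_carrier(1), of n n] kron_carrier(1)[OF ev_coev_carrier(2) one_carrier_mat, of n n]
    by (simp_all add: mult.assoc)
  have e: "transpose_mat (coev_mat n) = ev_mat n" unfolding transpose_ev[symmetric] by simp
  have "transpose_mat (kron_mat (1\<^sub>m n) (ev_mat n) * kron_mat (coev_mat n) (1\<^sub>m n)) = 1\<^sub>m n"
    unfolding ev_coev_triangle by simp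
  then show ?thesis unfolding transpose_mult[OF c] kron_transpose transpose_ev e by simp
qed

lemma ev_mult_index:
  assumes A: "A \<in> carrier_mat (n * n) c" and j: "j < c"
  shows "(ev_mat n * A) $$ (0, j) = (\<Sum>a<n. A $$ (a * n + a, j))"
proof -
  have "(ev_mat n * A) $$ (0, j) = (\<Sum>k<n * n. ev_mat n $$ (0, k) * A $$ (k, j))"
    using A j by (subst mult_mat_index) (auto simp: ev_mat_def)
  also have "\<dots> = (\<Sum>k<n * n. if k div n = k mod n then A $$ (k div n * n + k mod n, j) else 0)"
    by (rule sum.cong[OF refl], simp only: div_mult_mod_eq) (simp add: ev_mat_def)
  also have "\<dots> = (\<Sum>a<n. \<Sum>b<n. if a = b then A $$ (a * n + b, j) else 0)" by (rule sum_div_mod)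
  also have "\<dots> = (\<Sum>a<n. A $$ (a * n + a, j))"
    by (rule sum.cong) auto
  finally show ?thesis .
qed

lemma ev_dinatural:
  assumes f: "f \<in> carrier_mat m n"
  shows "ev_mat n * kron_mat (transpose_mat f) (1\<^sub>m n) = ev_mat m * kron_mat (1\<^sub>m m) f"
proof (rule eq_matI)
  fix i j assume "i < dim_row (ev_mat m * kron_mat (1\<^sub>m m) f)" "j < dim_col (ev_mat m * kron_mat (1\<^sub>m m) f)"
  then have i: "i = 0" and j: "j < m * n" using f by (auto simp: ev_mat_def)
  note b = div_mod_bounds[OF j]
  have "(ev_mat n * kron_mat (transpose_mat f) (1\<^sub>m n)) $$ (0, j) = (\<Sum>a<n. if a = j mod n then f $$ (j div n, a) else 0)"
    using f j b pair_index_bound[of _ n _ n]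
    by (subst ev_mult_index[of _ _ "m * n"]) (auto intro!: sum.cong simp: pair_index_div_mod sum.delta if_distrib cong: if_cong)
  moreover have "(ev_mat m * kron_mat (1\<^sub>m m) f) $$ (0, j) = (\<Sum>a<m. if a = j div n then f $$ (a, j mod n) else 0)"
    using f j b pair_index_bound[of _ m _ m]
    by (subst ev_mult_index[of _ _ "m * n"])
       (auto intro!: sum.cong simp: pair_index_div_mod if_distrib[of "\<lambda>x. x * _"] cong: if_cong)
  ultimately show "(ev_mat n * kron_mat (transpose_mat f) (1\<^sub>m n)) $$ (i, j) = (ev_mat m * kron_mat (1\<^sub>m m) f) $$ (i, j)"
    using b i by simp
qed (use f in \<open>auto simp: ev_mat_def\<close>)

section \<open>Tensor categories of matrices\<close>

text \<open>
  MHS and SHS have the same composition, constraints and evaluations, given by matrices that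
  depend only on the dimensions \<open>d\<close> of the objects. All axioms of a tensor category are then
  matrix identities, once these matrices are known to be morphisms.
\<close>

locale matrix_category_data =
  fixes C :: "('o, real mat) tensor_cat" and d :: "'o \<Rightarrow> nat"
  assumes Id_C: "Id C = (\<lambda>X. 1\<^sub>m (d X))" and Cmp_C: "Cmp C = (*)"
    and HAdd_C: "HAdd C = (+)" and HZero_C: "HZero C = (\<lambda>X Y. 0\<^sub>m (d Y) (d X))"
    and TensM_C: "TensM C = kron_mat"
    and Assoc_C: "Assoc C = (\<lambda>X Y Z. 1\<^sub>m (d X * d Y * d Z))"
    and LUnit_C: "LUnit C = (\<lambda>X. 1\<^sub>m (d X))" and RUnit_C: "RUnit C = (\<lambda>X. 1\<^sub>m (d X))"
    and Braid_C: "Braid C = (\<lambda>X Y. swap_mat (d X) (d Y))" and DualM_C: "DualM C = transpose_mat"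
    and Ev_C: "Ev C = (\<lambda>X. ev_mat (d X))" and Coev_C: "Coev C = (\<lambda>X. coev_mat (d X))"
    and d_tens: "d (TensO C X Y) = d X * d Y" and d_unit: "d (UnitO C) = 1"
    and d_dual: "d (DualO C X) = d X"
    and hom_carrier: "f \<in> Hom C X Y \<Longrightarrow> f \<in> carrier_mat (d Y) (d X)"
begin

lemmas data_simps = Id_C Cmp_C HAdd_C HZero_C TensM_C Assoc_C LUnit_C RUnit_C Braid_C DualM_C
  Ev_C Coev_C d_tens d_unit d_dual

end

locale matrix_tensor_category = matrix_category_data +
  assumes one_hom: "X \<in> Obj C \<Longrightarrow> 1\<^sub>m (d X) \<in> Hom C X X"
    and mult_hom: "\<lbrakk>X \<in> Obj C; Y \<in> Obj C; Z \<in> Obj C; f \<in> Hom C X Y; g \<in> Hom C Y Z\<rbrakk> \<Longrightarrow> g * f \<in> Hom C X Z"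
    and zero_hom: "\<lbrakk>X \<in> Obj C; Y \<in> Obj C\<rbrakk> \<Longrightarrow> 0\<^sub>m (d Y) (d X) \<in> Hom C X Y"
    and add_hom: "\<lbrakk>X \<in> Obj C; Y \<in> Obj C; f \<in> Hom C X Y; g \<in> Hom C X Y\<rbrakk> \<Longrightarrow> f + g \<in> Hom C X Y"
    and uminus_hom: "\<lbrakk>X \<in> Obj C; Y \<in> Obj C; f \<in> Hom C X Y\<rbrakk> \<Longrightarrow> - f \<in> Hom C X Y"
    and unit_obj: "UnitO C \<in> Obj C"
    and tens_obj: "\<lbrakk>X \<in> Obj C; Y \<in> Obj C\<rbrakk> \<Longrightarrow> TensO C X Y \<in> Obj C"
    and dual_obj: "X \<in> Obj C \<Longrightarrow> DualO C X \<in> Obj C"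
    and kron_hom: "\<lbrakk>X \<in> Obj C; Y \<in> Obj C; X' \<in> Obj C; Y' \<in> Obj C; f \<in> Hom C X X'; g \<in> Hom C Y Y'\<rbrakk>
          \<Longrightarrow> kron_mat f g \<in> Hom C (TensO C X Y) (TensO C X' Y')"
    and assoc_hom: "\<lbrakk>X \<in> Obj C; Y \<in> Obj C; Z \<in> Obj C\<rbrakk>
          \<Longrightarrow> 1\<^sub>m (d X * d Y * d Z) \<in> Hom C (TensO C (TensO C X Y) Z) (TensO C X (TensO C Y Z))"
      "\<lbrakk>X \<in> Obj C; Y \<in> Obj C; Z \<in> Obj C\<rbrakk>
          \<Longrightarrow> 1\<^sub>m (d X * d Y * d Z) \<in> Hom C (TensO C X (TensO C Y Z)) (TensO C (TensO C X Y) Z)"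
    and lunit_hom: "X \<in> Obj C \<Longrightarrow> 1\<^sub>m (d X) \<in> Hom C (TensO C (UnitO C) X) X"
      "X \<in> Obj C \<Longrightarrow> 1\<^sub>m (d X) \<in> Hom C X (TensO C (UnitO C) X)"
    and runit_hom: "X \<in> Obj C \<Longrightarrow> 1\<^sub>m (d X) \<in> Hom C (TensO C X (UnitO C)) X"
      "X \<in> Obj C \<Longrightarrow> 1\<^sub>m (d X) \<in> Hom C X (TensO C X (UnitO C))"
    and swap_hom: "\<lbrakk>X \<in> Obj C; Y \<in> Obj C\<rbrakk> \<Longrightarrow> swap_mat (d X) (d Y) \<in> Hom C (TensO C X Y) (TensO C Y X)"
    and transpose_hom: "\<lbrakk>X \<in> Obj C; Y \<in> Obj C; f \<in> Hom C X Y\<rbrakk>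
          \<Longrightarrow> transpose_mat f \<in> Hom C (DualO C Y) (DualO C X)"
    and ev_hom: "X \<in> Obj C \<Longrightarrow> ev_mat (d X) \<in> Hom C (TensO C (DualO C X) X) (UnitO C)"
    and coev_hom: "X \<in> Obj C \<Longrightarrow> coev_mat (d X) \<in> Hom C (UnitO C) (TensO C X (DualO C X))"
begin

lemma category: "category C"
proof
  fix X Y Z U f g h
  show "X \<in> Obj C \<Longrightarrow> Id C X \<in> Hom C X X" using one_hom by (simp add: data_simps)
  assume XY: "X \<in> Obj C" "Y \<in> Obj C" and f: "f \<in> Hom C X Y"
  note fc = hom_carrier[OF f]
  show "Cmp C (Id C Y) f = f" "Cmp C f (Id C X) = f" using fc by (simp_all add: data_simps)
  assume Z: "Z \<in> Obj C" and g: "g \<in> Hom C Y Z"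
  show "Cmp C g f \<in> Hom C X Z" using mult_hom[OF XY Z f g] by (simp add: data_simps)
  assume "h \<in> Hom C Z U"
  from hom_carrier[OF this] hom_carrier[OF g] fc
  show "Cmp C (Cmp C h g) f = Cmp C h (Cmp C g f)" by (simp add: data_simps assoc_mult_mat)
qed

lemma preadditive: "preadditive_category C"
proof -
  show ?thesis
  proof (rule preadditive_category.intro[OF category preadditive_category_axioms.intro])
    fix X Y Z f f' g g'
    assume XY: "X \<in> Obj C" "Y \<in> Obj C"
    show "comm_group \<lparr>carrier = Hom C X Y, monoid.mult = HAdd C, one = HZero C X Y\<rparr>"
    proof (rule comm_groupI)
      fix f assume "f \<in> carrier \<lparr>carrier = Hom C X Y, monoid.mult = HAdd C, one = HZero C X Y\<rparr>"
      then have f: "f \<in> Hom C X Y" by simp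
      then show "\<exists>g\<in>carrier \<lparr>carrier = Hom C X Y, monoid.mult = HAdd C, one = HZero C X Y\<rparr>.
        g \<otimes>\<^bsub>\<lparr>carrier = Hom C X Y, monoid.mult = HAdd C, one = HZero C X Y\<rparr>\<^esub> f
          = \<one>\<^bsub>\<lparr>carrier = Hom C X Y, monoid.mult = HAdd C, one = HZero C X Y\<rparr>\<^esub>"
        using uminus_hom[OF XY f] hom_carrier[OF f] by (auto simp: data_simps intro!: bexI[of _ "- f"])
    qed (use zero_hom[OF XY] add_hom[OF XY] hom_carrier[of _ X Y] in
          \<open>auto simp: data_simps intro: assoc_add_mat comm_add_mat\<close>)
    assume Z: "Z \<in> Obj C"
    show "f \<in> Hom C X Y \<Longrightarrow> f' \<in> Hom C X Y \<Longrightarrow> g \<in> Hom C Y Z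
      \<Longrightarrow> Cmp C g (HAdd C f f') = HAdd C (Cmp C g f) (Cmp C g f')"
      unfolding Cmp_C HAdd_C by (rule mult_add_distrib_mat; erule hom_carrier)
    show "f \<in> Hom C X Y \<Longrightarrow> g \<in> Hom C Y Z \<Longrightarrow> g' \<in> Hom C Y Z
      \<Longrightarrow> Cmp C (HAdd C g g') f = HAdd C (Cmp C g f) (Cmp C g' f)"
      unfolding Cmp_C HAdd_C by (rule add_mult_distrib_mat; erule hom_carrier)
  qed
qed

lemma is_iso_one:
  assumes "1\<^sub>m (d X) \<in> Hom C X Y" "1\<^sub>m (d X) \<in> Hom C Y X" "d X = d Y"
  shows "is_iso C X Y (1\<^sub>m (d X))"
  using assms unfolding is_iso_def inverse_arrows_def
  by (intro exI[of _ "1\<^sub>m (d X)"]) (simp add: data_simps)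

lemma is_isoI:
  assumes "f \<in> Hom C X Y" "g \<in> Hom C Y X" "g * f = 1\<^sub>m (d X)" "f * g = 1\<^sub>m (d Y)"
  shows "is_iso C X Y f"
  using assms unfolding is_iso_def inverse_arrows_def by (intro exI[of _ g]) (simp add: data_simps)

lemma symmetric_monoidal: "symmetric_monoidal_category C"
proof -
  interpret category C by (rule category)
  note [simp] = data_simps tens_obj unit_obj dual_obj
  show ?thesis
  proof
    show "UnitO C \<in> Obj C" by simp
    fix X Y assume XY: "X \<in> Obj C" "Y \<in> Obj C"
    then show "TensO C X Y \<in> Obj C" by simp
    show "TensM C (Id C X) (Id C Y) = Id C (TensO C X Y)" by (simp add: kron_one)
    show "is_iso C (TensO C (UnitO C) X) X (LUnit C X)"
      using XY lunit_hom by (auto intro!: is_isoI[where g = "1\<^sub>m (d X)"])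
    show "is_iso C (TensO C X (UnitO C)) X (RUnit C X)"
      using XY runit_hom by (auto intro!: is_isoI[where g = "1\<^sub>m (d X)"])
    show "is_iso C (TensO C X Y) (TensO C Y X) (Braid C X Y)"
      using XY swap_hom by (auto intro!: is_isoI[where g = "swap_mat (d Y) (d X)"] simp: swap_swap)
    show "Cmp C (Braid C Y X) (Braid C X Y) = Id C (TensO C X Y)" by (simp add: swap_swap)
    show "Cmp C (TensM C (Id C X) (LUnit C Y)) (Assoc C X (UnitO C) Y) = TensM C (RUnit C X) (Id C Y)"
      by (simp add: kron_one)
    fix f assume f: "f \<in> Hom C X Y"
    note fc = hom_carrier[OF f]
    show "Cmp C (LUnit C Y) (TensM C (Id C (UnitO C)) f) = Cmp C f (LUnit C X)"
      using fc kron_one_left[of f] by simp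
    show "Cmp C (RUnit C Y) (TensM C f (Id C (UnitO C))) = Cmp C f (RUnit C X)"
      using fc kron_one_right[of f] by simp
  next
    fix X Y Z assume X: "X \<in> Obj C" and Y: "Y \<in> Obj C" and Z: "Z \<in> Obj C"
    show "is_iso C (TensO C (TensO C X Y) Z) (TensO C X (TensO C Y Z)) (Assoc C X Y Z)"
      using assoc_hom[OF X Y Z] by (auto intro!: is_isoI[where g = "1\<^sub>m (d X * d Y * d Z)"] simp: mult.assoc)
    show "Cmp C (Cmp C (Assoc C Y Z X) (Braid C X (TensO C Y Z))) (Assoc C X Y Z)
      = Cmp C (Cmp C (TensM C (Id C Y) (Braid C X Z)) (Assoc C Y X Z)) (TensM C (Braid C X Y) (Id C Z))"
    proof -
      have a: "1\<^sub>m (d Y * d Z * d X) * swap_mat (d X) (d Y * d Z) = swap_mat (d X) (d Y * d Z)"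
        using swap_mat_carrier by (rule left_mult_one_mat)
      have b: "swap_mat (d X) (d Y * d Z) * 1\<^sub>m (d X * d Y * d Z) = swap_mat (d X) (d Y * d Z)"
        using swap_mat_carrier[of "d X" "d Y * d Z"] unfolding mult.assoc by (rule right_mult_one_mat)
      have c: "kron_mat (1\<^sub>m (d Y)) (swap_mat (d X) (d Z)) * 1\<^sub>m (d Y * d X * d Z)
          = kron_mat (1\<^sub>m (d Y)) (swap_mat (d X) (d Z))"
        by (intro right_mult_one_mat[of _ "d Y * (d Z * d X)"]) (auto simp: mult.assoc)
      show ?thesis by (simp only: data_simps a b c swap_hexagon[symmetric])
    qed
    fix U assume U: "U \<in> Obj C"
    show "Cmp C (Assoc C X Y (TensO C Z U)) (Assoc C (TensO C X Y) Z U)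
      = Cmp C (Cmp C (TensM C (Id C X) (Assoc C Y Z U)) (Assoc C X (TensO C Y Z) U)) (TensM C (Assoc C X Y Z) (Id C U))"
      by (simp add: kron_one mult.assoc)
  next
    fix X Y X' Y' f g
    assume o: "X \<in> Obj C" "Y \<in> Obj C" "X' \<in> Obj C" "Y' \<in> Obj C"
      and f: "f \<in> Hom C X X'" and g: "g \<in> Hom C Y Y'"
    note fc = hom_carrier[OF f] and gc = hom_carrier[OF g]
    show "TensM C f g \<in> Hom C (TensO C X Y) (TensO C X' Y')" using kron_hom[OF o f g] by simp
    show "Cmp C (Braid C X' Y') (TensM C f g) = Cmp C (TensM C g f) (Braid C X Y)"
      using swap_natural[OF fc gc] by simp
    fix X'' Y'' f' g'
    assume o2: "X'' \<in> Obj C" "Y'' \<in> Obj C" and f': "f' \<in> Hom C X' X''" and g': "g' \<in> Hom C Y' Y''"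
    show "TensM C (Cmp C f' f) (Cmp C g' g) = Cmp C (TensM C f' g') (TensM C f g)"
      using kron_mult[OF hom_carrier[OF f'] fc hom_carrier[OF g'] gc] by simp
  next
    fix X Y Z X' Y' Z' f g h
    assume f: "f \<in> Hom C X X'" and g: "g \<in> Hom C Y Y'" and h: "h \<in> Hom C Z Z'"
    note c = hom_carrier[OF f] hom_carrier[OF g] hom_carrier[OF h]
    have 1: "kron_mat (kron_mat f g) h \<in> carrier_mat (d X' * d Y' * d Z') (d X * d Y * d Z)" using c by auto
    show "Cmp C (Assoc C X' Y' Z') (TensM C (TensM C f g) h) = Cmp C (TensM C f (TensM C g h)) (Assoc C X Y Z)"
      using left_mult_one_mat[OF 1] right_mult_one_mat[OF 1] by (simp add: kron_assoc)
  qed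
qed

lemma rigid: "rigid_tensor_category C"
proof -
  interpret preadditive_category C by (rule preadditive)
  interpret symmetric_monoidal_category C by (rule symmetric_monoidal)
  note [simp] = data_simps tens_obj unit_obj dual_obj
  show ?thesis
  proof
    fix X Y X' Y' f f' g
    assume f: "f \<in> Hom C X X'" "f' \<in> Hom C X X'" and g: "g \<in> Hom C Y Y'"
    show "TensM C (HAdd C f f') g = HAdd C (TensM C f g) (TensM C f' g)"
      using kron_add_left[OF hom_carrier[OF f(1)] hom_carrier[OF f(2)]] by simp
  next
    fix X Y X' Y' f g g'
    assume f: "f \<in> Hom C X X'" and g: "g \<in> Hom C Y Y'" "g' \<in> Hom C Y Y'"
    show "TensM C f (HAdd C g g') = HAdd C (TensM C f g) (TensM C f g')"
      using kron_add_right[OF hom_carrier[OF g(1)] hom_carrier[OF g(2)]] by simp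
  next
    fix X Y f assume XY: "X \<in> Obj C" "Y \<in> Obj C" and f: "f \<in> Hom C X Y"
    show "DualM C f \<in> Hom C (DualO C Y) (DualO C X)" using transpose_hom[OF XY f] by simp
    show "Cmp C (Ev C X) (TensM C (DualM C f) (Id C X)) = Cmp C (Ev C Y) (TensM C (Id C (DualO C Y)) f)"
      using ev_dinatural[OF hom_carrier[OF f]] by simp
  next
    fix X a assume X: "X \<in> Obj C"
    let ?n = "d X"
    have k: "kron_mat (1\<^sub>m ?n) (ev_mat ?n) \<in> carrier_mat ?n (?n * ?n * ?n)"
      "kron_mat (coev_mat ?n) (1\<^sub>m ?n) \<in> carrier_mat (?n * ?n * ?n) ?n"
      "kron_mat (ev_mat ?n) (1\<^sub>m ?n) \<in> carrier_mat ?n (?n * ?n * ?n)"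
      "kron_mat (1\<^sub>m ?n) (coev_mat ?n) \<in> carrier_mat (?n * ?n * ?n) ?n"
      by (rule carrier_matI; simp add: ev_mat_def coev_mat_def mult.assoc)+
    show "DualO C X \<in> Obj C" "Ev C X \<in> Hom C (TensO C (DualO C X) X) (UnitO C)"
      "Coev C X \<in> Hom C (UnitO C) (TensO C X (DualO C X))"
      using X ev_hom coev_hom by simp_all
    show "Cmp C (Cmp C (Cmp C (RUnit C X) (TensM C (Id C X) (Ev C X))) (Assoc C X (DualO C X) X)) (TensM C (Coev C X) (Id C X)) = LUnit C X"
      using ev_coev_triangle[of ?n] left_mult_one_mat[OF k(1)] right_mult_one_mat[OF k(1)] by simp
    assume "inverse_arrows C (TensO C (TensO C (DualO C X) X) (DualO C X)) (TensO C (DualO C X) (TensO C X (DualO C X)))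
            (Assoc C (DualO C X) X (DualO C X)) a"
    then have a: "a \<in> carrier_mat (?n * ?n * ?n) (?n * ?n * ?n)" "a * 1\<^sub>m (?n * ?n * ?n) = 1\<^sub>m (?n * ?n * ?n)"
      unfolding inverse_arrows_def
      using hom_carrier[of a "TensO C (DualO C X) (TensO C X (DualO C X))" "TensO C (TensO C (DualO C X) X) (DualO C X)"]
      by (auto simp: mult.assoc)
    then have "a = 1\<^sub>m (?n * ?n * ?n)" by simp
    then show "Cmp C (Cmp C (Cmp C (LUnit C (DualO C X)) (TensM C (Ev C X) (Id C (DualO C X)))) a)
        (TensM C (Id C (DualO C X)) (Coev C X)) = RUnit C (DualO C X)"
      using coev_ev_triangle[of ?n] left_mult_one_mat[OF k(3)] right_mult_one_mat[OF k(3)] by simp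
  qed
qed

end

text \<open>
  For an equivalence it is enough to have a correspondence between the objects of two such
  categories that is compatible with the tensor operations and such that corresponding pairs have
  the same morphisms. Then identity matrices are natural isomorphisms between any two choices of corresponding objects,
  and all coherence conditions hold because identity matrices satisfy them.
\<close>

locale matrix_correspondence =
  source: matrix_category_data C dC + target: matrix_tensor_category D dD
  for C :: "('o, real mat) tensor_cat" and dC and D :: "('p, real mat) tensor_cat" and dD +
  fixes R :: "'p \<Rightarrow> 'o \<Rightarrow> bool"
  assumes R_obj: "R A X \<Longrightarrow> A \<in> Obj D" "R A X \<Longrightarrow> X \<in> Obj C" and R_dim: "R A X \<Longrightarrow> dD A = dC X"
    and R_total: "A \<in> Obj D \<Longrightarrow> \<exists>X. R A X" "X \<in> Obj C \<Longrightarrow> \<exists>A. R A X"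
    and R_hom: "R A X \<Longrightarrow> R B Y \<Longrightarrow> Hom D A B = Hom C X Y"
    and R_unit: "R (UnitO D) (UnitO C)"
    and R_tens: "R A X \<Longrightarrow> R B Y \<Longrightarrow> R (TensO D A B) (TensO C X Y)"
    and R_dual: "R A X \<Longrightarrow> R (DualO D A) (DualO C X)"
begin

text \<open>
  That the matrices of the structure are morphisms is a statement about hom-sets, so that it may
  be checked on corresponding objects of the target.
\<close>

lemma source_tensor_category: "matrix_tensor_category C dC"
proof unfold_locales
  note T = R_total(2)
  note H = R_hom[symmetric] and o = R_obj and dim = R_dim[symmetric]
  note tr = R_tens R_unit R_dual
  show "UnitO C \<in> Obj C" using o(2) R_unit by blast
  fix X assume "X \<in> Obj C"
  then obtain A where A: "R A X" using T by blast
  show "1\<^sub>m (dC X) \<in> Hom C X X" using target.one_hom[OF o(1)[OF A]] by (simp add: H[OF A A] dim[OF A])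
  show "DualO C X \<in> Obj C" using o(2) R_dual A by blast
  show "1\<^sub>m (dC X) \<in> Hom C (TensO C (UnitO C) X) X" "1\<^sub>m (dC X) \<in> Hom C X (TensO C (UnitO C) X)"
    using target.lunit_hom[OF o(1)[OF A]] H[OF R_tens[OF R_unit A] A] H[OF A R_tens[OF R_unit A]]
    by (simp_all add: dim[OF A])
  show "1\<^sub>m (dC X) \<in> Hom C (TensO C X (UnitO C)) X" "1\<^sub>m (dC X) \<in> Hom C X (TensO C X (UnitO C))"
    using target.runit_hom[OF o(1)[OF A]] H[OF R_tens[OF A R_unit] A] H[OF A R_tens[OF A R_unit]]
    by (simp_all add: dim[OF A])
  show "ev_mat (dC X) \<in> Hom C (TensO C (DualO C X) X) (UnitO C)"
    using target.ev_hom[OF o(1)[OF A]] H[OF R_tens[OF R_dual[OF A] A] R_unit] by (simp add: dim[OF A])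
  show "coev_mat (dC X) \<in> Hom C (UnitO C) (TensO C X (DualO C X))"
    using target.coev_hom[OF o(1)[OF A]] H[OF R_unit R_tens[OF A R_dual[OF A]]] by (simp add: dim[OF A])
  fix Y assume "Y \<in> Obj C"
  then obtain B where B: "R B Y" using T by blast
  show "TensO C X Y \<in> Obj C" using o(2) R_tens A B by blast
  show "0\<^sub>m (dC Y) (dC X) \<in> Hom C X Y"
    using target.zero_hom[OF o(1)[OF A] o(1)[OF B]] by (simp add: H[OF A B] dim[OF A] dim[OF B])
  show "swap_mat (dC X) (dC Y) \<in> Hom C (TensO C X Y) (TensO C Y X)"
    using target.swap_hom[OF o(1)[OF A] o(1)[OF B]] H[OF R_tens[OF A B] R_tens[OF B A]]
    by (simp add: dim[OF A] dim[OF B])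
  { fix f assume f: "f \<in> Hom C X Y"
    then have f': "f \<in> Hom D A B" by (simp add: H[OF A B])
    show "- f \<in> Hom C X Y" using target.uminus_hom[OF o(1)[OF A] o(1)[OF B] f'] by (simp add: H[OF A B])
    show "transpose_mat f \<in> Hom C (DualO C Y) (DualO C X)"
      using target.transpose_hom[OF o(1)[OF A] o(1)[OF B] f'] H[OF R_dual[OF B] R_dual[OF A]] by simp
    fix g assume g: "g \<in> Hom C X Y"
    then have g': "g \<in> Hom D A B" by (simp add: H[OF A B])
    show "f + g \<in> Hom C X Y" using target.add_hom[OF o(1)[OF A] o(1)[OF B] f' g'] by (simp add: H[OF A B]) }
  fix Z assume "Z \<in> Obj C"
  then obtain E where E: "R E Z" using T by blast
  show "1\<^sub>m (dC X * dC Y * dC Z) \<in> Hom C (TensO C (TensO C X Y) Z) (TensO C X (TensO C Y Z))"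
    "1\<^sub>m (dC X * dC Y * dC Z) \<in> Hom C (TensO C X (TensO C Y Z)) (TensO C (TensO C X Y) Z)"
    using target.assoc_hom[OF o(1)[OF A] o(1)[OF B] o(1)[OF E]]
      H[OF R_tens[OF R_tens[OF A B] E] R_tens[OF A R_tens[OF B E]]]
      H[OF R_tens[OF A R_tens[OF B E]] R_tens[OF R_tens[OF A B] E]]
    by (simp_all add: dim[OF A] dim[OF B] dim[OF E])
  { fix f g assume f: "f \<in> Hom C X Y" and g: "g \<in> Hom C Y Z"
    show "g * f \<in> Hom C X Z"
      using target.mult_hom[OF o(1)[OF A] o(1)[OF B] o(1)[OF E], of f g] f g
      by (simp add: H[OF A B] H[OF B E] H[OF A E]) }
  fix U f g assume "U \<in> Obj C" and f: "f \<in> Hom C X Z" and g: "g \<in> Hom C Y U"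
  then obtain L where L: "R L U" using T by blast
  show "kron_mat f g \<in> Hom C (TensO C X Y) (TensO C Z U)"
    using target.kron_hom[OF o(1)[OF A] o(1)[OF B] o(1)[OF E] o(1)[OF L], of f g] f g
      H[OF R_tens[OF A B] R_tens[OF E L]] by (simp add: H[OF A E] H[OF B L])
qed

sublocale source: matrix_tensor_category C dC by (rule source_tensor_category)

definition F :: "('o, real mat, 'p, real mat) ftor" where
  "F = \<lparr>FObj = (\<lambda>X. SOME A. R A X), FMor = (\<lambda>X Y f. f)\<rparr>"

definition G :: "('p, real mat, 'o, real mat) ftor" where
  "G = \<lparr>FObj = (\<lambda>A. SOME X. R A X), FMor = (\<lambda>A B f. f)\<rparr>"

lemma R_F: "X \<in> Obj C \<Longrightarrow> R (FObj F X) X"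
  unfolding F_def by simp (rule someI_ex[OF R_total(2)])

lemma R_G: "A \<in> Obj D \<Longrightarrow> R A (FObj G A)"
  unfolding G_def by simp (rule someI_ex[OF R_total(1)])

lemma FMor [simp]: "FMor F X Y f = f" "FMor G A B f = f"
  by (simp_all add: F_def G_def)

lemma F_dim: "X \<in> Obj C \<Longrightarrow> dD (FObj F X) = dC X"
  using R_dim R_F by blast

lemma G_dim: "A \<in> Obj D \<Longrightarrow> dC (FObj G A) = dD A"
  using R_dim R_G by metis

lemma iso_target:
  assumes "R A X" "R B X"
  shows "is_iso D A B (1\<^sub>m (dC X))"
proof -
  have "1\<^sub>m (dD A) \<in> Hom D A B" "1\<^sub>m (dD A) \<in> Hom D B A"
    using target.one_hom[OF R_obj(1)[OF assms(1)]] R_hom assms by metis+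
  then show ?thesis using target.is_iso_one[of A B] R_dim assms by metis
qed

lemma iso_source:
  assumes "R A X" "R A Y"
  shows "is_iso C X Y (1\<^sub>m (dC X))"
proof -
  have "1\<^sub>m (dC X) \<in> Hom C X Y" "1\<^sub>m (dC X) \<in> Hom C Y X"
    using source.one_hom[OF R_obj(2)[OF assms(1)]] R_hom assms by metis+
  then show ?thesis using source.is_iso_one[of X Y] R_dim assms by metis
qed

lemma functor_F: "cat_functor C D F"
proof -
  interpret c: category C by (rule source.category)
  interpret d: category D by (rule target.category)
  show ?thesis
  proof
    fix X Y f
    show "X \<in> Obj C \<Longrightarrow> FObj F X \<in> Obj D" using R_obj(1) R_F by blast
    show "X \<in> Obj C \<Longrightarrow> FMor F X X (Id C X) = Id D (FObj F X)"
      by (simp add: F_dim source.data_simps target.data_simps)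
    show "X \<in> Obj C \<Longrightarrow> Y \<in> Obj C \<Longrightarrow> f \<in> Hom C X Y \<Longrightarrow> FMor F X Y f \<in> Hom D (FObj F X) (FObj F Y)"
      using R_hom[OF R_F R_F] by simp
  qed (simp add: source.data_simps target.data_simps)
qed

lemma functor_G: "cat_functor D C G"
proof -
  interpret c: category C by (rule source.category)
  interpret d: category D by (rule target.category)
  show ?thesis
  proof
    fix X Y f
    show "X \<in> Obj D \<Longrightarrow> FObj G X \<in> Obj C" using R_obj(2) R_G by blast
    show "X \<in> Obj D \<Longrightarrow> FMor G X X (Id D X) = Id C (FObj G X)"
      by (simp add: G_dim source.data_simps target.data_simps)
    show "X \<in> Obj D \<Longrightarrow> Y \<in> Obj D \<Longrightarrow> f \<in> Hom D X Y \<Longrightarrow> FMor G X Y f \<in> Hom C (FObj G X) (FObj G Y)"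
      using R_hom[OF R_G R_G] by simp
  qed (simp add: source.data_simps target.data_simps)
qed

lemma functor_id: "category C' \<Longrightarrow> cat_functor C' C' id_ftor"
  by (simp add: cat_functor_def cat_functor_axioms_def id_ftor_def category.Id_hom)

lemma functor_comp:
  assumes "cat_functor C1 C2 F1" "cat_functor C2 C3 F2"
  shows "cat_functor C1 C3 (comp_ftor F2 F1)"
proof -
  interpret a: cat_functor C1 C2 F1 by (rule assms)
  interpret b: cat_functor C2 C3 F2 by (rule assms)
  show ?thesis
    by unfold_locales
       (simp_all add: comp_ftor_def a.FObj_obj b.FObj_obj a.FMor_hom b.FMor_hom a.FMor_Id b.FMor_Id
         a.FMor_Cmp b.FMor_Cmp)
qed

lemma equivalence:
  "equivalence_of_categories C D F G (\<lambda>X. 1\<^sub>m (dC X)) (\<lambda>A. 1\<^sub>m (dD A))"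
proof -
  interpret f: cat_functor C D F by (rule functor_F)
  interpret g: cat_functor D C G by (rule functor_G)
  have "natural_iso C C id_ftor (comp_ftor G F) (\<lambda>X. 1\<^sub>m (dC X))"
  proof (intro natural_iso.intro natural_iso_axioms.intro)
    show "cat_functor C C id_ftor" by (rule functor_id[OF source.category])
    show "cat_functor C C (comp_ftor G F)" by (rule functor_comp[OF functor_F functor_G])
    fix X Y f assume X: "X \<in> Obj C"
    show "is_iso C (FObj id_ftor X) (FObj (comp_ftor G F) X) (1\<^sub>m (dC X))"
      using iso_source[OF R_F[OF X] R_G[OF f.FObj_obj[OF X]]] by (simp add: id_ftor_def comp_ftor_def)
    assume Y: "Y \<in> Obj C" and f: "f \<in> Hom C X Y"
    show "Cmp C (1\<^sub>m (dC Y)) (FMor id_ftor X Y f) = Cmp C (FMor (comp_ftor G F) X Y f) (1\<^sub>m (dC X))"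
      using source.hom_carrier[OF f] by (simp add: source.data_simps id_ftor_def comp_ftor_def)
  qed
  moreover have "natural_iso D D (comp_ftor F G) id_ftor (\<lambda>A. 1\<^sub>m (dD A))"
  proof (intro natural_iso.intro natural_iso_axioms.intro)
    show "cat_functor D D id_ftor" by (rule functor_id[OF target.category])
    show "cat_functor D D (comp_ftor F G)" by (rule functor_comp[OF functor_G functor_F])
    fix A B f assume A: "A \<in> Obj D"
    show "is_iso D (FObj (comp_ftor F G) A) (FObj id_ftor A) (1\<^sub>m (dD A))"
      using iso_target[OF R_F[OF g.FObj_obj[OF A]] R_G[OF A]] G_dim[OF A]
      by (simp add: id_ftor_def comp_ftor_def)
    assume B: "B \<in> Obj D" and f: "f \<in> Hom D A B"
    show "Cmp D (1\<^sub>m (dD B)) (FMor (comp_ftor F G) A B f) = Cmp D (FMor id_ftor A B f) (1\<^sub>m (dD A))"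
      using target.hom_carrier[OF f] by (simp add: target.data_simps id_ftor_def comp_ftor_def)
  qed
  ultimately show ?thesis
    by (intro equivalence_of_categories.intro functor_F functor_G)
qed

lemma additive: "additive_functor C D F"
  by (intro additive_functor.intro additive_functor_axioms.intro source.preadditive target.preadditive functor_F)
     (simp add: source.data_simps target.data_simps)

lemma tensor:
  "tensor_functor C D F (\<lambda>X Y. 1\<^sub>m (dC X * dC Y)) (1\<^sub>m 1)"
proof (intro tensor_functor.intro tensor_functor_axioms.intro functor_F
    source.symmetric_monoidal target.symmetric_monoidal)
  note [simp] = source.data_simps target.data_simps source.tens_obj source.unit_obj F_dim
  show "is_iso D (UnitO D) (FObj F (UnitO C)) (1\<^sub>m 1)"
    using iso_target[OF R_unit R_F] by simp
  fix X assume X: "X \<in> Obj C"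
  show "Cmp D (Cmp D (FMor F (TensO C (UnitO C) X) X (LUnit C X)) (1\<^sub>m (dC (UnitO C) * dC X)))
      (TensM D (1\<^sub>m 1) (Id D (FObj F X))) = LUnit D (FObj F X)"
    using X kron_one[of 1 "dC X", where ?'a = real] by simp
  show "Cmp D (Cmp D (FMor F (TensO C X (UnitO C)) X (RUnit C X)) (1\<^sub>m (dC X * dC (UnitO C))))
      (TensM D (Id D (FObj F X)) (1\<^sub>m 1)) = RUnit D (FObj F X)"
    using X kron_one[of "dC X" 1, where ?'a = real] by simp
  fix Y assume Y: "Y \<in> Obj C"
  show "is_iso D (TensO D (FObj F X) (FObj F Y)) (FObj F (TensO C X Y)) (1\<^sub>m (dC X * dC Y))"
    using iso_target[OF R_tens[OF R_F[OF X] R_F[OF Y]] R_F] X Y by simp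
  show "Cmp D (FMor F (TensO C X Y) (TensO C Y X) (Braid C X Y)) (1\<^sub>m (dC X * dC Y))
      = Cmp D (1\<^sub>m (dC Y * dC X)) (Braid D (FObj F X) (FObj F Y))"
    using X Y right_mult_one_mat[OF swap_mat_carrier] left_mult_one_mat[OF swap_mat_carrier] by simp
  { fix Z assume Z: "Z \<in> Obj C"
    show "Cmp D (Cmp D (FMor F (TensO C (TensO C X Y) Z) (TensO C X (TensO C Y Z)) (Assoc C X Y Z))
          (1\<^sub>m (dC (TensO C X Y) * dC Z))) (TensM D (1\<^sub>m (dC X * dC Y)) (Id D (FObj F Z)))
      = Cmp D (Cmp D (1\<^sub>m (dC X * dC (TensO C Y Z))) (TensM D (Id D (FObj F X)) (1\<^sub>m (dC Y * dC Z))))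
          (Assoc D (FObj F X) (FObj F Y) (FObj F Z))"
      using X Y Z by (simp add: kron_one mult.assoc) }
  fix X' Y' f g assume o: "X' \<in> Obj C" "Y' \<in> Obj C" and f: "f \<in> Hom C X X'" and g: "g \<in> Hom C Y Y'"
  show "Cmp D (1\<^sub>m (dC X' * dC Y')) (TensM D (FMor F X X' f) (FMor F Y Y' g))
      = Cmp D (FMor F (TensO C X Y) (TensO C X' Y') (TensM C f g)) (1\<^sub>m (dC X * dC Y))"
    using left_mult_one_mat[OF kron_carrier(1)[OF source.hom_carrier[OF f] source.hom_carrier[OF g]]]
      right_mult_one_mat[OF kron_carrier(1)[OF source.hom_carrier[OF f] source.hom_carrier[OF g]]] by simp
qed

lemma dual_preserving:
  "dual_preserving_functor C D F (\<lambda>X Y. 1\<^sub>m (dC X * dC Y)) (1\<^sub>m 1) (\<lambda>X. 1\<^sub>m (dC X))"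
proof (intro dual_preserving_functor.intro dual_preserving_functor_axioms.intro tensor source.rigid target.rigid)
  note [simp] = source.data_simps target.data_simps source.dual_obj F_dim
  fix X assume X: "X \<in> Obj C"
  show "is_iso D (FObj F (DualO C X)) (DualO D (FObj F X)) (1\<^sub>m (dC X))"
    using iso_target[OF R_F R_dual[OF R_F[OF X]]] X by simp
  show "Cmp D (Cmp D (1\<^sub>m 1) (Ev D (FObj F X))) (TensM D (1\<^sub>m (dC X)) (Id D (FObj F X)))
      = Cmp D (FMor F (TensO C (DualO C X) X) (UnitO C) (Ev C X)) (1\<^sub>m (dC (DualO C X) * dC X))"
    using X left_mult_one_mat[OF ev_coev_carrier(1)] by (simp add: kron_one)
  fix Y f assume Y: "Y \<in> Obj C" and f: "f \<in> Hom C X Y"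
  show "Cmp D (1\<^sub>m (dC X)) (FMor F (DualO C Y) (DualO C X) (DualM C f)) = Cmp D (DualM D (FMor F X Y f)) (1\<^sub>m (dC Y))"
    using source.hom_carrier[OF f] by simp
qed

end

section \<open>Power series of nilpotent matrices\<close>

lemma one_smult_mat [simp]: "1 \<cdot>\<^sub>m A = (A :: 'a :: semiring_1 mat)"
  by (rule eq_matI) auto

lemma zero_smult_add_mat: "B \<in> carrier_mat n m \<Longrightarrow> 0 \<cdot>\<^sub>m 1\<^sub>m n + B = (B :: 'a :: semiring_1 mat)" if "n = m"
  by (rule eq_matI) (use that in auto)

definition peval :: "nat \<Rightarrow> 'a :: field poly \<Rightarrow> 'a mat \<Rightarrow> 'a mat" where
  "peval n p A = fold_coeffs (\<lambda>a B. a \<cdot>\<^sub>m 1\<^sub>m n + A * B) p (0\<^sub>m n n)"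

context
  fixes n :: nat and A :: "'a :: field mat"
  assumes A: "A \<in> carrier_mat n n"
begin

lemma peval_0 [simp]: "peval n 0 A = 0\<^sub>m n n"
  by (simp add: peval_def)

lemma peval_pCons [simp]: "peval n (pCons a p) A = a \<cdot>\<^sub>m 1\<^sub>m n + A * peval n p A"
proof (cases "p = 0 \<and> a = 0")
  case True
  have "0 \<cdot>\<^sub>m 1\<^sub>m n + A * 0\<^sub>m n n = 0\<^sub>m n n" using A by (intro eq_matI) auto
  then show ?thesis using True by simp
next
  case False
  then show ?thesis by (auto simp: peval_def)
qed

lemma peval_carrier [simp]: "peval n p A \<in> carrier_mat n n"
  by (induction p) (use A in auto)

lemma peval_dims [simp]: "dim_row (peval n p A) = n" "dim_col (peval n p A) = n"
  using carrier_matD[OF peval_carrier[of p]] by simp_all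

lemma peval_add: "peval n (p + q) A = peval n p A + peval n q A"
proof (induction p q rule: poly_induct2)
  case (pCons a p b q)
  have "peval n (pCons a p + pCons b q) A = (a + b) \<cdot>\<^sub>m 1\<^sub>m n + (A * peval n p A + A * peval n q A)"
    using A by (simp add: pCons mult_add_distrib_mat[OF A peval_carrier peval_carrier])
  also have "\<dots> = (a \<cdot>\<^sub>m 1\<^sub>m n + A * peval n p A) + (b \<cdot>\<^sub>m 1\<^sub>m n + A * peval n q A)"
    by (rule eq_matI) (use A in \<open>auto simp: algebra_simps\<close>)
  finally show ?case by simp
qed simp

lemma peval_smult: "peval n (Polynomial.smult c p) A = c \<cdot>\<^sub>m peval n p A"
proof (induction p)
  case (pCons a p)
  have "peval n (Polynomial.smult c (pCons a p)) A = (c * a) \<cdot>\<^sub>m 1\<^sub>m n + A * (c \<cdot>\<^sub>m peval n p A)"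
    using pCons by simp
  also have "A * (c \<cdot>\<^sub>m peval n p A) = c \<cdot>\<^sub>m (A * peval n p A)" by (rule mult_smult_distrib[OF A peval_carrier])
  also have "(c * a) \<cdot>\<^sub>m 1\<^sub>m n + c \<cdot>\<^sub>m (A * peval n p A) = c \<cdot>\<^sub>m (a \<cdot>\<^sub>m 1\<^sub>m n + A * peval n p A)"
    by (rule eq_matI) (use A in \<open>auto simp: algebra_simps\<close>)
  finally show ?case by simp
qed (simp add: eq_matI)

lemma peval_mult: "peval n (p * q) A = peval n p A * peval n q A"
proof (induction p)
  case (pCons a p)
  have "peval n (pCons a p * q) A = a \<cdot>\<^sub>m peval n q A + (0 \<cdot>\<^sub>m 1\<^sub>m n + A * (peval n p A * peval n q A))"
    using pCons by (simp add: peval_add peval_smult)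
  also have "A * (peval n p A * peval n q A) = (A * peval n p A) * peval n q A"
    by (rule assoc_mult_mat[symmetric, OF A peval_carrier peval_carrier])
  also have "0 \<cdot>\<^sub>m 1\<^sub>m n + A * peval n p A * peval n q A = A * peval n p A * peval n q A"
    by (rule eq_matI) (use A in auto)
  also have "a \<cdot>\<^sub>m peval n q A = (a \<cdot>\<^sub>m 1\<^sub>m n) * peval n q A"
    using mult_smult_assoc_mat[OF one_carrier_mat peval_carrier, of a q] left_mult_one_mat[OF peval_carrier, of q] by simp
  also have "(a \<cdot>\<^sub>m 1\<^sub>m n) * peval n q A + A * peval n p A * peval n q A = (a \<cdot>\<^sub>m 1\<^sub>m n + A * peval n p A) * peval n q A"
    by (rule add_mult_distrib_mat[symmetric, where nr = n and nc = n and n = n]) (use A in auto)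
  finally show ?case by simp
qed simp

lemma peval_1 [simp]: "peval n 1 A = 1\<^sub>m n"
  using peval_pCons[of 1 0] A by (simp add: one_pCons right_add_zero_mat[of _ n n] del: peval_pCons)

lemma peval_X [simp]: "peval n [:0, 1:] A = A"
proof -
  have "peval n [:0, 1:] A = 0 \<cdot>\<^sub>m 1\<^sub>m n + A * (1 \<cdot>\<^sub>m 1\<^sub>m n + A * 0\<^sub>m n n)" by simp
  also have "1 \<cdot>\<^sub>m 1\<^sub>m n + A * 0\<^sub>m n n = 1\<^sub>m n" using A by (intro eq_matI) auto
  also have "0 \<cdot>\<^sub>m 1\<^sub>m n + A * 1\<^sub>m n = A" using A by (intro eq_matI) auto
  finally show ?thesis .
qed

lemma peval_power: "peval n (p ^ k) A = peval n p A ^\<^sub>m k"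
proof (induction k)
  case (Suc k)
  have "peval n (p ^ Suc k) A = peval n (p ^ k * p) A" by (simp add: mult.commute)
  then show ?case using Suc by (simp add: peval_mult)
qed simp

lemma peval_pcompose: "peval n (pcompose p q) A = peval n p (peval n q A)"
proof (induction p)
  case 0
  then show ?case by (simp add: peval_def)
next
  case (pCons a p)
  have "peval n (pcompose (pCons a p) q) A = (a \<cdot>\<^sub>m 1\<^sub>m n + A * 0\<^sub>m n n) + peval n q A * peval n p (peval n q A)"
    using pCons by (simp add: pcompose_pCons peval_add peval_mult)
  also have "a \<cdot>\<^sub>m 1\<^sub>m n + A * 0\<^sub>m n n = a \<cdot>\<^sub>m 1\<^sub>m n" using A by (intro eq_matI) auto
  finally show ?case by (simp add: Submission.peval_pCons[OF peval_carrier])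
qed

lemma peval_cong_mod:
  assumes nil: "A ^\<^sub>m m = 0\<^sub>m n n" and co: "\<And>k. k < m \<Longrightarrow> coeff p k = coeff q k"
  shows "peval n p A = peval n q A"
proof -
  have "monom 1 m dvd p - q" using co by (simp add: monom_1_dvd_iff')
  then obtain r where r: "p - q = monom 1 m * r" by (elim dvdE)
  have "peval n (monom 1 m) A = A ^\<^sub>m m" by (simp only: monom_altdef peval_power peval_X smult_1_left)
  then have "peval n (p - q) A = 0\<^sub>m n n" by (simp add: r peval_mult nil)
  moreover have "peval n p A = peval n (p - q) A + peval n q A" by (simp flip: peval_add)
  ultimately show ?thesis by (simp add: left_add_zero_mat[of _ n n])
qed

lemma peval_entry:
  assumes "\<And>k. k \<ge> m \<Longrightarrow> coeff p k = 0" "i < n" "j < n"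
  shows "peval n p A $$ (i, j) = (\<Sum>k<m. coeff p k * (A ^\<^sub>m k) $$ (i, j))"
  using assms
proof (induction m arbitrary: p i)
  case 0
  then have "p = 0" by (simp add: poly_eq_iff)
  then show ?case using 0 by simp
next
  case (Suc m)
  obtain a q where p: "p = pCons a q" by (cases p)
  have q: "coeff q k = 0" if "k \<ge> m" for k using Suc.prems(1)[of "Suc k"] that p by simp
  have pow: "A * A ^\<^sub>m k = A ^\<^sub>m Suc k" for k
    by (induction k) (use A in \<open>simp_all flip: assoc_mult_mat[of A n n _ n A n]\<close>)
  have "(A * peval n q A) $$ (i, j) = (\<Sum>l<n. A $$ (i, l) * (\<Sum>k<m. coeff q k * (A ^\<^sub>m k) $$ (l, j)))"
    using A Suc.prems q by (subst mult_mat_index) (auto intro!: sum.cong simp: Suc.IH)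
  also have "\<dots> = (\<Sum>k<m. coeff q k * (\<Sum>l<n. A $$ (i, l) * (A ^\<^sub>m k) $$ (l, j)))"
    unfolding sum_distrib_left by (subst sum.swap) (simp add: mult_ac)
  also have "\<dots> = (\<Sum>k<m. coeff q k * (A * A ^\<^sub>m k) $$ (i, j))"
    using A Suc.prems by (intro sum.cong refl, subst mult_mat_index) auto
  finally have "(A * peval n q A) $$ (i, j) = (\<Sum>k<m. coeff p (Suc k) * (A ^\<^sub>m Suc k) $$ (i, j))"
    unfolding pow by (simp add: p)
  then show ?case using A Suc.prems unfolding sum.lessThan_Suc_shift by (simp add: p)
qed

lemma peval_transpose: "peval n p (transpose_mat A) = transpose_mat (peval n p A)"
proof (induction p)
  case 0
  then show ?case by (simp add: peval_def eq_matI)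
next
  case (pCons a p)
  have At: "transpose_mat A \<in> carrier_mat n n" using A by simp
  have comm: "A * peval n p A = peval n p A * A"
    using peval_mult[of "[:0, 1:]" p] peval_mult[of p "[:0, 1:]"] by (simp add: mult.commute del: peval_pCons mult_pCons_right mult_pCons_left)
  have "transpose_mat (peval n p A * A) = transpose_mat A * transpose_mat (peval n p A)"
    by (rule transpose_mult[OF peval_carrier A])
  moreover have "transpose_mat (a \<cdot>\<^sub>m 1\<^sub>m n + A * peval n p A) = a \<cdot>\<^sub>m 1\<^sub>m n + transpose_mat (A * peval n p A)"
    by (rule eq_matI) (use A in auto)
  ultimately show ?case using pCons by (simp add: Submission.peval_pCons[OF At] comm)
qed

lemma peval_closed:
  assumes "A \<in> S" "\<And>B C. B \<in> S \<Longrightarrow> C \<in> S \<Longrightarrow> B + C \<in> S" "\<And>c B. B \<in> S \<Longrightarrow> c \<cdot>\<^sub>m B \<in> S"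
    "\<And>B C. B \<in> S \<Longrightarrow> C \<in> S \<Longrightarrow> B * C \<in> S" "0\<^sub>m n n \<in> S" "coeff p 0 = 0"
  shows "peval n p A \<in> S"
proof -
  have S: "A * peval n q A \<in> S" for q
  proof (induction q)
    case 0
    then show ?case using A assms by simp
  next
    case (pCons a q)
    have "A * peval n (pCons a q) A = A * (a \<cdot>\<^sub>m 1\<^sub>m n) + A * (A * peval n q A)"
      using A by (simp add: mult_add_distrib_mat[of A n n _ n])
    also have "A * (a \<cdot>\<^sub>m 1\<^sub>m n) = a \<cdot>\<^sub>m A" using A by (simp add: mult_smult_distrib[of A n n _ n])
    finally show ?case using assms pCons by simp
  qed
  obtain q where "p = pCons 0 q" using assms(6) by (cases p) auto
  then have "peval n p A = A * peval n q A" using A by (simp add: zero_smult_add_mat)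
  then show ?thesis using S by simp
qed

end

lemma peval_intertwine:
  assumes X: "X \<in> carrier_mat n' n'" and Y: "Y \<in> carrier_mat n n" and g: "g \<in> carrier_mat n' n"
    and XY: "X * g = g * Y"
  shows "peval n' p X * g = g * peval n p Y"
proof (induction p)
  case 0
  show ?case using g by (simp add: peval_0[OF X] peval_0[OF Y])
next
  case (pCons a p)
  have "peval n' (pCons a p) X * g = (a \<cdot>\<^sub>m 1\<^sub>m n') * g + X * peval n' p X * g"
    unfolding peval_pCons[OF X] using X g peval_carrier[OF X] by (intro add_mult_distrib_mat) auto
  also have "(a \<cdot>\<^sub>m 1\<^sub>m n') * g = g * (a \<cdot>\<^sub>m 1\<^sub>m n)"
    using g by (simp add: mult_smult_assoc_mat[of _ n' n' g n] mult_smult_distrib[of g n' n _ n])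
  also have "X * peval n' p X * g = X * (peval n' p X * g)"
    by (rule assoc_mult_mat[OF X peval_carrier[OF X] g])
  also have "\<dots> = X * (g * peval n p Y)" by (simp add: pCons)
  also have "\<dots> = X * g * peval n p Y" by (rule assoc_mult_mat[symmetric, OF X g peval_carrier[OF Y]])
  also have "\<dots> = g * (Y * peval n p Y)" unfolding XY by (rule assoc_mult_mat[OF g Y peval_carrier[OF Y]])
  also have "g * (a \<cdot>\<^sub>m 1\<^sub>m n) + g * (Y * peval n p Y) = g * peval n (pCons a p) Y"
    unfolding peval_pCons[OF Y] using Y g peval_carrier[OF Y] by (intro mult_add_distrib_mat[symmetric]) auto
  finally show ?case .
qed

lemma peval_cnj:
  assumes A: "A \<in> carrier_mat n n"
  shows "map_mat cnj (peval n p A) = peval n (map_poly cnj p) (map_mat cnj A)"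
proof (induction p)
  case 0
  have "map_mat cnj (0\<^sub>m n n) = 0\<^sub>m n n" by (rule eq_matI) auto
  then show ?case by (simp add: peval_def)
next
  case (pCons a p)
  have A': "map_mat cnj A \<in> carrier_mat n n" using A by simp
  have "map_mat cnj (A * peval n p A) = map_mat cnj A * map_mat cnj (peval n p A)"
    by (rule eq_matI) (use A peval_dims[OF A] in \<open>simp_all add: mult_mat_index del: index_mult_mat(1)\<close>)
  moreover have "map_mat cnj (a \<cdot>\<^sub>m 1\<^sub>m n + A * peval n p A) = cnj a \<cdot>\<^sub>m 1\<^sub>m n + map_mat cnj (A * peval n p A)"
    by (rule eq_matI) (use A peval_dims[OF A] in auto)
  ultimately show ?case using pCons by (simp add: peval_pCons[OF A] peval_pCons[OF A'] map_poly_pCons)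
qed

definition nilpotent_mat :: "nat \<Rightarrow> 'a :: field mat \<Rightarrow> bool" where
  "nilpotent_mat n A \<longleftrightarrow> A \<in> carrier_mat n n \<and> (\<exists>m. A ^\<^sub>m m = 0\<^sub>m n n)"

definition truncate_fps :: "nat \<Rightarrow> 'a :: field fps \<Rightarrow> 'a poly" where
  "truncate_fps m f = Poly (map (fps_nth f) [0..<m])"

lemma coeff_truncate_fps: "coeff (truncate_fps m f) k = (if k < m then fps_nth f k else 0)"
  by (simp add: truncate_fps_def nth_default_def)

text \<open>
  The value of a power series at a nilpotent matrix. The degree of the truncation is irrelevant as
  long as the omitted powers of the matrix vanish; the least such degree merely fixes a choice.
\<close>

definition fps_mat :: "nat \<Rightarrow> 'a :: field fps \<Rightarrow> 'a mat \<Rightarrow> 'a mat" where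
  "fps_mat n f A = peval n (truncate_fps (LEAST m. A ^\<^sub>m m = 0\<^sub>m n n) f) A"

lemma pow_mat_zero_mono:
  assumes "A \<in> carrier_mat n n" "A ^\<^sub>m m = 0\<^sub>m n n" "m \<le> k"
  shows "A ^\<^sub>m k = (0\<^sub>m n n :: 'a :: field mat)"
  using assms(3)
proof (induction k rule: dec_induct)
  case (step k)
  then show ?case using assms(1) by simp
qed (rule assms(2))

lemma fps_mat_eq_peval:
  assumes A: "A \<in> carrier_mat n n" and m: "A ^\<^sub>m m = 0\<^sub>m n n" and co: "\<And>k. k < m \<Longrightarrow> coeff p k = fps_nth f k"
  shows "fps_mat n f A = peval n p A"
proof -
  let ?m = "LEAST m. A ^\<^sub>m m = 0\<^sub>m n n"
  have 1: "A ^\<^sub>m ?m = 0\<^sub>m n n" using m by (rule LeastI)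
  have 2: "?m \<le> m" using m by (rule Least_le)
  show ?thesis unfolding fps_mat_def
    by (rule peval_cong_mod[OF A 1]) (use 2 co in \<open>auto simp: coeff_truncate_fps\<close>)
qed

lemma fps_mat_truncate:
  assumes "A \<in> carrier_mat n n" "A ^\<^sub>m m = 0\<^sub>m n n"
  shows "fps_mat n f A = peval n (truncate_fps m f) A"
  by (rule fps_mat_eq_peval[OF assms]) (simp add: coeff_truncate_fps)

definition fps_eq_mod :: "nat \<Rightarrow> 'a :: field fps \<Rightarrow> 'a fps \<Rightarrow> bool" where
  "fps_eq_mod m f g \<longleftrightarrow> (\<forall>k<m. fps_nth f k = fps_nth g k)"

lemma fps_eq_mod_mult: "fps_eq_mod m f f' \<Longrightarrow> fps_eq_mod m g g' \<Longrightarrow> fps_eq_mod m (f * g) (f' * g')"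
  unfolding fps_eq_mod_def fps_mult_nth by (intro allI impI sum.cong) auto

lemma fps_eq_mod_power: "fps_eq_mod m f f' \<Longrightarrow> fps_eq_mod m (f ^ k) (f' ^ k)"
  by (induction k) (auto intro: fps_eq_mod_mult simp: fps_eq_mod_def[of _ 1])

lemma fps_eq_mod_compose: "fps_eq_mod m f f' \<Longrightarrow> fps_eq_mod m g g' \<Longrightarrow> fps_eq_mod m (f oo g) (f' oo g')"
  using fps_eq_mod_power[of m g g']
  unfolding fps_eq_mod_def fps_compose_nth by (intro allI impI sum.cong) auto

lemma fps_eq_mod_truncate: "fps_eq_mod m (fps_of_poly (truncate_fps m f)) f"
  by (simp add: fps_eq_mod_def coeff_truncate_fps)

context
  fixes n :: nat and A :: "'a :: field mat"
  assumes nil: "nilpotent_mat n A"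
begin

lemma nil_carrier: "A \<in> carrier_mat n n"
  using nil by (simp add: nilpotent_mat_def)

lemma fps_mat_carrier [simp]: "fps_mat n f A \<in> carrier_mat n n"
  using peval_carrier[OF nil_carrier] by (simp add: fps_mat_def)

lemma fps_mat_mult: "fps_mat n (f * g) A = fps_mat n f A * fps_mat n g A"
proof -
  obtain m where m: "A ^\<^sub>m m = 0\<^sub>m n n" using nil by (auto simp: nilpotent_mat_def)
  have "fps_mat n (f * g) A = peval n (truncate_fps m f * truncate_fps m g) A"
  proof (rule fps_mat_eq_peval[OF nil_carrier m])
    have "fps_eq_mod m (fps_of_poly (truncate_fps m f) * fps_of_poly (truncate_fps m g)) (f * g)"
      by (intro fps_eq_mod_mult fps_eq_mod_truncate)
    then show "k < m \<Longrightarrow> coeff (truncate_fps m f * truncate_fps m g) k = fps_nth (f * g) k" for k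
      by (simp add: fps_eq_mod_def flip: fps_of_poly_mult)
  qed
  then show ?thesis
    by (simp add: fps_mat_truncate[OF nil_carrier m] peval_mult[OF nil_carrier])
qed

lemma nilpotent_fps_mat:
  assumes "fps_nth f 0 = 0"
  shows "nilpotent_mat n (fps_mat n f A)"
proof -
  obtain m where m: "A ^\<^sub>m m = 0\<^sub>m n n" using nil by (auto simp: nilpotent_mat_def)
  let ?p = "truncate_fps m f"
  have "coeff ?p 0 = 0" using assms by (simp add: coeff_truncate_fps)
  then have "monom 1 1 dvd ?p" by (subst monom_1_dvd_iff') simp
  then have "[:0, 1:] dvd ?p" by (simp add: monom_altdef)
  then have "[:0, 1:] ^ m dvd ?p ^ m" by (rule dvd_power_same)
  then obtain r where r: "?p ^ m = [:0, 1:] ^ m * r" by (elim dvdE)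
  have "peval n ?p A ^\<^sub>m m = peval n (?p ^ m) A" by (rule peval_power[OF nil_carrier, symmetric])
  also have "\<dots> = 0\<^sub>m n n"
    unfolding r peval_mult[OF nil_carrier] peval_power[OF nil_carrier] peval_X[OF nil_carrier] m
    by (rule left_mult_zero_mat[OF peval_carrier[OF nil_carrier]])
  finally show ?thesis
    unfolding nilpotent_mat_def fps_mat_truncate[OF nil_carrier m] using peval_carrier[OF nil_carrier] by blast
qed

lemma fps_mat_compose:
  assumes g0: "fps_nth g 0 = 0"
  shows "fps_mat n (f oo g) A = fps_mat n f (fps_mat n g A)"
proof -
  obtain m1 where m1: "A ^\<^sub>m m1 = 0\<^sub>m n n" using nil by (auto simp: nilpotent_mat_def)
  obtain m2 where m2: "fps_mat n g A ^\<^sub>m m2 = 0\<^sub>m n n" using nilpotent_fps_mat[OF g0] by (auto simp: nilpotent_mat_def)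
  define m where "m = max m1 m2"
  have m: "A ^\<^sub>m m = 0\<^sub>m n n" "fps_mat n g A ^\<^sub>m m = 0\<^sub>m n n"
    using pow_mat_zero_mono[OF nil_carrier m1] pow_mat_zero_mono[OF fps_mat_carrier m2] by (auto simp: m_def)
  have "fps_mat n (f oo g) A = peval n (pcompose (truncate_fps m f) (truncate_fps m g)) A"
  proof (rule fps_mat_eq_peval[OF nil_carrier m(1)])
    have "fps_eq_mod m (fps_of_poly (truncate_fps m f) oo fps_of_poly (truncate_fps m g)) (f oo g)"
      by (intro fps_eq_mod_compose fps_eq_mod_truncate)
    moreover have "coeff (truncate_fps m g) 0 = 0" using g0 by (simp add: coeff_truncate_fps)
    ultimately show "k < m \<Longrightarrow> coeff (pcompose (truncate_fps m f) (truncate_fps m g)) k = fps_nth (f oo g) k" for k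
      by (simp add: fps_eq_mod_def flip: fps_of_poly_pcompose)
  qed
  also have "\<dots> = peval n (truncate_fps m f) (peval n (truncate_fps m g) A)" by (rule peval_pcompose[OF nil_carrier])
  also have "peval n (truncate_fps m g) A = fps_mat n g A" by (rule fps_mat_truncate[OF nil_carrier m(1), symmetric])
  also have "peval n (truncate_fps m f) (fps_mat n g A) = fps_mat n f (fps_mat n g A)"
    by (rule fps_mat_truncate[OF fps_mat_carrier m(2), symmetric])
  finally show ?thesis .
qed

lemma fps_mat_poly: "fps_mat n (fps_of_poly p) A = peval n p A"
  using nil fps_mat_eq_peval[OF nil_carrier] by (auto simp: nilpotent_mat_def)

lemma fps_mat_1: "fps_mat n 1 A = 1\<^sub>m n"
  using fps_mat_poly[of 1] peval_1[OF nil_carrier] by simp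

lemma fps_mat_linear: "fps_mat n (fps_const c * fps_X) A = c \<cdot>\<^sub>m A"
proof -
  have "fps_of_poly (Polynomial.smult c [:0, 1:]) = fps_const c * fps_X"
    by (simp add: fps_of_poly_smult fps_of_poly_fps_X del: smult_pCons)
  then show ?thesis
    using fps_mat_poly[of "Polynomial.smult c [:0, 1:]"] peval_smult[OF nil_carrier] peval_X[OF nil_carrier] by metis
qed

lemma fps_mat_minus_const:
  "fps_mat n (f - 1) A = fps_mat n f A - 1\<^sub>m n"
proof -
  obtain m where m: "A ^\<^sub>m m = 0\<^sub>m n n" using nil by (auto simp: nilpotent_mat_def)
  have "fps_mat n (f - 1) A = peval n (truncate_fps m f + Polynomial.smult (-1) 1) A"
    by (rule fps_mat_eq_peval[OF nil_carrier m]) (simp add: coeff_truncate_fps coeff_pCons split: nat.splits)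
  also have "\<dots> = fps_mat n f A + (-1) \<cdot>\<^sub>m 1\<^sub>m n"
    by (simp only: peval_add[OF nil_carrier] peval_smult[OF nil_carrier] peval_1[OF nil_carrier] fps_mat_truncate[OF nil_carrier m])
  also have "\<dots> = fps_mat n f A - 1\<^sub>m n"
    using fps_mat_carrier[of f] by (intro eq_matI) auto
  finally show ?thesis .
qed

lemma fps_mat_transpose:
  "nilpotent_mat n (transpose_mat A)" "fps_mat n f (transpose_mat A) = transpose_mat (fps_mat n f A)"
proof -
  obtain m where m: "A ^\<^sub>m m = 0\<^sub>m n n" using nil by (auto simp: nilpotent_mat_def)
  have At: "transpose_mat A \<in> carrier_mat n n" using nil_carrier by simp
  have "transpose_mat A ^\<^sub>m m = transpose_mat (A ^\<^sub>m m)"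
    using peval_transpose[OF nil_carrier, of "[:0, 1:] ^ m"]
    unfolding peval_power[OF At] peval_power[OF nil_carrier] peval_X[OF At] peval_X[OF nil_carrier] .
  also have "\<dots> = 0\<^sub>m n n" unfolding m by (rule eq_matI) auto
  finally have mt: "transpose_mat A ^\<^sub>m m = 0\<^sub>m n n" .
  then show "nilpotent_mat n (transpose_mat A)" using At by (auto simp: nilpotent_mat_def)
  show "fps_mat n f (transpose_mat A) = transpose_mat (fps_mat n f A)"
    by (simp add: fps_mat_truncate[OF At mt] fps_mat_truncate[OF nil_carrier m] peval_transpose[OF nil_carrier])
qed

lemma fps_mat_closed:
  assumes "A \<in> S" "\<And>B C. B \<in> S \<Longrightarrow> C \<in> S \<Longrightarrow> B + C \<in> S" "\<And>c B. B \<in> S \<Longrightarrow> c \<cdot>\<^sub>m B \<in> S"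
    "\<And>B C. B \<in> S \<Longrightarrow> C \<in> S \<Longrightarrow> B * C \<in> S" "0\<^sub>m n n \<in> S" "fps_nth f 0 = 0"
  shows "fps_mat n f A \<in> S"
  unfolding fps_mat_def by (rule peval_closed[OF nil_carrier assms(1-5)]) (auto simp: coeff_truncate_fps assms(6))

end

lemma fps_mat_cnj:
  assumes nil: "nilpotent_mat n A"
  shows "nilpotent_mat n (map_mat cnj A)"
    "map_mat cnj (fps_mat n f A) = fps_mat n (Abs_fps (\<lambda>k. cnj (fps_nth f k))) (map_mat cnj A)"
proof -
  note Ac = nil_carrier[OF nil]
  obtain m where m: "A ^\<^sub>m m = 0\<^sub>m n n" using nil by (auto simp: nilpotent_mat_def)
  have A': "map_mat cnj A \<in> carrier_mat n n" using Ac by simp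
  have X: "map_poly cnj ([:0, 1:] ^ m) = [:0, 1:] ^ m"
    using map_poly_monom[of cnj 1 m] by (simp add: monom_altdef)
  have "map_mat cnj A ^\<^sub>m m = map_mat cnj (A ^\<^sub>m m)"
    using peval_cnj[OF Ac, of "[:0, 1:] ^ m"]
    unfolding X peval_power[OF A'] peval_power[OF Ac] peval_X[OF A'] peval_X[OF Ac] by simp
  also have "\<dots> = 0\<^sub>m n n" unfolding m by (rule eq_matI) auto
  finally have mt: "map_mat cnj A ^\<^sub>m m = 0\<^sub>m n n" .
  then show "nilpotent_mat n (map_mat cnj A)" using A' by (auto simp: nilpotent_mat_def)
  show "map_mat cnj (fps_mat n f A) = fps_mat n (Abs_fps (\<lambda>k. cnj (fps_nth f k))) (map_mat cnj A)"
    unfolding fps_mat_truncate[OF Ac m] peval_cnj[OF Ac]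
    by (rule fps_mat_eq_peval[OF A' mt, symmetric]) (simp add: coeff_truncate_fps coeff_map_poly)
qed

lemma fps_mat_intertwine:
  assumes X: "nilpotent_mat n' X" and Y: "nilpotent_mat n Y" and g: "g \<in> carrier_mat n' n"
    and XY: "X * g = g * Y"
  shows "fps_mat n' f X * g = g * fps_mat n f Y"
proof -
  note Xc = nil_carrier[OF X] and Yc = nil_carrier[OF Y]
  obtain m1 m2 where m: "X ^\<^sub>m m1 = 0\<^sub>m n' n'" "Y ^\<^sub>m m2 = 0\<^sub>m n n"
    using X Y by (auto simp: nilpotent_mat_def)
  have "X ^\<^sub>m max m1 m2 = 0\<^sub>m n' n'" "Y ^\<^sub>m max m1 m2 = 0\<^sub>m n n"
    using pow_mat_zero_mono[OF Xc m(1)] pow_mat_zero_mono[OF Yc m(2)] by auto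
  then show ?thesis
    using peval_intertwine[OF Xc Yc g XY] by (simp add: fps_mat_truncate[OF Xc] fps_mat_truncate[OF Yc])
qed

subsection \<open>Exponential and logarithm\<close>

definition mexp :: "nat \<Rightarrow> complex \<Rightarrow> complex mat \<Rightarrow> complex mat" where
  "mexp n c A = fps_mat n (fps_exp c) A"

context
  fixes n :: nat and A :: "complex mat"
  assumes nil: "nilpotent_mat n A"
begin

lemma mexp_carrier [simp]: "mexp n c A \<in> carrier_mat n n"
  by (simp add: mexp_def fps_mat_carrier[OF nil])

lemma mexp_add: "mexp n (a + b) A = mexp n a A * mexp n b A"
  by (simp add: mexp_def fps_exp_add_mult fps_mat_mult[OF nil])

lemma mexp_0: "mexp n 0 A = 1\<^sub>m n"
  by (simp add: mexp_def fps_mat_1[OF nil])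

lemma mexp_inverse: "inverse_mats n (mexp n c A) (mexp n (- c) A)"
  using mexp_add[of c "- c"] mexp_0 by (intro inverse_matsI) simp_all

lemma mexp_transpose: "mexp n c (transpose_mat A) = transpose_mat (mexp n c A)"
  by (simp add: mexp_def fps_mat_transpose[OF nil])

lemma mexp_cnj: "map_mat cnj (mexp n c A) = mexp n (cnj c) (map_mat cnj A)"
proof -
  have "Abs_fps (\<lambda>k. cnj (fps_nth (fps_exp c) k)) = fps_exp (cnj c)" by (rule fps_ext) simp
  then show ?thesis by (simp add: mexp_def fps_mat_cnj(2)[OF nil])
qed

lemma nilpotent_smult: "nilpotent_mat n (c \<cdot>\<^sub>m A)"
  using nilpotent_fps_mat[OF nil, of "fps_const c * fps_X"] by (simp add: fps_mat_linear[OF nil])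

lemma mexp_smult: "mexp n c (b \<cdot>\<^sub>m A) = mexp n (c * b) A"
proof -
  have "fps_exp c oo (fps_const b * fps_X) = fps_exp (c * b)"
    using fps_exp_compose_linear[of c b] unfolding mult.commute[of b c] .
  moreover have "fps_mat n (fps_exp c oo (fps_const b * fps_X)) A = fps_mat n (fps_exp c) (b \<cdot>\<^sub>m A)"
    by (subst fps_mat_compose[OF nil]) (simp_all only: fps_mat_linear[OF nil], simp)
  ultimately show ?thesis by (simp only: mexp_def)
qed

lemma mexp_minus_one_closed:
  assumes "A \<in> S" "\<And>B C. B \<in> S \<Longrightarrow> C \<in> S \<Longrightarrow> B + C \<in> S" "\<And>c B. B \<in> S \<Longrightarrow> c \<cdot>\<^sub>m B \<in> S"
    "\<And>B C. B \<in> S \<Longrightarrow> C \<in> S \<Longrightarrow> B * C \<in> S" "0\<^sub>m n n \<in> S"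
  shows "mexp n c A - 1\<^sub>m n \<in> S"
  using fps_mat_closed[OF nil assms, of "fps_exp c - 1"] by (simp add: mexp_def fps_mat_minus_const[OF nil])

end

definition log_series :: "complex fps" where
  "log_series = fps_inv (fps_exp 1 - 1)"

lemma log_series_0: "fps_nth log_series 0 = 0"
  by (simp add: log_series_def fps_inv_def)

lemma log_exp:
  assumes nil: "nilpotent_mat n A"
  shows "nilpotent_mat n (mexp n 1 A - 1\<^sub>m n)" "fps_mat n log_series (mexp n 1 A - 1\<^sub>m n) = A"
proof -
  have 1: "mexp n 1 A - 1\<^sub>m n = fps_mat n (fps_exp 1 - 1) A"
    by (simp add: mexp_def fps_mat_minus_const[OF nil])
  show "nilpotent_mat n (mexp n 1 A - 1\<^sub>m n)" unfolding 1 by (rule nilpotent_fps_mat[OF nil]) simp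
  have "log_series oo (fps_exp 1 - 1) = fps_X" unfolding log_series_def by (rule fps_inv) simp_all
  then have "fps_mat n log_series (fps_mat n (fps_exp 1 - 1) A) = fps_mat n (fps_const 1 * fps_X) A"
    using fps_mat_compose[OF nil, of "fps_exp 1 - 1" log_series] by simp
  then show "fps_mat n log_series (mexp n 1 A - 1\<^sub>m n) = A"
    unfolding 1 fps_mat_linear[OF nil] using nil_carrier[OF nil] by simp
qed

lemma exp_log:
  assumes nil: "nilpotent_mat n (U - 1\<^sub>m n)" and U: "U \<in> carrier_mat n n"
  shows "nilpotent_mat n (fps_mat n log_series (U - 1\<^sub>m n))" "mexp n 1 (fps_mat n log_series (U - 1\<^sub>m n)) = U"
proof -
  let ?L = "fps_mat n log_series (U - 1\<^sub>m n)"
  show L: "nilpotent_mat n ?L" by (rule nilpotent_fps_mat[OF nil log_series_0])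
  have "(fps_exp 1 - 1) oo log_series = fps_X" unfolding log_series_def by (rule fps_inv_right) simp_all
  then have "fps_mat n (fps_exp 1 - 1) ?L = fps_mat n (fps_const 1 * fps_X) (U - 1\<^sub>m n)"
    using fps_mat_compose[OF nil log_series_0, of "fps_exp 1 - 1"] by simp
  then have eq: "mexp n 1 ?L - 1\<^sub>m n = U - 1\<^sub>m n"
    unfolding fps_mat_linear[OF nil] fps_mat_minus_const[OF L] mexp_def using nil_carrier[OF nil] by simp
  show "mexp n 1 ?L = U"
  proof (rule eq_matI)
    fix i j assume ij: "i < dim_row U" "j < dim_col U"
    then have "(mexp n 1 ?L - 1\<^sub>m n) $$ (i, j) = (U - 1\<^sub>m n) $$ (i, j)" by (simp only: eq)
    then show "mexp n 1 ?L $$ (i, j) = U $$ (i, j)" using ij U mexp_carrier[OF L, of 1] by simp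
  qed (use U mexp_carrier[OF L, of 1] in auto)
qed

text \<open>Since the logarithm is a power series in the exponential, whatever intertwines exponentials
  of nilpotent matrices intertwines the matrices.\<close>

lemma mexp_intertwine_imp:
  assumes X: "nilpotent_mat n' X" and Y: "nilpotent_mat n Y" and g: "g \<in> carrier_mat n' n"
    and XY: "mexp n' 1 X * g = g * mexp n 1 Y"
  shows "X * g = g * Y"
proof -
  note c = mexp_carrier[OF X, of 1] mexp_carrier[OF Y, of 1]
  have "(mexp n' 1 X - 1\<^sub>m n') * g = g * (mexp n 1 Y - 1\<^sub>m n)"
    using c g XY by (simp add: minus_mult_distrib_mat[of _ n' n' _ g n] mult_minus_distrib_mat[of g n' n _ n])
  from fps_mat_intertwine[OF log_exp(1)[OF X] log_exp(1)[OF Y] g this, of log_series]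
  show ?thesis by (simp add: log_exp(2)[OF X] log_exp(2)[OF Y])
qed

lemma mexp_entry:
  assumes A: "A \<in> carrier_mat n n" "A ^\<^sub>m m = 0\<^sub>m n n" and ij: "i < n" "j < n"
  shows "mexp n c A $$ (i, j) = (\<Sum>k<m. c ^ k / fact k * (A ^\<^sub>m k) $$ (i, j))"
  unfolding mexp_def fps_mat_truncate[OF A]
  by (subst peval_entry[OF A(1), of m]) (use ij in \<open>auto simp: coeff_truncate_fps\<close>)

lemma kron_uminus: "kron_mat (- A) B = - kron_mat A B" "kron_mat A (- B) = - kron_mat A B"
  for A :: "'a :: comm_ring_1 mat"
proof -
  have "kron_mat (- A) B $$ (i, j) = (- kron_mat A B) $$ (i, j)" "kron_mat A (- B) $$ (i, j) = (- kron_mat A B) $$ (i, j)"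
    if ij: "i < dim_row A * dim_row B" "j < dim_col A * dim_col B" for i j
    using ij div_mod_bounds[OF ij(1)] div_mod_bounds[OF ij(2)] by simp_all
  then show "kron_mat (- A) B = - kron_mat A B" "kron_mat A (- B) = - kron_mat A B"
    by (intro eq_matI; simp)+
qed

lemma kron_smult: "kron_mat (c \<cdot>\<^sub>m A) B = c \<cdot>\<^sub>m kron_mat A B" "kron_mat A (c \<cdot>\<^sub>m B) = c \<cdot>\<^sub>m kron_mat A B"
  for A :: "'a :: comm_ring_1 mat"
proof -
  have "kron_mat (c \<cdot>\<^sub>m A) B $$ (i, j) = (c \<cdot>\<^sub>m kron_mat A B) $$ (i, j)" "kron_mat A (c \<cdot>\<^sub>m B) $$ (i, j) = (c \<cdot>\<^sub>m kron_mat A B) $$ (i, j)"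
    if ij: "i < dim_row A * dim_row B" "j < dim_col A * dim_col B" for i j
    using ij div_mod_bounds[OF ij(1)] div_mod_bounds[OF ij(2)] by simp_all
  then show "kron_mat (c \<cdot>\<^sub>m A) B = c \<cdot>\<^sub>m kron_mat A B" "kron_mat A (c \<cdot>\<^sub>m B) = c \<cdot>\<^sub>m kron_mat A B"
    by (intro eq_matI; simp)+
qed

text \<open>
  The endomorphism that the Leibniz rule puts on a tensor product: \<open>A \<otimes> 1 + 1 \<otimes> B\<close>.
\<close>

definition kron_sum :: "'a :: semiring_1 mat \<Rightarrow> 'a mat \<Rightarrow> 'a mat" where
  "kron_sum A B = kron_mat A (1\<^sub>m (dim_row B)) + kron_mat (1\<^sub>m (dim_row A)) B"

lemma kron_sum_carrier [simp]:
  "A \<in> carrier_mat n n \<Longrightarrow> B \<in> carrier_mat m m \<Longrightarrow> kron_sum A B \<in> carrier_mat (n * m) (n * m)"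
  unfolding kron_sum_def by (intro add_carrier_mat kron_carrier) auto

lemma kron_mult_kron_sum:
  fixes A :: "'a :: comm_ring_1 mat"
  assumes A: "A \<in> carrier_mat n n" and B: "B \<in> carrier_mat m m"
    and X: "X \<in> carrier_mat k n" and Y: "Y \<in> carrier_mat k' m"
  shows "kron_mat X Y * kron_sum A B = kron_mat (X * A) Y + kron_mat X (Y * B)"
proof -
  have "kron_mat X Y * kron_sum A B = kron_mat X Y * kron_mat A (1\<^sub>m m) + kron_mat X Y * kron_mat (1\<^sub>m n) B"
    unfolding kron_sum_def using A B X Y
    by (subst mult_add_distrib_mat[of _ "k * k'" "n * m" _ "n * m"]) auto
  also have "kron_mat X Y * kron_mat A (1\<^sub>m m) = kron_mat (X * A) Y"
    using kron_mult[OF X A Y one_carrier_mat] Y by simp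
  also have "kron_mat X Y * kron_mat (1\<^sub>m n) B = kron_mat X (Y * B)"
    using kron_mult[OF X one_carrier_mat Y B] X by simp
  finally show ?thesis .
qed

lemma kron_sum_mult_kron:
  fixes A :: "'a :: comm_ring_1 mat"
  assumes A: "A \<in> carrier_mat n n" and B: "B \<in> carrier_mat m m"
    and X: "X \<in> carrier_mat n k" and Y: "Y \<in> carrier_mat m k'"
  shows "kron_sum A B * kron_mat X Y = kron_mat (A * X) Y + kron_mat X (B * Y)"
proof -
  have "kron_sum A B * kron_mat X Y = kron_mat A (1\<^sub>m m) * kron_mat X Y + kron_mat (1\<^sub>m n) B * kron_mat X Y"
    unfolding kron_sum_def using A B X Y
    by (subst add_mult_distrib_mat[of _ "n * m" "n * m" _ _ "k * k'"]) auto
  also have "kron_mat A (1\<^sub>m m) * kron_mat X Y = kron_mat (A * X) Y"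
    using kron_mult[OF A X one_carrier_mat Y] Y by simp
  also have "kron_mat (1\<^sub>m n) B * kron_mat X Y = kron_mat X (B * Y)"
    using kron_mult[OF one_carrier_mat X B Y] X by simp
  finally show ?thesis .
qed

text \<open>
  Pascal's rule gives the induction step of the binomial theorem for the commuting matrices
  \<open>A \<otimes> 1\<close> and \<open>1 \<otimes> B\<close>, which is proved entry by entry.
\<close>

lemma binomial_recurrence:
  fixes \<alpha> \<beta> :: "nat \<Rightarrow> 'a :: comm_ring_1"
  shows "(\<Sum>i\<le>k. of_nat (k choose i) * (\<alpha> (Suc i) * \<beta> (k - i) + \<alpha> i * \<beta> (Suc (k - i))))
    = (\<Sum>i\<le>Suc k. of_nat (Suc k choose i) * (\<alpha> i * \<beta> (Suc k - i)))"
proof -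
  have A: "(\<Sum>i\<le>k. of_nat (k choose i) * (\<alpha> i * \<beta> (Suc (k - i)))) = (\<Sum>i\<le>Suc k. of_nat (k choose i) * (\<alpha> i * \<beta> (Suc k - i)))"
    by (simp add: Suc_diff_le binomial_eq_0)
  have "(\<Sum>i\<le>Suc k. of_nat (Suc k choose i) * (\<alpha> i * \<beta> (Suc k - i)))
    = \<alpha> 0 * \<beta> (Suc k) + (\<Sum>i\<le>k. of_nat (k choose i) * (\<alpha> (Suc i) * \<beta> (k - i)) + of_nat (k choose Suc i) * (\<alpha> (Suc i) * \<beta> (k - i)))"
    unfolding sum.atMost_Suc_shift by (simp add: algebra_simps)
  also have "\<dots> = (\<Sum>i\<le>k. of_nat (k choose i) * (\<alpha> (Suc i) * \<beta> (k - i))) + (\<Sum>i\<le>Suc k. of_nat (k choose i) * (\<alpha> i * \<beta> (Suc k - i)))"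
    unfolding sum.atMost_Suc_shift[of _ k] by (simp add: sum.distrib)
  finally show ?thesis unfolding A[symmetric] by (simp add: distrib_left sum.distrib)
qed

lemma kron_sum_power:
  fixes A :: "'a :: comm_ring_1 mat"
  assumes A: "A \<in> carrier_mat n n" and B: "B \<in> carrier_mat m m" and ij: "i < n * m" "j < n * m"
  shows "(kron_sum A B ^\<^sub>m k) $$ (i, j)
    = (\<Sum>a\<le>k. of_nat (k choose a) * ((A ^\<^sub>m a) $$ (i div m, j div m) * (B ^\<^sub>m (k - a)) $$ (i mod m, j mod m)))"
  using ij
proof (induction k arbitrary: j)
  case 0
  then show ?case
    using A B carrier_matD[OF kron_sum_carrier[OF A B]] one_mat_index_div_mod[of i n m j, where ?'a = 'a] by simp
next
  case (Suc k)
  let ?S = "kron_sum A B"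
  note S = kron_sum_carrier[OF A B]
  have K: "kron_mat (A ^\<^sub>m a) (B ^\<^sub>m b) \<in> carrier_mat (n * m) (n * m)" for a b
    using A B by (intro kron_carrier) auto
  have ent: "kron_mat (A ^\<^sub>m a) (B ^\<^sub>m b) $$ (i, l) = (A ^\<^sub>m a) $$ (i div m, l div m) * (B ^\<^sub>m b) $$ (i mod m, l mod m)"
    if "l < n * m" for a b l
    using A B Suc.prems that by simp
  have step: "(kron_mat (A ^\<^sub>m a) (B ^\<^sub>m b) * ?S) $$ (i, j)
    = (A ^\<^sub>m Suc a) $$ (i div m, j div m) * (B ^\<^sub>m b) $$ (i mod m, j mod m)
      + (A ^\<^sub>m a) $$ (i div m, j div m) * (B ^\<^sub>m Suc b) $$ (i mod m, j mod m)" for a b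
  proof -
    have "kron_mat (A ^\<^sub>m a) (B ^\<^sub>m b) * ?S = kron_mat (A ^\<^sub>m Suc a) (B ^\<^sub>m b) + kron_mat (A ^\<^sub>m a) (B ^\<^sub>m Suc b)"
      using kron_mult_kron_sum[OF A B pow_carrier_mat[OF A] pow_carrier_mat[OF B]] by simp
    then show ?thesis using Suc.prems ent[OF Suc.prems(2)] K[of "Suc a" b] K[of a "Suc b"]
      by (simp only: index_add_mat carrier_matD)
  qed
  have "(?S ^\<^sub>m Suc k) $$ (i, j) = (\<Sum>l<n * m. (?S ^\<^sub>m k) $$ (i, l) * ?S $$ (l, j))"
    unfolding pow_mat.simps using S Suc.prems by (subst mult_mat_index) auto
  also have "\<dots> = (\<Sum>l<n * m. \<Sum>a\<le>k. of_nat (k choose a) * (kron_mat (A ^\<^sub>m a) (B ^\<^sub>m (k - a)) $$ (i, l) * ?S $$ (l, j)))"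
    using Suc by (intro sum.cong refl) (simp only: lessThan_iff ent sum_distrib_right mult.assoc)
  also have "\<dots> = (\<Sum>a\<le>k. of_nat (k choose a) * (\<Sum>l<n * m. kron_mat (A ^\<^sub>m a) (B ^\<^sub>m (k - a)) $$ (i, l) * ?S $$ (l, j)))"
    by (subst sum.swap) (simp only: sum_distrib_left)
  also have "\<dots> = (\<Sum>a\<le>k. of_nat (k choose a) * (kron_mat (A ^\<^sub>m a) (B ^\<^sub>m (k - a)) * ?S) $$ (i, j))"
  proof (intro sum.cong refl arg_cong2[where f = "(*)"])
    fix a
    show "(\<Sum>l<n * m. kron_mat (A ^\<^sub>m a) (B ^\<^sub>m (k - a)) $$ (i, l) * ?S $$ (l, j)) = (kron_mat (A ^\<^sub>m a) (B ^\<^sub>m (k - a)) * ?S) $$ (i, j)"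
      using carrier_matD[OF S] carrier_matD[OF K[of a "k - a"]] Suc.prems
      by (subst mult_mat_index) (simp_all only:)
  qed
  also have "\<dots> = (\<Sum>a\<le>Suc k. of_nat (Suc k choose a) * ((A ^\<^sub>m a) $$ (i div m, j div m) * (B ^\<^sub>m (Suc k - a)) $$ (i mod m, j mod m)))"
    unfolding step by (rule binomial_recurrence[of k "\<lambda>a. (A ^\<^sub>m a) $$ (i div m, j div m)" "\<lambda>b. (B ^\<^sub>m b) $$ (i mod m, j mod m)"])
  finally show ?case .
qed

text \<open>
  The matrices \<open>A \<otimes> 1\<close> and \<open>1 \<otimes> B\<close> commute, so the binomial theorem turns the exponential of
  their sum into a Cauchy product, which is finite by nilpotency.
\<close>

lemma mexp_kron_sum:
  assumes A: "nilpotent_mat n A" and B: "nilpotent_mat m B"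
  shows "nilpotent_mat (n * m) (kron_sum A B)"
    and "mexp (n * m) c (kron_sum A B) = kron_mat (mexp n c A) (mexp m c B)"
proof -
  note Ac = nil_carrier[OF A] and Bc = nil_carrier[OF B]
  note S = kron_sum_carrier[OF Ac Bc]
  obtain k1 k2 where k12: "A ^\<^sub>m k1 = 0\<^sub>m n n" "B ^\<^sub>m k2 = 0\<^sub>m m m" using A B by (auto simp: nilpotent_mat_def)
  define K where "K = max k1 k2"
  have AK: "A ^\<^sub>m k = 0\<^sub>m n n" and BK: "B ^\<^sub>m k = 0\<^sub>m m m" if "k \<ge> K" for k
    using pow_mat_zero_mono[OF Ac k12(1), of k] pow_mat_zero_mono[OF Bc k12(2), of k] that by (auto simp: K_def)
  have SK: "kron_sum A B ^\<^sub>m (2 * K) = 0\<^sub>m (n * m) (n * m)"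
  proof (rule eq_matI)
    fix i j assume "i < dim_row (0\<^sub>m (n * m) (n * m))" "j < dim_col (0\<^sub>m (n * m) (n * m))"
    then have ij: "i < n * m" "j < n * m" by auto
    note b = div_mod_bounds[OF ij(1)] div_mod_bounds[OF ij(2)]
    have "(A ^\<^sub>m a) $$ (i div m, j div m) * (B ^\<^sub>m (2 * K - a)) $$ (i mod m, j mod m) = 0" for a
      using b AK[of a] BK[of "2 * K - a"] by (cases "a \<ge> K") auto
    then show "(kron_sum A B ^\<^sub>m (2 * K)) $$ (i, j) = 0\<^sub>m (n * m) (n * m) $$ (i, j)"
      using ij by (simp add: kron_sum_power[OF Ac Bc ij])
  qed (use S in auto)
  then show nS: "nilpotent_mat (n * m) (kron_sum A B)" using S by (auto simp: nilpotent_mat_def)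
  show "mexp (n * m) c (kron_sum A B) = kron_mat (mexp n c A) (mexp m c B)"
  proof (rule eq_matI)
    note cA = carrier_matD[OF mexp_carrier[OF A, of c]] and cB = carrier_matD[OF mexp_carrier[OF B, of c]]
    fix i j assume "i < dim_row (kron_mat (mexp n c A) (mexp m c B))" "j < dim_col (kron_mat (mexp n c A) (mexp m c B))"
    then have ij: "i < n * m" "j < n * m" using cA cB by auto
    note b = div_mod_bounds[OF ij(1)] div_mod_bounds[OF ij(2)]
    define \<alpha> where "\<alpha> a = c ^ a / fact a * (A ^\<^sub>m a) $$ (i div m, j div m)" for a
    define \<beta> where "\<beta> a = c ^ a / fact a * (B ^\<^sub>m a) $$ (i mod m, j mod m)" for a
    have z: "\<alpha> a = 0" "\<beta> a = 0" if "a \<ge> K" for a using AK[OF that] BK[OF that] b by (auto simp: \<alpha>_def \<beta>_def)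
    have "mexp (n * m) c (kron_sum A B) $$ (i, j) = (\<Sum>k<2 * K. c ^ k / fact k * (kron_sum A B ^\<^sub>m k) $$ (i, j))"
      by (rule mexp_entry[OF S SK ij])
    also have "\<dots> = (\<Sum>k<2 * K. \<Sum>a\<le>k. \<alpha> a * \<beta> (k - a))"
    proof (intro sum.cong refl)
      fix k
      have "c ^ k / fact k * (of_nat (k choose a) * (x * y)) = c ^ a / fact a * x * (c ^ (k - a) / fact (k - a) * y)"
        if "a \<le> k" for a and x y :: complex
      proof -
        have "c ^ k = c ^ a * c ^ (k - a)" using that by (simp flip: power_add)
        moreover have "(of_nat (k choose a) :: complex) = fact k / (fact a * fact (k - a))"
          using that by (simp add: binomial_fact)
        ultimately show ?thesis by (simp add: field_simps)
      qed
      then show "c ^ k / fact k * (kron_sum A B ^\<^sub>m k) $$ (i, j) = (\<Sum>a\<le>k. \<alpha> a * \<beta> (k - a))"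
        unfolding kron_sum_power[OF Ac Bc ij] sum_distrib_left \<alpha>_def \<beta>_def by (intro sum.cong refl) auto
    qed
    also have "\<dots> = (\<Sum>(a, b)\<in>{(a, b). a + b < 2 * K}. \<alpha> a * \<beta> b)"
      by (rule sum.triangle_reindex[symmetric])
    also have "\<dots> = (\<Sum>(a, b)\<in>{..<K} \<times> {..<K}. \<alpha> a * \<beta> b)"
    proof (rule sum.mono_neutral_right)
      have "{(a, b). a + b < 2 * K} \<subseteq> {..<2 * K} \<times> {..<2 * K}" by auto
      then show "finite {(a, b). a + b < 2 * K}" by (rule finite_subset) auto
      show "\<forall>x\<in>{(a, b). a + b < 2 * K} - {..<K} \<times> {..<K}. (case x of (a, b) \<Rightarrow> \<alpha> a * \<beta> b) = 0"
      proof
        fix x assume x: "x \<in> {(a, b). a + b < 2 * K} - {..<K} \<times> {..<K}"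
        obtain a b where ab: "x = (a, b)" by (cases x)
        then have "a \<ge> K \<or> b \<ge> K" using x by auto
        then show "(case x of (a, b) \<Rightarrow> \<alpha> a * \<beta> b) = 0" using z ab by auto
      qed
    qed auto
    also have "\<dots> = (\<Sum>a<K. \<alpha> a) * (\<Sum>b<K. \<beta> b)"
      by (simp add: sum_product sum.cartesian_product)
    also have "\<dots> = mexp n c A $$ (i div m, j div m) * mexp m c B $$ (i mod m, j mod m)"
      using b mexp_entry[OF Ac AK[OF order_refl], of "i div m" "j div m" c]
        mexp_entry[OF Bc BK[OF order_refl], of "i mod m" "j mod m" c] by (simp add: \<alpha>_def \<beta>_def)
    also have "\<dots> = kron_mat (mexp n c A) (mexp m c B) $$ (i, j)" using ij cA cB by simp
    finally show "mexp (n * m) c (kron_sum A B) $$ (i, j) = kron_mat (mexp n c A) (mexp m c B) $$ (i, j)" .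
  qed (use carrier_matD[OF mexp_carrier[OF A, of c]] carrier_matD[OF mexp_carrier[OF B, of c]]
        carrier_matD[OF mexp_carrier[OF nS, of c]] in auto)
qed

section \<open>Matrices between bigraded spaces\<close>

text \<open>
  A matrix with respect to bases of types \<open>c\<close> and \<open>r\<close>: the entry \<open>(i, j)\<close> is the component of
  bidegree \<open>r i - c j\<close> of the map, and only bidegrees with property \<open>C\<close> are allowed to occur.
\<close>

definition supp_in :: "(nat \<Rightarrow> int \<times> int) \<Rightarrow> (nat \<Rightarrow> int \<times> int) \<Rightarrow> (int \<Rightarrow> int \<Rightarrow> bool) \<Rightarrow> 'a :: zero mat \<Rightarrow> bool" where
  "supp_in r c C A \<longleftrightarrow> (\<forall>i < dim_row A. \<forall>j < dim_col A.
     A $$ (i, j) \<noteq> 0 \<longrightarrow> C (fst (r i) - fst (c j)) (snd (r i) - snd (c j)))"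

lemma supp_inD:
  "supp_in r c C A \<Longrightarrow> i < dim_row A \<Longrightarrow> j < dim_col A \<Longrightarrow> A $$ (i, j) \<noteq> 0 \<Longrightarrow>
    C (fst (r i) - fst (c j)) (snd (r i) - snd (c j))"
  by (auto simp: supp_in_def)

lemma supp_in_mono: "supp_in r c C A \<Longrightarrow> (\<And>a b. C a b \<Longrightarrow> C' a b) \<Longrightarrow> supp_in r c C' A"
  by (auto simp: supp_in_def)

lemma supp_in_mult:
  fixes A :: "'a :: semiring_1 mat"
  assumes "supp_in r m C1 A" "supp_in m c C2 B" "dim_col A = dim_row B"
    and "\<And>a b a' b'. C1 a b \<Longrightarrow> C2 a' b' \<Longrightarrow> C (a + a') (b + b')"
  shows "supp_in r c C (A * B)"
  unfolding supp_in_def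
proof (intro allI impI)
  fix i j assume ij: "i < dim_row (A * B)" "j < dim_col (A * B)" and ne: "(A * B) $$ (i, j) \<noteq> 0"
  then have "(\<Sum>k<dim_row B. A $$ (i, k) * B $$ (k, j)) \<noteq> 0"
    using assms(3) by (simp add: mult_mat_index del: index_mult_mat(1))
  then obtain k where k: "k < dim_row B" "A $$ (i, k) * B $$ (k, j) \<noteq> 0"
    by (meson lessThan_iff sum.neutral)
  then have "A $$ (i, k) \<noteq> 0" "B $$ (k, j) \<noteq> 0" by auto
  then have "C1 (fst (r i) - fst (m k)) (snd (r i) - snd (m k))" "C2 (fst (m k) - fst (c j)) (snd (m k) - snd (c j))"
    using assms(1-3) ij k by (auto simp: supp_in_def)
  from assms(4)[OF this] show "C (fst (r i) - fst (c j)) (snd (r i) - snd (c j))" by simp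
qed

lemma supp_in_add:
  fixes A :: "'a :: semiring_1 mat"
  assumes "supp_in r c C A" "supp_in r c C B" "dim_row A = dim_row B" "dim_col A = dim_col B"
  shows "supp_in r c C (A + B)"
  using assms unfolding supp_in_def by auto (metis add.left_neutral)

lemma supp_in_smult: "supp_in r c C A \<Longrightarrow> supp_in r c C (k \<cdot>\<^sub>m A)" for A :: "'a :: semiring_1 mat"
  unfolding supp_in_def by simp (metis mult_zero_right)

lemma supp_in_diff:
  fixes A :: "'a :: ring_1 mat"
  assumes "supp_in r c C A" "supp_in r c C B" "dim_row A = dim_row B" "dim_col A = dim_col B"
  shows "supp_in r c C (A - B)"
  using assms unfolding supp_in_def by auto (metis diff_zero)

lemma supp_in_zero: "supp_in r c C (0\<^sub>m n m)"
  by (auto simp: supp_in_def)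

lemma supp_in_one: "C 0 0 \<Longrightarrow> supp_in r r C (1\<^sub>m n)"
  by (auto simp: supp_in_def)

abbreviation both_neg :: "int \<Rightarrow> int \<Rightarrow> bool" where
  "both_neg a b \<equiv> a < 0 \<and> b < 0"

abbreviation same_type :: "int \<Rightarrow> int \<Rightarrow> bool" where
  "same_type a b \<equiv> a = 0 \<and> b = 0"

lemma supp_in_nilpotent:
  assumes A: "A \<in> carrier_mat n n" and s: "supp_in t t C A" and C: "\<And>a b. C a b \<Longrightarrow> a + b < 0"
  shows "nilpotent_mat n (A :: 'a :: field mat)"
proof -
  have pow: "supp_in t t (\<lambda>a b. a + b \<le> - int k) (A ^\<^sub>m k)" for k
  proof (induction k)
    case 0
    then show ?case by (simp add: supp_in_one)
  next
    case (Suc k)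
    show ?case unfolding pow_mat.simps
      by (rule supp_in_mult[OF Suc s]) (use A in \<open>auto dest!: C\<close>)
  qed
  define N where "N = (\<Sum>i<n. \<bar>fst (t i)\<bar> + \<bar>snd (t i)\<bar>)"
  have N: "\<bar>fst (t i)\<bar> + \<bar>snd (t i)\<bar> \<le> N" if "i < n" for i
    unfolding N_def by (rule member_le_sum) (use that in auto)
  have "A ^\<^sub>m nat (2 * N + 1) = 0\<^sub>m n n"
  proof (rule eq_matI)
    fix i j assume "i < dim_row (0\<^sub>m n n)" "j < dim_col (0\<^sub>m n n)"
    then have ij: "i < n" "j < n" by auto
    have "(A ^\<^sub>m nat (2 * N + 1)) $$ (i, j) = 0"
    proof (rule ccontr)
      assume "(A ^\<^sub>m nat (2 * N + 1)) $$ (i, j) \<noteq> 0"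
      from supp_inD[OF pow _ _ this]
      have "(fst (t i) - fst (t j)) + (snd (t i) - snd (t j)) \<le> - int (nat (2 * N + 1))" using A ij by simp
      then show False using N[OF ij(1)] N[OF ij(2)] by linarith
    qed
    then show "(A ^\<^sub>m nat (2 * N + 1)) $$ (i, j) = 0\<^sub>m n n $$ (i, j)" using ij by simp
  qed (use A in auto)
  then show ?thesis using A by (auto simp: nilpotent_mat_def)
qed

lemma supp_in_mexp:
  assumes A: "A \<in> carrier_mat n n" and s: "supp_in t t C A" and C: "\<And>a b. C a b \<Longrightarrow> a + b < 0"
    and add: "\<And>a b a' b'. C a b \<Longrightarrow> C a' b' \<Longrightarrow> C (a + a') (b + b')"
  shows "supp_in t t C (mexp n c A - 1\<^sub>m n)"
proof -
  have "mexp n c A - 1\<^sub>m n \<in> {B \<in> carrier_mat n n. supp_in t t C B}"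
    by (rule mexp_minus_one_closed[OF supp_in_nilpotent[OF A s C]])
       (use A s add in \<open>auto intro: supp_in_add supp_in_smult supp_in_zero
          intro!: supp_in_mult[of t t C _ t C _ C]\<close>)
  then show ?thesis by simp
qed

section \<open>Characters and regular functions\<close>

text \<open>
  The characters of \<open>S\<close>; the exponents are the type of the corresponding Hodge structure.
\<close>

definition chi :: "int \<times> int \<Rightarrow> complex \<Rightarrow> complex" where
  "chi t l = l powi fst t * cnj l powi snd t"

lemma chi_mult: "chi t (l * m) = chi t l * chi t m"
  by (simp add: chi_def power_int_mult_distrib mult_ac)

lemma chi_one [simp]: "chi t 1 = 1"
  by (simp add: chi_def)

lemma chi_nonzero: "l \<noteq> 0 \<Longrightarrow> chi t l \<noteq> 0"
  by (simp add: chi_def)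

lemma chi_add: "l \<noteq> 0 \<Longrightarrow> chi (s + t) l = chi s l * chi t l"
  by (simp add: chi_def power_int_add mult_ac)

lemma chi_zero [simp]: "chi (0, 0) l = 1"
  by (simp add: chi_def)

lemma chi_cnj: "cnj (chi t l) = chi (prod.swap t) l"
  by (simp add: chi_def mult.commute)

lemma chi_uminus: "chi (- t) l = chi t (inverse l)"
  by (simp add: chi_def power_int_minus power_int_inverse)

text \<open>
  The value at \<open>2\<close> determines the sum of the exponents, and the values on the unit circle determine
  their difference.
\<close>

lemma chi_distinct:
  assumes "\<And>l. l \<noteq> 0 \<Longrightarrow> chi s l = chi t l"
  shows "s = t"
proof -
  have "(2 :: complex) powi (fst s + snd s) = 2 powi (fst t + snd t)"
    using assms[of 2] by (simp add: chi_def power_int_add)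
  then have "of_real (2 powi (fst s + snd s)) = (of_real (2 powi (fst t + snd t)) :: complex)"
    by (simp add: of_real_power_int)
  then have "(2 :: real) powi (fst s + snd s) = 2 powi (fst t + snd t)" by (simp only: of_real_eq_iff)
  then have sum: "fst s + snd s = fst t + snd t"
    by (smt (verit, best) power_int_strict_increasing)
  have unit: "chi u (cis x) = cis (of_int (fst u - snd u) * x)" for u x
  proof -
    have "chi u (cis x) = cis (of_int (fst u) * x) * cis (of_int (snd u) * - x)"
      by (simp only: chi_def cis_cnj cis_power_int)
    then show ?thesis by (simp add: cis_mult algebra_simps)
  qed
  define d where "d = (fst s - snd s) - (fst t - snd t)"
  have "d = 0"
  proof (rule ccontr)
    assume d: "d \<noteq> 0"
    let ?x = "pi / of_int d"
    have "cis (of_int (fst s - snd s) * ?x) = cis (of_int (fst t - snd t) * ?x)"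
      using assms[of "cis ?x"] unfolding unit by simp
    then have "cis (of_int (fst s - snd s) * ?x) / cis (of_int (fst t - snd t) * ?x) = 1" by simp
    moreover have "of_int d * ?x = of_int (fst s - snd s) * ?x - of_int (fst t - snd t) * ?x"
      unfolding left_diff_distrib[symmetric] of_int_diff[symmetric] by (simp add: d_def)
    ultimately have "cis (of_int d * ?x) = 1" by (simp only: cis_divide)
    then show False using d by simp
  qed
  then show ?thesis using sum by (simp add: d_def prod_eq_iff)
qed

text \<open>
  Dedekind's argument: subtracting \<open>chi s m\<close> times a relation at \<open>l\<close> from the relation at \<open>l m\<close>
  removes \<open>s\<close> from it, where \<open>m\<close> is chosen to keep a given other character.
\<close>

lemma chi_independent:
  assumes "finite S" "\<And>l. l \<noteq> 0 \<Longrightarrow> (\<Sum>t\<in>S. c t * chi t l) = 0" "t \<in> S"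
  shows "c t = 0"
  using assms
proof (induction S arbitrary: c t)
  case (insert s S)
  have *: "c t = 0" if t: "t \<in> S" for t
  proof -
    have "t \<noteq> s" using t insert by auto
    then obtain m where m: "m \<noteq> 0" "chi t m \<noteq> chi s m" using chi_distinct by blast
    have "(\<Sum>t\<in>S. (c t * (chi t m - chi s m)) * chi t l) = 0" if l: "l \<noteq> 0" for l
    proof -
      have "(\<Sum>t\<in>S. (c t * (chi t m - chi s m)) * chi t l)
        = (\<Sum>t\<in>insert s S. c t * chi t (l * m)) - chi s m * (\<Sum>t\<in>insert s S. c t * chi t l)"
        using insert.hyps by (simp add: chi_mult sum_distrib_left sum_subtractf algebra_simps)
      then show ?thesis using insert.prems(1)[OF l] insert.prems(1)[of "l * m"] l m by simp
    qed
    from insert.IH[OF this t] m show ?thesis by simp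
  qed
  show ?case
  proof (cases "t \<in> S")
    case False
    then have "t = s" using insert.prems by simp
    then show ?thesis using insert.prems(1)[of 1] insert.hyps * by simp
  qed (rule *)
qed simp

definition char_sum :: "(int \<times> int) set \<Rightarrow> (complex \<Rightarrow> complex) \<Rightarrow> bool" where
  "char_sum P f \<longleftrightarrow> (\<exists>S c. finite S \<and> S \<subseteq> P \<and> (\<forall>l. l \<noteq> 0 \<longrightarrow> f l = (\<Sum>t\<in>S. c t * chi t l)))"

lemma char_sumI:
  "finite S \<Longrightarrow> S \<subseteq> P \<Longrightarrow> (\<And>l. l \<noteq> 0 \<Longrightarrow> f l = (\<Sum>t\<in>S. c t * chi t l)) \<Longrightarrow> char_sum P f"
  unfolding char_sum_def by (intro exI[of _ S] exI[of _ c]) simp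

lemma char_sumE:
  assumes "char_sum P f"
  obtains S c where "finite S" "S \<subseteq> P" "\<And>l. l \<noteq> 0 \<Longrightarrow> f l = (\<Sum>t\<in>S. c t * chi t l)"
proof -
  obtain S c where "finite S \<and> S \<subseteq> P \<and> (\<forall>l. l \<noteq> 0 \<longrightarrow> f l = (\<Sum>t\<in>S. c t * chi t l))"
    using assms[unfolded char_sum_def] by (elim exE)
  then show thesis using that[of S c] by simp
qed

lemma char_sum_cong: "char_sum P f \<Longrightarrow> (\<And>l. l \<noteq> 0 \<Longrightarrow> f l = g l) \<Longrightarrow> char_sum P g"
  unfolding char_sum_def by simp

lemma char_sum_zero: "char_sum P (\<lambda>l. 0)"
  unfolding char_sum_def by (intro exI[of _ "{}"]) simp

lemma char_sum_add:
  assumes "char_sum P f" "char_sum P g"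
  shows "char_sum P (\<lambda>l. f l + g l)"
proof -
  obtain S c where S: "finite S" "S \<subseteq> P" "\<And>l. l \<noteq> 0 \<Longrightarrow> f l = (\<Sum>t\<in>S. c t * chi t l)"
    by (rule char_sumE[OF assms(1)]) (rule that, simp_all)
  obtain S' c' where S': "finite S'" "S' \<subseteq> P" "\<And>l. l \<noteq> 0 \<Longrightarrow> g l = (\<Sum>t\<in>S'. c' t * chi t l)"
    by (rule char_sumE[OF assms(2)]) (rule that, simp_all)
  have eq: "f l + g l = (\<Sum>t\<in>S \<union> S'. ((if t \<in> S then c t else 0) + (if t \<in> S' then c' t else 0)) * chi t l)"
    if "l \<noteq> 0" for l
  proof -
    have "(\<Sum>t\<in>S. c t * chi t l) = (\<Sum>t\<in>S \<union> S'. (if t \<in> S then c t else 0) * chi t l)"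
      using S(1) S'(1) by (intro sum.mono_neutral_cong_left) auto
    moreover have "(\<Sum>t\<in>S'. c' t * chi t l) = (\<Sum>t\<in>S \<union> S'. (if t \<in> S' then c' t else 0) * chi t l)"
      using S(1) S'(1) by (intro sum.mono_neutral_cong_left) auto
    ultimately show ?thesis using S(3)[OF that] S'(3)[OF that] by (simp add: distrib_right sum.distrib)
  qed
  show ?thesis by (rule char_sumI[OF _ _ eq]) (use S(1,2) S'(1,2) in auto)
qed

lemma char_sum_sum: "(\<And>i. i \<in> I \<Longrightarrow> char_sum P (f i)) \<Longrightarrow> char_sum P (\<lambda>l. \<Sum>i\<in>I. f i l)"
  by (induction I rule: infinite_finite_induct) (auto intro: char_sum_zero char_sum_add)

lemma char_sum_mult_chi:
  assumes "char_sum P f" "\<And>t. t \<in> P \<Longrightarrow> s + t \<in> P'"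
  shows "char_sum P' (\<lambda>l. c * chi s l * f l)"
proof -
  obtain S d where S: "finite S" "S \<subseteq> P" "\<And>l. l \<noteq> 0 \<Longrightarrow> f l = (\<Sum>t\<in>S. d t * chi t l)"
    by (rule char_sumE[OF assms(1)]) (rule that, simp_all)
  have eq: "c * chi s l * f l = (\<Sum>t\<in>(+) s ` S. (c * d (t - s)) * chi t l)" if "l \<noteq> 0" for l
    using S(3)[OF that] that by (subst sum.reindex) (auto simp: chi_add sum_distrib_left mult_ac)
  show ?thesis by (rule char_sumI[OF _ _ eq]) (use S(1,2) assms(2) in auto)
qed

lemma char_sum_mult:
  assumes "char_sum P f" "char_sum P g" "\<And>s t. s \<in> P \<Longrightarrow> t \<in> P \<Longrightarrow> s + t \<in> P"
  shows "char_sum P (\<lambda>l. f l * g l)"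
proof -
  obtain S d where S: "finite S" "S \<subseteq> P" "\<And>l. l \<noteq> 0 \<Longrightarrow> f l = (\<Sum>t\<in>S. d t * chi t l)"
    by (rule char_sumE[OF assms(1)]) (rule that, simp_all)
  have "char_sum P (\<lambda>l. \<Sum>t\<in>S. d t * chi t l * g l)"
    using S assms by (intro char_sum_sum char_sum_mult_chi) auto
  then show ?thesis by (rule char_sum_cong) (simp add: S(3) sum_distrib_right)
qed

lemma char_sum_chi: "t \<in> P \<Longrightarrow> char_sum P (\<lambda>l. c * chi t l)"
  unfolding char_sum_def by (intro exI[of _ "{t}"] exI[of _ "\<lambda>_. c"]) simp

lemma char_sum_chiD:
  assumes f: "char_sum P f" and eq: "\<And>l. l \<noteq> 0 \<Longrightarrow> f l = c * chi t l" and c: "c \<noteq> 0"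
  shows "t \<in> P"
proof (rule ccontr)
  assume t: "t \<notin> P"
  obtain S d where S: "finite S" "S \<subseteq> P" "\<And>l. l \<noteq> 0 \<Longrightarrow> f l = (\<Sum>t\<in>S. d t * chi t l)"
    by (rule char_sumE[OF f]) (rule that, simp_all)
  let ?d = "\<lambda>u. if u = t then - c else d u"
  have "(\<Sum>u\<in>insert t S. ?d u * chi u l) = 0" if "l \<noteq> 0" for l
  proof -
    have "(\<Sum>u\<in>S. ?d u * chi u l) = (\<Sum>u\<in>S. d u * chi u l)" using t S(2) by (intro sum.cong) auto
    moreover have "t \<notin> S" using t S(2) by auto
    ultimately have "(\<Sum>u\<in>insert t S. ?d u * chi u l) = - c * chi t l + (\<Sum>u\<in>S. d u * chi u l)"
      using S(1) by (subst sum.insert) simp_all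
    then show ?thesis using eq[OF that] S(3)[OF that] by simp
  qed
  from chi_independent[OF _ this, of t] S(1) c show False by simp
qed

definition quadrant :: "(int \<times> int) set" where
  "quadrant = {t. fst t \<ge> 0 \<and> snd t \<ge> 0}"

lemma char_sum_Re_Im: "char_sum quadrant (\<lambda>l. of_real (Re l))" "char_sum quadrant (\<lambda>l. of_real (- Im l))"
proof -
  have c: "char_sum quadrant (\<lambda>l. c * chi (1, 0) l + d * chi (0, 1) l)" for c d
    by (intro char_sum_add char_sum_chi) (auto simp: quadrant_def)
  show "char_sum quadrant (\<lambda>l. of_real (Re l))"
    by (rule char_sum_cong[OF c[of "1/2" "1/2"]]) (simp add: chi_def complex_eq_iff)
  show "char_sum quadrant (\<lambda>l. of_real (- Im l))"
    by (rule char_sum_cong[OF c[of "\<i>/2" "-\<i>/2"]]) (simp add: chi_def complex_eq_iff)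
qed

lemma eval2_pCons: "eval2 (pCons q p) a b = poly q a + b * eval2 p a b"
  by (simp add: eval2_def)

text \<open>
  As \<open>l\<close> and its conjugate are the characters of types \<open>(1, 0)\<close> and \<open>(0, 1)\<close>, polynomials in
  the real and imaginary part of \<open>l\<close> are sums of characters with nonnegative exponents.
\<close>

lemma char_sum_eval2:
  assumes f: "char_sum quadrant (\<lambda>l. of_real (f l))" and g: "char_sum quadrant (\<lambda>l. of_real (g l))"
  shows "char_sum quadrant (\<lambda>l. of_real (eval2 p (f l) (g l)))"
proof -
  have qa: "s \<in> quadrant \<Longrightarrow> t \<in> quadrant \<Longrightarrow> s + t \<in> quadrant" for s t by (auto simp: quadrant_def)
  have const: "char_sum quadrant (\<lambda>l. c)" for c
    using char_sum_chi[of "(0,0)" quadrant c] by (simp add: quadrant_def)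
  have inner: "char_sum quadrant (\<lambda>l. of_real (poly q (f l)))" for q
  proof (induction q)
    case (pCons a q)
    have "char_sum quadrant (\<lambda>l. of_real a + of_real (f l) * of_real (poly q (f l)))"
      by (intro char_sum_add const char_sum_mult[OF f pCons(2) qa])
    then show ?case by simp
  qed (simp add: const)
  show ?thesis
  proof (induction p)
    case 0
    then show ?case by (simp add: const)
  next
    case (pCons q p)
    have "char_sum quadrant (\<lambda>l. of_real (poly q (f l)) + of_real (g l) * of_real (eval2 p (f l) (g l)))"
      by (intro char_sum_add inner char_sum_mult[OF g pCons(2) qa])
    then show ?case by (simp add: eval2_pCons)
  qed
qed

text \<open>
  The denominator of a regular function on \<open>S\<close> is a power of the character of type \<open>(1, 1)\<close>.
\<close>

lemma char_sum_regular:
  assumes "regular_on_S f"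
  shows "char_sum UNIV (\<lambda>l. of_real (f l))"
proof -
  obtain p k where f: "\<And>l. l \<noteq> 0 \<Longrightarrow> f l = eval2 p (Re l) (Im l) / ((Re l)\<^sup>2 + (Im l)\<^sup>2) ^ k"
    using assms unfolding regular_on_S_def by blast
  have im: "char_sum quadrant (\<lambda>l. of_real (Im l))"
    by (rule char_sum_cong[OF char_sum_mult_chi[OF char_sum_Re_Im(2), of "(0,0)" quadrant "-1"]]) auto
  have "char_sum UNIV (\<lambda>l. 1 * chi (- int k, - int k) l * of_real (eval2 p (Re l) (Im l)))"
    by (rule char_sum_mult_chi[OF char_sum_eval2[OF char_sum_Re_Im(1) im]]) simp
  then show ?thesis
  proof (rule char_sum_cong)
    fix l :: complex assume l: "l \<noteq> 0"
    have "of_real ((Re l)\<^sup>2 + (Im l)\<^sup>2) = l * cnj l" by (simp add: complex_mult_cnj)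
    then have "complex_of_real (f l) = of_real (eval2 p (Re l) (Im l)) / (l * cnj l) ^ k"
      using f[OF l] by (simp only: of_real_divide of_real_power)
    then show "1 * chi (- int k, - int k) l * of_real (eval2 p (Re l) (Im l)) = of_real (f l)"
      by (simp add: chi_def power_int_minus power_mult_distrib field_simps)
  qed
qed

text \<open>Algebras of real functions on the nonzero complex numbers, and the complex-valued functions
  whose real and imaginary parts belong to them.\<close>

definition fun_alg :: "(complex \<Rightarrow> real) set \<Rightarrow> bool" where
  "fun_alg K \<longleftrightarrow> (\<forall>c. (\<lambda>l. c) \<in> K) \<and> (\<forall>f\<in>K. \<forall>g\<in>K. (\<lambda>l. f l + g l) \<in> K \<and> (\<lambda>l. f l * g l) \<in> K)"

definition cfun :: "(complex \<Rightarrow> real) set \<Rightarrow> (complex \<Rightarrow> complex) \<Rightarrow> bool" where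
  "cfun K f \<longleftrightarrow> (\<lambda>l. Re (f l)) \<in> K \<and> (\<lambda>l. Im (f l)) \<in> K"

lemma cfun_ops:
  assumes K: "fun_alg K"
  shows "cfun K (\<lambda>l. c)" "cfun K f \<Longrightarrow> cfun K g \<Longrightarrow> cfun K (\<lambda>l. f l + g l)"
    "cfun K f \<Longrightarrow> cfun K g \<Longrightarrow> cfun K (\<lambda>l. f l * g l)"
    "cfun K f \<Longrightarrow> cfun K (\<lambda>l. f l ^ k)"
    "(\<And>i. i \<in> I \<Longrightarrow> cfun K (h i)) \<Longrightarrow> cfun K (\<lambda>l. \<Sum>i\<in>I. h i l)"
proof -
  have c: "(\<lambda>l. a) \<in> K" and add: "\<And>f g. f \<in> K \<Longrightarrow> g \<in> K \<Longrightarrow> (\<lambda>l. f l + g l) \<in> K"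
    and mult: "\<And>f g. f \<in> K \<Longrightarrow> g \<in> K \<Longrightarrow> (\<lambda>l. f l * g l) \<in> K" for a
    using K by (auto simp: fun_alg_def)
  have minus: "(\<lambda>l. f l - g l) \<in> K" if "f \<in> K" "g \<in> K" for f g
    using add[OF that(1) mult[OF c[of "-1"] that(2)]] by simp
  show C: "cfun K (\<lambda>l. c)" for c using c by (simp add: cfun_def)
  show A: "cfun K f \<Longrightarrow> cfun K g \<Longrightarrow> cfun K (\<lambda>l. f l + g l)" for f g using add by (simp add: cfun_def)
  show M: "cfun K f \<Longrightarrow> cfun K g \<Longrightarrow> cfun K (\<lambda>l. f l * g l)" for f g
    using add mult minus by (simp add: cfun_def)
  show "cfun K f \<Longrightarrow> cfun K (\<lambda>l. f l ^ k)" by (induction k) (auto intro: C M)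
  show "(\<And>i. i \<in> I \<Longrightarrow> cfun K (h i)) \<Longrightarrow> cfun K (\<lambda>l. \<Sum>i\<in>I. h i l)"
    by (induction I rule: infinite_finite_induct) (auto intro: C A)
qed

definition regular_funs :: "(complex \<Rightarrow> real) set" where
  "regular_funs = {f. regular_on_S f}"

definition polynomial_funs :: "(complex \<Rightarrow> real) set" where
  "polynomial_funs = {f. \<exists>p. \<forall>l. l \<noteq> 0 \<longrightarrow> f l = eval2 p (Re l) (- Im l)}"

lemma regular_funsI:
  "(\<And>l. l \<noteq> 0 \<Longrightarrow> f l = eval2 p (Re l) (Im l) / ((Re l)\<^sup>2 + (Im l)\<^sup>2) ^ k) \<Longrightarrow> f \<in> regular_funs"
  unfolding regular_funs_def regular_on_S_def by blast

lemma polynomial_funsI: "(\<And>l. l \<noteq> 0 \<Longrightarrow> f l = eval2 p (Re l) (- Im l)) \<Longrightarrow> f \<in> polynomial_funs"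
  unfolding polynomial_funs_def by blast

lemma fun_alg_regular: "fun_alg regular_funs"
  unfolding fun_alg_def
proof (intro conjI allI ballI)
  fix c :: real
  show "(\<lambda>l. c) \<in> regular_funs" by (rule regular_funsI[of _ "const2 c" 0]) simp
next
  fix f g assume "f \<in> regular_funs" "g \<in> regular_funs"
  then obtain p k q m where f: "\<And>l. l \<noteq> 0 \<Longrightarrow> f l = eval2 p (Re l) (Im l) / ((Re l)\<^sup>2 + (Im l)\<^sup>2) ^ k"
    and g: "\<And>l. l \<noteq> 0 \<Longrightarrow> g l = eval2 q (Re l) (Im l) / ((Re l)\<^sup>2 + (Im l)\<^sup>2) ^ m"
    unfolding regular_funs_def regular_on_S_def mem_Collect_eq by metis
  let ?N = "X2 * X2 + Y2 * Y2"
  have N: "eval2 (?N ^ j) a b = (a\<^sup>2 + b\<^sup>2) ^ j" for j a b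
  proof (induction j)
    case 0
    show ?case by (simp add: eval2_def)
  next
    case (Suc j)
    then show ?case by (simp add: power2_eq_square)
  qed
  have pos: "(Re l)\<^sup>2 + (Im l)\<^sup>2 \<noteq> 0" if "l \<noteq> 0" for l
    using that by (simp add: complex_eq_iff)
  have add_frac: "x / n ^ k + y / n ^ m = (x * n ^ m + y * n ^ k) / n ^ (k + m)" if "n \<noteq> 0" for x y n :: real
    using that by (simp add: power_add add_divide_distrib)
  have "f l + g l = eval2 (p * ?N ^ m + q * ?N ^ k) (Re l) (Im l) / ((Re l)\<^sup>2 + (Im l)\<^sup>2) ^ (k + m)"
    if "l \<noteq> 0" for l using f[OF that] g[OF that] add_frac[OF pos[OF that]]
    by (simp add: N)
  then show "(\<lambda>l. f l + g l) \<in> regular_funs" unfolding regular_funs_def regular_on_S_def by blast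
  have "f l * g l = eval2 (p * q) (Re l) (Im l) / ((Re l)\<^sup>2 + (Im l)\<^sup>2) ^ (k + m)"
    if "l \<noteq> 0" for l using f[OF that] g[OF that] by (simp add: power_add)
  then show "(\<lambda>l. f l * g l) \<in> regular_funs" unfolding regular_funs_def regular_on_S_def by blast
qed

lemma fun_alg_polynomial: "fun_alg polynomial_funs"
  unfolding fun_alg_def
proof (intro conjI allI ballI)
  fix c :: real
  show "(\<lambda>l. c) \<in> polynomial_funs" unfolding polynomial_funs_def by (intro CollectI exI[of _ "const2 c"]) simp
next
  fix f g assume "f \<in> polynomial_funs" "g \<in> polynomial_funs"
  then obtain p q where f: "\<And>l. l \<noteq> 0 \<Longrightarrow> f l = eval2 p (Re l) (- Im l)"
    and g: "\<And>l. l \<noteq> 0 \<Longrightarrow> g l = eval2 q (Re l) (- Im l)"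
    unfolding polynomial_funs_def by auto
  show "(\<lambda>l. f l + g l) \<in> polynomial_funs" unfolding polynomial_funs_def
    using f g by (auto intro!: exI[of _ "p + q"])
  show "(\<lambda>l. f l * g l) \<in> polynomial_funs" unfolding polynomial_funs_def
    using f g by (auto intro!: exI[of _ "p * q"])
qed

lemma cfun_polynomial_chi: "t \<in> quadrant \<Longrightarrow> cfun polynomial_funs (chi t)"
proof -
  assume t: "t \<in> quadrant"
  have id: "cfun polynomial_funs (\<lambda>l. l)" "cfun polynomial_funs cnj"
    unfolding cfun_def
    by (simp_all add: polynomial_funsI[of _ X2] polynomial_funsI[of _ Y2] polynomial_funsI[of Im "const2 (-1) * Y2"])
  have "chi t = (\<lambda>l. l ^ nat (fst t) * cnj l ^ nat (snd t))"
    using t by (auto simp: chi_def quadrant_def power_int_def)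
  then show ?thesis using cfun_ops(3,4)[OF fun_alg_polynomial] id by simp
qed

lemma cfun_regular_chi: "cfun regular_funs (chi t)"
proof -
  have id: "cfun regular_funs (\<lambda>l. l)" "cfun regular_funs cnj"
    unfolding cfun_def
    by (simp_all add: regular_funsI[of _ X2 0] regular_funsI[of Im Y2 0] regular_funsI[of "\<lambda>l. - Im l" "const2 (-1) * Y2" 0])
  have inv: "cfun regular_funs inverse" "cfun regular_funs (\<lambda>l. inverse (cnj l))"
    unfolding cfun_def
    by (auto intro: regular_funsI[of _ X2 1] regular_funsI[of _ "const2 (-1) * Y2" 1] regular_funsI[of _ Y2 1])
  have pw: "cfun regular_funs (\<lambda>l. l powi k)" for k
    using cfun_ops(4)[OF fun_alg_regular id(1)] cfun_ops(4)[OF fun_alg_regular inv(1)]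
    by (cases "k \<ge> 0") (auto simp: power_int_def)
  have pw': "cfun regular_funs (\<lambda>l. cnj l powi k)" for k
    using cfun_ops(4)[OF fun_alg_regular id(2)] cfun_ops(4)[OF fun_alg_regular inv(2)]
    by (cases "k \<ge> 0") (auto simp: power_int_def)
  have "chi t = (\<lambda>l. l powi fst t * cnj l powi snd t)" by (auto simp: chi_def)
  then show ?thesis using cfun_ops(3)[OF fun_alg_regular pw pw'] by simp
qed

section \<open>Representations of the Deligne torus as bigradings\<close>

abbreviation cm :: "real mat \<Rightarrow> complex mat" where
  "cm \<equiv> map_mat complex_of_real"

abbreviation cnj_mat :: "complex mat \<Rightarrow> complex mat" where
  "cnj_mat \<equiv> map_mat cnj"

lemma map_mat_hom_mult:
  assumes h: "\<And>a b. h (a + b) = h a + h b" "\<And>a b. h (a * b) = h a * h b" "h 0 = 0"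
    and d: "dim_col A = dim_row B"
  shows "map_mat h (A * B) = map_mat h A * map_mat h B"
proof (rule eq_matI)
  have hs: "h (sum f I) = (\<Sum>i\<in>I. h (f i))" for f :: "nat \<Rightarrow> 'a" and I
    by (induction I rule: infinite_finite_induct) (simp_all add: h)
  fix i j assume "i < dim_row (map_mat h A * map_mat h B)" "j < dim_col (map_mat h A * map_mat h B)"
  then show "map_mat h (A * B) $$ (i, j) = (map_mat h A * map_mat h B) $$ (i, j)"
    using d by (simp add: mult_mat_index hs h del: index_mult_mat(1))
qed simp_all

lemma cm_mult: "dim_col A = dim_row B \<Longrightarrow> cm (A * B) = cm A * cm B"
  by (rule map_mat_hom_mult) simp_all

lemma cnj_mat_mult: "dim_col A = dim_row B \<Longrightarrow> cnj_mat (A * B) = cnj_mat A * cnj_mat B"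
  by (rule map_mat_hom_mult) simp_all

lemma cm_one: "cm (1\<^sub>m n) = 1\<^sub>m n"
  by (rule eq_matI) auto

lemma cnj_mat_one: "cnj_mat (1\<^sub>m n) = 1\<^sub>m n"
  by (rule eq_matI) auto

lemma cnj_mat_cm: "cnj_mat (cm A) = cm A"
  by (rule eq_matI) auto

lemma cnj_mat_cnj_mat: "cnj_mat (cnj_mat A) = A"
  by (rule eq_matI) auto

lemma cm_inj: "cm A = cm B \<Longrightarrow> A = B"
proof (rule eq_matI)
  assume e: "cm A = cm B"
  show d: "dim_row A = dim_row B" "dim_col A = dim_col B" using arg_cong[OF e, of dim_row] arg_cong[OF e, of dim_col] by simp_all
  fix i j assume "i < dim_row B" "j < dim_col B"
  then show "A $$ (i, j) = B $$ (i, j)" using arg_cong[OF e, of "\<lambda>M. M $$ (i, j)"] d by simp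
qed

lemma cm_map_Re: "cnj_mat A = A \<Longrightarrow> cm (map_mat Re A) = A"
proof (rule eq_matI)
  assume e: "cnj_mat A = A"
  fix i j assume ij: "i < dim_row A" "j < dim_col A"
  then have "cnj (A $$ (i, j)) = A $$ (i, j)" using arg_cong[OF e, of "\<lambda>M. M $$ (i, j)"] by simp
  then show "cm (map_mat Re A) $$ (i, j) = A $$ (i, j)" using ij by (simp add: complex_eq_iff)
qed simp_all

lemma mat_diag_dims [simp]: "dim_row (mat_diag n f) = n" "dim_col (mat_diag n f) = n"
  by (simp_all add: mat_diag_def)

lemma cnj_mat_diag: "cnj_mat (mat_diag n f) = mat_diag n (\<lambda>i. cnj (f i))"
  by (rule eq_matI) (auto simp: mat_diag_def)

lemma cnj_mat_inverse: "inverse_mats n T T' \<Longrightarrow> inverse_mats n (cnj_mat T) (cnj_mat T')"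
  by (auto simp: inverse_mats_def cnj_mat_one simp flip: cnj_mat_mult)

text \<open>
  The columns of \<open>T\<close> are eigenvectors of the representation, and \<open>t\<close> lists their types.
\<close>

definition adapted :: "nat \<Rightarrow> (complex \<Rightarrow> real mat) \<Rightarrow> complex mat \<Rightarrow> complex mat \<Rightarrow> (nat \<Rightarrow> int \<times> int) \<Rightarrow> bool" where
  "adapted n \<rho> T T' t \<longleftrightarrow> inverse_mats n T T' \<and> (\<forall>l. l \<noteq> 0 \<longrightarrow> \<rho> l \<in> carrier_mat n n
     \<and> cm (\<rho> l) = T * mat_diag n (\<lambda>i. chi (t i) l) * T')"

lemma adaptedD:
  assumes "adapted n \<rho> T T' t"
  shows "inverse_mats n T T'" "l \<noteq> 0 \<Longrightarrow> \<rho> l \<in> carrier_mat n n"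
    "l \<noteq> 0 \<Longrightarrow> cm (\<rho> l) = T * mat_diag n (\<lambda>i. chi (t i) l) * T'"
  using assms by (auto simp: adapted_def)

lemma adapted_mult_basis:
  assumes "adapted n \<rho> T T' t" "l \<noteq> 0"
  shows "cm (\<rho> l) * T = T * mat_diag n (\<lambda>i. chi (t i) l)" "T' * cm (\<rho> l) = mat_diag n (\<lambda>i. chi (t i) l) * T'"
proof -
  note T = inverse_matsD[OF adaptedD(1)[OF assms(1)]]
  let ?d = "mat_diag n (\<lambda>i. chi (t i) l)"
  have "cm (\<rho> l) * T = T * ?d * (T' * T)"
    unfolding adaptedD(3)[OF assms] using T by (intro assoc_mult_mat[of _ n n _ n]) auto
  then show "cm (\<rho> l) * T = T * ?d" using T by (simp add: right_mult_one_mat[of _ n n])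
  have "T' * cm (\<rho> l) = T' * (T * (?d * T'))"
    unfolding adaptedD(3)[OF assms] using T by (simp add: assoc_mult_mat[of T n n ?d n T' n])
  also have "\<dots> = T' * T * (?d * T')" using T by (intro assoc_mult_mat[symmetric, of _ n n _ n]) auto
  finally show "T' * cm (\<rho> l) = ?d * T'" using T by (simp add: left_mult_one_mat[of _ n n])
qed

text \<open>
  The matrix entries of a representation are sums of characters. By independence of characters the
  coefficient matrices \<open>P t\<close> satisfy \<open>\<rho> l * P t = chi t l P t\<close>, and they sum to \<open>\<rho> 1 = 1\<close>; so the
  eigenvectors in their images span the space.
\<close>

lemma S_representation_adapted:
  assumes rep: "S_representation n \<rho>"
  shows "\<exists>T T' t. adapted n \<rho> T T' t"
proof -
  have rc: "\<And>l. l \<noteq> 0 \<Longrightarrow> \<rho> l \<in> carrier_mat n n" and r1: "\<rho> 1 = 1\<^sub>m n"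
    and rm: "\<And>l m. l \<noteq> 0 \<Longrightarrow> m \<noteq> 0 \<Longrightarrow> \<rho> (l * m) = \<rho> l * \<rho> m"
    and rr: "\<And>i j. i < n \<Longrightarrow> j < n \<Longrightarrow> regular_on_S (\<lambda>l. \<rho> l $$ (i, j))"
    using rep by (auto simp: S_representation_def)
  define Q where "Q i j Sc \<longleftrightarrow> finite (fst Sc) \<and> (\<forall>l. l \<noteq> 0 \<longrightarrow> complex_of_real (\<rho> l $$ (i, j)) = (\<Sum>t\<in>fst Sc. snd Sc t * chi t l))"
    for i j and Sc :: "(int \<times> int) set \<times> (int \<times> int \<Rightarrow> complex)"
  have "\<exists>Sc. i < n \<longrightarrow> j < n \<longrightarrow> Q i j Sc" for i j
  proof (cases "i < n \<and> j < n")
    case True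
    then have "char_sum UNIV (\<lambda>l. complex_of_real (\<rho> l $$ (i, j)))" using char_sum_regular rr by blast
    then obtain S c where "finite S" "\<And>l. l \<noteq> 0 \<Longrightarrow> complex_of_real (\<rho> l $$ (i, j)) = (\<Sum>t\<in>S. c t * chi t l)"
      by (rule char_sumE) (rule that, simp_all)
    then have "Q i j (S, c)" by (simp add: Q_def)
    then show ?thesis by blast
  qed blast
  then obtain g where g: "\<And>i j. i < n \<Longrightarrow> j < n \<Longrightarrow> Q i j (g i j)" by metis
  define S where "S = (\<Union>i<n. \<Union>j<n. fst (g i j))"
  define P where "P t = mat n n (\<lambda>(i, j). if t \<in> fst (g i j) then snd (g i j) t else 0)" for t
  have P: "P t \<in> carrier_mat n n" for t by (simp add: P_def)
  have finS: "finite S" unfolding S_def using g by (auto simp: Q_def)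
  have ent: "complex_of_real (\<rho> l $$ (i, j)) = (\<Sum>t\<in>S. P t $$ (i, j) * chi t l)"
    if ij: "i < n" "j < n" and l: "l \<noteq> 0" for i j l
  proof -
    have q: "complex_of_real (\<rho> l $$ (i, j)) = (\<Sum>t\<in>fst (g i j). snd (g i j) t * chi t l)"
      using g[OF ij] l by (simp add: Q_def)
    also have "\<dots> = (\<Sum>t\<in>S. P t $$ (i, j) * chi t l)"
      using finS ij by (intro sum.mono_neutral_cong_left) (auto simp: S_def P_def)
    finally show ?thesis .
  qed
  have eig: "cm (\<rho> l) * P s = chi s l \<cdot>\<^sub>m P s" if s: "s \<in> S" and l: "l \<noteq> 0" for s l
  proof (rule eq_matI)
    fix i j assume "i < dim_row (chi s l \<cdot>\<^sub>m P s)" "j < dim_col (chi s l \<cdot>\<^sub>m P s)"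
    then have ij: "i < n" "j < n" using P[of s] by auto
    define c where "c t = (\<Sum>k<n. complex_of_real (\<rho> l $$ (i, k)) * P t $$ (k, j)) - chi t l * P t $$ (i, j)" for t
    have "(\<Sum>t\<in>S. c t * chi t m) = 0" if m: "m \<noteq> 0" for m
    proof -
      have "(\<Sum>t\<in>S. c t * chi t m) = (\<Sum>k<n. complex_of_real (\<rho> l $$ (i, k)) * (\<Sum>t\<in>S. P t $$ (k, j) * chi t m))
          - (\<Sum>t\<in>S. P t $$ (i, j) * chi t (l * m))"
        unfolding c_def left_diff_distrib sum_subtractf sum_distrib_left sum_distrib_right
        by (subst sum.swap) (simp add: chi_mult mult_ac)
      also have "\<dots> = complex_of_real ((\<Sum>k<n. \<rho> l $$ (i, k) * \<rho> m $$ (k, j)) - \<rho> (l * m) $$ (i, j))"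
        using ent[OF _ ij(2) m] ent[OF ij, of "l * m"] l m by simp
      also have "(\<Sum>k<n. \<rho> l $$ (i, k) * \<rho> m $$ (k, j)) = \<rho> (l * m) $$ (i, j)"
        unfolding rm[OF l m] using rc[OF l] rc[OF m] ij by (subst mult_mat_index) auto
      finally show ?thesis by simp
    qed
    from chi_independent[OF finS this s] have "(\<Sum>k<n. complex_of_real (\<rho> l $$ (i, k)) * P s $$ (k, j)) = chi s l * P s $$ (i, j)"
      by (simp add: c_def)
    moreover have "(cm (\<rho> l) * P s) $$ (i, j) = (\<Sum>k<n. complex_of_real (\<rho> l $$ (i, k)) * P s $$ (k, j))"
      using rc[OF l] P[of s] ij by (subst mult_mat_index) auto
    ultimately show "(cm (\<rho> l) * P s) $$ (i, j) = (chi s l \<cdot>\<^sub>m P s) $$ (i, j)" using ij P[of s] by simp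
  qed (use rc[OF l] P[of s] in auto)
  define X where "X = {P t *\<^sub>v v | t v. t \<in> S \<and> v \<in> carrier_vec n}"
  have Xc: "X \<subseteq> carrier_vec n" unfolding X_def using mult_mat_vec_carrier[OF P] by blast
  have span: "v \<in> lin_span n X" if v: "v \<in> carrier_vec n" for v
  proof -
    have "v = vec n (\<lambda>i. \<Sum>t\<in>S. (P t *\<^sub>v v) $ i)"
    proof (rule eq_vecI)
      fix i assume "i < dim_vec (vec n (\<lambda>i. \<Sum>t\<in>S. (P t *\<^sub>v v) $ i))"
      then have i: "i < n" by simp
      have "(\<Sum>t\<in>S. (P t *\<^sub>v v) $ i) = (\<Sum>t\<in>S. \<Sum>k<n. P t $$ (i, k) * v $ k)"
      proof (rule sum.cong[OF refl])
        fix t show "(P t *\<^sub>v v) $ i = (\<Sum>k<n. P t $$ (i, k) * v $ k)"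
          using P[of t] v i by (simp add: scalar_prod_def atLeast0LessThan)
      qed
      also have "\<dots> = (\<Sum>k<n. (\<Sum>t\<in>S. P t $$ (i, k) * chi t 1) * v $ k)"
        by (subst sum.swap) (simp add: sum_distrib_right)
      also have "\<dots> = (\<Sum>k<n. if k = i then v $ k else 0)"
      proof (rule sum.cong[OF refl])
        fix k assume "k \<in> {..<n}"
        then have k: "k < n" by simp
        show "(\<Sum>t\<in>S. P t $$ (i, k) * chi t 1) * v $ k = (if k = i then v $ k else 0)"
          using ent[OF i k, of 1, symmetric] i k by (auto simp: r1)
      qed
      finally show "v $ i = vec n (\<lambda>i. \<Sum>t\<in>S. (P t *\<^sub>v v) $ i) $ i" using i by simp
    qed (use v in simp)
    moreover have "vec n (\<lambda>i. \<Sum>t\<in>S. (P t *\<^sub>v v) $ i) \<in> lin_span n X"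
      by (rule is_subspace_sum[OF lin_span_subspace[OF Xc] finS])
         (use lin_span_superset[OF Xc] v in \<open>auto simp: X_def\<close>)
    ultimately show ?thesis by simp
  qed
  define W where "W k = (if k \<ge> 0 then carrier_vec n else {0\<^sub>v n :: complex vec})" for k :: int
  define Xk where "Xk k = (if k = 0 then X else {})" for k :: int
  have Wsub: "is_subspace n (W k)" for k
    unfolding W_def is_subspace_iff by auto
  have "\<exists>T T' w. inverse_mats n T T' \<and> (\<forall>j<n. col T j \<in> Xk (w j)) \<and> (\<forall>k. W k = colspan T (\<lambda>j. w j \<le> k))"
  proof (rule filtered_basis[OF Wsub, where lo = "-1" and hi = 0])
    show "k \<le> l \<Longrightarrow> W k \<subseteq> W l" for k l by (auto simp: W_def)
    show "Xk k \<subseteq> W k" for k using Xc by (auto simp: Xk_def W_def)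
    fix k
    have c: "Xk k \<union> W (k - 1) \<subseteq> carrier_vec n" using Xc by (auto simp: Xk_def W_def)
    note sup = lin_span_superset[OF c] and sub = lin_span_subspace[OF c]
    consider "k < 0" | "k = 0" | "k > 0" by linarith
    then show "W k \<subseteq> lin_span n (Xk k \<union> W (k - 1))"
    proof cases
      case 1
      then show ?thesis using is_subspaceD(2)[OF sub] by (simp add: W_def)
    next
      case 2
      have "lin_span n X \<subseteq> lin_span n (Xk k \<union> W (k - 1))"
        by (rule lin_span_least[OF sub]) (use sup 2 in \<open>auto simp: Xk_def\<close>)
      then show ?thesis using span 2 by (auto simp: W_def)
    next
      case 3
      then show ?thesis using sup by (auto simp: W_def)
    qed
  qed (simp_all add: W_def)
  then obtain T T' w where T: "inverse_mats n T T'" "\<And>j. j < n \<Longrightarrow> col T j \<in> Xk (w j)" by blast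
  have "\<exists>t. j < n \<longrightarrow> t \<in> S \<and> (\<exists>v\<in>carrier_vec n. col T j = P t *\<^sub>v v)" for j
    using T(2)[of j] by (cases "w j = 0") (auto simp: Xk_def X_def)
  then obtain t where t: "\<And>j. j < n \<Longrightarrow> t j \<in> S \<and> (\<exists>v\<in>carrier_vec n. col T j = P (t j) *\<^sub>v v)" by metis
  note Tc = inverse_matsD[OF T(1)]
  have rT: "cm (\<rho> l) * T = T * mat_diag n (\<lambda>i. chi (t i) l)" if l: "l \<noteq> 0" for l
  proof (rule eq_matI)
    fix i j assume "i < dim_row (T * mat_diag n (\<lambda>i. chi (t i) l))" "j < dim_col (T * mat_diag n (\<lambda>i. chi (t i) l))"
    then have ij: "i < n" "j < n" using Tc by (auto simp: mat_diag_def)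
    obtain v where v: "v \<in> carrier_vec n" "col T j = P (t j) *\<^sub>v v" using t[OF ij(2)] by blast
    have "cm (\<rho> l) *\<^sub>v col T j = cm (\<rho> l) * P (t j) *\<^sub>v v"
      unfolding v(2) using rc[OF l] P[of "t j"] v(1) by (intro assoc_mult_mat_vec[symmetric]) auto
    also have "\<dots> = chi (t j) l \<cdot>\<^sub>v col T j"
      unfolding v(2) eig[OF conjunct1[OF t[OF ij(2)]] l]
      using P[of "t j"] v(1) by (intro eq_vecI) auto
    finally have "(cm (\<rho> l) *\<^sub>v col T j) $ i = chi (t j) l * T $$ (i, j)" using ij Tc by simp
    then show "(cm (\<rho> l) * T) $$ (i, j) = (T * mat_diag n (\<lambda>i. chi (t i) l)) $$ (i, j)"
      using ij Tc rc[OF l] by (simp add: mat_diag_mult_right[OF Tc(1)] mult.commute)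
  qed (use Tc rc[OF l] in auto)
  have "cm (\<rho> l) = T * mat_diag n (\<lambda>i. chi (t i) l) * T'" if l: "l \<noteq> 0" for l
  proof -
    have "cm (\<rho> l) * T * T' = cm (\<rho> l) * (T * T')" using rc[OF l] Tc by (intro assoc_mult_mat[of _ n n]) auto
    then show ?thesis using rc[OF l] Tc rT[OF l] by (simp add: right_mult_one_mat[of _ n n])
  qed
  then show ?thesis using T(1) rc unfolding adapted_def by blast
qed

lemma adapted_regular:
  assumes a: "adapted n \<rho> T T' t" and ij: "i < n" "j < n"
  shows "regular_on_S (\<lambda>l. \<rho> l $$ (i, j))"
proof -
  note T = inverse_matsD[OF adaptedD(1)[OF a]]
  let ?f = "\<lambda>l. \<Sum>k<n. T $$ (i, k) * chi (t k) l * T' $$ (k, j)"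
  have "cfun regular_funs ?f"
    by (intro cfun_ops[OF fun_alg_regular] cfun_regular_chi)
  then have "regular_on_S (\<lambda>l. Re (?f l))" by (simp add: cfun_def regular_funs_def)
  moreover have "\<rho> l $$ (i, j) = Re (?f l)" if l: "l \<noteq> 0" for l
  proof -
    have "complex_of_real (\<rho> l $$ (i, j)) = (T * mat_diag n (\<lambda>i. chi (t i) l) * T') $$ (i, j)"
      using adaptedD(2,3)[OF a l] ij by (metis carrier_matD index_map_mat(1))
    also have "\<dots> = ?f l"
      using ij T by (subst mult_mat_index) (auto simp: mat_diag_mult_right[OF T(1)] mult.commute)
    finally show ?thesis by (metis Re_complex_of_real)
  qed
  ultimately show ?thesis unfolding regular_on_S_def by simp
qed

lemma adapted_S_representation:
  assumes a: "adapted n \<rho> T T' t"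
  shows "S_representation n \<rho>"
  unfolding S_representation_def
proof (intro conjI allI impI)
  note T = inverse_matsD[OF adaptedD(1)[OF a]]
  show "\<rho> 1 = 1\<^sub>m n"
    by (rule cm_inj) (use T in \<open>simp add: adaptedD(3)[OF a] cm_one right_mult_one_mat[of _ n n]\<close>)
  fix l m :: complex assume l: "l \<noteq> 0"
  show "\<rho> l \<in> carrier_mat n n" using adaptedD(2)[OF a l] .
  assume m: "m \<noteq> 0"
  let ?d = "\<lambda>l. mat_diag n (\<lambda>i. chi (t i) l)"
  show "\<rho> (l * m) = \<rho> l * \<rho> m"
  proof (rule cm_inj)
    have "cm (\<rho> l * \<rho> m) = cm (\<rho> l) * (T * ?d m * T')"
      using adaptedD(2)[OF a l] adaptedD(2)[OF a m] adaptedD(3)[OF a m] by (simp add: cm_mult)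
    also have "\<dots> = cm (\<rho> l) * (T * ?d m) * T'"
      using T adaptedD(2)[OF a l] by (intro assoc_mult_mat[symmetric, of _ n n _ n]) auto
    also have "cm (\<rho> l) * (T * ?d m) = cm (\<rho> l) * T * ?d m"
      using T adaptedD(2)[OF a l] by (intro assoc_mult_mat[symmetric, of _ n n _ n]) auto
    also have "\<dots> = T * (?d l * ?d m)"
      unfolding adapted_mult_basis(1)[OF a l] using T by (intro assoc_mult_mat[of _ n n _ n]) auto
    also have "?d l * ?d m = ?d (l * m)" by (simp add: mat_diag_diag chi_mult)
    finally show "cm (\<rho> (l * m)) = cm (\<rho> l * \<rho> m)" using adaptedD(3)[OF a, of "l * m"] l m by simp
  qed
next
  fix i j assume "i < n" "j < n"
  then show "regular_on_S (\<lambda>l. \<rho> l $$ (i, j))" by (rule adapted_regular[OF a])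
qed

lemma mat_diag_commute_iff:
  assumes M: "M \<in> carrier_mat n m"
  shows "M * mat_diag m f = mat_diag n g * M \<longleftrightarrow> (\<forall>i<n. \<forall>j<m. M $$ (i, j) \<noteq> 0 \<longrightarrow> f j = (g i :: 'a :: field))"
proof -
  have e: "(M * mat_diag m f) $$ (i, j) = M $$ (i, j) * f j" "(mat_diag n g * M) $$ (i, j) = g i * M $$ (i, j)"
    if "i < n" "j < m" for i j using that M by (simp_all add: mat_diag_mult_right[OF M] mat_diag_mult_left[OF M])
  show ?thesis
  proof
    assume "M * mat_diag m f = mat_diag n g * M"
    then show "\<forall>i<n. \<forall>j<m. M $$ (i, j) \<noteq> 0 \<longrightarrow> f j = g i" using e by (metis mult.commute mult_left_cancel)
  next
    assume h: "\<forall>i<n. \<forall>j<m. M $$ (i, j) \<noteq> 0 \<longrightarrow> f j = g i"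
    show "M * mat_diag m f = mat_diag n g * M"
    proof (rule eq_matI)
      fix i j assume "i < dim_row (mat_diag n g * M)" "j < dim_col (mat_diag n g * M)"
      then have "i < n" "j < m" using M by auto
      then show "(M * mat_diag m f) $$ (i, j) = (mat_diag n g * M) $$ (i, j)"
        using e h by (metis mult.commute mult_zero_left mult_zero_right)
    qed (use M in auto)
  qed
qed

text \<open>
  A map commutes with diagonal actions iff it maps eigenvectors to eigenvectors with the same
  character, and distinct types have distinct characters.
\<close>

lemma supp_same_type_iff:
  assumes M: "M \<in> carrier_mat n m"
  shows "supp_in r c same_type M \<longleftrightarrow>
    (\<forall>l. l \<noteq> 0 \<longrightarrow> M * mat_diag m (\<lambda>j. chi (c j) l) = mat_diag n (\<lambda>i. chi (r i) l) * M)"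
proof -
  have "(\<forall>l. l \<noteq> 0 \<longrightarrow> (\<forall>i<n. \<forall>j<m. M $$ (i, j) \<noteq> 0 \<longrightarrow> chi (c j) l = chi (r i) l))
    \<longleftrightarrow> (\<forall>i<n. \<forall>j<m. M $$ (i, j) \<noteq> 0 \<longrightarrow> (\<forall>l. l \<noteq> 0 \<longrightarrow> chi (c j) l = chi (r i) l))" by blast
  also have "\<dots> \<longleftrightarrow> (\<forall>i<n. \<forall>j<m. M $$ (i, j) \<noteq> 0 \<longrightarrow> r i = c j)"
    using chi_distinct by metis
  finally show ?thesis
    unfolding mat_diag_commute_iff[OF M] supp_in_def using M by (simp add: prod_eq_iff)
qed

abbreviation swap_types :: "(nat \<Rightarrow> int \<times> int) \<Rightarrow> nat \<Rightarrow> int \<times> int" where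
  "swap_types t \<equiv> \<lambda>i. prod.swap (t i)"

lemma adapted_conj:
  assumes a: "adapted n \<rho> T T' t"
  shows "supp_in t (swap_types t) same_type (T' * cnj_mat T)"
proof -
  note T = inverse_matsD[OF adaptedD(1)[OF a]]
  have M: "T' * cnj_mat T \<in> carrier_mat n n" using T by auto
  show ?thesis unfolding supp_same_type_iff[OF M]
  proof (intro allI impI)
    fix l :: complex assume l: "l \<noteq> 0"
    note rl = adaptedD(2)[OF a l]
    have e: "cm (\<rho> l) * cnj_mat T = cnj_mat T * mat_diag n (\<lambda>i. chi (swap_types t i) l)"
      using arg_cong[OF adapted_mult_basis(1)[OF a l], of cnj_mat] rl T
      by (simp add: cnj_mat_mult cnj_mat_cm cnj_mat_diag chi_cnj)
    have "T' * cnj_mat T * mat_diag n (\<lambda>j. chi (swap_types t j) l) = T' * (cm (\<rho> l) * cnj_mat T)"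
      unfolding e using T by (intro assoc_mult_mat[of _ n n _ n]) auto
    also have "\<dots> = T' * cm (\<rho> l) * cnj_mat T" using T rl by (intro assoc_mult_mat[symmetric, of _ n n _ n]) auto
    also have "\<dots> = mat_diag n (\<lambda>i. chi (t i) l) * (T' * cnj_mat T)"
      unfolding adapted_mult_basis(2)[OF a l] using T by (intro assoc_mult_mat[of _ n n _ n]) auto
    finally show "T' * cnj_mat T * mat_diag n (\<lambda>j. chi (swap_types t j) l) = mat_diag n (\<lambda>i. chi (t i) l) * (T' * cnj_mat T)" .
  qed
qed

text \<open>
  Conjugation exchanges \<open>(p, q)\<close> and \<open>(q, p)\<close> both for the basis and for the characters, which
  makes the complex matrices \<open>T diag (chi t) T\<^sup>-\<^sup>1\<close> real.
\<close>

lemma adapted_exists: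
  assumes inv: "inverse_mats n T T'" and s: "supp_in t (swap_types t) same_type (T' * cnj_mat T)"
  shows "\<exists>\<rho>. adapted n \<rho> T T' t"
proof -
  note T = inverse_matsD[OF inv]
  let ?d = "\<lambda>l. mat_diag n (\<lambda>i. chi (t i) l)" and ?ds = "\<lambda>l. mat_diag n (\<lambda>i. chi (swap_types t i) l)"
  let ?A = "\<lambda>l. T * ?d l * T'"
  have M: "T' * cnj_mat T \<in> carrier_mat n n" using T by auto
  have real: "cnj_mat (?A l) = ?A l" if l: "l \<noteq> 0" for l
  proof -
    have cT: "cnj_mat T = T * (T' * cnj_mat T)"
      using T by (subst assoc_mult_mat[symmetric, of _ n n _ n]) auto
    have comm: "T' * cnj_mat T * ?ds l = ?d l * (T' * cnj_mat T)"
      using s l unfolding supp_same_type_iff[OF M] by blast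
    have "cnj_mat (?A l) = cnj_mat T * ?ds l * cnj_mat T'"
      using T by (simp add: cnj_mat_mult cnj_mat_diag chi_cnj)
    also have "cnj_mat T * ?ds l = T * (T' * cnj_mat T * ?ds l)"
      using T by (subst cT) (intro assoc_mult_mat[of _ n n _ n], auto)
    also have "\<dots> = T * ?d l * (T' * cnj_mat T)"
      unfolding comm using T by (intro assoc_mult_mat[symmetric, of _ n n _ n]) auto
    also have "\<dots> * cnj_mat T' = T * ?d l * (T' * cnj_mat T * cnj_mat T')"
      using T by (intro assoc_mult_mat[of _ n n _ n]) auto
    also have "T' * cnj_mat T * cnj_mat T' = T' * (cnj_mat T * cnj_mat T')"
      using T by (intro assoc_mult_mat[of _ n n _ n]) auto
    also have "\<dots> = T'" using inverse_matsD(3)[OF cnj_mat_inverse[OF inv]] T by simp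
    finally show ?thesis .
  qed
  have "adapted n (\<lambda>l. map_mat Re (?A l)) T T' t"
    unfolding adapted_def using inv cm_map_Re[OF real] T by auto
  then show ?thesis by blast
qed

lemma kron_mat_diag:
  "kron_mat (mat_diag n f) (mat_diag m g) = mat_diag (n * m) (\<lambda>i. f (i div m) * g (i mod m) :: 'a :: comm_semiring_1)"
proof (rule eq_matI)
  fix i j assume "i < dim_row (mat_diag (n * m) (\<lambda>i. f (i div m) * g (i mod m)))" "j < dim_col (mat_diag (n * m) (\<lambda>i. f (i div m) * g (i mod m)))"
  then have ij: "i < n * m" "j < n * m" by auto
  note b = div_mod_bounds[OF ij(1)] div_mod_bounds[OF ij(2)]
  have "i = j \<longleftrightarrow> i div m = j div m \<and> i mod m = j mod m" by (metis div_mult_mod_eq)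
  then show "kron_mat (mat_diag n f) (mat_diag m g) $$ (i, j) = mat_diag (n * m) (\<lambda>i. f (i div m) * g (i mod m)) $$ (i, j)"
    using ij b by (auto simp: mat_diag_def)
qed auto

lemma adapted_kron:
  assumes a: "adapted n \<rho> T T' t" and b: "adapted m \<sigma> U U' s"
  shows "adapted (n * m) (\<lambda>l. kron_mat (\<rho> l) (\<sigma> l)) (kron_mat T U) (kron_mat T' U') (\<lambda>i. t (i div m) + s (i mod m))"
  unfolding adapted_def
proof (intro conjI allI impI)
  note T = inverse_matsD[OF adaptedD(1)[OF a]] and U = inverse_matsD[OF adaptedD(1)[OF b]]
  show "inverse_mats (n * m) (kron_mat T U) (kron_mat T' U')"
    by (rule kron_inverse_mats[OF adaptedD(1)[OF a] adaptedD(1)[OF b]])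
  fix l :: complex assume l: "l \<noteq> 0"
  show "kron_mat (\<rho> l) (\<sigma> l) \<in> carrier_mat (n * m) (n * m)"
    using adaptedD(2)[OF a l] adaptedD(2)[OF b l] by auto
  have "cm (kron_mat (\<rho> l) (\<sigma> l)) = kron_mat (cm (\<rho> l)) (cm (\<sigma> l))" by (rule kron_map) simp
  also have "\<dots> = kron_mat (T * mat_diag n (\<lambda>i. chi (t i) l)) (U * mat_diag m (\<lambda>i. chi (s i) l)) * kron_mat T' U'"
    unfolding adaptedD(3)[OF a l] adaptedD(3)[OF b l]
    using T U by (intro kron_mult[of _ n n _ n _ m m _ m]) auto
  also have "kron_mat (T * mat_diag n (\<lambda>i. chi (t i) l)) (U * mat_diag m (\<lambda>i. chi (s i) l))
      = kron_mat T U * kron_mat (mat_diag n (\<lambda>i. chi (t i) l)) (mat_diag m (\<lambda>i. chi (s i) l))"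
    using T U by (intro kron_mult[of _ n n _ n _ m m _ m]) auto
  finally show "cm (kron_mat (\<rho> l) (\<sigma> l))
    = kron_mat T U * mat_diag (n * m) (\<lambda>i. chi (t (i div m) + s (i mod m)) l) * kron_mat T' U'"
    by (simp add: kron_mat_diag chi_add[OF l])
qed

lemma adapted_dual:
  assumes a: "adapted n \<rho> T T' t"
  shows "adapted n (\<lambda>l. transpose_mat (\<rho> (inverse l))) (transpose_mat T') (transpose_mat T) (\<lambda>i. - t i)"
  unfolding adapted_def
proof (intro conjI allI impI)
  note T = inverse_matsD[OF adaptedD(1)[OF a]]
  show "inverse_mats n (transpose_mat T') (transpose_mat T)"
    using T by (intro inverse_matsI) (auto simp flip: transpose_mult)
  fix l :: complex assume "l \<noteq> 0"
  then have l: "inverse l \<noteq> 0" by simp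
  show "transpose_mat (\<rho> (inverse l)) \<in> carrier_mat n n" using adaptedD(2)[OF a l] by simp
  let ?d = "mat_diag n (\<lambda>i. chi (t i) (inverse l))"
  have dt: "transpose_mat ?d = ?d" by (rule eq_matI) (auto simp: mat_diag_def)
  have "cm (transpose_mat (\<rho> (inverse l))) = transpose_mat (T * ?d * T')"
    unfolding adaptedD(3)[OF a l, symmetric] by (rule eq_matI) auto
  also have "\<dots> = transpose_mat T' * transpose_mat (T * ?d)"
    using T by (intro transpose_mult[of _ n n _ n]) auto
  also have "transpose_mat (T * ?d) = ?d * transpose_mat T"
    using T dt by (subst transpose_mult[of _ n n _ n]) auto
  also have "transpose_mat T' * (?d * transpose_mat T) = transpose_mat T' * ?d * transpose_mat T"
    using T by (intro assoc_mult_mat[symmetric, of _ n n _ n]) auto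
  finally show "cm (transpose_mat (\<rho> (inverse l))) = transpose_mat T' * mat_diag n (\<lambda>i. chi (- t i) l) * transpose_mat T"
    by (simp add: chi_uminus)
qed

lemma adapted_unit: "adapted 1 (\<lambda>l. 1\<^sub>m 1) (1\<^sub>m 1) (1\<^sub>m 1) (\<lambda>i. 0)"
proof -
  have "mat_diag 1 (\<lambda>i. 1) = (1\<^sub>m 1 :: complex mat)" by (rule eq_matI) (auto simp: mat_diag_def)
  then show ?thesis by (auto simp: adapted_def inverse_mats_def cm_one zero_prod_def)
qed

section \<open>The objects of SHS\<close>

lemma smult_smult_mat: "a \<cdot>\<^sub>m (b \<cdot>\<^sub>m A) = (a * b :: 'a :: semiring_1) \<cdot>\<^sub>m A"
  by (rule eq_matI) (auto simp: mult.assoc)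

lemma smult_add_distrib_mat:
  "dim_row A = dim_row B \<Longrightarrow> dim_col A = dim_col B \<Longrightarrow> c \<cdot>\<^sub>m (A + B) = c \<cdot>\<^sub>m A + (c :: 'a :: semiring_1) \<cdot>\<^sub>m B"
  by (rule eq_matI) (auto simp: distrib_left)

lemma smult_mat_mult_vec: "v \<in> carrier_vec (dim_col A) \<Longrightarrow> (k \<cdot>\<^sub>m A) *\<^sub>v v = (k :: 'a :: comm_semiring_1) \<cdot>\<^sub>v (A *\<^sub>v v)"
  by (rule eq_vecI) (auto simp: scalar_prod_def sum_distrib_left mult.assoc intro!: sum.cong)

lemma mat_minus_mult: "dim_col A = dim_row B \<Longrightarrow> - A * B = - (A * B :: 'a :: ring_1 mat)"
  by (rule eq_matI) (simp_all add: mult_mat_index sum_negf del: index_mult_mat(1))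

lemma mat_mult_minus: "dim_col A = dim_row B \<Longrightarrow> A * - B = - (A * B :: 'a :: ring_1 mat)"
  by (rule eq_matI) (simp_all add: mult_mat_index sum_negf del: index_mult_mat(1))

lemmas ev_coev_carrier_Suc [simp] = ev_coev_carrier[unfolded One_nat_def]

text \<open>
  The value of \<open>\<beta>\<close> at the point \<open>(x, y)\<close> with \<open>x - \<i> y = m\<close>. The point \<open>(1, 0)\<close>, i.e. \<open>m = 1\<close>, has
  a dense orbit under \<open>S\<close>, so that the equivariant \<open>\<beta>\<close> is determined by its value there.
\<close>

definition beta_at :: "real poly poly mat \<Rightarrow> complex \<Rightarrow> real mat" where
  "beta_at B m = map_mat (\<lambda>p. eval2 p (Re m) (- Im m)) B"

lemma beta_at_dims [simp]: "dim_row (beta_at B m) = dim_row B" "dim_col (beta_at B m) = dim_col B"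
  by (simp_all add: beta_at_def)

lemma beta_at_carrier [simp]: "B \<in> carrier_mat n k \<Longrightarrow> beta_at B m \<in> carrier_mat n k"
  by (simp add: beta_at_def)

lemma eval2_one [simp]: "eval2 1 a b = 1"
  by (simp add: eval2_def)

lemma eval2_uminus [simp]: "eval2 (- p) a b = - eval2 p a b"
  by (simp add: eval2_def)

lemma eval2_sum: "eval2 (sum f I) a b = (\<Sum>i\<in>I. eval2 (f i) a b)"
  by (induction I rule: infinite_finite_induct) simp_all

lemma beta_at_ops:
  "dim_col A = dim_row B \<Longrightarrow> beta_at (A * B) m = beta_at A m * beta_at B m"
  "beta_at (map_mat const2 f) m = f" "beta_at (1\<^sub>m n) m = 1\<^sub>m n" "beta_at (0\<^sub>m n k) m = 0\<^sub>m n k"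
  "beta_at (kron_mat A B) m = kron_mat (beta_at A m) (beta_at B m)"
  "beta_at (transpose_mat A) m = transpose_mat (beta_at A m)" "beta_at (- A) m = - beta_at A m"
  unfolding beta_at_def
proof -
  let ?e = "\<lambda>p. eval2 p (Re m) (- Im m)"
  show "dim_col A = dim_row B \<Longrightarrow> map_mat ?e (A * B)
    = map_mat ?e A * map_mat ?e B"
    by (rule map_mat_hom_mult) simp_all
  show "map_mat ?e (kron_mat A B)
    = kron_mat (map_mat ?e A) (map_mat ?e B)"
    by (rule kron_map) simp
qed (auto intro!: eq_matI)

lemma beta_at_add:
  "dim_row A = dim_row B \<Longrightarrow> dim_col A = dim_col B \<Longrightarrow> beta_at (A + B) m = beta_at A m + beta_at B m"
  unfolding beta_at_def by (auto intro!: eq_matI)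

lemma eval2_eq_zero:
  assumes "\<And>m. m \<noteq> 0 \<Longrightarrow> eval2 p (Re m) (- Im m) = 0"
  shows "p = 0"
proof -
  have z: "poly p [:b:] = 0" if b: "b \<noteq> 0" for b
  proof (rule ccontr)
    assume "poly p [:b:] \<noteq> 0"
    then have "finite {a. poly (poly p [:b:]) a = 0}" by (rule poly_roots_finite)
    moreover have "poly (poly p [:b:]) a = 0" for a
      using assms[of "Complex a (- b)"] b by (auto simp: eval2_def complex_eq_iff)
    ultimately show False by (simp add: infinite_UNIV_char_0)
  qed
  show ?thesis
  proof (rule ccontr)
    assume "p \<noteq> 0"
    then have fin: "finite {x. poly p x = 0}" by (rule poly_roots_finite)
    have "(\<lambda>b :: real. [:b:]) ` (UNIV - {0}) \<subseteq> {x. poly p x = 0}" using z by auto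
    then have "finite ((\<lambda>b :: real. [:b:]) ` (UNIV - {0}))" using fin by (rule finite_subset)
    then have "finite (UNIV - {0 :: real})" by (rule finite_imageD) (auto intro: inj_onI)
    then show False by (simp add: infinite_UNIV_char_0)
  qed
qed

lemma eval2_eqI:
  assumes "\<And>m. m \<noteq> 0 \<Longrightarrow> eval2 p (Re m) (- Im m) = eval2 q (Re m) (- Im m)"
  shows "p = q"
  using eval2_eq_zero[of "p - q"] assms by simp

lemma beta_at_eqI:
  assumes "\<And>m. m \<noteq> 0 \<Longrightarrow> beta_at A m = beta_at B m"
  shows "A = B"
proof (rule eq_matI)
  have "dim_row (beta_at A 1) = dim_row (beta_at B 1)" "dim_col (beta_at A 1) = dim_col (beta_at B 1)"
    using assms[of 1] by simp_all
  then show d: "dim_row A = dim_row B" "dim_col A = dim_col B" by simp_all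
  fix i j assume ij: "i < dim_row B" "j < dim_col B"
  show "A $$ (i, j) = B $$ (i, j)"
  proof (rule eval2_eqI)
    fix m :: complex assume "m \<noteq> 0"
    from arg_cong[OF assms[OF this], of "\<lambda>M. M $$ (i, j)"]
    show "eval2 (A $$ (i, j)) (Re m) (- Im m) = eval2 (B $$ (i, j)) (Re m) (- Im m)"
      using ij d by (simp add: beta_at_def)
  qed
qed

lemma eval2_S_act: "eval2 (S_act_poly l p) (Re m) (- Im m) = eval2 p (Re (l * m)) (- Im (l * m))"
proof -
  have "Re l * Re m + Im l * - Im m = Re (l * m)" "Re l * - Im m - Im l * Re m = - Im (l * m)" by simp_all
  then show ?thesis by (simp only: S_act_poly_def eval2_subst2 eval2_simps)
qed

lemma eq_mat_by_vec:
  assumes "A \<in> carrier_mat n m" "B \<in> carrier_mat n m" "\<And>v. v \<in> carrier_vec m \<Longrightarrow> A *\<^sub>v v = B *\<^sub>v v"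
  shows "A = (B :: 'a :: field mat)"
proof (rule eq_matI)
  fix i j assume "i < dim_row B" "j < dim_col B"
  then have ij: "i < n" "j < m" using assms by auto
  have "col A j = col B j" using assms(3)[of "unit_vec m j"] ij assms(1,2) by (simp add: mult_mat_unit_vec)
  then have "col A j $ i = col B j $ i" by simp
  then show "A $$ (i, j) = B $$ (i, j)" using ij assms(1,2) by simp
qed (use assms in auto)

text \<open>
  Polynomials agree if they agree at all nonzero points. The element \<open>m\<close> of \<open>S\<close> moves the point
  with \<open>x - \<i> y = 1\<close> to the one with \<open>x - \<i> y = m\<close>, so that equivariance only has to be tested
  by evaluation at the former.
\<close>

lemma is_shs_iff:
  "is_shs V \<longleftrightarrow> S_representation (shs_dim V) (shs_rep V)
    \<and> shs_beta V \<in> carrier_mat (shs_dim V) (shs_dim V)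
    \<and> (\<forall>m. m \<noteq> 0 \<longrightarrow> (cmod m)\<^sup>2 \<cdot>\<^sub>m (shs_rep V m * beta_at (shs_beta V) m) = beta_at (shs_beta V) 1 * shs_rep V m)"
proof -
  define n where "n = shs_dim V"
  define \<rho> where "\<rho> = shs_rep V"
  define B where "B = shs_beta V"
  have core: "(\<forall>l v. l \<noteq> 0 \<longrightarrow> v \<in> carrier_vec n \<longrightarrow> B *\<^sub>v map_vec const2 (\<rho> l *\<^sub>v v) = S_act_twisted \<rho> l (B *\<^sub>v map_vec const2 v))
    \<longleftrightarrow> (\<forall>m. m \<noteq> 0 \<longrightarrow> (cmod m)\<^sup>2 \<cdot>\<^sub>m (\<rho> m * beta_at B m) = beta_at B 1 * \<rho> m)"
    if rep: "S_representation n \<rho>" and Bc: "B \<in> carrier_mat n n"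
  proof -
    have rc: "\<And>l. l \<noteq> 0 \<Longrightarrow> \<rho> l \<in> carrier_mat n n" and r1: "\<rho> 1 = 1\<^sub>m n"
      and rm: "\<And>l m. l \<noteq> 0 \<Longrightarrow> m \<noteq> 0 \<Longrightarrow> \<rho> (l * m) = \<rho> l * \<rho> m"
      using rep by (auto simp: S_representation_def)
    let ?p = "\<lambda>l v. B *\<^sub>v map_vec const2 (\<rho> l *\<^sub>v v)" and ?q = "\<lambda>l v. S_act_twisted \<rho> l (B *\<^sub>v map_vec const2 v)"
    let ?ev = "\<lambda>m w. map_vec (\<lambda>p. eval2 p (Re m) (- Im m)) w"
    have evB: "?ev m (B *\<^sub>v map_vec const2 v) = beta_at B m *\<^sub>v v" if v: "v \<in> carrier_vec n" for v m
      using Bc v by (intro eq_vecI) (auto simp: beta_at_def scalar_prod_def eval2_sum)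
    have lhs: "?ev m (?p l v) = beta_at B m * \<rho> l *\<^sub>v v"
      if v: "v \<in> carrier_vec n" and l: "l \<noteq> 0" for v m l
    proof -
      have "?ev m (?p l v) = beta_at B m *\<^sub>v (\<rho> l *\<^sub>v v)"
        using v rc[OF l] by (intro evB) auto
      then show ?thesis using v rc[OF l] Bc by (simp add: assoc_mult_mat_vec[of _ n n _ n])
    qed
    have rhs: "?ev m (?q l v) = (cmod l)\<^sup>2 \<cdot>\<^sub>m (\<rho> l * beta_at B (l * m)) *\<^sub>v v"
      if v: "v \<in> carrier_vec n" and l: "l \<noteq> 0" for v m l
    proof -
      define w where "w = B *\<^sub>v map_vec const2 v"
      have w: "w \<in> carrier_vec n" unfolding w_def using Bc v by (intro mult_mat_vec_carrier[of _ n n]) auto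
      have "?ev m (S_act_twisted \<rho> l w) = (cmod l)\<^sup>2 \<cdot>\<^sub>v (\<rho> l *\<^sub>v ?ev (l * m) w)"
      proof (rule eq_vecI)
        fix i assume "i < dim_vec ((cmod l)\<^sup>2 \<cdot>\<^sub>v (\<rho> l *\<^sub>v ?ev (l * m) w))"
        then have i: "i < n" using rc[OF l] by simp
        have "S_act_twisted \<rho> l w $ i
          = const2 ((cmod l)\<^sup>2) * (\<Sum>k<n. const2 (\<rho> l $$ (i, k)) * S_act_poly l (w $ k))"
          unfolding S_act_twisted_def using w i rc[OF l]
          by (auto simp: scalar_prod_def atLeast0LessThan intro!: arg_cong2[where f = "(*)"] sum.cong)
        then have "eval2 (S_act_twisted \<rho> l w $ i) (Re m) (- Im m)
          = (cmod l)\<^sup>2 * (\<Sum>k<n. \<rho> l $$ (i, k) * eval2 (w $ k) (Re (l * m)) (- Im (l * m)))"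
          by (simp only: eval2_simps eval2_sum eval2_S_act)
        moreover have "((cmod l)\<^sup>2 \<cdot>\<^sub>v (\<rho> l *\<^sub>v ?ev (l * m) w)) $ i
          = (cmod l)\<^sup>2 * (\<Sum>k<n. \<rho> l $$ (i, k) * eval2 (w $ k) (Re (l * m)) (- Im (l * m)))"
          using w i rc[OF l]
          by (auto simp: scalar_prod_def atLeast0LessThan simp del: times_complex.sel
              intro!: arg_cong2[where f = "(*)"] sum.cong)
        ultimately show "?ev m (S_act_twisted \<rho> l w) $ i = ((cmod l)\<^sup>2 \<cdot>\<^sub>v (\<rho> l *\<^sub>v ?ev (l * m) w)) $ i"
          using i rc[OF l] l by (simp add: S_act_twisted_def del: index_mult_mat_vec times_complex.sel)
      qed (use rc[OF l] in \<open>simp add: S_act_twisted_def\<close>)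
      also note w_def
      also have "?ev (l * m) (B *\<^sub>v map_vec const2 v) = beta_at B (l * m) *\<^sub>v v" by (rule evB[OF v])
      finally show ?thesis using v rc[OF l] Bc
        by (simp add: assoc_mult_mat_vec[of _ n n _ n] smult_mat_mult_vec[of v])
    qed
    have "(\<forall>l v. l \<noteq> 0 \<longrightarrow> v \<in> carrier_vec n \<longrightarrow> ?p l v = ?q l v)
      \<longleftrightarrow> (\<forall>l m. l \<noteq> 0 \<longrightarrow> m \<noteq> 0 \<longrightarrow> beta_at B m * \<rho> l = (cmod l)\<^sup>2 \<cdot>\<^sub>m (\<rho> l * beta_at B (l * m)))"
      (is "?L \<longleftrightarrow> ?M")
    proof
      assume L: ?L
      show ?M
      proof (intro allI impI)
        fix l m :: complex assume l: "l \<noteq> 0"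
        show "beta_at B m * \<rho> l = (cmod l)\<^sup>2 \<cdot>\<^sub>m (\<rho> l * beta_at B (l * m))"
        proof (rule eq_mat_by_vec)
          fix v :: "real vec" assume v: "v \<in> carrier_vec n"
          show "beta_at B m * \<rho> l *\<^sub>v v = (cmod l)\<^sup>2 \<cdot>\<^sub>m (\<rho> l * beta_at B (l * m)) *\<^sub>v v"
            unfolding lhs[OF v l, symmetric] rhs[OF v l, symmetric] using L l v by simp
        qed (use rc[OF l] Bc in auto)
      qed
    next
      assume M: ?M
      show ?L
      proof (intro allI impI)
        fix l :: complex and v :: "real vec" assume l: "l \<noteq> 0" and v: "v \<in> carrier_vec n"
        have ev: "?ev m (?p l v) = ?ev m (?q l v)"
          if "m \<noteq> 0" for m unfolding lhs[OF v l] rhs[OF v l] using M l that by simp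
        show "?p l v = ?q l v"
        proof (rule eq_vecI)
          show d: "dim_vec (?p l v) = dim_vec (?q l v)"
            using Bc rc[OF l] by (simp add: S_act_twisted_def)
          fix i assume i: "i < dim_vec (?q l v)"
          show "(?p l v) $ i = ?q l v $ i"
          proof (rule eval2_eqI)
            fix m :: complex assume "m \<noteq> 0"
            from arg_cong[OF ev[OF this], of "\<lambda>w. w $ i"]
            show "eval2 ((?p l v) $ i) (Re m) (- Im m)
              = eval2 (?q l v $ i) (Re m) (- Im m)"
              using i d by (simp del: index_mult_mat_vec)
          qed
        qed
      qed
    qed
    also have "\<dots> \<longleftrightarrow> (\<forall>m. m \<noteq> 0 \<longrightarrow> (cmod m)\<^sup>2 \<cdot>\<^sub>m (\<rho> m * beta_at B m) = beta_at B 1 * \<rho> m)" (is "?M \<longleftrightarrow> ?N")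
    proof
      assume ?M
      show ?N
      proof (intro allI impI)
        fix m :: complex assume m: "m \<noteq> 0"
        show "(cmod m)\<^sup>2 \<cdot>\<^sub>m (\<rho> m * beta_at B m) = beta_at B 1 * \<rho> m"
          using \<open>?M\<close>[rule_format, OF m one_neq_zero] by simp
      qed
    next
      assume N: ?N
      show ?M
      proof (intro allI impI)
        fix l m :: complex assume l: "l \<noteq> 0" and m: "m \<noteq> 0"
        have lm: "l * m \<noteq> 0" using l m by simp
        note c = rc[OF l] rc[OF m] rc[OF lm] Bc beta_at_carrier[OF Bc]
        have im: "inverse m \<noteq> 0" using m by simp
        have inv: "\<rho> (inverse m) * \<rho> m = 1\<^sub>m n" using rm[OF im m] m r1 by simp
        let ?a = "(cmod m)\<^sup>2" and ?b = "(cmod l)\<^sup>2"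
        have a0: "?a \<noteq> 0" using m by simp
        have "?a \<cdot>\<^sub>m (\<rho> m * (?b \<cdot>\<^sub>m (\<rho> l * beta_at B (l * m)))) = (?a * ?b) \<cdot>\<^sub>m (\<rho> m * \<rho> l * beta_at B (l * m))"
          using c by (simp add: mult_smult_distrib[of _ n n _ n] assoc_mult_mat[of _ n n _ n _ n] smult_smult_mat)
        also have "\<dots> = (cmod (l * m))\<^sup>2 \<cdot>\<^sub>m (\<rho> (l * m) * beta_at B (l * m))"
          using rm[OF m l] by (simp add: norm_mult power_mult_distrib mult.commute)
        also have "\<dots> = beta_at B 1 * (\<rho> m * \<rho> l)"
        proof -
          have rml: "\<rho> (l * m) = \<rho> m * \<rho> l" using rm[OF m l] by (simp only: mult.commute)
          show ?thesis using N[rule_format, OF lm] by (simp only: rml)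
        qed
        also have "\<dots> = beta_at B 1 * \<rho> m * \<rho> l" using c by (simp add: assoc_mult_mat[of _ n n _ n _ n])
        also have "beta_at B 1 * \<rho> m = ?a \<cdot>\<^sub>m (\<rho> m * beta_at B m)" using N m by simp
        also have "?a \<cdot>\<^sub>m (\<rho> m * beta_at B m) * \<rho> l = ?a \<cdot>\<^sub>m (\<rho> m * (beta_at B m * \<rho> l))"
          using c by (simp add: mult_smult_assoc_mat[of _ n n _ n] assoc_mult_mat[of _ n n _ n _ n])
        finally have "inverse ?a \<cdot>\<^sub>m (?a \<cdot>\<^sub>m (\<rho> m * (?b \<cdot>\<^sub>m (\<rho> l * beta_at B (l * m)))))
          = inverse ?a \<cdot>\<^sub>m (?a \<cdot>\<^sub>m (\<rho> m * (beta_at B m * \<rho> l)))" by simp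
        then have "\<rho> m * (?b \<cdot>\<^sub>m (\<rho> l * beta_at B (l * m))) = \<rho> m * (beta_at B m * \<rho> l)"
          using a0 by (simp add: smult_smult_mat)
        then have "\<rho> (inverse m) * (\<rho> m * (?b \<cdot>\<^sub>m (\<rho> l * beta_at B (l * m)))) = \<rho> (inverse m) * (\<rho> m * (beta_at B m * \<rho> l))"
          by simp
        moreover have "\<rho> (inverse m) * (\<rho> m * X) = X" if "X \<in> carrier_mat n n" for X
          using c rc[OF im] that inv by (simp flip: assoc_mult_mat[of _ n n _ n _ n])
        moreover have "beta_at B m * \<rho> l \<in> carrier_mat n n" "?b \<cdot>\<^sub>m (\<rho> l * beta_at B (l * m)) \<in> carrier_mat n n"
          using mult_carrier_mat[OF beta_at_carrier[OF Bc] rc[OF l]] mult_carrier_mat[OF rc[OF l] beta_at_carrier[OF Bc]] by simp_all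
        ultimately show "beta_at B m * \<rho> l = ?b \<cdot>\<^sub>m (\<rho> l * beta_at B (l * m))"
          by metis
      qed
    qed
    finally show ?thesis .
  qed
  show ?thesis
    unfolding is_shs_def Let_def using core unfolding n_def \<rho>_def B_def by blast
qed

definition shs_D :: "shs \<Rightarrow> real mat" where
  "shs_D V = beta_at (shs_beta V) 1"

lemma shs_facts:
  assumes "is_shs V"
  shows "l \<noteq> 0 \<Longrightarrow> shs_rep V l \<in> carrier_mat (shs_dim V) (shs_dim V)"
    "shs_rep V 1 = 1\<^sub>m (shs_dim V)" "l \<noteq> 0 \<Longrightarrow> m \<noteq> 0 \<Longrightarrow> shs_rep V (l * m) = shs_rep V l * shs_rep V m"
    "l \<noteq> 0 \<Longrightarrow> shs_rep V l * shs_rep V (inverse l) = 1\<^sub>m (shs_dim V)"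
    "l \<noteq> 0 \<Longrightarrow> shs_rep V (inverse l) * shs_rep V l = 1\<^sub>m (shs_dim V)"
    "shs_beta V \<in> carrier_mat (shs_dim V) (shs_dim V)" "shs_D V \<in> carrier_mat (shs_dim V) (shs_dim V)"
    "m \<noteq> 0 \<Longrightarrow> (cmod m)\<^sup>2 \<cdot>\<^sub>m (shs_rep V m * beta_at (shs_beta V) m) = shs_D V * shs_rep V m"
proof -
  note h = assms[unfolded is_shs_iff S_representation_def]
  show "l \<noteq> 0 \<Longrightarrow> shs_rep V l \<in> carrier_mat (shs_dim V) (shs_dim V)" using h by blast
  show r1: "shs_rep V 1 = 1\<^sub>m (shs_dim V)" using h by blast
  show rm: "l \<noteq> 0 \<Longrightarrow> m \<noteq> 0 \<Longrightarrow> shs_rep V (l * m) = shs_rep V l * shs_rep V m" for l m using h by blast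
  show "l \<noteq> 0 \<Longrightarrow> shs_rep V l * shs_rep V (inverse l) = 1\<^sub>m (shs_dim V)"
    "l \<noteq> 0 \<Longrightarrow> shs_rep V (inverse l) * shs_rep V l = 1\<^sub>m (shs_dim V)"
    using rm[of l "inverse l"] rm[of "inverse l" l] r1 by simp_all
  show b: "shs_beta V \<in> carrier_mat (shs_dim V) (shs_dim V)" using h by blast
  then show "shs_D V \<in> carrier_mat (shs_dim V) (shs_dim V)" by (simp add: shs_D_def)
  show "m \<noteq> 0 \<Longrightarrow> (cmod m)\<^sup>2 \<cdot>\<^sub>m (shs_rep V m * beta_at (shs_beta V) m) = shs_D V * shs_rep V m"
    using h unfolding shs_D_def by blast
qed

text \<open>
  By equivariance, a map that is compatible with the values of \<open>\<beta>\<close> at \<open>(1, 0)\<close> is compatible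
  with those on the orbit of this point, which consists of all nonzero real points.
\<close>

lemma shs_hom_iff:
  assumes V: "is_shs V" and V': "is_shs V'"
  shows "f \<in> shs_hom V V' \<longleftrightarrow> f \<in> carrier_mat (shs_dim V') (shs_dim V)
    \<and> (\<forall>l. l \<noteq> 0 \<longrightarrow> f * shs_rep V l = shs_rep V' l * f) \<and> shs_D V' * f = f * shs_D V"
proof -
  define n where "n = shs_dim V"
  define n' where "n' = shs_dim V'"
  note v = shs_facts[OF V, folded n_def] and v' = shs_facts[OF V', folded n'_def]
  have "shs_beta V' * map_mat const2 f = map_mat const2 f * shs_beta V \<longleftrightarrow> shs_D V' * f = f * shs_D V"
    if f: "f \<in> carrier_mat n' n" and comm: "\<And>l. l \<noteq> 0 \<Longrightarrow> f * shs_rep V l = shs_rep V' l * f"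
  proof
    assume "shs_beta V' * map_mat const2 f = map_mat const2 f * shs_beta V"
    from arg_cong[OF this, of "\<lambda>M. beta_at M 1"] show "shs_D V' * f = f * shs_D V"
      using f v(6) v'(6) by (simp add: beta_at_ops shs_D_def)
  next
    assume D: "shs_D V' * f = f * shs_D V"
    show "shs_beta V' * map_mat const2 f = map_mat const2 f * shs_beta V"
    proof (rule beta_at_eqI)
      fix m :: complex assume m: "m \<noteq> 0"
      then have im: "inverse m \<noteq> 0" by simp
      let ?r = "shs_rep V m" and ?r' = "shs_rep V' m" and ?b = "beta_at (shs_beta V) m" and ?b' = "beta_at (shs_beta V') m"
      let ?a = "(cmod m)\<^sup>2"
      note c = f v(1)[OF m] v'(1)[OF m] v(6) v'(6) v(7) v'(7) beta_at_carrier[OF v(6), of m] beta_at_carrier[OF v'(6), of m] v'(1)[OF im]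
      have "?a \<cdot>\<^sub>m (?r' * (?b' * f)) = ?a \<cdot>\<^sub>m (?r' * ?b') * f"
        using c by (simp add: mult_smult_assoc_mat[of _ n' n' _ n] assoc_mult_mat[of _ n' n' _ n' _ n])
      also have "\<dots> = shs_D V' * (?r' * f)"
        unfolding v'(8)[OF m] using c by (simp add: assoc_mult_mat[of _ n' n' _ n' _ n])
      also have "\<dots> = shs_D V' * f * ?r"
        unfolding comm[OF m, symmetric] using c by (simp add: assoc_mult_mat[of _ n' n' _ n _ n])
      also have "\<dots> = f * (shs_D V * ?r)" unfolding D using c by (simp add: assoc_mult_mat[of _ n' n _ n _ n])
      also have "\<dots> = ?a \<cdot>\<^sub>m (f * ?r * ?b)"
        unfolding v(8)[OF m, symmetric] using c by (simp add: mult_smult_distrib[of _ n' n _ n] assoc_mult_mat[of _ n' n _ n _ n])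
      also have "f * ?r * ?b = ?r' * (f * ?b)"
        unfolding comm[OF m] using c by (simp add: assoc_mult_mat[of _ n' n' _ n _ n])
      finally have "inverse ?a \<cdot>\<^sub>m (?a \<cdot>\<^sub>m (?r' * (?b' * f))) = inverse ?a \<cdot>\<^sub>m (?a \<cdot>\<^sub>m (?r' * (f * ?b)))" by simp
      then have "?r' * (?b' * f) = ?r' * (f * ?b)" using m by (simp add: smult_smult_mat)
      then have "shs_rep V' (inverse m) * (?r' * (?b' * f)) = shs_rep V' (inverse m) * (?r' * (f * ?b))" by simp
      moreover have "shs_rep V' (inverse m) * (?r' * X) = X" if "X \<in> carrier_mat n' n" for X
        using c that v'(5)[OF m] by (simp flip: assoc_mult_mat[of _ n' n' _ n' _ n])
      ultimately have "?b' * f = f * ?b" using c by simp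
      then show "beta_at (shs_beta V' * map_mat const2 f) m = beta_at (map_mat const2 f * shs_beta V) m"
        using f v(6) v'(6) by (simp add: beta_at_ops)
    qed
  qed
  then show ?thesis unfolding shs_hom_def n_def n'_def by blast
qed

lemma shs_hom_carrier: "f \<in> shs_hom V V' \<Longrightarrow> f \<in> carrier_mat (shs_dim V') (shs_dim V)"
  by (simp add: shs_hom_def)

subsection \<open>Unit, tensor products and duals\<close>

lemma is_shs_unit: "is_shs shs_unit"
proof -
  have "S_representation 1 (\<lambda>l. 1\<^sub>m 1)" by (rule adapted_S_representation[OF adapted_unit])
  then show ?thesis unfolding is_shs_iff by (simp add: shs_unit_def beta_at_ops)
qed

lemma shs_D_unit: "shs_D shs_unit = 0\<^sub>m 1 1"
  by (simp add: shs_D_def shs_unit_def beta_at_ops)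

lemma beta_at_tensor:
  assumes "is_shs U" "is_shs V"
  shows "beta_at (shs_beta (shs_tensor U V)) m = kron_sum (beta_at (shs_beta U) m) (beta_at (shs_beta V) m)"
  using shs_facts(6)[OF assms(1)] shs_facts(6)[OF assms(2)]
  by (simp add: shs_tensor_def beta_at_add beta_at_ops kron_sum_def)

lemma shs_D_tensor:
  assumes "is_shs U" "is_shs V"
  shows "shs_D (shs_tensor U V) = kron_sum (shs_D U) (shs_D V)"
  unfolding shs_D_def by (rule beta_at_tensor[OF assms])

lemma is_shs_tensor:
  assumes U: "is_shs U" and V: "is_shs V"
  shows "is_shs (shs_tensor U V)"
  unfolding is_shs_iff
proof (intro conjI allI impI)
  let ?n = "shs_dim U" and ?m = "shs_dim V"
  note u = shs_facts[OF U] and v = shs_facts[OF V]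
  obtain T T' t S S' s where "adapted ?n (shs_rep U) T T' t" "adapted ?m (shs_rep V) S S' s"
    using S_representation_adapted U V unfolding is_shs_iff by meson
  from adapted_S_representation[OF adapted_kron[OF this]]
  show "S_representation (shs_dim (shs_tensor U V)) (shs_rep (shs_tensor U V))" by (simp add: shs_tensor_def)
  show "shs_beta (shs_tensor U V) \<in> carrier_mat (shs_dim (shs_tensor U V)) (shs_dim (shs_tensor U V))"
    unfolding shs_tensor_def shs.simps using u(6) v(6) by (intro add_carrier_mat kron_carrier) auto
  fix l :: complex assume l: "l \<noteq> 0"
  let ?a = "(cmod l)\<^sup>2" and ?r = "shs_rep U l" and ?s = "shs_rep V l"
    and ?b = "beta_at (shs_beta U) l" and ?c = "beta_at (shs_beta V) l"
  note c = u(1)[OF l] v(1)[OF l] beta_at_carrier[OF u(6), of l] beta_at_carrier[OF v(6), of l]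
  have "kron_mat ?r ?s * kron_sum ?b ?c = kron_mat (?r * ?b) ?s + kron_mat ?r (?s * ?c)"
    using c by (intro kron_mult_kron_sum[of _ ?n _ ?m]) auto
  then have "?a \<cdot>\<^sub>m (kron_mat ?r ?s * kron_sum ?b ?c) = kron_mat (?a \<cdot>\<^sub>m (?r * ?b)) ?s + kron_mat ?r (?a \<cdot>\<^sub>m (?s * ?c))"
    using c carrier_matD[OF c(1)] carrier_matD[OF c(2)] carrier_matD[OF c(3)] carrier_matD[OF c(4)]
    by (simp add: kron_smult smult_add_distrib_mat)
  also have "\<dots> = kron_sum (shs_D U) (shs_D V) * kron_mat ?r ?s"
    unfolding u(8)[OF l] v(8)[OF l] using c u(7) v(7) by (intro kron_sum_mult_kron[symmetric, of _ ?n _ ?m]) auto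
  finally show "?a \<cdot>\<^sub>m (shs_rep (shs_tensor U V) l * beta_at (shs_beta (shs_tensor U V)) l)
      = beta_at (shs_beta (shs_tensor U V)) 1 * shs_rep (shs_tensor U V) l"
    unfolding beta_at_tensor[OF U V] shs_D_def by (simp add: shs_tensor_def)
qed

lemma shs_D_dual: "shs_D (shs_dual V) = - transpose_mat (shs_D V)"
  by (simp add: shs_D_def shs_dual_def beta_at_ops)

lemma is_shs_dual:
  assumes V: "is_shs V"
  shows "is_shs (shs_dual V)"
  unfolding is_shs_iff
proof (intro conjI allI impI)
  let ?n = "shs_dim V"
  note v = shs_facts[OF V]
  obtain T T' t where "adapted ?n (shs_rep V) T T' t"
    using S_representation_adapted V unfolding is_shs_iff by meson
  from adapted_S_representation[OF adapted_dual[OF this]]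
  show "S_representation (shs_dim (shs_dual V)) (shs_rep (shs_dual V))" by (simp add: shs_dual_def)
  show "shs_beta (shs_dual V) \<in> carrier_mat (shs_dim (shs_dual V)) (shs_dim (shs_dual V))"
    using v(6) by (simp add: shs_dual_def)
  fix l :: complex assume l: "l \<noteq> 0"
  then have il: "inverse l \<noteq> 0" by simp
  let ?a = "(cmod l)\<^sup>2" and ?r = "shs_rep V l" and ?i = "shs_rep V (inverse l)" and ?b = "beta_at (shs_beta V) l"
  note c = v(1)[OF l] v(1)[OF il] v(6) beta_at_carrier[OF v(6), of l] v(7)
  have "?i * (?a \<cdot>\<^sub>m (?r * ?b)) * ?i = ?a \<cdot>\<^sub>m (?b * ?i)"
  proof -
    have "?i * (?r * ?b) = ?b" using c v(5)[OF l] by (simp flip: assoc_mult_mat[of _ ?n ?n _ ?n _ ?n])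
    then show ?thesis using c by (simp add: mult_smult_distrib[of _ ?n ?n _ ?n] mult_smult_assoc_mat[of _ ?n ?n _ ?n])
  qed
  moreover have "?i * (shs_D V * ?r) * ?i = ?i * shs_D V"
  proof -
    have "?i * (shs_D V * ?r) * ?i = ?i * (shs_D V * (?r * ?i))" using c by (simp add: assoc_mult_mat[of _ ?n ?n _ ?n _ ?n])
    then show ?thesis using c v(4)[OF l] by simp
  qed
  ultimately have key: "?a \<cdot>\<^sub>m (?b * ?i) = ?i * shs_D V" using v(8)[OF l] by simp
  have "?a \<cdot>\<^sub>m (transpose_mat ?i * - transpose_mat ?b) = - transpose_mat (?a \<cdot>\<^sub>m (?b * ?i))"
  proof -
    have "transpose_mat (?a \<cdot>\<^sub>m (?b * ?i)) = ?a \<cdot>\<^sub>m transpose_mat (?b * ?i)" by (rule eq_matI) auto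
    also have "transpose_mat (?b * ?i) = transpose_mat ?i * transpose_mat ?b" by (rule transpose_mult[OF c(4,2)])
    finally have "- transpose_mat (?a \<cdot>\<^sub>m (?b * ?i)) = - (?a \<cdot>\<^sub>m (transpose_mat ?i * transpose_mat ?b))" by simp
    also have "\<dots> = ?a \<cdot>\<^sub>m - (transpose_mat ?i * transpose_mat ?b)" by (rule eq_matI) auto
    also have "- (transpose_mat ?i * transpose_mat ?b) = transpose_mat ?i * - transpose_mat ?b"
      using carrier_matD[OF c(4)] carrier_matD[OF c(2)] by (intro mat_mult_minus[symmetric]) simp
    finally show ?thesis by simp
  qed
  also have "\<dots> = - transpose_mat (shs_D V) * transpose_mat ?i"
    unfolding key transpose_mult[OF c(2,5)] using carrier_matD[OF c(2)] carrier_matD[OF c(5)]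
    by (intro mat_minus_mult[symmetric]) simp
  finally show "?a \<cdot>\<^sub>m (shs_rep (shs_dual V) l * beta_at (shs_beta (shs_dual V)) l)
      = beta_at (shs_beta (shs_dual V)) 1 * shs_rep (shs_dual V) l"
    by (simp add: shs_dual_def beta_at_ops shs_D_def)
qed

lemma kron_sum_assoc:
  fixes A :: "'a :: comm_ring_1 mat"
  assumes "A \<in> carrier_mat n n" "B \<in> carrier_mat m m" "C \<in> carrier_mat k k"
  shows "kron_sum (kron_sum A B) C = kron_sum A (kron_sum B C)"
proof -
  have d: "dim_row (kron_sum A B) = n * m" "dim_row (kron_sum B C) = m * k"
    using assms carrier_matD(1)[OF kron_sum_carrier[OF assms(1,2)]] carrier_matD(1)[OF kron_sum_carrier[OF assms(2,3)]] by auto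
  have "kron_sum (kron_sum A B) C = kron_mat (kron_mat A (1\<^sub>m m)) (1\<^sub>m k) + kron_mat (kron_mat (1\<^sub>m n) B) (1\<^sub>m k) + kron_mat (1\<^sub>m (n * m)) C"
    unfolding kron_sum_def[of _ C] d using assms
    by (simp add: kron_sum_def kron_add_left[of _ "n * m" "n * m"])
  also have "kron_mat (kron_mat A (1\<^sub>m m)) (1\<^sub>m k) = kron_mat A (1\<^sub>m (m * k))"
    by (simp only: kron_assoc kron_one)
  also have "kron_mat (kron_mat (1\<^sub>m n) B) (1\<^sub>m k) = kron_mat (1\<^sub>m n) (kron_mat B (1\<^sub>m k))"
    by (rule kron_assoc)
  also have "kron_mat (1\<^sub>m (n * m)) C = kron_mat (1\<^sub>m n) (kron_mat (1\<^sub>m m) C)"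
    by (simp only: kron_assoc[symmetric] kron_one)
  also have "kron_mat A (1\<^sub>m (m * k)) + kron_mat (1\<^sub>m n) (kron_mat B (1\<^sub>m k)) + kron_mat (1\<^sub>m n) (kron_mat (1\<^sub>m m) C)
    = kron_mat A (1\<^sub>m (m * k)) + (kron_mat (1\<^sub>m n) (kron_mat B (1\<^sub>m k)) + kron_mat (1\<^sub>m n) (kron_mat (1\<^sub>m m) C))"
    using assms by (intro assoc_add_mat[of _ "n * (m * k)" "n * (m * k)"]) auto
  also have "\<dots> = kron_sum A (kron_sum B C)"
    unfolding kron_sum_def[of A] d using assms
    by (simp add: kron_sum_def kron_add_right[of _ "m * k" "m * k"])
  finally show ?thesis .
qed

lemma swap_kron_sum:
  assumes A: "A \<in> carrier_mat n n" and B: "B \<in> carrier_mat m m"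
  shows "kron_sum B A * swap_mat n m = swap_mat n m * kron_sum A B"
proof -
  have "kron_sum B A * swap_mat n m = kron_mat B (1\<^sub>m n) * swap_mat n m + kron_mat (1\<^sub>m m) A * swap_mat n m"
    unfolding kron_sum_def using A B by (subst add_mult_distrib_mat[of _ "m * n" "m * n" _ _ "n * m"]) auto
  also have "\<dots> = swap_mat n m * kron_mat (1\<^sub>m n) B + swap_mat n m * kron_mat A (1\<^sub>m m)"
    using swap_natural[OF one_carrier_mat B, of n] swap_natural[OF A one_carrier_mat, of m] by simp
  also have "\<dots> = swap_mat n m * (kron_mat (1\<^sub>m n) B + kron_mat A (1\<^sub>m m))"
    using A B by (intro mult_add_distrib_mat[symmetric, of _ "m * n" "n * m" _ "n * m"]) auto
  also have "kron_mat (1\<^sub>m n) B + kron_mat A (1\<^sub>m m) = kron_sum A B"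
    unfolding kron_sum_def using A B by (simp add: comm_add_mat[of _ "n * m" "n * m"])
  finally show ?thesis .
qed

lemma ev_kron_inverse:
  assumes A: "A \<in> carrier_mat n n" and B: "B \<in> carrier_mat n n" and AB: "A * B = 1\<^sub>m n"
  shows "ev_mat n * kron_mat (transpose_mat A) B = ev_mat n"
proof -
  have "kron_mat (transpose_mat A) B = kron_mat (transpose_mat A) (1\<^sub>m n) * kron_mat (1\<^sub>m n) B"
    using kron_mult[of "transpose_mat A" n n "1\<^sub>m n" n "1\<^sub>m n" n n B n] A B by simp
  then have "ev_mat n * kron_mat (transpose_mat A) B = ev_mat n * kron_mat (transpose_mat A) (1\<^sub>m n) * kron_mat (1\<^sub>m n) B"
    using A B by (simp add: assoc_mult_mat[of _ 1 "n * n" _ "n * n" _ "n * n"])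
  also have "\<dots> = ev_mat n * (kron_mat (1\<^sub>m n) A * kron_mat (1\<^sub>m n) B)"
    unfolding ev_dinatural[OF A] using A B by (intro assoc_mult_mat[of _ 1 "n * n" _ "n * n" _ "n * n"]) auto
  also have "kron_mat (1\<^sub>m n) A * kron_mat (1\<^sub>m n) B = 1\<^sub>m (n * n)"
    using kron_mult[of "1\<^sub>m n" n n "1\<^sub>m n" n A n n B n] A B AB by (simp add: kron_one)
  finally show ?thesis by (simp add: right_mult_one_mat[OF ev_coev_carrier(1)])
qed

text \<open>
  The evaluation is a morphism because \<open>D\<close> acts on the dual by minus its transpose, and the
  evaluation exchanges a transpose on the left with the matrix itself on the right.
\<close>

lemma ev_kron_sum:
  assumes D: "D \<in> carrier_mat n n"
  shows "ev_mat n * kron_sum (- transpose_mat D) D = 0\<^sub>m 1 (n * n)"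
proof -
  have "ev_mat n * kron_sum (- transpose_mat D) D
    = ev_mat n * kron_mat (- transpose_mat D) (1\<^sub>m n) + ev_mat n * kron_mat (1\<^sub>m n) D"
    unfolding kron_sum_def using D by (subst mult_add_distrib_mat[of _ 1 "n * n" _ "n * n"]) auto
  also have "ev_mat n * kron_mat (- transpose_mat D) (1\<^sub>m n) = - (ev_mat n * kron_mat (1\<^sub>m n) D)"
    using carrier_matD[OF D] ev_dinatural[OF D] by (simp add: kron_uminus mat_mult_minus ev_mat_def)
  also have "- (ev_mat n * kron_mat (1\<^sub>m n) D) + ev_mat n * kron_mat (1\<^sub>m n) D = 0\<^sub>m 1 (n * n)"
    by (intro uminus_l_inv_mat mult_carrier_mat[OF ev_coev_carrier(1)] kron_carrier(1)[OF one_carrier_mat D])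
  finally show ?thesis .
qed

lemma shs_homD:
  assumes "is_shs X" "is_shs Y" "f \<in> shs_hom X Y"
  shows "f \<in> carrier_mat (shs_dim Y) (shs_dim X)" "l \<noteq> 0 \<Longrightarrow> f * shs_rep X l = shs_rep Y l * f"
    "shs_D Y * f = f * shs_D X"
  using assms(3) by (auto simp: shs_hom_iff[OF assms(1,2)])

lemma SHS_matrix_tensor_category: "matrix_tensor_category SHS shs_dim"
proof
  note [simp] = SHS_def is_shs_unit is_shs_tensor is_shs_dual
  have dims [simp]: "shs_dim (shs_tensor U V) = shs_dim U * shs_dim V" "shs_dim shs_unit = 1"
    "shs_dim (shs_dual V) = shs_dim V" for U V by (simp_all add: shs_tensor_def shs_unit_def shs_dual_def)
  have reps: "shs_rep (shs_tensor U V) l = kron_mat (shs_rep U l) (shs_rep V l)" "shs_rep shs_unit l = 1\<^sub>m 1"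
    "shs_rep (shs_dual V) l = transpose_mat (shs_rep V (inverse l))" for U V l
    by (simp_all add: shs_tensor_def shs_unit_def shs_dual_def)
  note D = shs_D_tensor shs_D_unit shs_D_dual
  show "f \<in> Hom SHS X Y \<Longrightarrow> f \<in> carrier_mat (shs_dim Y) (shs_dim X)" for f X Y
    using shs_hom_carrier by simp
  fix X assume "X \<in> Obj SHS"
  then have X: "is_shs X" by simp
  note x = shs_facts[OF X]
  show "1\<^sub>m (shs_dim X) \<in> Hom SHS X X"
    using left_mult_one_mat[OF x(1)] right_mult_one_mat[OF x(1)] x(7) by (simp add: shs_hom_iff[OF X X])
  have ks1: "kron_sum (0\<^sub>m 1 1) (shs_D X) = shs_D X" "kron_sum (shs_D X) (0\<^sub>m 1 1) = shs_D X"
  proof -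
    have z: "kron_mat (0\<^sub>m 1 1) (1\<^sub>m (shs_dim X)) = (0\<^sub>m (shs_dim X) (shs_dim X) :: real mat)"
      "kron_mat (1\<^sub>m (shs_dim X)) (0\<^sub>m 1 1) = (0\<^sub>m (shs_dim X) (shs_dim X) :: real mat)"
      by (rule eq_matI; simp)+
    show "kron_sum (0\<^sub>m 1 1) (shs_D X) = shs_D X" "kron_sum (shs_D X) (0\<^sub>m 1 1) = shs_D X"
      unfolding kron_sum_def using x(7) z kron_one_left[of "shs_D X"] kron_one_right[of "shs_D X"] by simp_all
  qed
  show "1\<^sub>m (shs_dim X) \<in> Hom SHS (TensO SHS (UnitO SHS) X) X" "1\<^sub>m (shs_dim X) \<in> Hom SHS X (TensO SHS (UnitO SHS) X)"
    using left_mult_one_mat[OF x(1)] right_mult_one_mat[OF x(1)] x(7) X kron_one_left[of "shs_rep X _"]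
    by (simp_all add: shs_hom_iff[OF is_shs_tensor[OF is_shs_unit X] X] shs_hom_iff[OF X is_shs_tensor[OF is_shs_unit X]]
      reps D ks1 del: One_nat_def)
  show "1\<^sub>m (shs_dim X) \<in> Hom SHS (TensO SHS X (UnitO SHS)) X" "1\<^sub>m (shs_dim X) \<in> Hom SHS X (TensO SHS X (UnitO SHS))"
    using left_mult_one_mat[OF x(1)] right_mult_one_mat[OF x(1)] x(7) X kron_one_right[of "shs_rep X _"]
    by (simp_all add: shs_hom_iff[OF is_shs_tensor[OF X is_shs_unit] X] shs_hom_iff[OF X is_shs_tensor[OF X is_shs_unit]]
      reps D ks1 del: One_nat_def)
  have EVc: "ev_mat (shs_dim X) \<in> carrier_mat 1 (shs_dim X * shs_dim X)" by simp
  show "ev_mat (shs_dim X) \<in> Hom SHS (TensO SHS (DualO SHS X) X) (UnitO SHS)"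
  proof -
    have "ev_mat (shs_dim X) * kron_mat (transpose_mat (shs_rep X (inverse l))) (shs_rep X l) = 1\<^sub>m 1 * ev_mat (shs_dim X)"
      if l: "l \<noteq> 0" for l
      using ev_kron_inverse[OF x(1) x(1) x(5)[OF l]] l left_mult_one_mat[OF EVc] by simp
    moreover have "0\<^sub>m 1 1 * ev_mat (shs_dim X) = ev_mat (shs_dim X) * kron_sum (- transpose_mat (shs_D X)) (shs_D X)"
      unfolding ev_kron_sum[OF x(7)] by (rule left_mult_zero_mat[OF EVc])
    ultimately show ?thesis
      using X by (simp add: shs_hom_iff[OF is_shs_tensor[OF is_shs_dual[OF X] X] is_shs_unit] reps D del: One_nat_def)
  qed
  show "coev_mat (shs_dim X) \<in> Hom SHS (UnitO SHS) (TensO SHS X (DualO SHS X))"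
  proof -
    have COc: "coev_mat (shs_dim X) \<in> carrier_mat (shs_dim X * shs_dim X) 1" by simp
    have "coev_mat (shs_dim X) * 1\<^sub>m 1 = kron_mat (shs_rep X l) (transpose_mat (shs_rep X (inverse l))) * coev_mat (shs_dim X)"
      if l: "l \<noteq> 0" for l
    proof -
      have il: "inverse l \<noteq> 0" using l by simp
      note c = x(1)[OF l] x(1)[OF il]
      have "kron_mat (shs_rep X l) (transpose_mat (shs_rep X (inverse l))) * coev_mat (shs_dim X)
        = transpose_mat (ev_mat (shs_dim X) * kron_mat (transpose_mat (shs_rep X l)) (shs_rep X (inverse l)))"
        using c by (subst transpose_mult[OF EVc]) (auto simp: kron_transpose transpose_ev)
      also have "\<dots> = coev_mat (shs_dim X)" unfolding ev_kron_inverse[OF c x(4)[OF l]] transpose_ev ..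
      finally show ?thesis using right_mult_one_mat[OF COc] by simp
    qed
    moreover have "kron_sum (shs_D X) (- transpose_mat (shs_D X)) * coev_mat (shs_dim X) = coev_mat (shs_dim X) * 0\<^sub>m 1 1"
    proof -
      have mD: "- shs_D X \<in> carrier_mat (shs_dim X) (shs_dim X)" using x(7) by simp
      have tt: "transpose_mat (- M) = - transpose_mat M" for M :: "real mat" by (rule eq_matI) auto
      have c: "kron_sum (- transpose_mat (- shs_D X)) (- shs_D X) \<in> carrier_mat (shs_dim X * shs_dim X) (shs_dim X * shs_dim X)"
        using x(7) by (intro kron_sum_carrier) auto
      have "transpose_mat (kron_sum (- transpose_mat (- shs_D X)) (- shs_D X)) = kron_sum (shs_D X) (- transpose_mat (shs_D X))"
        unfolding kron_sum_def using x(7)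
        by (subst transpose_add[of _ "shs_dim X * shs_dim X" "shs_dim X * shs_dim X"]) (auto simp: kron_transpose tt)
      then have "kron_sum (shs_D X) (- transpose_mat (shs_D X)) * coev_mat (shs_dim X)
        = transpose_mat (ev_mat (shs_dim X) * kron_sum (- transpose_mat (- shs_D X)) (- shs_D X))"
        by (subst transpose_mult[OF EVc c]) (simp add: transpose_ev)
      also have "\<dots> = 0\<^sub>m (shs_dim X * shs_dim X) 1" unfolding ev_kron_sum[OF mD] by (rule eq_matI) auto
      finally show ?thesis using right_mult_zero_mat[OF COc, of 1] by simp
    qed
    ultimately show ?thesis
      using X by (simp add: shs_hom_iff[OF is_shs_unit is_shs_tensor[OF X is_shs_dual[OF X]]] reps D del: One_nat_def)
  qed
  show "DualO SHS X \<in> Obj SHS" using X by simp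
  fix Y assume "Y \<in> Obj SHS"
  then have Y: "is_shs Y" by simp
  note y = shs_facts[OF Y]
  show "TensO SHS X Y \<in> Obj SHS" using X Y by simp
  show "0\<^sub>m (shs_dim Y) (shs_dim X) \<in> Hom SHS X Y"
    using left_mult_zero_mat[OF y(1)] right_mult_zero_mat[OF x(1)] left_mult_zero_mat[OF x(1)] right_mult_zero_mat[OF y(1)] x(7) y(7)
    by (simp add: shs_hom_iff[OF X Y])
  show "swap_mat (shs_dim X) (shs_dim Y) \<in> Hom SHS (TensO SHS X Y) (TensO SHS Y X)"
    using X Y swap_natural[OF x(1) y(1)] swap_kron_sum[OF x(7) y(7)]
    by (simp add: shs_hom_iff[OF is_shs_tensor[OF X Y] is_shs_tensor[OF Y X]] reps D)
  { fix f assume "f \<in> Hom SHS X Y"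
    then have "f \<in> shs_hom X Y" by simp
    note f = shs_homD[OF X Y this]
    show "- f \<in> Hom SHS X Y"
      using f carrier_matD[OF f(1)] carrier_matD[OF x(1)] carrier_matD[OF y(1)] carrier_matD[OF x(7)] carrier_matD[OF y(7)]
      by (simp add: shs_hom_iff[OF X Y] mat_minus_mult mat_mult_minus)
    show "transpose_mat f \<in> Hom SHS (DualO SHS Y) (DualO SHS X)"
    proof -
      have "transpose_mat f * transpose_mat (shs_rep Y (inverse l)) = transpose_mat (shs_rep X (inverse l)) * transpose_mat f"
        if l: "l \<noteq> 0" for l
      proof -
        have il: "inverse l \<noteq> 0" using l by simp
        show ?thesis using transpose_mult[OF y(1)[OF il] f(1)] transpose_mult[OF f(1) x(1)[OF il]] f(2)[OF il] by simp
      qed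
      moreover have "transpose_mat (shs_D X) * transpose_mat f = transpose_mat f * transpose_mat (shs_D Y)"
        using transpose_mult[OF y(7) f(1)] transpose_mult[OF f(1) x(7)] f(3) by simp
      ultimately show ?thesis using f(1) carrier_matD[OF f(1)] carrier_matD[OF x(7)] carrier_matD[OF y(7)]
        by (simp add: shs_hom_iff[OF is_shs_dual[OF Y] is_shs_dual[OF X]] reps D mat_minus_mult mat_mult_minus)
    qed
    fix g assume "g \<in> Hom SHS X Y"
    then have "g \<in> shs_hom X Y" by simp
    note g = shs_homD[OF X Y this]
    show "f + g \<in> Hom SHS X Y"
      using f g add_mult_distrib_mat[OF f(1) g(1) x(1)] mult_add_distrib_mat[OF y(1) f(1) g(1)]
        add_mult_distrib_mat[OF f(1) g(1) x(7)] mult_add_distrib_mat[OF y(7) f(1) g(1)]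
      by (simp add: shs_hom_iff[OF X Y]) }
  fix Z assume "Z \<in> Obj SHS"
  then have Z: "is_shs Z" by simp
  note z = shs_facts[OF Z]
  let ?n = "shs_dim X * shs_dim Y * shs_dim Z"
  have rc: "kron_mat (shs_rep X l) (kron_mat (shs_rep Y l) (shs_rep Z l)) \<in> carrier_mat ?n ?n" if l: "l \<noteq> 0" for l
    using kron_carrier(1)[OF x(1)[OF l] kron_carrier(1)[OF y(1)[OF l] z(1)[OF l]]] by (simp add: mult.assoc)
  have Dc: "kron_sum (shs_D X) (kron_sum (shs_D Y) (shs_D Z)) \<in> carrier_mat ?n ?n"
    using kron_sum_carrier[OF x(7) kron_sum_carrier[OF y(7) z(7)]] by (simp add: mult.assoc)
  show "1\<^sub>m ?n \<in> Hom SHS (TensO SHS (TensO SHS X Y) Z) (TensO SHS X (TensO SHS Y Z))"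
    "1\<^sub>m ?n \<in> Hom SHS (TensO SHS X (TensO SHS Y Z)) (TensO SHS (TensO SHS X Y) Z)"
    using X Y Z left_mult_one_mat[OF rc] right_mult_one_mat[OF rc] left_mult_one_mat[OF Dc] right_mult_one_mat[OF Dc]
    by (simp_all add: shs_hom_iff reps D kron_assoc kron_sum_assoc[OF x(7) y(7) z(7)] mult.assoc)
  { fix f g assume "f \<in> Hom SHS X Y" "g \<in> Hom SHS Y Z"
    then have "f \<in> shs_hom X Y" "g \<in> shs_hom Y Z" by simp_all
    note f = shs_homD[OF X Y this(1)] and g = shs_homD[OF Y Z this(2)]
    have "g * f * shs_rep X l = shs_rep Z l * (g * f)" if l: "l \<noteq> 0" for l
    proof -
      have "g * f * shs_rep X l = g * (shs_rep Y l * f)" unfolding f(2)[OF l, symmetric] by (rule assoc_mult_mat[OF g(1) f(1) x(1)[OF l]])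
      also have "\<dots> = g * shs_rep Y l * f" by (rule assoc_mult_mat[OF g(1) y(1)[OF l] f(1), symmetric])
      also have "\<dots> = shs_rep Z l * (g * f)" unfolding g(2)[OF l] by (rule assoc_mult_mat[OF z(1)[OF l] g(1) f(1)])
      finally show ?thesis .
    qed
    moreover have "shs_D Z * (g * f) = g * f * shs_D X"
    proof -
      have "shs_D Z * (g * f) = g * shs_D Y * f" unfolding g(3)[symmetric] by (rule assoc_mult_mat[OF z(7) g(1) f(1), symmetric])
      also have "\<dots> = g * (f * shs_D X)" unfolding f(3)[symmetric] by (rule assoc_mult_mat[OF g(1) y(7) f(1)])
      also have "\<dots> = g * f * shs_D X" by (rule assoc_mult_mat[OF g(1) f(1) x(7), symmetric])
      finally show ?thesis .
    qed
    ultimately show "g * f \<in> Hom SHS X Z" using f(1) g(1) by (simp add: shs_hom_iff[OF X Z]) }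
  fix U f g assume "U \<in> Obj SHS" and "f \<in> Hom SHS X Z" "g \<in> Hom SHS Y U"
  then have U: "is_shs U" and fg: "f \<in> shs_hom X Z" "g \<in> shs_hom Y U" by simp_all
  note f = shs_homD[OF X Z fg(1)] and g = shs_homD[OF Y U fg(2)]
  note u = shs_facts[OF U]
  have "kron_mat f g * kron_mat (shs_rep X l) (shs_rep Y l) = kron_mat (shs_rep Z l) (shs_rep U l) * kron_mat f g" if l: "l \<noteq> 0" for l
    using kron_mult[OF f(1) x(1)[OF l] g(1) y(1)[OF l]] kron_mult[OF z(1)[OF l] f(1) u(1)[OF l] g(1)] f(2)[OF l] g(2)[OF l] by simp
  moreover have "kron_sum (shs_D Z) (shs_D U) * kron_mat f g = kron_mat f g * kron_sum (shs_D X) (shs_D Y)"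
    using kron_sum_mult_kron[OF z(7) u(7) f(1) g(1)] kron_mult_kron_sum[OF x(7) y(7) f(1) g(1)] f(3) g(3) by simp
  ultimately show "kron_mat f g \<in> Hom SHS (TensO SHS X Y) (TensO SHS Z U)"
    using X Y Z U kron_carrier(1)[OF f(1) g(1)] by (simp add: shs_hom_iff reps D)
qed (simp_all add: SHS_def shs_tensor_def shs_dual_def is_shs_unit, simp add: shs_unit_def)

section \<open>From Hodge data to mixed Hodge structures\<close>

abbreviation wt :: "int \<times> int \<Rightarrow> int" where
  "wt u \<equiv> fst u + snd u"

text \<open>
  The columns of \<open>T\<close> are a basis of the complexification, of types \<open>t\<close>. The matrix of complex
  conjugation in this basis is \<open>T\<^sup>-\<^sup>1 cnj T\<close>, so that the second condition says that conjugation
  exchanges \<open>(p, q)\<close> and \<open>(q, p)\<close>; the last one says that \<open>D\<close> lowers both degrees.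
\<close>

definition hodge_datum :: "nat \<Rightarrow> complex mat \<Rightarrow> complex mat \<Rightarrow> (nat \<Rightarrow> int \<times> int) \<Rightarrow> real mat \<Rightarrow> bool" where
  "hodge_datum n T T' t D \<longleftrightarrow> inverse_mats n T T' \<and> supp_in t (swap_types t) same_type (T' * cnj_mat T)
     \<and> D \<in> carrier_mat n n \<and> supp_in t t both_neg (T' * cm D * T)"

definition mhs_of :: "nat \<Rightarrow> complex mat \<Rightarrow> (nat \<Rightarrow> int \<times> int) \<Rightarrow> real mat \<Rightarrow> mhs" where
  "mhs_of n T t D = \<lparr>mhs_dim = n,
     weight_fil = (\<lambda>k. {v \<in> carrier_vec n. map_vec complex_of_real v \<in> colspan T (\<lambda>i. wt (t i) \<le> k)}),
     hodge_fil = (\<lambda>p. colspan (mexp n \<i> (cm D) * T) (\<lambda>i. p \<le> fst (t i)))\<rparr>"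

lemma nilpotent_similar:
  assumes T: "inverse_mats n T T'" and X: "X \<in> carrier_mat n n" and Y: "nilpotent_mat n Y" and XT: "X * T = T * Y"
  shows "nilpotent_mat n (X :: 'a :: field mat)"
proof -
  note Tc = inverse_matsD[OF T] and Yc = nil_carrier[OF Y]
  obtain m where m: "Y ^\<^sub>m m = 0\<^sub>m n n" using Y by (auto simp: nilpotent_mat_def)
  have "X ^\<^sub>m m * T = T * Y ^\<^sub>m m"
    using peval_intertwine[OF X Yc Tc(1) XT, of "[:0, 1:] ^ m"]
    unfolding peval_power[OF X] peval_power[OF Yc] peval_X[OF X] peval_X[OF Yc] .
  also have "\<dots> = 0\<^sub>m n n" unfolding m using Tc by simp
  finally have "X ^\<^sub>m m * T * T' = 0\<^sub>m n n * T'" by simp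
  moreover have "X ^\<^sub>m m * T * T' = X ^\<^sub>m m * (T * T')" using Tc X by (intro assoc_mult_mat[of _ n n _ n _ n]) auto
  ultimately have "X ^\<^sub>m m = 0\<^sub>m n n" using Tc X by (simp add: right_mult_one_mat[of _ n n])
  then show ?thesis using X by (auto simp: nilpotent_mat_def)
qed

locale datum =
  fixes n :: nat and T T' :: "complex mat" and t :: "nat \<Rightarrow> int \<times> int" and D :: "real mat"
  assumes datum: "hodge_datum n T T' t D"
begin

definition \<Delta> :: "complex mat" where
  "\<Delta> = T' * cm D * T"

lemma inv: "inverse_mats n T T'" and D: "D \<in> carrier_mat n n"
  and conj_supp: "supp_in t (swap_types t) same_type (T' * cnj_mat T)"
  and Delta_supp: "supp_in t t both_neg \<Delta>"
  using datum by (auto simp: hodge_datum_def \<Delta>_def)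

lemmas T = inverse_matsD[OF inv]

lemma Delta: "\<Delta> \<in> carrier_mat n n"
  using T D by (auto simp: \<Delta>_def)

lemma D_mult_T: "cm D * T = T * \<Delta>"
proof -
  have "T * \<Delta> = T * (T' * (cm D * T))"
    unfolding \<Delta>_def using T D by (subst assoc_mult_mat[of T' n n "cm D" n T n]) auto
  also have "\<dots> = T * T' * (cm D * T)" using T D by (intro assoc_mult_mat[symmetric, of _ n n _ n _ n]) auto
  finally show ?thesis using T D by simp
qed

lemma nil_Delta: "nilpotent_mat n \<Delta>"
  by (rule supp_in_nilpotent[OF Delta Delta_supp]) simp

lemma nil_D: "nilpotent_mat n (cm D)"
  by (rule nilpotent_similar[OF inv _ nil_Delta D_mult_T]) (use D in simp)

lemma mexp_mult_T: "mexp n c (cm D) * T = T * mexp n c \<Delta>"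
  unfolding mexp_def by (rule fps_mat_intertwine[OF nil_D nil_Delta T(1) D_mult_T])

text \<open>
  The columns of \<open>E \<i>\<close> split the Hodge filtration, and those of \<open>E (- \<i>)\<close> its conjugate.
\<close>

abbreviation E :: "complex \<Rightarrow> complex mat" where
  "E c \<equiv> mexp n c (cm D) * T"

lemma E_inv: "inverse_mats n (E c) (mexp n (- c) \<Delta> * T')"
  unfolding mexp_mult_T by (rule inverse_mats_mult[OF inv mexp_inverse[OF nil_Delta]])

lemma E_inv': "inverse_mats n (E c) (T' * mexp n (- c) (cm D))"
  by (rule inverse_mats_mult[OF mexp_inverse[OF nil_D] inv])

lemma E_carrier: "E c \<in> carrier_mat n n"
  using inverse_matsD[OF E_inv] by simp

lemma mexp_Delta_supp: "supp_in t t both_neg (mexp n c \<Delta> - 1\<^sub>m n)"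
  by (rule supp_in_mexp[OF Delta Delta_supp]) auto

end

subsection \<open>Real points of the weight filtration\<close>

lemma mult_vec_support:
  fixes A :: "'a :: field mat"
  assumes "i < dim_row A" "x \<in> carrier_vec (dim_col A)" "(A *\<^sub>v x) $ i \<noteq> 0"
  obtains j where "j < dim_col A" "A $$ (i, j) \<noteq> 0" "x $ j \<noteq> 0"
proof -
  have "(A *\<^sub>v x) $ i = (\<Sum>j<dim_col A. A $$ (i, j) * x $ j)"
    using assms by (auto simp: scalar_prod_def atLeast0LessThan)
  then have "\<exists>j<dim_col A. A $$ (i, j) * x $ j \<noteq> 0"
    using assms(3) by (metis (no_types, lifting) lessThan_iff sum.neutral)
  then show ?thesis using that by auto
qed

text \<open>
  Here \<open>U' g T\<close> is the matrix of \<open>g\<close> with respect to the bases \<open>T\<close> and \<open>U\<close>. A linear map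
  respects spans of basis vectors iff certain entries of its matrix vanish.
\<close>

lemma colspan_mult:
  assumes T: "inverse_mats n T T'" and U: "inverse_mats m U U'" and g: "g \<in> carrier_mat m n"
    and PQ: "\<And>i j. i < m \<Longrightarrow> j < n \<Longrightarrow> (U' * g * T) $$ (i, j) \<noteq> 0 \<Longrightarrow> Q j \<Longrightarrow> P i" and v: "v \<in> colspan T Q"
  shows "g *\<^sub>v v \<in> colspan U P"
proof -
  note Tc = inverse_matsD[OF T] and Uc = inverse_matsD[OF U]
  obtain x where x: "v = T *\<^sub>v x" "x \<in> carrier_vec n" "\<And>i. i < n \<Longrightarrow> x $ i \<noteq> 0 \<Longrightarrow> Q i"
    using v Tc by (auto simp: colspan_def)
  have e: "U' *\<^sub>v (g *\<^sub>v v) = (U' * g * T) *\<^sub>v x"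
    unfolding x(1) using Tc Uc g x(2) by (simp add: assoc_mult_mat_vec[of _ m n _ n] assoc_mult_mat_vec[of _ m m _ n] assoc_mult_mat[of _ m m _ n _ n])
  show ?thesis unfolding colspan_iff[OF U]
  proof (intro conjI allI impI)
    show "g *\<^sub>v v \<in> carrier_vec m" unfolding x(1) using Tc g x(2) by auto
    fix i assume i: "i < m" and ne: "(U' *\<^sub>v (g *\<^sub>v v)) $ i \<noteq> 0"
    have d: "dim_row (U' * g * T) = m" "dim_col (U' * g * T) = n" using Uc Tc by auto
    obtain j where "j < n" "(U' * g * T) $$ (i, j) \<noteq> 0" "x $ j \<noteq> 0"
      using mult_vec_support[of i "U' * g * T" x] i x(2) ne unfolding d e by blast
    then show "P i" using PQ i x(3) by blast
  qed
qed

lemma colspan_mult_conv: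
  assumes T: "inverse_mats n T T'" and U: "inverse_mats m U U'" and g: "g \<in> carrier_mat m n"
    and map: "g *\<^sub>v col T j \<in> colspan U P" and ij: "i < m" "j < n" and ne: "(U' * g * T) $$ (i, j) \<noteq> 0"
  shows "P i"
proof -
  note Tc = inverse_matsD[OF T] and Uc = inverse_matsD[OF U]
  have "(U' * g * T) $$ (i, j) = (U' *\<^sub>v (g *\<^sub>v col T j)) $ i"
  proof -
    have "U' *\<^sub>v (g *\<^sub>v col T j) = (U' * g) *\<^sub>v col T j"
      using Uc g Tc ij by (simp add: assoc_mult_mat_vec[of _ m m _ n])
    moreover have "col (U' * g * T) j = (U' * g) *\<^sub>v col T j"
      using ij Tc by (intro col_mult2[of _ m n _ n]) (use Uc g in auto)
    moreover have "(U' * g * T) $$ (i, j) = col (U' * g * T) j $ i" using ij Uc Tc by simp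
    ultimately show ?thesis by simp
  qed
  then show ?thesis using map ij ne unfolding colspan_iff[OF U] by simp
qed

abbreviation cv :: "real vec \<Rightarrow> complex vec" where
  "cv \<equiv> map_vec complex_of_real"

lemma real_points_subspace:
  assumes "is_subspace n V"
  shows "is_subspace n {v \<in> carrier_vec n. cv v \<in> V}"
proof (rule is_subspaceI)
  note V = is_subspaceD[OF assms]
  have "cv (0\<^sub>v n) = 0\<^sub>v n" by (rule eq_vecI) auto
  then show "0\<^sub>v n \<in> {v \<in> carrier_vec n. cv v \<in> V}" unfolding mem_Collect_eq using V(2) zero_carrier_vec by metis
  fix u v assume uv: "u \<in> {v \<in> carrier_vec n. cv v \<in> V}" "v \<in> {v \<in> carrier_vec n. cv v \<in> V}"
  then have "cv (u + v) = cv u + cv v" by (intro eq_vecI) auto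
  then show "u + v \<in> {v \<in> carrier_vec n. cv v \<in> V}" using uv V(3) by simp
next
  note V = is_subspaceD[OF assms]
  fix c v assume v: "v \<in> {v \<in> carrier_vec n. cv v \<in> V}"
  then have "cv (c \<cdot>\<^sub>v v) = complex_of_real c \<cdot>\<^sub>v cv v" by (intro eq_vecI) auto
  then show "c \<cdot>\<^sub>v v \<in> {v \<in> carrier_vec n. cv v \<in> V}" using v V(4) by simp
qed auto

lemma vec_Re_Im: "v \<in> carrier_vec n \<Longrightarrow> v = cv (map_vec Re v) + \<i> \<cdot>\<^sub>v cv (map_vec Im v)"
  by (rule eq_vecI) (auto simp: complex_eq_iff)

lemma cv_Re_Im_mem:
  assumes sub: "is_subspace n V" and conj: "\<And>v. v \<in> V \<Longrightarrow> map_vec cnj v \<in> V" and v: "v \<in> V"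
  shows "cv (map_vec Re v) \<in> V" "cv (map_vec Im v) \<in> V"
proof -
  note V = is_subspaceD[OF sub]
  have vc: "v \<in> carrier_vec n" using V(1) v by auto
  have "cv (map_vec Re v) = (1 / 2) \<cdot>\<^sub>v (v + map_vec cnj v)"
    using vc by (intro eq_vecI) (auto simp: complex_eq_iff)
  then show "cv (map_vec Re v) \<in> V" using V(3,4) v conj by simp
  have "cv (map_vec Im v) = (- \<i> / 2) \<cdot>\<^sub>v (v - map_vec cnj v)"
    using vc by (intro eq_vecI) (auto simp: complex_eq_iff)
  then show "cv (map_vec Im v) \<in> V" using V(4,5) v conj by simp
qed

text \<open>
  A subspace that is stable under conjugation contains the real and imaginary parts of its elements.
\<close>

lemma complexification_real_points:
  assumes sub: "is_subspace n V" and conj: "\<And>v. v \<in> V \<Longrightarrow> map_vec cnj v \<in> V"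
  shows "subspace_complexification n {v \<in> carrier_vec n. cv v \<in> V} = V"
proof
  note V = is_subspaceD[OF sub]
  let ?S = "cv ` {v \<in> carrier_vec n. cv v \<in> V}"
  show "lin_span n ?S \<subseteq> V" by (rule lin_span_least[OF sub]) auto
  have Sc: "?S \<subseteq> carrier_vec n" using V(1) by auto
  note L = is_subspaceD[OF lin_span_subspace[OF Sc]]
  show "V \<subseteq> lin_span n ?S"
  proof
    fix v assume v: "v \<in> V"
    then have vc: "v \<in> carrier_vec n" using V(1) by auto
    have "cv (map_vec Re v) \<in> ?S" "cv (map_vec Im v) \<in> ?S"
      using cv_Re_Im_mem[OF sub conj v] vc by auto
    then have "cv (map_vec Re v) + \<i> \<cdot>\<^sub>v cv (map_vec Im v) \<in> lin_span n ?S"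
      using lin_span_superset[OF Sc] L(3,4) by (meson subsetD)
    then show "v \<in> lin_span n ?S" using vec_Re_Im[OF vc] by simp
  qed
qed

context datum
begin

abbreviation Wc :: "int \<Rightarrow> complex vec set" where
  "Wc k \<equiv> colspan T (\<lambda>i. wt (t i) \<le> k)"

lemma cnj_mult_vec: "A \<in> carrier_mat n n \<Longrightarrow> v \<in> carrier_vec n \<Longrightarrow> map_vec cnj (A *\<^sub>v v) = cnj_mat A *\<^sub>v map_vec cnj v"
  by (rule eq_vecI) (auto simp: scalar_prod_def)

lemma colspan_cnj:
  assumes "\<And>i j. i < n \<Longrightarrow> j < n \<Longrightarrow> t i = prod.swap (t j) \<Longrightarrow> P j \<Longrightarrow> Q i" "v \<in> colspan T P"
  shows "map_vec cnj v \<in> colspan T Q"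
proof -
  obtain x where x: "v = T *\<^sub>v x" "x \<in> carrier_vec n" "\<And>i. i < n \<Longrightarrow> x $ i \<noteq> 0 \<Longrightarrow> P i"
    using assms(2) T by (auto simp: colspan_def)
  have cx: "map_vec cnj x \<in> carrier_vec n" using x by simp
  have M: "T' * cnj_mat T \<in> carrier_mat n n" using T by auto
  have "T' *\<^sub>v map_vec cnj v = T' * cnj_mat T *\<^sub>v map_vec cnj x"
    using T cx x by (simp add: cnj_mult_vec assoc_mult_mat_vec[of _ n n _ n])
  moreover have "Q i" if i: "i < n" and ne: "(T' * cnj_mat T *\<^sub>v map_vec cnj x) $ i \<noteq> 0" for i
  proof -
    obtain j where j: "j < n" "(T' * cnj_mat T) $$ (i, j) \<noteq> 0" "map_vec cnj x $ j \<noteq> 0"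
      using mult_vec_support[of i "T' * cnj_mat T" "map_vec cnj x"] i cx ne carrier_matD[OF M] by metis
    have "t i = prod.swap (t j)"
      using supp_inD[OF conj_supp _ _ j(2)] carrier_matD[OF T(1)] carrier_matD[OF T(2)] i j(1) by (simp add: prod_eq_iff)
    then show ?thesis using assms(1) i j x(2,3) by simp
  qed
  ultimately show ?thesis unfolding colspan_iff[OF inv] using x T by auto
qed

lemma Wc_cnj: "v \<in> Wc k \<Longrightarrow> map_vec cnj v \<in> Wc k"
  by (rule colspan_cnj) auto

lemma Wc_subspace: "is_subspace n (Wc k)"
  using colspan_subspace[OF T(1)] .

lemma W_complexification: "subspace_complexification n (weight_fil (mhs_of n T t D) k) = Wc k"
  using complexification_real_points[OF Wc_subspace Wc_cnj] by (simp add: mhs_of_def)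

text \<open>
  The Hodge filtration is \<open>exp (\<i> D)\<close> applied to the one of the bigrading, and its conjugate is
  \<open>exp (- \<i> D)\<close> applied to the other one.
\<close>

lemma conj_hodge: "conj_fil (hodge_fil (mhs_of n T t D)) p = colspan (E (- \<i>)) (\<lambda>i. p \<le> snd (t i))"
proof -
  have conjv: "conjugate v = map_vec cnj v" for v :: "complex vec"
    by (rule eq_vecI) auto
  have cE: "map_vec cnj (E c *\<^sub>v x) = mexp n (cnj c) (cm D) *\<^sub>v map_vec cnj (T *\<^sub>v x)" if "x \<in> carrier_vec n" for c x
  proof -
    note m = mexp_carrier[OF nil_D, of c]
    have "E c *\<^sub>v x = mexp n c (cm D) *\<^sub>v (T *\<^sub>v x)" using m T that by (intro assoc_mult_mat_vec) auto
    then show ?thesis using m T that by (simp add: cnj_mult_vec mexp_cnj[OF nil_D] cnj_mat_cm)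
  qed
  have key: "map_vec cnj v \<in> colspan (E (cnj c)) Q"
    if v: "v \<in> colspan (E c) P" and PQ: "\<And>i j. i < n \<Longrightarrow> j < n \<Longrightarrow> t i = prod.swap (t j) \<Longrightarrow> P j \<Longrightarrow> Q i" for v c P Q
  proof -
    obtain x where x: "v = E c *\<^sub>v x" "x \<in> carrier_vec n" "\<And>i. i < n \<Longrightarrow> x $ i \<noteq> 0 \<Longrightarrow> P i"
      using v carrier_matD[OF E_carrier[of c]] unfolding colspan_def by auto
    have "T *\<^sub>v x \<in> colspan T P" using x T by (auto simp: colspan_def)
    then have "map_vec cnj (T *\<^sub>v x) \<in> colspan T Q" by (rule colspan_cnj[rotated]) (rule PQ)
    then obtain y where y: "map_vec cnj (T *\<^sub>v x) = T *\<^sub>v y" "y \<in> carrier_vec n" "\<And>i. i < n \<Longrightarrow> y $ i \<noteq> 0 \<Longrightarrow> Q i"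
      using T by (auto simp: colspan_def)
    have "map_vec cnj v = E (cnj c) *\<^sub>v y"
      unfolding x(1) cE[OF x(2)] y(1) using mexp_carrier[OF nil_D, of "cnj c"] T y(2)
      by (intro assoc_mult_mat_vec[symmetric]) auto
    then show ?thesis using y carrier_matD[OF E_carrier[of "cnj c"]] unfolding colspan_def by auto
  qed
  show ?thesis
  proof (intro equalityI subsetI)
    fix v assume "v \<in> conj_fil (hodge_fil (mhs_of n T t D)) p"
    then obtain u where "v = map_vec cnj u" "u \<in> colspan (E \<i>) (\<lambda>i. p \<le> fst (t i))"
      by (auto simp: conj_fil_def mhs_of_def conjv)
    then show "v \<in> colspan (E (- \<i>)) (\<lambda>i. p \<le> snd (t i))"
      using key[of u \<i> "\<lambda>i. p \<le> fst (t i)" "\<lambda>i. p \<le> snd (t i)"] by simp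
  next
    fix v assume "v \<in> colspan (E (- \<i>)) (\<lambda>i. p \<le> snd (t i))"
    then have "map_vec cnj v \<in> colspan (E \<i>) (\<lambda>i. p \<le> fst (t i))"
      using key[of v "- \<i>" "\<lambda>i. p \<le> snd (t i)" "\<lambda>i. p \<le> fst (t i)"] by simp
    moreover have "v = map_vec cnj (map_vec cnj v)" by (rule eq_vecI) auto
    ultimately show "v \<in> conj_fil (hodge_fil (mhs_of n T t D)) p"
      unfolding conj_fil_def mhs_of_def by (simp add: conjv)
  qed
qed

text \<open>
  Unipotent changes of basis that lower weights do not change the filtration induced on graded
  pieces of the weight filtration.
\<close>

lemma graded_step:
  assumes QQ: "\<And>i. Q' i \<Longrightarrow> Q i"
  shows "lin_span n ((colspan (E c) P \<inter> colspan T (\<lambda>i. wt (t i) < k \<or> wt (t i) = k \<and> Q i))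
      \<union> colspan T (\<lambda>i. wt (t i) < k \<or> wt (t i) = k \<and> Q' i))
    = colspan T (\<lambda>i. wt (t i) < k \<or> wt (t i) = k \<and> (Q' i \<or> Q i \<and> P i))"
    (is "lin_span n ((?F \<inter> ?A) \<union> ?B) = ?R")
proof -
  have N: "mexp n c \<Delta> - 1\<^sub>m n \<in> carrier_mat n n" for c using mexp_carrier[OF nil_Delta] by auto
  have split: "mexp n c \<Delta> *\<^sub>v y = y + (mexp n c \<Delta> - 1\<^sub>m n) *\<^sub>v y" if "y \<in> carrier_vec n" for c y
  proof -
    have "(mexp n c \<Delta> - 1\<^sub>m n) *\<^sub>v y = mexp n c \<Delta> *\<^sub>v y - y"
      using minus_mult_distrib_mat_vec[OF mexp_carrier[OF nil_Delta] one_carrier_mat that, of c] that by simp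
    then show ?thesis using mexp_carrier[OF nil_Delta, of c] that by (intro eq_vecI) (auto simp del: index_mult_mat_vec)
  qed
  have lower: "(mexp n c \<Delta> *\<^sub>v y) $ i = y $ i" "((mexp n c \<Delta> - 1\<^sub>m n) *\<^sub>v y) $ i = 0"
    if y: "y \<in> carrier_vec n" and i: "i < n" and h: "\<And>j. j < n \<Longrightarrow> y $ j \<noteq> 0 \<Longrightarrow> wt (t j) \<le> wt (t i)" for c y i
  proof -
    show z: "((mexp n c \<Delta> - 1\<^sub>m n) *\<^sub>v y) $ i = 0"
    proof (rule ccontr)
      assume "((mexp n c \<Delta> - 1\<^sub>m n) *\<^sub>v y) $ i \<noteq> 0"
      then obtain j where j: "j < n" "(mexp n c \<Delta> - 1\<^sub>m n) $$ (i, j) \<noteq> 0" "y $ j \<noteq> 0"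
        using mult_vec_support[of i "mexp n c \<Delta> - 1\<^sub>m n" y] i y carrier_matD[OF N[of c]] by metis
      show False using supp_inD[OF mexp_Delta_supp _ _ j(2)] h[OF j(1,3)] i j(1) carrier_matD[OF N[of c]] by auto
    qed
    show "(mexp n c \<Delta> *\<^sub>v y) $ i = y $ i"
      unfolding split[OF y] using z y i carrier_matD[OF N[of c]] by (simp del: index_mult_mat_vec)
  qed
  have Rs: "is_subspace n ?R" and Bs: "is_subspace n ?B" and As: "is_subspace n ?A" and Fs: "is_subspace n ?F"
    using colspan_subspace[OF T(1)] colspan_subspace[OF E_carrier] by blast+
  have sc: "(?F \<inter> ?A) \<union> ?B \<subseteq> carrier_vec n" using is_subspaceD(1)[OF Bs] is_subspaceD(1)[OF As] by auto
  note L = is_subspaceD[OF lin_span_subspace[OF sc]] and sup = lin_span_superset[OF sc]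
  show ?thesis
  proof
    show "lin_span n ((?F \<inter> ?A) \<union> ?B) \<subseteq> ?R"
    proof (rule lin_span_least[OF Rs], intro Un_least subsetI)
      fix v assume "v \<in> ?B"
      then show "v \<in> ?R" unfolding colspan_iff[OF inv] by blast
    next
      fix v assume v: "v \<in> ?F \<inter> ?A"
      then obtain x where x: "v = E c *\<^sub>v x" "x \<in> carrier_vec n" "\<And>i. i < n \<Longrightarrow> x $ i \<noteq> 0 \<Longrightarrow> P i"
        using carrier_matD[OF E_carrier[of c]] unfolding colspan_def[of "E c"] by auto
      have vc: "v \<in> carrier_vec n" using v is_subspaceD(1)[OF As] by auto
      have y: "T' *\<^sub>v v \<in> carrier_vec n" using T vc by auto
      have ysupp: "wt (t i) \<le> k \<and> (wt (t i) = k \<longrightarrow> Q i)" if "i < n" "(T' *\<^sub>v v) $ i \<noteq> 0" for i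
      proof -
        have "v \<in> ?A" using v by blast
        then have "wt (t i) < k \<or> wt (t i) = k \<and> Q i" using that unfolding colspan_iff[OF inv] by blast
        then show ?thesis by auto
      qed
      have xy: "x = mexp n (- c) \<Delta> *\<^sub>v (T' *\<^sub>v v)"
      proof -
        have "x = (mexp n (- c) \<Delta> * T') *\<^sub>v v" unfolding x(1) using inverse_mats_vec(2)[OF E_inv x(2)] by simp
        then show ?thesis using mexp_carrier[OF nil_Delta, of "- c"] T vc by (simp add: assoc_mult_mat_vec[of _ n n _ n])
      qed
      show "v \<in> ?R" unfolding colspan_iff[OF inv]
      proof (intro conjI allI impI vc)
        fix i assume i: "i < n" and ne: "(T' *\<^sub>v v) $ i \<noteq> 0"
        show "wt (t i) < k \<or> wt (t i) = k \<and> (Q' i \<or> Q i \<and> P i)"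
        proof (cases "wt (t i) < k")
          case False
          then have k: "wt (t i) = k" using ysupp[OF i ne] by auto
          have "x $ i = (T' *\<^sub>v v) $ i" unfolding xy by (rule lower(1)[OF y i]) (use ysupp k in auto)
          then have "P i" using x(3)[OF i] ne by simp
          then show ?thesis using ysupp[OF i ne] k by auto
        qed simp
      qed
    qed
    show "?R \<subseteq> lin_span n ((?F \<inter> ?A) \<union> ?B)"
    proof (rule colspan_least[OF T(1) lin_span_subspace[OF sc]])
      fix j assume j: "j < n" and h: "wt (t j) < k \<or> wt (t j) = k \<and> (Q' j \<or> Q j \<and> P j)"
      show "col T j \<in> lin_span n ((?F \<inter> ?A) \<union> ?B)"
      proof (cases "wt (t j) < k \<or> Q' j")
        case True
        then have "col T j \<in> ?B" using h by (intro col_in_colspan[OF T(1) j]) auto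
        then show ?thesis using sup by auto
      next
        case False
        then have k: "wt (t j) = k" "Q j" "P j" using h by auto
        let ?u = "unit_vec n j :: complex vec"
        have u: "?u \<in> carrier_vec n" by simp
        let ?r = "T *\<^sub>v ((mexp n c \<Delta> - 1\<^sub>m n) *\<^sub>v ?u)"
        have rs: "wt (t i) < k" if i: "i < n" and ne: "((mexp n c \<Delta> - 1\<^sub>m n) *\<^sub>v ?u) $ i \<noteq> 0" for i
        proof (rule ccontr)
          assume "\<not> wt (t i) < k"
          then have "((mexp n c \<Delta> - 1\<^sub>m n) *\<^sub>v ?u) $ i = 0"
            using k j by (intro lower(2)[OF u i]) (auto split: if_splits)
          then show False using ne by simp
        qed
        have cN: "(mexp n c \<Delta> - 1\<^sub>m n) *\<^sub>v ?u \<in> carrier_vec n" using N[of c] by auto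
        have rlow: "?r \<in> colspan T (\<lambda>i. wt (t i) < k)"
          unfolding colspan_def using cN rs T by auto
        then have rB: "?r \<in> ?B" and rA: "?r \<in> ?A" unfolding colspan_iff[OF inv] by auto
        have "E c *\<^sub>v ?u = T *\<^sub>v (mexp n c \<Delta> *\<^sub>v ?u)"
          unfolding mexp_mult_T using T mexp_carrier[OF nil_Delta, of c] by (intro assoc_mult_mat_vec) auto
        also have "\<dots> = T *\<^sub>v ?u + ?r" unfolding split[OF u] using T u cN by (simp add: mult_add_distrib_mat_vec)
        also have "T *\<^sub>v ?u = col T j" by (rule mult_mat_unit_vec[OF T(1) j])
        finally have e: "E c *\<^sub>v ?u = col T j + ?r" .
        have "E c *\<^sub>v ?u \<in> ?F"
          using mult_mat_unit_vec[OF E_carrier j, of c] col_in_colspan[OF E_carrier j, of P c] k by simp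
        moreover have "col T j \<in> ?A" using k by (intro col_in_colspan[OF T(1) j]) auto
        ultimately have "E c *\<^sub>v ?u \<in> lin_span n ((?F \<inter> ?A) \<union> ?B)"
          using is_subspaceD(3)[OF As] rA e sup by auto
        moreover have "?r \<in> lin_span n ((?F \<inter> ?A) \<union> ?B)" using rB sup by auto
        ultimately have "E c *\<^sub>v ?u - ?r \<in> lin_span n ((?F \<inter> ?A) \<union> ?B)" by (rule L(5))
        moreover have "E c *\<^sub>v ?u - ?r = col T j"
          unfolding e using T j cN by (intro eq_vecI) (auto simp del: index_mult_mat_vec)
        ultimately show ?thesis by simp
      qed
    qed
  qed
qed

lemma colspan_exhaustive:
  fixes w :: "nat \<Rightarrow> int"
  assumes inv': "inverse_mats n A A'"
  shows "(\<Union>k. colspan A (\<lambda>i. w i \<le> k)) = carrier_vec n" "(\<Inter>k. colspan A (\<lambda>i. w i \<le> k)) = {0\<^sub>v n}"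
proof -
  note A = inverse_matsD[OF inv']
  define N where "N = (\<Sum>i<n. \<bar>w i\<bar>)"
  have N: "\<bar>w i\<bar> \<le> N" if "i < n" for i
    unfolding N_def by (rule member_le_sum) (use that in auto)
  have 1: "colspan A (\<lambda>i. w i \<le> N) = carrier_vec n"
    unfolding set_eq_iff colspan_iff[OF inv'] using N by force
  have 2: "colspan A (\<lambda>i. w i \<le> - N - 1) \<subseteq> {0\<^sub>v n}"
  proof
    fix v assume v: "v \<in> colspan A (\<lambda>i. w i \<le> - N - 1)"
    then obtain x where x: "v = A *\<^sub>v x" "x \<in> carrier_vec n" "\<And>i. i < n \<Longrightarrow> x $ i \<noteq> 0 \<Longrightarrow> w i \<le> - N - 1"
      using A by (auto simp: colspan_def)
    have "x = 0\<^sub>v n"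
    proof (rule eq_vecI)
      fix i assume "i < dim_vec (0\<^sub>v n)"
      then have i: "i < n" by simp
      show "x $ i = 0\<^sub>v n $ i" using x(3)[OF i] N[OF i] i by (cases "x $ i = 0") auto
    qed (use x in simp)
    then show "v \<in> {0\<^sub>v n}" using x(1) A by (auto intro!: eq_vecI)
  qed
  have sub: "is_subspace n (colspan A P)" for P using colspan_subspace[OF A(1)] .
  show "(\<Union>k. colspan A (\<lambda>i. w i \<le> k)) = carrier_vec n"
    using 1 is_subspaceD(1)[OF sub] by blast
  show "(\<Inter>k. colspan A (\<lambda>i. w i \<le> k)) = {0\<^sub>v n}"
    using 2 is_subspaceD(2)[OF sub] by blast
qed

text \<open>
  The exponentials disappear modulo lower weights, so that the graded pieces of the three
  filtrations are spanned by the basis vectors of type \<open>(i, j)\<close>. These are of weight \<open>i + j\<close>.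
\<close>

lemma is_mhs: "is_mhs (mhs_of n T t D)"
proof -
  let ?X = "mhs_of n T t D"
  have dim: "mhs_dim ?X = n" by (simp add: mhs_of_def)
  have W: "weight_fil ?X k = {v \<in> carrier_vec n. cv v \<in> Wc k}" for k by (simp add: mhs_of_def)
  have F: "hodge_fil ?X p = colspan (E \<i>) (\<lambda>i. p \<le> fst (t i))" for p by (simp add: mhs_of_def)
  have WU: "(\<Union>k. weight_fil ?X k) = carrier_vec n" and WI: "(\<Inter>k. weight_fil ?X k) = {0\<^sub>v n}"
  proof -
    show "(\<Union>k. weight_fil ?X k) = carrier_vec n"
    proof
      show "carrier_vec n \<subseteq> (\<Union>k. weight_fil ?X k)"
      proof
        fix v :: "real vec" assume v: "v \<in> carrier_vec n"
        then have "cv v \<in> (\<Union>k. Wc k)" unfolding colspan_exhaustive(1)[OF inv] by simp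
        then show "v \<in> (\<Union>k. weight_fil ?X k)" using v W by auto
      qed
    qed (auto simp: W)
    show "(\<Inter>k. weight_fil ?X k) = {0\<^sub>v n}"
    proof
      show "(\<Inter>k. weight_fil ?X k) \<subseteq> {0\<^sub>v n}"
      proof
        fix v assume v: "v \<in> (\<Inter>k. weight_fil ?X k)"
        then have vc: "v \<in> carrier_vec n" using W by auto
        have "cv v \<in> (\<Inter>k. Wc k)" using v W by auto
        then have z: "cv v = 0\<^sub>v n" unfolding colspan_exhaustive(2)[OF inv] by simp
        have "v $ i = 0" if "i < n" for i
          using arg_cong[OF z, of "\<lambda>w. w $ i"] that vc by simp
        then show "v \<in> {0\<^sub>v n}" using vc by (auto intro!: eq_vecI)
      qed
      show "{0\<^sub>v n} \<subseteq> (\<Inter>k. weight_fil ?X k)"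
        using is_subspaceD(2)[OF real_points_subspace[OF Wc_subspace]] by (auto simp: W)
    qed
  qed
  have FU: "(\<Union>p. hodge_fil ?X p) = carrier_vec n" and FI: "(\<Inter>p. hodge_fil ?X p) = {0\<^sub>v n}"
  proof -
    have e: "hodge_fil ?X p = colspan (E \<i>) (\<lambda>i. - fst (t i) \<le> - p)" for p by (simp add: F)
    have neg: "range (\<lambda>p. g (- p)) = range g" for g :: "int \<Rightarrow> complex vec set"
    proof (intro equalityI subsetI)
      fix A assume "A \<in> range g"
      then obtain k where "A = g (- (- k))" by auto
      then show "A \<in> range (\<lambda>p. g (- p))" by (rule range_eqI)
    qed auto
    have r: "range (hodge_fil ?X) = range (\<lambda>k. colspan (E \<i>) (\<lambda>i. - fst (t i) \<le> k))"
      unfolding neg[of "\<lambda>k. colspan (E \<i>) (\<lambda>i. - fst (t i) \<le> k)", symmetric] e ..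
    show "(\<Union>p. hodge_fil ?X p) = carrier_vec n" "(\<Inter>p. hodge_fil ?X p) = {0\<^sub>v n}"
      unfolding r by (rule colspan_exhaustive[OF E_inv])+
  qed
  have gr: "(case gr_subquotient n (hodge_fil ?X) i (gr_subquotient n (conj_fil (hodge_fil ?X)) j (gr_weight n (weight_fil ?X) k)) of
             (A, B) \<Rightarrow> A = B)" if ijk: "i + j \<noteq> k" for i j k
  proof -
    have le: "(\<lambda>i. wt (t i) \<le> k) = (\<lambda>i. wt (t i) < k \<or> wt (t i) = k \<and> True)"
      "(\<lambda>i. wt (t i) \<le> k - 1) = (\<lambda>i. wt (t i) < k \<or> wt (t i) = k \<and> False)" by (auto simp: fun_eq_iff)
    have w: "gr_weight n (weight_fil ?X) k = (colspan T (\<lambda>i. wt (t i) < k \<or> wt (t i) = k \<and> True), colspan T (\<lambda>i. wt (t i) < k \<or> wt (t i) = k \<and> False))"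
      unfolding gr_weight_def W_complexification le ..
    have g1: "gr_subquotient n (conj_fil (hodge_fil ?X)) j (gr_weight n (weight_fil ?X) k)
      = (colspan T (\<lambda>i. wt (t i) < k \<or> wt (t i) = k \<and> j \<le> snd (t i)), colspan T (\<lambda>i. wt (t i) < k \<or> wt (t i) = k \<and> j + 1 \<le> snd (t i)))"
      unfolding w gr_subquotient_def prod.case conj_hodge
      using graded_step[of "\<lambda>_. False" "\<lambda>_. True" "- \<i>" "\<lambda>i. j \<le> snd (t i)" k]
        graded_step[of "\<lambda>_. False" "\<lambda>_. True" "- \<i>" "\<lambda>i. j + 1 \<le> snd (t i)" k] by simp
    have g2: "gr_subquotient n (hodge_fil ?X) i (gr_subquotient n (conj_fil (hodge_fil ?X)) j (gr_weight n (weight_fil ?X) k))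
      = (colspan T (\<lambda>l. wt (t l) < k \<or> wt (t l) = k \<and> (j + 1 \<le> snd (t l) \<or> j \<le> snd (t l) \<and> i \<le> fst (t l))),
         colspan T (\<lambda>l. wt (t l) < k \<or> wt (t l) = k \<and> (j + 1 \<le> snd (t l) \<or> j \<le> snd (t l) \<and> i + 1 \<le> fst (t l))))"
      by (subst g1, unfold gr_subquotient_def prod.case F,
          use graded_step[of "\<lambda>l. j + 1 \<le> snd (t l)" "\<lambda>l. j \<le> snd (t l)" \<i> "\<lambda>l. i \<le> fst (t l)" k]
            graded_step[of "\<lambda>l. j + 1 \<le> snd (t l)" "\<lambda>l. j \<le> snd (t l)" \<i> "\<lambda>l. i + 1 \<le> fst (t l)" k] in simp)
    have "(\<lambda>l. wt (t l) < k \<or> wt (t l) = k \<and> (j + 1 \<le> snd (t l) \<or> j \<le> snd (t l) \<and> i \<le> fst (t l)))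
      = (\<lambda>l. wt (t l) < k \<or> wt (t l) = k \<and> (j + 1 \<le> snd (t l) \<or> j \<le> snd (t l) \<and> i + 1 \<le> fst (t l)))"
      using ijk by (auto simp: fun_eq_iff)
    then show ?thesis unfolding g2 by simp
  qed
  have mono: "weight_fil ?X k \<subseteq> weight_fil ?X l" if "k \<le> l" for k l
    using that unfolding W by (auto simp: colspan_iff[OF inv])
  have anti: "hodge_fil ?X q \<subseteq> hodge_fil ?X p" if "p \<le> q" for p q
    unfolding F subset_iff colspan_iff[OF E_inv] using that by (meson order_trans)
  have s1: "is_subspace n (weight_fil ?X k)" for k
    unfolding W by (rule real_points_subspace[OF Wc_subspace])
  have s2: "is_subspace n (hodge_fil ?X p)" for p
    unfolding F by (rule colspan_subspace[OF E_carrier])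
  show ?thesis unfolding is_mhs_def Let_def dim
    using s1 s2 mono anti WU WI FU FI gr by (intro conjI allI impI) simp_all
qed

end

section \<open>Morphisms\<close>

lemma mult_assoc_dims:
  "dim_col A = dim_row B \<Longrightarrow> dim_col B = dim_row C \<Longrightarrow> A * B * C = A * (B * C :: 'a :: semiring_0 mat)"
  by (rule assoc_mult_mat[of _ "dim_row A" "dim_col A" _ "dim_col B" _ "dim_col C"]) auto

lemma smult_mult_dims:
  fixes A :: "'a :: comm_semiring_0 mat"
  assumes "dim_col A = dim_row B"
  shows "(c \<cdot>\<^sub>m A) * B = c \<cdot>\<^sub>m (A * B)" "A * (c \<cdot>\<^sub>m B) = c \<cdot>\<^sub>m (A * B)"
proof -
  have A: "A \<in> carrier_mat (dim_row A) (dim_row B)" and B: "B \<in> carrier_mat (dim_row B) (dim_col B)"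
    using assms by (auto intro: carrier_matI)
  show "(c \<cdot>\<^sub>m A) * B = c \<cdot>\<^sub>m (A * B)" by (rule mult_smult_assoc_mat[OF A B])
  show "A * (c \<cdot>\<^sub>m B) = c \<cdot>\<^sub>m (A * B)" by (rule mult_smult_distrib[OF A B])
qed

lemma inverse_mats_cancel:
  assumes "inverse_mats n T T'" "dim_row X = n"
  shows "T * (T' * X) = X" "T' * (T * X) = X"
proof -
  note T = inverse_matsD[OF assms(1)]
  have "X \<in> carrier_mat n (dim_col X)" using assms(2) by auto
  then show "T * (T' * X) = X" "T' * (T * X) = X"
    using T assms(2) by (simp_all flip: mult_assoc_dims)
qed

lemma cm_mult_cv: "v \<in> carrier_vec (dim_col A) \<Longrightarrow> cv (A *\<^sub>v v) = cm A *\<^sub>v cv v"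
  by (rule eq_vecI) (auto simp: scalar_prod_def)

lemma cnj_mat_supp: "supp_in r c C A \<Longrightarrow> supp_in (swap_types r) (swap_types c) (\<lambda>a b. C b a) (cnj_mat A)"
  by (auto simp: supp_in_def)

text \<open>
  Given a real map that respects both filtrations, let \<open>g\<close> be its matrix with respect to the bases
  \<open>exp (\<i> D) T\<close> and \<open>exp (\<i> D') U\<close>, which split the Hodge filtrations. It has entries of
  bidegree \<open>(a, b)\<close> only if \<open>a \<ge> 0\<close> and \<open>a + b \<le> 0\<close>. The map being real, it respects the
  conjugate filtrations, so that its matrix \<open>h = exp (2 \<i> D') g exp (- 2 \<i> D)\<close> with respect to
  the conjugate bases has entries only if \<open>b \<ge> 0\<close> and \<open>a + b \<le> 0\<close>. But \<open>D\<close> and \<open>D'\<close> lower both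
  degrees, so that \<open>h - g\<close> has entries only if \<open>a < 0\<close> and \<open>b < 0\<close>. Hence \<open>g = h\<close> is of
  bidegree \<open>(0, 0)\<close>, and \<open>exp (2 \<i> D') g = g exp (2 \<i> D)\<close>.
\<close>

lemma mhs_hom_iff:
  assumes X: "datum n T T' t D" and Y: "datum m U U' s D'" and f: "f \<in> carrier_mat m n"
  shows "f \<in> mhs_hom (mhs_of n T t D) (mhs_of m U s D')
    \<longleftrightarrow> supp_in s t same_type (U' * cm f * T) \<and> D' * f = f * D"
proof -
  interpret x: datum n T T' t D by (rule X)
  interpret y: datum m U U' s D' by (rule Y)
  define \<phi> where "\<phi> = U' * cm f * T"
  have dims: "dim_row f = m" "dim_col f = n" "dim_row T = n" "dim_col T = n" "dim_row T' = n" "dim_col T' = n"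
    "dim_row U = m" "dim_col U = m" "dim_row U' = m" "dim_col U' = m" "dim_row D = n" "dim_col D = n"
    "dim_row D' = m" "dim_col D' = m" "dim_row x.\<Delta> = n" "dim_col x.\<Delta> = n" "dim_row y.\<Delta> = m" "dim_col y.\<Delta> = m"
    using f x.T y.T x.D y.D x.Delta y.Delta by auto
  have edims: "dim_row (mexp n c x.\<Delta>) = n" "dim_col (mexp n c x.\<Delta>) = n" "dim_row (mexp m c y.\<Delta>) = m" "dim_col (mexp m c y.\<Delta>) = m"
    "dim_row (mexp n c (cm D)) = n" "dim_col (mexp n c (cm D)) = n" "dim_row (mexp m c (cm D')) = m" "dim_col (mexp m c (cm D')) = m" for c
    using mexp_carrier[OF x.nil_Delta, of c] mexp_carrier[OF y.nil_Delta, of c] mexp_carrier[OF x.nil_D, of c] mexp_carrier[OF y.nil_D, of c] by auto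
  have phi: "\<phi> \<in> carrier_mat m n" unfolding \<phi>_def using dims by (intro carrier_matI) simp_all
  have cf: "cm f \<in> carrier_mat m n" using f by simp
  note xe = inverse_matsD[OF mexp_inverse[OF x.nil_Delta]] and ye = inverse_matsD[OF mexp_inverse[OF y.nil_Delta]]
  show ?thesis unfolding \<phi>_def[symmetric]
  proof
    assume h: "supp_in s t same_type \<phi> \<and> D' * f = f * D"
    then have phi0: "s i = t j" if "i < m" "j < n" "\<phi> $$ (i, j) \<noteq> 0" for i j
      using supp_inD[of s t same_type \<phi> i j] phi that by (auto simp: prod_eq_iff)
    have comm: "cm D' * cm f = cm f * cm D" using h dims by (simp flip: cm_mult)
    have W: "f *\<^sub>v v \<in> weight_fil (mhs_of m U s D') k" if v: "v \<in> weight_fil (mhs_of n T t D) k" for v k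
    proof -
      have vc: "v \<in> carrier_vec n" "cv v \<in> colspan T (\<lambda>i. wt (t i) \<le> k)" using v by (auto simp: mhs_of_def)
      have "cm f *\<^sub>v cv v \<in> colspan U (\<lambda>i. wt (s i) \<le> k)"
        by (rule colspan_mult[OF x.inv y.inv cf _ vc(2)]) (use phi0 in \<open>auto simp: \<phi>_def\<close>)
      then show ?thesis using vc f by (auto simp: mhs_of_def cm_mult_cv simp del: index_mult_mat_vec)
    qed
    have F: "cm f *\<^sub>v v \<in> hodge_fil (mhs_of m U s D') p" if v: "v \<in> hodge_fil (mhs_of n T t D) p" for v p
    proof -
      have vc: "v \<in> colspan (x.E \<i>) (\<lambda>i. p \<le> fst (t i))" using v by (auto simp: mhs_of_def)
      have "mexp m (- \<i>) (cm D') * cm f = cm f * mexp n (- \<i>) (cm D)"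
        unfolding mexp_def by (rule fps_mat_intertwine[OF y.nil_D x.nil_D cf comm])
      then have "U' * mexp m (- \<i>) (cm D') * cm f * x.E \<i> = U' * (cm f * (mexp n (- \<i>) (cm D) * (mexp n \<i> (cm D) * T)))"
        using dims edims by (simp add: mult_assoc_dims)
      also have "mexp n (- \<i>) (cm D) * (mexp n \<i> (cm D) * T) = T"
        using inverse_mats_cancel(2)[OF mexp_inverse[OF x.nil_D]] dims by simp
      finally have e: "U' * mexp m (- \<i>) (cm D') * cm f * x.E \<i> = \<phi>" using dims by (simp add: \<phi>_def mult_assoc_dims)
      have "cm f *\<^sub>v v \<in> colspan (y.E \<i>) (\<lambda>i. p \<le> fst (s i))"
        by (rule colspan_mult[OF x.E_inv' y.E_inv' cf _ vc]) (use phi0 in \<open>auto simp: e\<close>)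
      then show ?thesis by (simp add: mhs_of_def)
    qed
    show "f \<in> mhs_hom (mhs_of n T t D) (mhs_of m U s D')"
      unfolding mhs_hom_def using W F f by (simp add: mhs_of_def)
  next
    assume "f \<in> mhs_hom (mhs_of n T t D) (mhs_of m U s D')"
    then have W: "\<And>k v. v \<in> weight_fil (mhs_of n T t D) k \<Longrightarrow> f *\<^sub>v v \<in> weight_fil (mhs_of m U s D') k"
      and F: "\<And>p v. v \<in> hodge_fil (mhs_of n T t D) p \<Longrightarrow> cm f *\<^sub>v v \<in> hodge_fil (mhs_of m U s D') p"
      by (auto simp: mhs_hom_def)
    have phi_w: "supp_in s t (\<lambda>a b. a + b \<le> 0) \<phi>"
      unfolding supp_in_def
    proof (intro allI impI)
      fix i j assume "i < dim_row \<phi>" "j < dim_col \<phi>" and ne: "\<phi> $$ (i, j) \<noteq> 0"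
      then have ij: "i < m" "j < n" using phi by auto
      let ?k = "wt (t j)" and ?v = "col T j"
      have v: "?v \<in> x.Wc ?k" by (rule col_in_colspan[OF x.T(1) ij(2)]) simp
      have vc: "?v \<in> carrier_vec n" using dims by (intro carrier_vecI) simp
      note ri = cv_Re_Im_mem[OF x.Wc_subspace x.Wc_cnj v]
      have "cm f *\<^sub>v cv (map_vec Re ?v) \<in> y.Wc ?k" "cm f *\<^sub>v cv (map_vec Im ?v) \<in> y.Wc ?k"
        using W[of "map_vec Re ?v" ?k] W[of "map_vec Im ?v" ?k] ri vc dims
        by (auto simp: mhs_of_def cm_mult_cv simp del: index_mult_mat_vec)
      then have "cm f *\<^sub>v cv (map_vec Re ?v) + \<i> \<cdot>\<^sub>v (cm f *\<^sub>v cv (map_vec Im ?v)) \<in> y.Wc ?k"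
        by (intro is_subspaceD(3,4)[OF y.Wc_subspace])
      moreover have "cm f *\<^sub>v ?v = cm f *\<^sub>v cv (map_vec Re ?v) + \<i> \<cdot>\<^sub>v (cm f *\<^sub>v cv (map_vec Im ?v))"
        using cf vc by (subst vec_Re_Im[OF vc]) (simp add: mult_add_distrib_mat_vec[of _ m n] mult_mat_vec[of _ m n])
      ultimately have "cm f *\<^sub>v ?v \<in> y.Wc ?k" by simp
      from colspan_mult_conv[OF x.inv y.inv cf this ij] ne
      show "fst (s i) - fst (t j) + (snd (s i) - snd (t j)) \<le> 0" by (simp add: \<phi>_def)
    qed
    define g where "g = mexp m (- \<i>) y.\<Delta> * \<phi> * mexp n \<i> x.\<Delta>"
    have g: "g \<in> carrier_mat m n" unfolding g_def using edims phi by (intro carrier_matI) auto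
    have g_eq: "g = mexp m (- \<i>) y.\<Delta> * U' * cm f * x.E \<i>"
      unfolding g_def \<phi>_def x.mexp_mult_T using dims edims by (simp add: mult_assoc_dims)
    have le: "supp_in r r (\<lambda>a b. a \<le> 0 \<and> b \<le> 0) P"
      if "supp_in r r both_neg (P - 1\<^sub>m k)" "P \<in> carrier_mat k k" for r and P :: "complex mat" and k
    proof -
      have "P = (P - 1\<^sub>m k) + 1\<^sub>m k" using that(2) by (intro eq_matI) auto
      moreover have "supp_in r r (\<lambda>a b. a \<le> 0 \<and> b \<le> 0) ((P - 1\<^sub>m k) + 1\<^sub>m k)"
        using that by (intro supp_in_add supp_in_mono[OF that(1)] supp_in_one) auto
      ultimately show ?thesis by simp
    qed
    have xle: "supp_in t t (\<lambda>a b. a \<le> 0 \<and> b \<le> 0) (mexp n c x.\<Delta>)" for c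
      by (rule le[OF x.mexp_Delta_supp]) (use edims in auto)
    have yle: "supp_in s s (\<lambda>a b. a \<le> 0 \<and> b \<le> 0) (mexp m c y.\<Delta>)" for c
      by (rule le[OF y.mexp_Delta_supp]) (use edims in auto)
    have g_w: "supp_in s t (\<lambda>a b. a + b \<le> 0) g"
    proof -
      have "supp_in s t (\<lambda>a b. a + b \<le> 0) (mexp m (- \<i>) y.\<Delta> * \<phi>)"
        by (rule supp_in_mult[OF yle phi_w]) (use edims phi in auto)
      then show ?thesis unfolding g_def
        by (rule supp_in_mult[OF _ xle]) (use edims phi in auto)
    qed
    have g_supp: "supp_in s t (\<lambda>a b. a \<ge> 0 \<and> a + b \<le> 0) g"
      unfolding supp_in_def
    proof (intro allI impI conjI)
      fix i j assume ij': "i < dim_row g" "j < dim_col g" and ne: "g $$ (i, j) \<noteq> 0"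
      then have ij: "i < m" "j < n" using g by auto
      show "fst (s i) - fst (t j) + (snd (s i) - snd (t j)) \<le> 0" using supp_inD[OF g_w ij' ne] .
      have "col (x.E \<i>) j \<in> hodge_fil (mhs_of n T t D) (fst (t j))"
        unfolding mhs_of_def mhs.simps by (rule col_in_colspan[OF x.E_carrier ij(2)]) simp
      from F[OF this] have "cm f *\<^sub>v col (x.E \<i>) j \<in> colspan (y.E \<i>) (\<lambda>i. fst (t j) \<le> fst (s i))"
        by (simp add: mhs_of_def)
      from colspan_mult_conv[OF x.E_inv y.E_inv cf this ij] ne
      show "fst (s i) - fst (t j) \<ge> 0" by (simp add: g_eq)
    qed
    (* The passage from the basis exp (i D) T to exp (- i D) T, and likewise for U. *)
    define P Q where "P = mexp m (2 * \<i>) y.\<Delta>" and "Q = mexp n (- (2 * \<i>)) x.\<Delta>"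
    define h where "h = P * g * Q"
    have PQ: "P \<in> carrier_mat m m" "Q \<in> carrier_mat n n" using edims by (auto simp: P_def Q_def)
    have h: "h \<in> carrier_mat m n" unfolding h_def using PQ g by auto
    have h_eq: "h = mexp m \<i> y.\<Delta> * \<phi> * mexp n (- \<i>) x.\<Delta>"
    proof -
      have "h = (P * mexp m (- \<i>) y.\<Delta>) * \<phi> * (mexp n \<i> x.\<Delta> * Q)"
        unfolding h_def g_def using PQ edims phi by (simp add: mult_assoc_dims)
      then show ?thesis unfolding P_def Q_def
        by (simp flip: mexp_add[OF x.nil_Delta] mexp_add[OF y.nil_Delta])
    qed
    have h_supp: "supp_in s t (\<lambda>a b. b \<ge> 0) h"
      unfolding supp_in_def
    proof (intro allI impI)
      fix i j assume "i < dim_row h" "j < dim_col h" and ne: "h $$ (i, j) \<noteq> 0"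
      then have ij: "i < m" "j < n" using h by auto
      have "col (x.E (- \<i>)) j \<in> conj_fil (hodge_fil (mhs_of n T t D)) (snd (t j))"
        unfolding x.conj_hodge by (rule col_in_colspan[OF x.E_carrier ij(2)]) simp
      then obtain u where u: "u \<in> hodge_fil (mhs_of n T t D) (snd (t j))" "col (x.E (- \<i>)) j = conjugate u"
        by (auto simp: conj_fil_def)
      have "u \<in> carrier_vec n"
        using u(1) is_subspaceD(1)[OF colspan_subspace[OF x.E_carrier]] by (auto simp: mhs_of_def)
      then have "cm f *\<^sub>v col (x.E (- \<i>)) j = conjugate (cm f *\<^sub>v u)"
        unfolding u(2) using cf by (intro eq_vecI) (auto simp: scalar_prod_def)
      moreover have "conjugate (cm f *\<^sub>v u) \<in> conj_fil (hodge_fil (mhs_of m U s D')) (snd (t j))"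
        unfolding conj_fil_def using F[OF u(1)] by blast
      ultimately have "cm f *\<^sub>v col (x.E (- \<i>)) j \<in> colspan (y.E (- \<i>)) (\<lambda>i. snd (t j) \<le> snd (s i))"
        unfolding y.conj_hodge by simp
      from colspan_mult_conv[OF x.E_inv y.E_inv cf this ij] ne
      show "snd (s i) - snd (t j) \<ge> 0"
        unfolding h_eq \<phi>_def x.mexp_mult_T using dims edims by (simp add: mult_assoc_dims)
    qed
    have h_w: "supp_in s t (\<lambda>a b. a + b \<le> 0) h"
    proof -
      have "supp_in s t (\<lambda>a b. a + b \<le> 0) (P * g)"
        unfolding P_def by (rule supp_in_mult[OF yle g_w]) (use edims g in auto)
      then show ?thesis unfolding h_def Q_def by (rule supp_in_mult[OF _ xle]) (use edims g PQ in auto)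
    qed
    have diff: "supp_in s t C' (mexp m c y.\<Delta> * Y * mexp n (- c) x.\<Delta> - Y)"
      if Y: "Y \<in> carrier_mat m n" "supp_in s t C Y"
        and neg: "\<And>a b a' b'. C a b \<Longrightarrow> a' < 0 \<Longrightarrow> b' < 0 \<Longrightarrow> C' (a + a') (b + b')"
        and le: "\<And>a b a' b'. C' a b \<Longrightarrow> a' \<le> 0 \<Longrightarrow> b' \<le> 0 \<Longrightarrow> C' (a + a') (b + b')" for Y c C C'
    proof -
      let ?P = "mexp m c y.\<Delta>" and ?Q = "mexp n (- c) x.\<Delta>"
      have PQ: "?P \<in> carrier_mat m m" "?Q \<in> carrier_mat n n" using edims by auto
      have "?P * Y * ?Q - Y = (?P - 1\<^sub>m m) * Y * ?Q + Y * (?Q - 1\<^sub>m n)"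
      proof -
        have "(?P - 1\<^sub>m m) * Y * ?Q = ?P * Y * ?Q - Y * ?Q"
          using PQ Y by (simp add: minus_mult_distrib_mat[of _ m m _ _ n] minus_mult_distrib_mat[of _ m n _ _ n])
        moreover have "Y * (?Q - 1\<^sub>m n) = Y * ?Q - Y" using PQ Y by (simp add: mult_minus_distrib_mat[of _ m n _ n])
        ultimately show ?thesis using Y PQ by (intro eq_matI) (auto simp del: index_mult_mat(1))
      qed
      moreover have "supp_in s t C' ((?P - 1\<^sub>m m) * Y * ?Q)"
      proof -
        have "supp_in s t C' ((?P - 1\<^sub>m m) * Y)"
        proof (rule supp_in_mult[OF y.mexp_Delta_supp Y(2)])
          show "dim_col (?P - 1\<^sub>m m) = dim_row Y" using edims Y by simp
          show "C' (a + a') (b + b')" if "both_neg a b" "C a' b'" for a b a' b'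
            using neg[OF that(2), of a b] that(1) by (simp add: add.commute)
        qed
        then show ?thesis by (rule supp_in_mult[OF _ xle]) (use edims Y le in auto)
      qed
      moreover have "supp_in s t C' (Y * (?Q - 1\<^sub>m n))"
        by (rule supp_in_mult[OF Y(2) x.mexp_Delta_supp]) (use edims Y neg in auto)
      ultimately show ?thesis using PQ Y by (auto intro!: supp_in_add)
    qed
    have hg: "supp_in s t (\<lambda>a b. b < 0) (h - g)"
      unfolding h_def P_def Q_def by (rule diff[OF g supp_in_mono[OF g_supp, of "\<lambda>a b. b \<le> 0"]]) auto
    have gh: "supp_in s t (\<lambda>a b. a < 0) (g - h)"
    proof -
      have "g = mexp m (- (2 * \<i>)) y.\<Delta> * h * mexp n (- (- (2 * \<i>))) x.\<Delta>"
      proof -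
        have "mexp m (- (2 * \<i>)) y.\<Delta> * h * mexp n (- (- (2 * \<i>))) x.\<Delta>
          = mexp m (- (2 * \<i>)) y.\<Delta> * (P * (g * (Q * mexp n (- (- (2 * \<i>))) x.\<Delta>)))"
          unfolding h_def using PQ g edims by (simp add: mult_assoc_dims)
        also have "Q * mexp n (- (- (2 * \<i>))) x.\<Delta> = 1\<^sub>m n"
          unfolding Q_def by (rule inverse_matsD(3)[OF mexp_inverse[OF x.nil_Delta]])
        finally show ?thesis
          unfolding P_def using inverse_mats_cancel(2)[OF mexp_inverse[OF y.nil_Delta], of g] g by simp
      qed
      moreover have "supp_in s t (\<lambda>a b. a \<le> 0) h"
        unfolding supp_in_def
      proof (intro allI impI)
        fix i j assume ij: "i < dim_row h" "j < dim_col h" "h $$ (i, j) \<noteq> 0"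
        show "fst (s i) - fst (t j) \<le> 0" using supp_inD[OF h_supp ij] supp_inD[OF h_w ij] by linarith
      qed
      ultimately show ?thesis using diff[OF h, of "\<lambda>a b. a \<le> 0" "\<lambda>a b. a < 0" "- (2 * \<i>)"] by simp
    qed
    have entry: "g $$ (i, j) = h $$ (i, j)" "g $$ (i, j) \<noteq> 0 \<Longrightarrow> same_type (fst (s i) - fst (t j)) (snd (s i) - snd (t j))"
      if ij: "i < m" "j < n" for i j
    proof -
      have d: "i < dim_row g" "j < dim_col g" "i < dim_row h" "j < dim_col h" using g h ij by auto
      have 1: "g $$ (i, j) \<noteq> h $$ (i, j) \<Longrightarrow> snd (s i) - snd (t j) < 0 \<and> fst (s i) - fst (t j) < 0"
        using supp_inD[OF hg, of i j] supp_inD[OF gh, of i j] d by auto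
      show e: "g $$ (i, j) = h $$ (i, j)"
        using 1 supp_inD[OF g_supp d(1,2)] supp_inD[OF h_supp d(3,4)] by force
      show "g $$ (i, j) \<noteq> 0 \<Longrightarrow> same_type (fst (s i) - fst (t j)) (snd (s i) - snd (t j))"
        using supp_inD[OF g_supp d(1,2)] supp_inD[OF h_supp d(3,4)] e by auto
    qed
    have g0: "supp_in s t same_type g" unfolding supp_in_def using entry(2) g by auto
    have "h = g" by (rule eq_matI) (use entry(1) g h in auto)
    have "P * g = g * mexp n (2 * \<i>) x.\<Delta>"
    proof -
      have "g * mexp n (2 * \<i>) x.\<Delta> = P * g * (Q * mexp n (2 * \<i>) x.\<Delta>)"
        using \<open>h = g\<close> PQ g edims unfolding h_def by (metis mult_assoc_dims carrier_matD index_mult_mat(2,3))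
      also have "Q * mexp n (2 * \<i>) x.\<Delta> = 1\<^sub>m n"
        unfolding Q_def using mexp_add[OF x.nil_Delta, of "- (2 * \<i>)" "2 * \<i>"] mexp_0[OF x.nil_Delta] by simp
      finally show ?thesis using PQ g by (simp add: right_mult_one_mat[of _ m n])
    qed
    then have "((2 * \<i>) \<cdot>\<^sub>m y.\<Delta>) * g = g * ((2 * \<i>) \<cdot>\<^sub>m x.\<Delta>)"
      unfolding P_def
      by (intro mexp_intertwine_imp[OF nilpotent_smult[OF y.nil_Delta] nilpotent_smult[OF x.nil_Delta] g])
         (simp add: mexp_smult[OF x.nil_Delta] mexp_smult[OF y.nil_Delta])
    then have "(1 / (2 * \<i>)) \<cdot>\<^sub>m ((2 * \<i>) \<cdot>\<^sub>m (y.\<Delta> * g)) = (1 / (2 * \<i>)) \<cdot>\<^sub>m ((2 * \<i>) \<cdot>\<^sub>m (g * x.\<Delta>))"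
      using y.Delta x.Delta g by (simp add: mult_smult_assoc_mat[of _ m m _ n] mult_smult_distrib[of _ m n _ n])
    then have Dg: "y.\<Delta> * g = g * x.\<Delta>" by (simp add: smult_smult_mat)
    have "mexp m \<i> y.\<Delta> * g = g * mexp n \<i> x.\<Delta>"
      unfolding mexp_def by (rule fps_mat_intertwine[OF y.nil_Delta x.nil_Delta g Dg])
    moreover have "mexp m \<i> y.\<Delta> * g = \<phi> * mexp n \<i> x.\<Delta>"
      unfolding g_def using inverse_mats_cancel(1)[OF mexp_inverse[OF y.nil_Delta, of \<i>], of "\<phi> * mexp n \<i> x.\<Delta>"] edims phi
      by (simp add: mult_assoc_dims)
    ultimately have "\<phi> * mexp n \<i> x.\<Delta> * mexp n (- \<i>) x.\<Delta> = g * mexp n \<i> x.\<Delta> * mexp n (- \<i>) x.\<Delta>" by simp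
    then have "\<phi> = g"
      using phi g xe[of \<i>] by (simp add: assoc_mult_mat[of _ m n _ n _ n] right_mult_one_mat[of _ m n])
    have "D' * f = f * D"
    proof (rule cm_inj)
      have "cm D' * cm f = U * (y.\<Delta> * \<phi>) * T'"
        unfolding \<phi>_def y.\<Delta>_def using dims x.T(3)
        by (simp add: mult_assoc_dims inverse_mats_cancel[OF y.inv] right_mult_one_mat[of _ m n])
      also have "\<dots> = cm f * cm D"
        unfolding \<open>\<phi> = g\<close> Dg unfolding \<open>\<phi> = g\<close>[symmetric] \<phi>_def x.\<Delta>_def using dims x.T(3) x.D
        by (simp add: mult_assoc_dims inverse_mats_cancel[OF y.inv] inverse_mats_cancel[OF x.inv] right_mult_one_mat[of _ n n])
      finally show "cm (D' * f) = cm (f * D)" using dims by (simp add: cm_mult)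
    qed
    then show "supp_in s t same_type \<phi> \<and> D' * f = f * D" using g0 \<open>\<phi> = g\<close> by simp
  qed
qed

lemma adapted_commute_iff:
  assumes a: "adapted n \<rho> T T' t" and b: "adapted m \<sigma> U U' s" and f: "f \<in> carrier_mat m n"
  shows "(\<forall>l. l \<noteq> 0 \<longrightarrow> f * \<rho> l = \<sigma> l * f) \<longleftrightarrow> supp_in s t same_type (U' * cm f * T)"
proof -
  note T = inverse_matsD[OF adaptedD(1)[OF a]] and U = inverse_matsD[OF adaptedD(1)[OF b]]
  have phi: "U' * cm f * T \<in> carrier_mat m n" using T U f by auto
  have "f * \<rho> l = \<sigma> l * f \<longleftrightarrow> U' * cm f * T * mat_diag n (\<lambda>j. chi (t j) l) = mat_diag m (\<lambda>i. chi (s i) l) * (U' * cm f * T)"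
    if l: "l \<noteq> 0" for l
  proof -
    note rc = adaptedD(2)[OF a l] and sc = adaptedD(2)[OF b l]
    have dims: "dim_row f = m" "dim_col f = n" "dim_row T = n" "dim_col T = n" "dim_row T' = n" "dim_col T' = n"
      "dim_row U = m" "dim_col U = m" "dim_row U' = m" "dim_col U' = m" "dim_row (\<rho> l) = n" "dim_col (\<rho> l) = n"
      "dim_row (\<sigma> l) = m" "dim_col (\<sigma> l) = m" using f T U rc sc by auto
    have L: "U' * cm f * T * mat_diag n (\<lambda>j. chi (t j) l) = U' * cm (f * \<rho> l) * T"
      using adapted_mult_basis(1)[OF a l] dims by (simp add: mult_assoc_dims cm_mult)
    have R: "mat_diag m (\<lambda>i. chi (s i) l) * (U' * cm f * T) = U' * cm (\<sigma> l * f) * T"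
    proof -
      have "mat_diag m (\<lambda>i. chi (s i) l) * (U' * cm f * T) = mat_diag m (\<lambda>i. chi (s i) l) * U' * cm f * T"
        using dims by (simp add: mult_assoc_dims)
      also have "\<dots> = U' * cm (\<sigma> l * f) * T"
        unfolding adapted_mult_basis(2)[OF b l, symmetric] using dims by (simp add: mult_assoc_dims cm_mult)
      finally show ?thesis .
    qed
    have canc: "U * (U' * cm X * T) * T' = cm X" if "X \<in> carrier_mat m n" for X
      using that dims T(3) inverse_mats_cancel[OF adaptedD(1)[OF b], of "cm X"]
      by (simp add: mult_assoc_dims inverse_mats_cancel[OF adaptedD(1)[OF b]] right_mult_one_mat[of _ m n])
    have "f * \<rho> l \<in> carrier_mat m n" "\<sigma> l * f \<in> carrier_mat m n" using f rc sc by auto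
    then show ?thesis unfolding L R using canc cm_inj by metis
  qed
  then show ?thesis unfolding supp_same_type_iff[OF phi] by blast
qed

section \<open>The correspondence between SHS and MHS\<close>

text \<open>
  By equivariance, the entry \<open>(i, j)\<close> of \<open>\<beta>\<close> at the point with \<open>x - \<i> y = m\<close> is the entry of \<open>D\<close>
  times the character of type \<open>t j - t i - (1, 1)\<close>. On the other hand it is a polynomial in \<open>x\<close> and
  \<open>y\<close>, hence a sum of characters with nonnegative exponents, so that \<open>t i - t j \<le> (- 1, - 1)\<close> by
  independence of characters.
\<close>

lemma shs_datum:
  assumes A: "is_shs A" and a: "adapted (shs_dim A) (shs_rep A) T T' t"
  shows "datum (shs_dim A) T T' t (shs_D A)"
proof -
  define n where "n = shs_dim A"
  note a = a[folded n_def] and h = shs_facts[OF A, folded n_def]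
  note T = inverse_matsD[OF adaptedD(1)[OF a]]
  let ?\<Delta> = "T' * cm (shs_D A) * T"
  have "supp_in t t both_neg ?\<Delta>"
    unfolding supp_in_def
  proof (intro allI impI)
    fix i j assume "i < dim_row ?\<Delta>" "j < dim_col ?\<Delta>" and ne: "?\<Delta> $$ (i, j) \<noteq> 0"
    then have ij: "i < n" "j < n" using T by auto
    let ?B = "\<lambda>m. cm (beta_at (shs_beta A) m)"
    let ?b = "\<lambda>m. (T' * ?B m * T) $$ (i, j)"
    let ?u = "t j - t i - (1, 1)"
    have b: "?b m = ?\<Delta> $$ (i, j) * chi ?u m" if m: "m \<noteq> 0" for m
    proof -
      let ?d = "mat_diag n (\<lambda>i. chi (t i) m)" and ?r = "cm (shs_rep A m)"
      have dims: "dim_row T = n" "dim_col T = n" "dim_row T' = n" "dim_col T' = n" "dim_row (shs_rep A m) = n" "dim_col (shs_rep A m) = n"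
        "dim_row (shs_beta A) = n" "dim_col (shs_beta A) = n" "dim_row (shs_D A) = n" "dim_col (shs_D A) = n"
        using T h(1)[OF m] h(6,7) by auto
      have "cm ((cmod m)\<^sup>2 \<cdot>\<^sub>m (shs_rep A m * beta_at (shs_beta A) m)) = chi (1, 1) m \<cdot>\<^sub>m (?r * ?B m)"
      proof -
        have "complex_of_real ((cmod m)\<^sup>2) = chi (1, 1) m" using complex_norm_square[of m] by (simp add: chi_def)
        then show ?thesis using dims by (simp flip: cm_mult) (auto intro!: eq_matI)
      qed
      then have eq: "chi (1, 1) m \<cdot>\<^sub>m (?r * ?B m) = cm (shs_D A) * ?r"
        using h(8)[OF m] dims by (simp add: cm_mult)
      have "chi (1, 1) m \<cdot>\<^sub>m (?d * (T' * ?B m * T)) = T' * (chi (1, 1) m \<cdot>\<^sub>m (?r * ?B m)) * T"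
      proof -
        have "?d * (T' * ?B m * T) = ?d * T' * (?B m * T)" using dims by (simp add: mult_assoc_dims)
        also have "\<dots> = T' * (?r * ?B m) * T"
          unfolding adapted_mult_basis(2)[OF a m, symmetric] using dims by (simp add: mult_assoc_dims)
        finally show ?thesis using dims
          by (simp add: smult_mult_dims mult_assoc_dims)
      qed
      also have "\<dots> = ?\<Delta> * ?d"
        unfolding eq using adapted_mult_basis(1)[OF a m] dims by (simp add: mult_assoc_dims)
      finally have "(chi (1, 1) m \<cdot>\<^sub>m (?d * (T' * ?B m * T))) $$ (i, j) = (?\<Delta> * ?d) $$ (i, j)" by simp
      moreover have "T' * ?B m * T \<in> carrier_mat n n" "?\<Delta> \<in> carrier_mat n n" using dims by (auto intro!: carrier_matI)
      ultimately have "chi (1, 1) m * (chi (t i) m * ?b m) = ?\<Delta> $$ (i, j) * chi (t j) m"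
        using ij by (simp add: mat_diag_mult_left mat_diag_mult_right del: index_mult_mat(1))
      moreover have "chi (t j) m = chi (1, 1) m * chi (t i) m * chi ?u m"
        using m by (simp flip: chi_add)
      ultimately show ?thesis using chi_nonzero[OF m, of "(1,1)"] chi_nonzero[OF m, of "t i"] by simp
    qed
    have const: "char_sum quadrant (\<lambda>m. c * f m)" if "char_sum quadrant f" for c f
      using char_sum_mult_chi[OF that, of "(0,0)" quadrant c] by (auto simp: plus_prod_def)
    have "char_sum quadrant (\<lambda>m. \<Sum>k<n. T $$ (k, j) * (\<Sum>l<n. T' $$ (i, l) * of_real (eval2 (shs_beta A $$ (l, k)) (Re m) (- Im m))))"
      by (intro char_sum_sum const char_sum_eval2 char_sum_Re_Im)
    moreover have "(\<Sum>k<n. T $$ (k, j) * (\<Sum>l<n. T' $$ (i, l) * of_real (eval2 (shs_beta A $$ (l, k)) (Re m) (- Im m)))) = ?b m" for m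
    proof -
      have "?b m = (\<Sum>k<n. (T' * ?B m) $$ (i, k) * T $$ (k, j))"
        using ij T h(6) by (subst mult_mat_index) auto
      also have "\<dots> = (\<Sum>k<n. (\<Sum>l<n. T' $$ (i, l) * ?B m $$ (l, k)) * T $$ (k, j))"
        using ij T h(6) by (intro sum.cong refl arg_cong2[where f = "(*)"], subst mult_mat_index) auto
      also have "\<dots> = (\<Sum>k<n. T $$ (k, j) * (\<Sum>l<n. T' $$ (i, l) * of_real (eval2 (shs_beta A $$ (l, k)) (Re m) (- Im m))))"
        using h(6) by (intro sum.cong refl) (auto simp: beta_at_def mult.commute intro!: sum.cong)
      finally show ?thesis by simp
    qed
    ultimately have "char_sum quadrant ?b" by simp
    from char_sum_chiD[OF this b ne] have "?u \<in> quadrant" by simp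
    then show "both_neg (fst (t i) - fst (t j)) (snd (t i) - snd (t j))" by (auto simp: quadrant_def)
  qed
  then show ?thesis
    unfolding datum_def hodge_datum_def n_def[symmetric]
    using adaptedD(1)[OF a] adapted_conj[OF a] h(7) by simp
qed

text \<open>
  Conversely, equivariance forces the value of \<open>\<beta>\<close> at \<open>m\<close> to be the matrix \<open>R m\<close> below. Its
  entries are combinations of characters with nonnegative exponents, that is, polynomials in \<open>x\<close>
  and \<open>y\<close>.
\<close>

lemma datum_shs:
  assumes "datum n T T' t D"
  shows "\<exists>A. is_shs A \<and> shs_dim A = n \<and> adapted n (shs_rep A) T T' t \<and> shs_D A = D"
proof -
  interpret datum n T T' t D by (rule assms)
  obtain \<rho> where a: "adapted n \<rho> T T' t" using adapted_exists[OF inv conj_supp] by blast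
  note rep = adapted_S_representation[OF a]
  have rc: "\<And>l. l \<noteq> 0 \<Longrightarrow> \<rho> l \<in> carrier_mat n n" and r1: "\<rho> 1 = 1\<^sub>m n"
    and rm: "\<And>l m. l \<noteq> 0 \<Longrightarrow> m \<noteq> 0 \<Longrightarrow> \<rho> (l * m) = \<rho> l * \<rho> m"
    using rep by (auto simp: S_representation_def)
  define R where "R l = (1 / (cmod l)\<^sup>2) \<cdot>\<^sub>m (\<rho> (inverse l) * (D * \<rho> l))" for l
  have Rc: "R l \<in> carrier_mat n n" if "l \<noteq> 0" for l
    unfolding R_def using rc[OF that] rc[of "inverse l"] that D by auto
  define G where "G l = mat n n (\<lambda>(i, j). \<Delta> $$ (i, j) * chi (t j - t i - (1, 1)) l)" for l
  have R_eq: "cm (R l) = T * G l * T'" if l: "l \<noteq> 0" for l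
  proof -
    have il: "inverse l \<noteq> 0" using l by simp
    let ?d = "\<lambda>l. mat_diag n (\<lambda>i. chi (t i) l)"
    have dims: "dim_row T = n" "dim_col T = n" "dim_row T' = n" "dim_col T' = n" "dim_row (\<rho> l) = n" "dim_col (\<rho> l) = n"
      "dim_row (\<rho> (inverse l)) = n" "dim_col (\<rho> (inverse l)) = n" "dim_row D = n" "dim_col D = n" "dim_row \<Delta> = n" "dim_col \<Delta> = n"
      using T rc[OF l] rc[OF il] D Delta by auto
    have "G l = complex_of_real (1 / (cmod l)\<^sup>2) \<cdot>\<^sub>m (?d (inverse l) * (\<Delta> * ?d l))"
    proof (rule eq_matI)
      fix i j assume "i < dim_row (complex_of_real (1 / (cmod l)\<^sup>2) \<cdot>\<^sub>m (?d (inverse l) * (\<Delta> * ?d l)))"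
        "j < dim_col (complex_of_real (1 / (cmod l)\<^sup>2) \<cdot>\<^sub>m (?d (inverse l) * (\<Delta> * ?d l)))"
      then have ij: "i < n" "j < n" using dims by auto
      have "complex_of_real ((cmod l)\<^sup>2) = chi (1, 1) l" using complex_norm_square[of l] by (simp add: chi_def)
      then have c: "complex_of_real (1 / (cmod l)\<^sup>2) = 1 / chi (1, 1) l" by simp
      have "\<Delta> * ?d l \<in> carrier_mat n n" using Delta by auto
      from mat_diag_mult_left[OF this] have "(?d (inverse l) * (\<Delta> * ?d l)) $$ (i, j) = chi (t i) (inverse l) * (\<Delta> $$ (i, j) * chi (t j) l)"
        using ij Delta by (simp add: mat_diag_mult_right[OF Delta])
      moreover have "chi (t j) l = chi (1, 1) l * chi (t i) l * chi (t j - t i - (1, 1)) l"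
        using l by (simp flip: chi_add)
      moreover have "chi (t i) (inverse l) * chi (t i) l = 1" using l by (simp flip: chi_mult)
      ultimately have "complex_of_real (1 / (cmod l)\<^sup>2) * (?d (inverse l) * (\<Delta> * ?d l)) $$ (i, j)
        = \<Delta> $$ (i, j) * chi (t j - t i - (1, 1)) l"
        unfolding c using chi_nonzero[OF l, of "(1,1)"] by (simp add: mult_ac)
      then show "G l $$ (i, j) = (complex_of_real (1 / (cmod l)\<^sup>2) \<cdot>\<^sub>m (?d (inverse l) * (\<Delta> * ?d l))) $$ (i, j)"
        using ij dims by (simp add: G_def del: index_mult_mat(1))
    qed (simp_all add: G_def Delta dims)
    then have "T * G l * T' = complex_of_real (1 / (cmod l)\<^sup>2) \<cdot>\<^sub>m (T * (?d (inverse l) * (\<Delta> * ?d l)) * T')"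
      using dims by (simp add: smult_mult_dims)
    also have "T * (?d (inverse l) * (\<Delta> * ?d l)) * T' = T * ?d (inverse l) * (\<Delta> * (?d l * T'))"
      using dims by (simp add: mult_assoc_dims)
    also have "\<dots> = cm (\<rho> (inverse l)) * (T * \<Delta> * (T' * cm (\<rho> l)))"
      unfolding adapted_mult_basis(1)[OF a il, symmetric] adapted_mult_basis(2)[OF a l, symmetric]
      using dims by (simp add: mult_assoc_dims)
    also have "T * \<Delta> * (T' * cm (\<rho> l)) = cm D * cm (\<rho> l)"
      unfolding D_mult_T[symmetric] using dims by (simp add: mult_assoc_dims inverse_mats_cancel[OF inv])
    also have "complex_of_real (1 / (cmod l)\<^sup>2) \<cdot>\<^sub>m (cm (\<rho> (inverse l)) * (cm D * cm (\<rho> l))) = cm (R l)"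
      unfolding R_def using dims by (simp flip: cm_mult) (auto intro!: eq_matI)
    finally show ?thesis by simp
  qed
  have "\<exists>p. \<forall>l. l \<noteq> 0 \<longrightarrow> R l $$ (i, j) = eval2 p (Re l) (- Im l)" if ij: "i < n" "j < n" for i j
  proof -
    let ?f = "\<lambda>l. \<Sum>k<n. (\<Sum>r<n. T $$ (i, r) * (\<Delta> $$ (r, k) * chi (t k - t r - (1, 1)) l)) * T' $$ (k, j)"
    have chi_term: "cfun polynomial_funs (\<lambda>l. \<Delta> $$ (r, k) * chi (t k - t r - (1, 1)) l)" if "r < n" "k < n" for r k
    proof (cases "\<Delta> $$ (r, k) = 0")
      case True
      then show ?thesis using cfun_ops(1)[OF fun_alg_polynomial, of 0] by simp
    next
      case False
      then have "t k - t r - (1, 1) \<in> quadrant"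
        using supp_inD[OF Delta_supp, of r k] Delta that by (auto simp: quadrant_def)
      then show ?thesis
        using cfun_ops(3)[OF fun_alg_polynomial cfun_ops(1)[OF fun_alg_polynomial] cfun_polynomial_chi] by simp
    qed
    have "cfun polynomial_funs (\<lambda>l. \<Sum>r<n. T $$ (i, r) * (\<Delta> $$ (r, k) * chi (t k - t r - (1, 1)) l))" if "k < n" for k
      by (rule cfun_ops(5)[OF fun_alg_polynomial], rule cfun_ops(3)[OF fun_alg_polynomial cfun_ops(1)[OF fun_alg_polynomial]])
         (use chi_term that in auto)
    then have "cfun polynomial_funs ?f"
      by (intro cfun_ops(5)[OF fun_alg_polynomial, of _ "\<lambda>k l. (\<Sum>r<n. T $$ (i, r) * (\<Delta> $$ (r, k) * chi (t k - t r - (1, 1)) l)) * T' $$ (k, j)"]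
          cfun_ops(3)[OF fun_alg_polynomial _ cfun_ops(1)[OF fun_alg_polynomial]]) auto
    then obtain p where p: "\<And>l. l \<noteq> 0 \<Longrightarrow> Re (?f l) = eval2 p (Re l) (- Im l)"
      by (auto simp: cfun_def polynomial_funs_def)
    have "R l $$ (i, j) = Re (?f l)" if l: "l \<noteq> 0" for l
    proof -
      have "complex_of_real (R l $$ (i, j)) = (T * G l * T') $$ (i, j)"
        using R_eq[OF l] Rc[OF l] ij by (metis carrier_matD index_map_mat(1))
      also have "\<dots> = (\<Sum>k<n. (T * G l) $$ (i, k) * T' $$ (k, j))"
        using ij T by (subst mult_mat_index) (auto simp: G_def)
      also have "\<dots> = ?f l"
        using ij T by (intro sum.cong refl arg_cong2[where f = "(*)"], subst mult_mat_index) (auto simp: G_def)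
      finally show ?thesis by (metis Re_complex_of_real)
    qed
    then show ?thesis using p by auto
  qed
  then have "\<exists>p. i < n \<longrightarrow> j < n \<longrightarrow> (\<forall>l. l \<noteq> 0 \<longrightarrow> R l $$ (i, j) = eval2 p (Re l) (- Im l))" for i j by blast
  then obtain p where p: "\<And>i j l. i < n \<Longrightarrow> j < n \<Longrightarrow> l \<noteq> 0 \<Longrightarrow> R l $$ (i, j) = eval2 (p i j) (Re l) (- Im l)" by metis
  define B where "B = mat n n (\<lambda>(i, j). p i j)"
  have B: "beta_at B l = R l" if l: "l \<noteq> 0" for l
    using Rc[OF l] p[OF _ _ l] by (intro eq_matI) (auto simp: B_def beta_at_def)
  have R1: "R 1 = D" unfolding R_def using D r1 by simp
  define A where "A = \<lparr>shs_dim = n, shs_rep = \<rho>, shs_beta = B\<rparr>"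
  have "is_shs A" unfolding is_shs_iff
  proof (intro conjI allI impI)
    show "S_representation (shs_dim A) (shs_rep A)" using rep by (simp add: A_def)
    show "shs_beta A \<in> carrier_mat (shs_dim A) (shs_dim A)" by (simp add: A_def B_def)
    fix l :: complex assume l: "l \<noteq> 0"
    then have il: "inverse l \<noteq> 0" by simp
    have inv: "\<rho> l * \<rho> (inverse l) = 1\<^sub>m n" using rm[OF l il] l r1 by simp
    have dims: "dim_row (\<rho> l) = n" "dim_col (\<rho> l) = n" "dim_row (\<rho> (inverse l)) = n" "dim_col (\<rho> (inverse l)) = n"
      "dim_row D = n" "dim_col D = n" using rc[OF l] rc[OF il] D by auto
    have "(cmod l)\<^sup>2 \<cdot>\<^sub>m (\<rho> l * R l) = \<rho> l * (\<rho> (inverse l) * (D * \<rho> l))"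
      unfolding R_def using dims l by (simp add: smult_mult_dims smult_smult_mat)
    also have "\<dots> = \<rho> l * \<rho> (inverse l) * (D * \<rho> l)" using dims by (simp add: mult_assoc_dims)
    also have "\<dots> = D * \<rho> l" unfolding inv using dims by (intro left_mult_one_mat[of _ n n] carrier_matI) auto
    finally show "(cmod l)\<^sup>2 \<cdot>\<^sub>m (shs_rep A l * beta_at (shs_beta A) l) = beta_at (shs_beta A) 1 * shs_rep A l"
      using B[OF l] B[OF one_neq_zero] R1 by (simp add: A_def)
  qed
  moreover have "shs_D A = D" unfolding shs_D_def using B[OF one_neq_zero] R1 by (simp add: A_def)
  ultimately show ?thesis using a by (intro exI[of _ A]) (simp add: A_def)
qed

text \<open>
  The same Hodge datum describes both objects. The bigrading is given by a basis, which is far from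
  unique, so that this is only a relation between the objects.
\<close>

definition corresponds :: "shs \<Rightarrow> mhs \<Rightarrow> bool" where
  "corresponds A X \<longleftrightarrow> is_shs A \<and> (\<exists>T T' t. adapted (shs_dim A) (shs_rep A) T T' t
     \<and> X = mhs_of (shs_dim A) T t (shs_D A))"

lemma correspondsE:
  assumes "corresponds A X"
  obtains T T' t where "is_shs A" "adapted (shs_dim A) (shs_rep A) T T' t" "X = mhs_of (shs_dim A) T t (shs_D A)"
  using assms unfolding corresponds_def by blast

lemma corresponds_hom:
  assumes "corresponds A X" "corresponds B Y"
  shows "shs_hom A B = mhs_hom X Y"
proof -
  obtain T T' t where A: "is_shs A" and a: "adapted (shs_dim A) (shs_rep A) T T' t" and X: "X = mhs_of (shs_dim A) T t (shs_D A)"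
    by (rule correspondsE[OF assms(1)])
  obtain U U' s where B: "is_shs B" and b: "adapted (shs_dim B) (shs_rep B) U U' s" and Y: "Y = mhs_of (shs_dim B) U s (shs_D B)"
    by (rule correspondsE[OF assms(2)])
  show ?thesis
  proof (rule Set.set_eqI)
    fix f
    have c: "f \<in> shs_hom A B \<Longrightarrow> f \<in> carrier_mat (shs_dim B) (shs_dim A)"
      "f \<in> mhs_hom X Y \<Longrightarrow> f \<in> carrier_mat (shs_dim B) (shs_dim A)"
      by (auto simp: shs_hom_def mhs_hom_def X Y mhs_of_def)
    show "f \<in> shs_hom A B \<longleftrightarrow> f \<in> mhs_hom X Y"
    proof (cases "f \<in> carrier_mat (shs_dim B) (shs_dim A)")
      case True
      show ?thesis
        unfolding shs_hom_iff[OF A B] X Y mhs_hom_iff[OF shs_datum[OF A a] shs_datum[OF B b] True]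
          adapted_commute_iff[OF a b True, symmetric] using True by blast
    qed (use c in blast)
  qed
qed

section \<open>Tensor products, duals and the unit\<close>

text \<open>
  Tensor products of elements of two spans expand into tensor products of basis vectors, whose
  degrees add up.
\<close>

lemma colspan_kron:
  fixes E G :: "'a :: field mat" and k :: int
  assumes E: "inverse_mats n E E'" and G: "inverse_mats m G G'"
    and R: "\<And>i j a b. i + j = k \<Longrightarrow> P i a \<Longrightarrow> Q j b \<Longrightarrow> R a b" "\<And>a b. R a b \<Longrightarrow> \<exists>i j. i + j = k \<and> P i a \<and> Q j b"
  shows "lin_span (n * m) {kron_vec v w | v w i j. i + j = k \<and> v \<in> colspan E (P i) \<and> w \<in> colspan G (Q j)}
    = colspan (kron_mat E G) (\<lambda>I. R (I div m) (I mod m))" (is "lin_span _ ?S = ?C")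
proof
  note Ec = inverse_matsD[OF E] and Gc = inverse_matsD[OF G]
  have EG: "inverse_mats (n * m) (kron_mat E G) (kron_mat E' G')" by (rule kron_inverse_mats[OF E G])
  note EGc = inverse_matsD[OF EG]
  have cs: "colspan E X \<subseteq> carrier_vec n" "colspan G Y \<subseteq> carrier_vec m" for X Y
    using is_subspaceD(1)[OF colspan_subspace[OF Ec(1)]] is_subspaceD(1)[OF colspan_subspace[OF Gc(1)]] by auto
  show "lin_span (n * m) ?S \<subseteq> ?C"
  proof (rule lin_span_least[OF colspan_subspace[OF EGc(1)]], rule subsetI)
    fix z assume "z \<in> ?S"
    then obtain v w i j where z: "z = kron_vec v w" and ij: "i + j = k" and v: "v \<in> colspan E (P i)" and w: "w \<in> colspan G (Q j)" by blast
    have vc: "v \<in> carrier_vec n" "w \<in> carrier_vec m" using v w cs by auto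
    have e: "kron_mat E' G' *\<^sub>v z = kron_vec (E' *\<^sub>v v) (G' *\<^sub>v w)"
      unfolding z by (rule kron_mult_vec) (use Ec Gc vc in auto)
    have d: "dim_vec (E' *\<^sub>v v) = n" "dim_vec (G' *\<^sub>v w) = m" using Ec Gc by auto
    show "z \<in> ?C" unfolding colspan_iff[OF EG]
    proof (intro conjI allI impI)
      show "z \<in> carrier_vec (n * m)" unfolding z by (rule kron_carrier(2)[OF vc])
      fix I assume I: "I < n * m" and "(kron_mat E' G' *\<^sub>v z) $ I \<noteq> 0"
      then have "(E' *\<^sub>v v) $ (I div m) \<noteq> 0" "(G' *\<^sub>v w) $ (I mod m) \<noteq> 0"
        unfolding e kron_vec_def d using I by auto
      then show "R (I div m) (I mod m)"
        using v w div_mod_bounds(1,2)[OF I] R(1)[OF ij] unfolding colspan_iff[OF E] colspan_iff[OF G] by blast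
    qed
  qed
  have Sc: "?S \<subseteq> carrier_vec (n * m)"
  proof
    fix z assume "z \<in> ?S"
    then obtain v w i j where "z = kron_vec v w" "v \<in> colspan E (P i)" "w \<in> colspan G (Q j)" by blast
    then show "z \<in> carrier_vec (n * m)" using cs(1)[of "P i"] cs(2)[of "Q j"] kron_carrier(2)[of v n w m] by blast
  qed
  show "?C \<subseteq> lin_span (n * m) ?S"
  proof (rule colspan_least[OF EGc(1) lin_span_subspace[OF Sc]])
    fix I assume I: "I < n * m" and RI: "R (I div m) (I mod m)"
    obtain i j where ij: "i + j = k" "P i (I div m)" "Q j (I mod m)" using R(2)[OF RI] by blast
    have "col E (I div m) \<in> colspan E (P i)" "col G (I mod m) \<in> colspan G (Q j)"
      using col_in_colspan[OF Ec(1) div_mod_bounds(1)[OF I], of "P i"] col_in_colspan[OF Gc(1) div_mod_bounds(2)[OF I], of "Q j"] ij by blast+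
    then have "kron_vec (col E (I div m)) (col G (I mod m)) \<in> ?S" using ij(1) by blast
    moreover have "col (kron_mat E G) I = kron_vec (col E (I div m)) (col G (I mod m))"
      using col_kron[of I E G] I Ec Gc by simp
    ultimately have "col (kron_mat E G) I \<in> ?S" by (simp only:)
    then show "col (kron_mat E G) I \<in> lin_span (n * m) ?S" by (rule subsetD[OF lin_span_superset[OF Sc]])
  qed
qed

lemma cm_kron: "cm (kron_mat A B) = kron_mat (cm A) (cm B)"
  by (rule kron_map) simp

lemma cv_kron: "cv (kron_vec v w) = kron_vec (cv v) (cv w)"
  by (rule kron_vec_map) simp

lemma cm_kron_sum:
  assumes "A \<in> carrier_mat n n" "B \<in> carrier_mat m m"
  shows "cm (kron_sum A B) = kron_sum (cm A) (cm B)"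
proof -
  have one: "cm (1\<^sub>m k) = 1\<^sub>m k" for k by (rule eq_matI) auto
  have "cm (X + Y) = cm X + cm Y" if "X \<in> carrier_mat (n * m) (n * m)" "Y \<in> carrier_mat (n * m) (n * m)" for X Y
    using that by (intro eq_matI) auto
  then show ?thesis using assms unfolding kron_sum_def
    by (simp add: cm_kron one kron_carrier(1)[of _ n n _ m m])
qed

text \<open>
  Expanding \<open>v\<close> and \<open>w\<close> into their real and imaginary parts writes \<open>v \<otimes> w\<close> in terms of tensor
  products of real vectors.
\<close>

lemma real_kron_span:
  assumes A: "is_subspace n A" "\<And>v. v \<in> A \<Longrightarrow> map_vec cnj v \<in> A" and B: "is_subspace m B" "\<And>v. v \<in> B \<Longrightarrow> map_vec cnj v \<in> B"
    and v: "v \<in> A" and w: "w \<in> B" and S: "is_subspace (n * m) S"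
    and gen: "\<And>v w. v \<in> carrier_vec n \<Longrightarrow> w \<in> carrier_vec m \<Longrightarrow> cv v \<in> A \<Longrightarrow> cv w \<in> B \<Longrightarrow> kron_vec v w \<in> S"
  shows "map_vec Re (kron_vec v w) \<in> S" "map_vec Im (kron_vec v w) \<in> S"
proof -
  have c: "v \<in> carrier_vec n" "w \<in> carrier_vec m" using is_subspaceD(1)[OF A(1)] is_subspaceD(1)[OF B(1)] v w by auto
  let ?v1 = "map_vec Re v" and ?v2 = "map_vec Im v" and ?w1 = "map_vec Re w" and ?w2 = "map_vec Im w"
  note S = is_subspaceD[OF S] and ri = cv_Re_Im_mem[OF A(1) A(2) v] cv_Re_Im_mem[OF B(1) B(2) w]
  have k: "kron_vec ?v1 ?w1 \<in> S" "kron_vec ?v2 ?w2 \<in> S" "kron_vec ?v1 ?w2 \<in> S" "kron_vec ?v2 ?w1 \<in> S"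
    using gen ri c by simp_all
  have "map_vec Re (kron_vec v w) = kron_vec ?v1 ?w1 - kron_vec ?v2 ?w2"
    using c by (intro eq_vecI) (auto simp: kron_vec_def div_mod_bounds)
  then show "map_vec Re (kron_vec v w) \<in> S" using k S(5) by simp
  have "map_vec Im (kron_vec v w) = kron_vec ?v1 ?w2 + kron_vec ?v2 ?w1"
    using c by (intro eq_vecI) (auto simp: kron_vec_def div_mod_bounds)
  then show "map_vec Im (kron_vec v w) \<in> S" using k S(3) by simp
qed

lemma complex_of_real_subspace:
  assumes "is_subspace n S"
  shows "is_subspace n {z \<in> carrier_vec n. map_vec Re z \<in> S \<and> map_vec Im z \<in> S}"
proof (rule is_subspaceI)
  let ?S = "{z \<in> carrier_vec n. map_vec Re z \<in> S \<and> map_vec Im z \<in> S}"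
  note S = is_subspaceD[OF assms]
  have "map_vec Re (0\<^sub>v n) = 0\<^sub>v n" "map_vec Im (0\<^sub>v n) = 0\<^sub>v n" by (intro eq_vecI; simp)+
  then show "0\<^sub>v n \<in> ?S" using S(2) by simp
  fix u v assume uv: "u \<in> ?S" "v \<in> ?S"
  then have "map_vec Re (u + v) = map_vec Re u + map_vec Re v" "map_vec Im (u + v) = map_vec Im u + map_vec Im v"
    by (auto intro!: eq_vecI)
  then show "u + v \<in> ?S" using uv S(3) by simp
next
  let ?S = "{z \<in> carrier_vec n. map_vec Re z \<in> S \<and> map_vec Im z \<in> S}"
  note S = is_subspaceD[OF assms]
  fix c v assume v: "v \<in> ?S"
  have "map_vec Re (c \<cdot>\<^sub>v v) = Re c \<cdot>\<^sub>v map_vec Re v - Im c \<cdot>\<^sub>v map_vec Im v"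
    "map_vec Im (c \<cdot>\<^sub>v v) = Re c \<cdot>\<^sub>v map_vec Im v + Im c \<cdot>\<^sub>v map_vec Re v"
    using v by (auto intro!: eq_vecI)
  then show "c \<cdot>\<^sub>v v \<in> ?S" using v S(3,4,5) by simp
qed auto

text \<open>
  The complex spans are spanned by parts of the basis \<open>T \<otimes> U\<close>. The weight filtration, however, is
  a real span, while the basis is complex. Its real span consists of the real points of the complex
  one, since real and imaginary parts of the generators of the latter lie in the former.
\<close>

lemma mhs_tensor_of:
  assumes X: "datum n T T' t D" and Y: "datum m U U' s D'"
  shows "mhs_tensor (mhs_of n T t D) (mhs_of m U s D')
    = mhs_of (n * m) (kron_mat T U) (\<lambda>I. t (I div m) + s (I mod m)) (kron_sum D D')"
proof -
  interpret x: datum n T T' t D by (rule X)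
  interpret y: datum m U U' s D' by (rule Y)
  let ?r = "\<lambda>I. t (I div m) + s (I mod m)"
  have F: "lin_span (n * m) {kron_vec v w |v w i j. i + j = p \<and> v \<in> hodge_fil (mhs_of n T t D) i \<and> w \<in> hodge_fil (mhs_of m U s D') j}
      = hodge_fil (mhs_of (n * m) (kron_mat T U) ?r (kron_sum D D')) p" for p
  proof -
    have "mexp (n * m) \<i> (cm (kron_sum D D')) * kron_mat T U = kron_mat (x.E \<i>) (y.E \<i>)"
      unfolding cm_kron_sum[OF x.D y.D] mexp_kron_sum(2)[OF x.nil_D y.nil_D]
      by (rule kron_mult[symmetric, OF mexp_carrier[OF x.nil_D] x.T(1) mexp_carrier[OF y.nil_D] y.T(1)])
    moreover have "lin_span (n * m) {kron_vec v w |v w i j. i + j = p \<and> v \<in> colspan (x.E \<i>) (\<lambda>a. i \<le> fst (t a)) \<and> w \<in> colspan (y.E \<i>) (\<lambda>b. j \<le> fst (s b))}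
        = colspan (kron_mat (x.E \<i>) (y.E \<i>)) (\<lambda>I. p \<le> fst (t (I div m)) + fst (s (I mod m)))"
      by (rule colspan_kron[OF x.E_inv y.E_inv, where R = "\<lambda>a b. p \<le> fst (t a) + fst (s b)"], linarith)
         (rule_tac x = "fst (t a)" in exI, rule_tac x = "p - fst (t a)" in exI, simp)
    ultimately show ?thesis by (simp add: mhs_of_def)
  qed
  have TU: "inverse_mats (n * m) (kron_mat T U) (kron_mat T' U')" by (rule kron_inverse_mats[OF x.inv y.inv])
  have W: "lin_span (n * m) {kron_vec v w |v w i j. i + j = k \<and> v \<in> weight_fil (mhs_of n T t D) i \<and> w \<in> weight_fil (mhs_of m U s D') j}
      = weight_fil (mhs_of (n * m) (kron_mat T U) ?r (kron_sum D D')) k" (is "lin_span _ ?S = _") for k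
  proof -
    let ?C = "colspan (kron_mat T U) (\<lambda>I. wt (t (I div m)) + wt (s (I mod m)) \<le> k)"
    let ?CS = "{kron_vec v w |v w i j. i + j = k \<and> v \<in> x.Wc i \<and> w \<in> y.Wc j}"
    have C: "lin_span (n * m) ?CS = ?C"
      by (rule colspan_kron[OF x.inv y.inv, where R = "\<lambda>a b. wt (t a) + wt (s b) \<le> k"], linarith)
         (rule_tac x = "wt (t a)" in exI, rule_tac x = "k - wt (t a)" in exI, simp)
    have Csub: "is_subspace (n * m) ?C" by (rule colspan_subspace[OF inverse_matsD(1)[OF TU]])
    have CSc: "?CS \<subseteq> carrier_vec (n * m)"
    proof
      fix z assume "z \<in> ?CS"
      then obtain v w i j where "z = kron_vec v w" "v \<in> x.Wc i" "w \<in> y.Wc j" by blast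
      then show "z \<in> carrier_vec (n * m)"
        using kron_carrier(2)[of v n w m] is_subspaceD(1)[OF x.Wc_subspace, of i] is_subspaceD(1)[OF y.Wc_subspace, of j] by blast
    qed
    have Sc: "?S \<subseteq> carrier_vec (n * m)"
    proof
      fix z assume "z \<in> ?S"
      then obtain v w i j where z: "z = kron_vec v w" and vw: "v \<in> weight_fil (mhs_of n T t D) i" "w \<in> weight_fil (mhs_of m U s D') j" by blast
      have "v \<in> carrier_vec n" using vw(1) by (simp add: mhs_of_def)
      moreover have "w \<in> carrier_vec m" using vw(2) by (simp add: mhs_of_def)
      ultimately show "z \<in> carrier_vec (n * m)" unfolding z by (rule kron_carrier(2))
    qed
    let ?V = "{z \<in> carrier_vec (n * m). map_vec Re z \<in> lin_span (n * m) ?S \<and> map_vec Im z \<in> lin_span (n * m) ?S}"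
    have "?CS \<subseteq> ?V"
    proof
      fix z assume z: "z \<in> ?CS"
      then obtain v w i j where d: "z = kron_vec v w" "i + j = k" "v \<in> x.Wc i" "w \<in> y.Wc j" by blast
      have gen: "kron_vec v w \<in> lin_span (n * m) ?S"
        if "v \<in> carrier_vec n" "w \<in> carrier_vec m" "cv v \<in> x.Wc i" "cv w \<in> y.Wc j" for v w
      proof -
        have "kron_vec v w \<in> ?S" using d(2) that by (auto simp: mhs_of_def)
        then show ?thesis using lin_span_superset[OF Sc] by blast
      qed
      have "map_vec Re z \<in> lin_span (n * m) ?S"
        unfolding d(1) by (rule real_kron_span(1)[OF x.Wc_subspace x.Wc_cnj y.Wc_subspace y.Wc_cnj d(3,4) lin_span_subspace[OF Sc] gen])
      moreover have "map_vec Im z \<in> lin_span (n * m) ?S"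
        unfolding d(1) by (rule real_kron_span(2)[OF x.Wc_subspace x.Wc_cnj y.Wc_subspace y.Wc_cnj d(3,4) lin_span_subspace[OF Sc] gen])
      moreover have "z \<in> carrier_vec (n * m)" using CSc z by (rule subsetD)
      ultimately show "z \<in> ?V" by (intro CollectI conjI)
    qed
    then have sub: "?C \<subseteq> ?V" unfolding C[symmetric] by (rule lin_span_least[OF complex_of_real_subspace[OF lin_span_subspace[OF Sc]]])
    have rk: "?S \<subseteq> {v \<in> carrier_vec (n * m). cv v \<in> ?C}"
    proof
      fix z assume z: "z \<in> ?S"
      then obtain v w i j where d: "z = kron_vec v w" "i + j = k" "v \<in> weight_fil (mhs_of n T t D) i" "w \<in> weight_fil (mhs_of m U s D') j" by blast
      have "cv z \<in> ?CS" unfolding d(1) cv_kron using d(2-4) by (auto simp: mhs_of_def)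
      then show "z \<in> {v \<in> carrier_vec (n * m). cv v \<in> ?C}" using lin_span_superset[OF CSc] Sc z unfolding C by blast
    qed
    have "lin_span (n * m) ?S = {v \<in> carrier_vec (n * m). cv v \<in> ?C}"
    proof
      show "lin_span (n * m) ?S \<subseteq> {v \<in> carrier_vec (n * m). cv v \<in> ?C}"
        by (rule lin_span_least[OF real_points_subspace[OF Csub] rk])
      show "{v \<in> carrier_vec (n * m). cv v \<in> ?C} \<subseteq> lin_span (n * m) ?S"
      proof
        fix v assume v: "v \<in> {v \<in> carrier_vec (n * m). cv v \<in> ?C}"
        then have "map_vec Re (cv v) \<in> lin_span (n * m) ?S" using sub by blast
        moreover have "map_vec Re (cv v) = v" by (rule eq_vecI) auto
        ultimately show "v \<in> lin_span (n * m) ?S" by simp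
      qed
    qed
    moreover have "(\<lambda>I. wt (?r I) \<le> k) = (\<lambda>I. wt (t (I div m)) + wt (s (I mod m)) \<le> k)" by (simp add: algebra_simps)
    ultimately show ?thesis by (simp add: mhs_of_def)
  qed
  have dims: "mhs_dim (mhs_of n T t D) = n" "mhs_dim (mhs_of m U s D') = m" by (simp_all add: mhs_of_def)
  show ?thesis unfolding mhs_tensor_def Let_def dims F W by (simp add: mhs_of_def)
qed

text \<open>
  The coordinates of a functional with respect to the dual basis are its values on the basis.
\<close>

lemma colspan_annihilator:
  fixes E :: "'a :: field mat"
  assumes E: "inverse_mats n E E'"
  shows "{\<phi> \<in> carrier_vec n. \<forall>v \<in> colspan E P. \<phi> \<bullet> v = 0} = colspan (transpose_mat E') (\<lambda>i. \<not> P i)"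
proof -
  note Ec = inverse_matsD[OF E]
  have Et: "inverse_mats n (transpose_mat E') (transpose_mat E)"
    using Ec transpose_mult[OF Ec(1) Ec(2)] by (intro inverse_matsI) auto
  have e: "(transpose_mat E *\<^sub>v \<phi>) $ i = \<phi> \<bullet> col E i" if "\<phi> \<in> carrier_vec n" "i < n" for \<phi> i
    using that Ec by (simp add: comm_scalar_prod[of _ n])
  have "(\<forall>v \<in> colspan E P. \<phi> \<bullet> v = 0) \<longleftrightarrow> (\<forall>i<n. (transpose_mat E *\<^sub>v \<phi>) $ i \<noteq> 0 \<longrightarrow> \<not> P i)"
    if p: "\<phi> \<in> carrier_vec n" for \<phi>
  proof
    assume h: "\<forall>v \<in> colspan E P. \<phi> \<bullet> v = 0"
    show "\<forall>i<n. (transpose_mat E *\<^sub>v \<phi>) $ i \<noteq> 0 \<longrightarrow> \<not> P i"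
    proof (intro allI impI notI)
      fix i assume i: "i < n" and ne: "(transpose_mat E *\<^sub>v \<phi>) $ i \<noteq> 0" and "P i"
      then have "col E i \<in> colspan E P" using col_in_colspan[OF Ec(1) i, of P] by blast
      then show False using h ne unfolding e[OF p i] by blast
    qed
  next
    assume h: "\<forall>i<n. (transpose_mat E *\<^sub>v \<phi>) $ i \<noteq> 0 \<longrightarrow> \<not> P i"
    have "is_subspace n {v \<in> carrier_vec n. \<phi> \<bullet> v = 0}"
      by (rule is_subspaceI) (use p in \<open>auto simp: scalar_prod_add_distrib[of _ n]\<close>)
    then have "colspan E P \<subseteq> {v \<in> carrier_vec n. \<phi> \<bullet> v = 0}"
    proof (rule colspan_least[OF Ec(1)])
      fix j assume j: "j < n" "P j"
      then have "\<phi> \<bullet> col E j = 0" using h e[OF p j(1)] by metis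
      then show "col E j \<in> {v \<in> carrier_vec n. \<phi> \<bullet> v = 0}" using Ec(1) by auto
    qed
    then show "\<forall>v \<in> colspan E P. \<phi> \<bullet> v = 0" by blast
  qed
  then show ?thesis unfolding set_eq_iff colspan_iff[OF Et] mem_Collect_eq by blast
qed

lemma mhs_dual_of:
  assumes X: "datum n T T' t D"
  shows "mhs_dual (mhs_of n T t D) = mhs_of n (transpose_mat T') (\<lambda>i. - t i) (- transpose_mat D)"
proof -
  interpret datum n T T' t D by (rule X)
  have F: "{\<phi> \<in> carrier_vec n. \<forall>v \<in> hodge_fil (mhs_of n T t D) (1 - p). \<phi> \<bullet> v = 0}
      = hodge_fil (mhs_of n (transpose_mat T') (\<lambda>i. - t i) (- transpose_mat D)) p" for p
  proof -
    have "cm (- transpose_mat D) = (- 1) \<cdot>\<^sub>m transpose_mat (cm D)" using D by (intro eq_matI) auto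
    then have "mexp n \<i> (cm (- transpose_mat D)) * transpose_mat T' = transpose_mat (mexp n (- \<i>) (cm D)) * transpose_mat T'"
      using mexp_smult[OF fps_mat_transpose(1)[OF nil_D], of \<i> "- 1"] mexp_transpose[OF nil_D, of "- \<i>"] by simp
    also have "\<dots> = transpose_mat (T' * mexp n (- \<i>) (cm D))"
      using transpose_mult[OF T(2) mexp_carrier[OF nil_D]] by simp
    finally have "mexp n \<i> (cm (- transpose_mat D)) * transpose_mat T' = transpose_mat (T' * mexp n (- \<i>) (cm D))" .
    moreover have "(\<lambda>i. \<not> 1 - p \<le> fst (t i)) = (\<lambda>i. p \<le> fst (- t i))" by (auto simp: fun_eq_iff)
    ultimately show ?thesis
      using colspan_annihilator[OF E_inv', of \<i> "\<lambda>i. 1 - p \<le> fst (t i)"] by (simp add: mhs_of_def)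
  qed
  have W: "{\<phi> \<in> carrier_vec n. \<forall>v \<in> weight_fil (mhs_of n T t D) (- k - 1). \<phi> \<bullet> v = 0}
      = weight_fil (mhs_of n (transpose_mat T') (\<lambda>i. - t i) (- transpose_mat D)) k" for k
  proof -
    have e: "(\<lambda>i. \<not> wt (t i) \<le> - k - 1) = (\<lambda>i. wt (- t i) \<le> k)" by (auto simp: fun_eq_iff)
    have cvp: "cv \<phi> \<bullet> cv v = complex_of_real (\<phi> \<bullet> v)" if "\<phi> \<in> carrier_vec n" "v \<in> carrier_vec n" for \<phi> v
      using that by (auto simp: scalar_prod_def)
    have "(\<forall>v \<in> weight_fil (mhs_of n T t D) (- k - 1). \<phi> \<bullet> v = 0) \<longleftrightarrow> (\<forall>z \<in> Wc (- k - 1). cv \<phi> \<bullet> z = 0)"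
      if p: "\<phi> \<in> carrier_vec n" for \<phi>
    proof
      assume h: "\<forall>v \<in> weight_fil (mhs_of n T t D) (- k - 1). \<phi> \<bullet> v = 0"
      show "\<forall>z \<in> Wc (- k - 1). cv \<phi> \<bullet> z = 0"
      proof
        fix z assume z: "z \<in> Wc (- k - 1)"
        then have zc: "z \<in> carrier_vec n" using is_subspaceD(1)[OF Wc_subspace] by blast
        have ri: "map_vec Re z \<in> carrier_vec n" "map_vec Im z \<in> carrier_vec n" using zc by auto
        have "\<phi> \<bullet> map_vec Re z = 0" "\<phi> \<bullet> map_vec Im z = 0"
          using h cv_Re_Im_mem[OF Wc_subspace Wc_cnj z] ri by (auto simp: mhs_of_def)
        then have "cv \<phi> \<bullet> cv (map_vec Re z) = 0" "cv \<phi> \<bullet> cv (map_vec Im z) = 0"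
          using cvp[OF p ri(1)] cvp[OF p ri(2)] by simp_all
        then have "cv \<phi> \<bullet> (cv (map_vec Re z) + \<i> \<cdot>\<^sub>v cv (map_vec Im z)) = 0"
          using p ri by (subst scalar_prod_add_distrib[of _ n]) auto
        then show "cv \<phi> \<bullet> z = 0" using vec_Re_Im[OF zc] by simp
      qed
    next
      assume h: "\<forall>z \<in> Wc (- k - 1). cv \<phi> \<bullet> z = 0"
      show "\<forall>v \<in> weight_fil (mhs_of n T t D) (- k - 1). \<phi> \<bullet> v = 0"
      proof
        fix v assume "v \<in> weight_fil (mhs_of n T t D) (- k - 1)"
        then have v: "v \<in> carrier_vec n" "cv v \<in> Wc (- k - 1)" by (auto simp: mhs_of_def)
        then have "cv \<phi> \<bullet> cv v = 0" using h by blast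
        then show "\<phi> \<bullet> v = 0" unfolding cvp[OF p v(1)] by simp
      qed
    qed
    moreover have "cv \<phi> \<in> colspan (transpose_mat T') (\<lambda>i. wt (- t i) \<le> k) \<longleftrightarrow> (\<forall>z \<in> Wc (- k - 1). cv \<phi> \<bullet> z = 0)"
      if p: "\<phi> \<in> carrier_vec n" for \<phi>
      unfolding e[symmetric] colspan_annihilator[OF inv, symmetric] using p by simp
    ultimately show ?thesis by (auto simp: mhs_of_def)
  qed
  have dims: "mhs_dim (mhs_of n T t D) = n" by (simp add: mhs_of_def)
  show ?thesis unfolding mhs_dual_def dims F W by (simp add: mhs_of_def)
qed

lemma mhs_unit_of: "mhs_unit = mhs_of 1 (1\<^sub>m 1) (\<lambda>i. (0, 0)) (0\<^sub>m 1 1)"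
proof -
  have nil: "nilpotent_mat 1 (0\<^sub>m 1 1 :: complex mat)"
    unfolding nilpotent_mat_def by (intro conjI exI[of _ 1]) auto
  have "cm (0\<^sub>m 1 1) = 0 \<cdot>\<^sub>m (0\<^sub>m 1 1)" by (rule eq_matI) auto
  then have e: "mexp 1 \<i> (cm (0\<^sub>m 1 1)) * 1\<^sub>m 1 = 1\<^sub>m 1"
    using mexp_smult[OF nil, of \<i> 0] mexp_0[OF nil] by simp
  have i1: "inverse_mats 1 (1\<^sub>m 1) (1\<^sub>m 1 :: complex mat)" by (rule inverse_matsI) auto
  have c: "colspan (1\<^sub>m 1) (\<lambda>i. Q) = (if Q then carrier_vec 1 else {0\<^sub>v 1 :: complex vec})" for Q
    unfolding set_eq_iff colspan_iff[OF i1] by (auto intro!: eq_vecI)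
  have W: "{v \<in> carrier_vec 1. cv v \<in> (if Q then carrier_vec 1 else {0\<^sub>v 1})} = (if Q then carrier_vec 1 else {0\<^sub>v 1})" for Q
  proof (cases Q)
    case False
    have "v = 0\<^sub>v 1" if "cv v = 0\<^sub>v 1" for v :: "real vec"
    proof (rule eq_vecI)
      have d: "dim_vec v = 1" using arg_cong[OF that, of dim_vec] by simp
      then show "dim_vec v = dim_vec (0\<^sub>v 1)" by simp
      show "v $ i = 0\<^sub>v 1 $ i" if "i < dim_vec (0\<^sub>v 1)" for i
        using arg_cong[OF \<open>cv v = 0\<^sub>v 1\<close>, of "\<lambda>x. x $ i"] that d by simp
    qed
    moreover have "cv (0\<^sub>v 1) = 0\<^sub>v 1" by (rule eq_vecI) auto
    ultimately show ?thesis using False by auto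
  qed auto
  show ?thesis unfolding mhs_unit_def mhs_of_def e by (simp add: c W del: One_nat_def)
qed

lemma corresponds_unit: "corresponds shs_unit mhs_unit"
  unfolding corresponds_def
proof (intro conjI exI)
  show "is_shs shs_unit" by (rule is_shs_unit)
  show "adapted (shs_dim shs_unit) (shs_rep shs_unit) (1\<^sub>m 1) (1\<^sub>m 1) (\<lambda>i. (0, 0))"
    using adapted_unit by (simp add: shs_unit_def zero_prod_def del: One_nat_def)
  show "mhs_unit = mhs_of (shs_dim shs_unit) (1\<^sub>m 1) (\<lambda>i. (0, 0)) (shs_D shs_unit)"
    unfolding shs_D_unit mhs_unit_of by (simp add: shs_unit_def del: One_nat_def)
qed

lemma corresponds_tensor:
  assumes "corresponds A X" "corresponds B Y"
  shows "corresponds (shs_tensor A B) (mhs_tensor X Y)"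
proof -
  obtain T T' t where A: "is_shs A" and a: "adapted (shs_dim A) (shs_rep A) T T' t" and X: "X = mhs_of (shs_dim A) T t (shs_D A)"
    by (rule correspondsE[OF assms(1)])
  obtain U U' s where B: "is_shs B" and b: "adapted (shs_dim B) (shs_rep B) U U' s" and Y: "Y = mhs_of (shs_dim B) U s (shs_D B)"
    by (rule correspondsE[OF assms(2)])
  show ?thesis unfolding corresponds_def
  proof (intro conjI exI)
    show "is_shs (shs_tensor A B)" by (rule is_shs_tensor[OF A B])
    show "adapted (shs_dim (shs_tensor A B)) (shs_rep (shs_tensor A B)) (kron_mat T U) (kron_mat T' U')
        (\<lambda>I. t (I div shs_dim B) + s (I mod shs_dim B))"
      using adapted_kron[OF a b] by (simp add: shs_tensor_def)
    show "mhs_tensor X Y = mhs_of (shs_dim (shs_tensor A B)) (kron_mat T U) (\<lambda>I. t (I div shs_dim B) + s (I mod shs_dim B)) (shs_D (shs_tensor A B))"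
      unfolding X Y mhs_tensor_of[OF shs_datum[OF A a] shs_datum[OF B b]] shs_D_tensor[OF A B] by (simp add: shs_tensor_def)
  qed
qed

lemma corresponds_dual:
  assumes "corresponds A X"
  shows "corresponds (shs_dual A) (mhs_dual X)"
proof -
  obtain T T' t where A: "is_shs A" and a: "adapted (shs_dim A) (shs_rep A) T T' t" and X: "X = mhs_of (shs_dim A) T t (shs_D A)"
    by (rule correspondsE[OF assms(1)])
  show ?thesis unfolding corresponds_def
  proof (intro conjI exI)
    show "is_shs (shs_dual A)" by (rule is_shs_dual[OF A])
    show "adapted (shs_dim (shs_dual A)) (shs_rep (shs_dual A)) (transpose_mat T') (transpose_mat T) (\<lambda>i. - t i)"
      using adapted_dual[OF a] by (simp add: shs_dual_def)
    show "mhs_dual X = mhs_of (shs_dim (shs_dual A)) (transpose_mat T') (\<lambda>i. - t i) (shs_D (shs_dual A))"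
      unfolding X mhs_dual_of[OF shs_datum[OF A a]] shs_D_dual by (simp add: shs_dual_def)
  qed
qed

section \<open>Straightening a basis\<close>

abbreviation has_supp :: "nat \<Rightarrow> (nat \<Rightarrow> int \<times> int) \<Rightarrow> (nat \<Rightarrow> int \<times> int) \<Rightarrow> (int \<Rightarrow> int \<Rightarrow> bool) \<Rightarrow> complex mat \<Rightarrow> bool" where
  "has_supp n r c C A \<equiv> A \<in> carrier_mat n n \<and> supp_in r c C A"

lemma has_supp_mult:
  "has_supp n r k C A \<Longrightarrow> has_supp n k c C' B \<Longrightarrow> (\<And>a b a' b'. C a b \<Longrightarrow> C' a' b' \<Longrightarrow> C'' (a + a') (b + b'))
    \<Longrightarrow> has_supp n r c C'' (A * B)"
  by (intro conjI mult_carrier_mat[of _ n n]; (rule supp_in_mult[of r k C A c C' B C''])?) auto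

lemma has_supp_add:
  assumes "has_supp n r c C A" "has_supp n r c C B"
  shows "has_supp n r c C (A + B)"
proof
  show "A + B \<in> carrier_mat n n" using assms by simp
  show "supp_in r c C (A + B)" by (rule supp_in_add) (use assms in auto)
qed

lemma has_supp_diff:
  assumes "has_supp n r c C A" "has_supp n r c C B"
  shows "has_supp n r c C (A - B)"
proof
  show "A - B \<in> carrier_mat n n" using assms by (intro minus_carrier_mat) simp
  show "supp_in r c C (A - B)" by (rule supp_in_diff) (use assms in auto)
qed

lemma has_supp_mono: "has_supp n r c C A \<Longrightarrow> (\<And>a b. C a b \<Longrightarrow> C' a b) \<Longrightarrow> has_supp n r c C' A"
  using supp_in_mono[of r c C A C'] by auto

lemma has_supp_cnj: "has_supp n r c C A \<Longrightarrow> has_supp n (swap_types r) (swap_types c) (\<lambda>a b. C b a) (cnj_mat A)"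
  using cnj_mat_supp by auto

lemma has_supp_cnj': "has_supp n r (swap_types c) C A \<Longrightarrow> has_supp n (swap_types r) c (\<lambda>a b. C b a) (cnj_mat A)"
  using has_supp_cnj[of A n r "swap_types c" C] by simp

lemma has_supp_one: "C 0 0 \<Longrightarrow> has_supp n r r C (1\<^sub>m n)"
  using supp_in_one[of C r n] by simp

lemma has_suppD:
  "has_supp n r c C A \<Longrightarrow> i < n \<Longrightarrow> j < n \<Longrightarrow> A $$ (i, j) \<noteq> 0 \<Longrightarrow> C (fst (r i) - fst (c j)) (snd (r i) - snd (c j))"
  using supp_inD[of r c C A i j] by auto

lemma has_suppI:
  "A \<in> carrier_mat n n \<Longrightarrow> (\<And>i j. i < n \<Longrightarrow> j < n \<Longrightarrow> A $$ (i, j) \<noteq> 0 \<Longrightarrow> C (fst (r i) - fst (c j)) (snd (r i) - snd (c j)))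
    \<Longrightarrow> has_supp n r c C A"
  by (auto simp: supp_in_def)

lemma has_supp_disjoint:
  assumes "has_supp n r c C A" "has_supp n r c C' A" "\<And>a b. C a b \<Longrightarrow> C' a b \<Longrightarrow> False"
  shows "A = 0\<^sub>m n n"
proof (rule eq_matI)
  fix i j assume "i < dim_row (0\<^sub>m n n)" "j < dim_col (0\<^sub>m n n)"
  then have ij: "i < n" "j < n" by auto
  have "A $$ (i, j) = 0" using has_suppD[OF assms(1) ij] has_suppD[OF assms(2) ij] assms(3) by blast
  then show "A $$ (i, j) = 0\<^sub>m n n $$ (i, j)" using ij by simp
qed (use assms(1) in auto)

definition bidegree_part :: "(nat \<Rightarrow> int \<times> int) \<Rightarrow> (nat \<Rightarrow> int \<times> int) \<Rightarrow> (int \<Rightarrow> int \<Rightarrow> bool) \<Rightarrow> complex mat \<Rightarrow> complex mat" where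
  "bidegree_part r c C A = mat (dim_row A) (dim_col A)
     (\<lambda>(i, j). if C (fst (r i) - fst (c j)) (snd (r i) - snd (c j)) then A $$ (i, j) else 0)"

lemma has_supp_bidegree_part: "A \<in> carrier_mat n n \<Longrightarrow> has_supp n r c C (bidegree_part r c C A)"
  by (auto simp: bidegree_part_def supp_in_def)

lemma bidegree_part_split:
  assumes A: "has_supp n r c (\<lambda>a b. C a b \<or> C' a b) A" and "\<And>a b. C a b \<Longrightarrow> C' a b \<Longrightarrow> False"
  shows "A = bidegree_part r c C A + bidegree_part r c C' A"
proof (rule eq_matI)
  fix i j assume "i < dim_row (bidegree_part r c C A + bidegree_part r c C' A)" "j < dim_col (bidegree_part r c C A + bidegree_part r c C' A)"
  then have ij: "i < n" "j < n" using A by (auto simp: bidegree_part_def)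
  then show "A $$ (i, j) = (bidegree_part r c C A + bidegree_part r c C' A) $$ (i, j)"
    using has_suppD[OF A ij] assms(2)[of "fst (r i) - fst (c j)" "snd (r i) - snd (c j)"] A
    by (cases "A $$ (i, j) = 0") (auto simp: bidegree_part_def)
qed (simp_all add: bidegree_part_def)

lemma mult_add_dims:
  fixes A :: "'a :: semiring_0 mat"
  shows "dim_col A = dim_row B \<Longrightarrow> dim_row C = dim_row B \<Longrightarrow> dim_col C = dim_col B \<Longrightarrow> A * (B + C) = A * B + A * C"
    "dim_col A = dim_row C \<Longrightarrow> dim_row B = dim_row A \<Longrightarrow> dim_col B = dim_col A \<Longrightarrow> (A + B) * C = A * C + B * C"
proof -
  assume d: "dim_col A = dim_row B" "dim_row C = dim_row B" "dim_col C = dim_col B"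
  show "A * (B + C) = A * B + A * C"
    by (rule mult_add_distrib_mat[of _ "dim_row A" "dim_row B" _ "dim_col B"]) (use d in \<open>auto intro: carrier_matI\<close>)
next
  assume d: "dim_col A = dim_row C" "dim_row B = dim_row A" "dim_col B = dim_col A"
  show "(A + B) * C = A * C + B * C"
    by (rule add_mult_distrib_mat[of _ "dim_row A" "dim_row C" _ _ "dim_col C"]) (use d in \<open>auto intro: carrier_matI\<close>)
qed

text \<open>
  The inverse of \<open>1 + Z\<close> is a power series in \<open>Z\<close> with constant term \<open>1\<close>.
\<close>

lemma unipotent_inverse:
  fixes Z :: "complex mat"
  assumes Z: "has_supp n t t C Z" and C: "\<And>a b. C a b \<Longrightarrow> a + b < 0"
    and add: "\<And>a b a' b'. C a b \<Longrightarrow> C a' b' \<Longrightarrow> C (a + a') (b + b')"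
  shows "\<exists>G'. inverse_mats n (1\<^sub>m n + Z) G' \<and> has_supp n t t C (G' - 1\<^sub>m n)"
proof -
  have Zc: "Z \<in> carrier_mat n n" and Zs: "supp_in t t C Z" using Z by auto
  have nil: "nilpotent_mat n Z" by (rule supp_in_nilpotent[OF Zc Zs C])
  let ?f = "inverse (1 + fps_X) :: complex fps"
  let ?G = "fps_mat n ?f Z"
  note carr = fps_mat_carrier[OF nil]
  have "fps_mat n (1 + fps_X) Z - 1\<^sub>m n = fps_mat n (1 + fps_X - 1) Z" by (rule fps_mat_minus_const[OF nil, symmetric])
  also have "\<dots> = 1 \<cdot>\<^sub>m Z" using fps_mat_linear[OF nil, of 1] by simp
  also have "\<dots> = Z" by (rule eq_matI) auto
  finally have m: "fps_mat n (1 + fps_X) Z - 1\<^sub>m n = Z" .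
  have e: "fps_mat n (1 + fps_X) Z = 1\<^sub>m n + Z"
  proof (rule eq_matI)
    fix i j assume "i < dim_row (1\<^sub>m n + Z)" "j < dim_col (1\<^sub>m n + Z)"
    then have ij: "i < n" "j < n" using Zc by auto
    have "(fps_mat n (1 + fps_X) Z - 1\<^sub>m n) $$ (i, j) = Z $$ (i, j)" unfolding m ..
    then show "fps_mat n (1 + fps_X) Z $$ (i, j) = (1\<^sub>m n + Z) $$ (i, j)"
      using ij Zc carrier_matD[OF carr] by (simp add: algebra_simps)
  qed (use Zc carrier_matD[OF carr] in auto)
  have "(1 + fps_X) * ?f = 1" by (rule inverse_mult_eq_1') simp
  then have "fps_mat n (1 + fps_X) Z * ?G = 1\<^sub>m n" using fps_mat_mult[OF nil, of "1 + fps_X" ?f] fps_mat_1[OF nil] by simp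
  then have "inverse_mats n (1\<^sub>m n + Z) ?G" unfolding e using Zc carr by (intro inverse_matsI) auto
  moreover have "fps_mat n (?f - 1) Z \<in> {B. has_supp n t t C B}"
  proof (rule fps_mat_closed[OF nil])
    show "Z \<in> {B. has_supp n t t C B}" using Z by simp
    show "0\<^sub>m n n \<in> {B. has_supp n t t C B}" using supp_in_zero[of t t C n n] by simp
    show "fps_nth (?f - 1) 0 = 0" by simp
    fix A B assume "A \<in> {B. has_supp n t t C B}" "B \<in> {B. has_supp n t t C B}"
    then have AB: "has_supp n t t C A" "has_supp n t t C B" by auto
    show "A + B \<in> {B. has_supp n t t C B}" using has_supp_add[OF AB] by simp
    show "A * B \<in> {B. has_supp n t t C B}" unfolding mem_Collect_eq by (rule has_supp_mult[OF AB]) (rule add)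
  next
    fix c B assume "B \<in> {B. has_supp n t t C B}"
    then show "c \<cdot>\<^sub>m B \<in> {B. has_supp n t t C B}" using supp_in_smult[of t t C B c] by simp
  qed
  then have "has_supp n t t C (?G - 1\<^sub>m n)" unfolding fps_mat_minus_const[OF nil] by simp
  ultimately show ?thesis by blast
qed

text \<open>
  If \<open>M\<close> is the matrix of a conjugation, then applying it twice gives \<open>M cnj M = 1\<close>. In total
  degree \<open>0\<close> this says \<open>M0 cnj M0 = 1\<close>, where \<open>M = M0 + Mr\<close>.
\<close>

lemma conj_leading_part:
  assumes s: "has_supp n t (swap_types t) same_type M0" and Mr: "has_supp n t (swap_types t) (\<lambda>a b. a + b < 0) Mr"
    and MM: "(M0 + Mr) * cnj_mat (M0 + Mr) = 1\<^sub>m n"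
  shows "inverse_mats n M0 (cnj_mat M0)" "M0 * cnj_mat Mr + Mr * cnj_mat M0 + Mr * cnj_mat Mr = 0\<^sub>m n n"
proof -
  let ?c = cnj_mat
  note cs = s[THEN has_supp_cnj'] and cMr = Mr[THEN has_supp_cnj']
  have dims: "dim_row M0 = n" "dim_col M0 = n" "dim_row Mr = n" "dim_col Mr = n" using s Mr by auto
  define Y where "Y = M0 * ?c Mr + Mr * ?c M0 + Mr * ?c Mr"
  have Y: "has_supp n t t (\<lambda>a b. a + b < 0) Y"
    unfolding Y_def
    by (intro has_supp_add has_supp_mult[OF s cMr] has_supp_mult[OF Mr cs] has_supp_mult[OF Mr cMr]) auto
  have "?c (M0 + Mr) = ?c M0 + ?c Mr" using dims by (intro eq_matI) auto
  then have "M0 * ?c M0 + Y = (M0 + Mr) * ?c (M0 + Mr)"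
    unfolding Y_def using dims by (simp add: mult_add_dims) (intro eq_matI, simp_all del: index_mult_mat(1))
  then have exp: "M0 * ?c M0 + Y = 1\<^sub>m n" unfolding MM .
  have M00: "M0 * ?c M0 - 1\<^sub>m n = 0\<^sub>m n n"
  proof (rule has_supp_disjoint)
    show "has_supp n t t same_type (M0 * ?c M0 - 1\<^sub>m n)"
      by (intro has_supp_diff has_supp_one has_supp_mult[OF s cs]) auto
    have "M0 * ?c M0 - 1\<^sub>m n = 0\<^sub>m n n - Y"
      unfolding exp[symmetric] using dims Y by (intro eq_matI) (auto simp del: index_mult_mat(1))
    then show "has_supp n t t (\<lambda>a b. a + b < 0) (M0 * ?c M0 - 1\<^sub>m n)"
      using has_supp_diff[OF _ Y, of "0\<^sub>m n n"] supp_in_zero[of t t "\<lambda>a b. a + b < 0" n n] by simp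
  qed auto
  have M01: "M0 * ?c M0 = 1\<^sub>m n"
  proof (rule eq_matI)
    fix i j assume ij: "i < dim_row (1\<^sub>m n)" "j < dim_col (1\<^sub>m n)"
    then show "(M0 * ?c M0) $$ (i, j) = 1\<^sub>m n $$ (i, j)"
      using arg_cong[OF M00, of "\<lambda>A. A $$ (i, j)"] dims by (simp del: index_mult_mat(1))
  qed (use dims in auto)
  then show "inverse_mats n M0 (?c M0)" using s by (intro inverse_matsI) auto
  have "Y = 0\<^sub>m n n"
  proof (rule eq_matI)
    fix i j assume ij: "i < dim_row (0\<^sub>m n n)" "j < dim_col (0\<^sub>m n n)"
    then show "Y $$ (i, j) = 0\<^sub>m n n $$ (i, j)"
      using arg_cong[OF exp[unfolded M01], of "\<lambda>A. A $$ (i, j)"] carrier_matD[OF conjunct1[OF Y]] by simp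
  qed (use Y in auto)
  then show "M0 * ?c Mr + Mr * ?c M0 + Mr * ?c Mr = 0\<^sub>m n n" unfolding Y_def .
qed

text \<open>
  A change of basis by \<open>G\<close> turns the matrix \<open>M\<close> of the conjugation into \<open>G\<^sup>-\<^sup>1 M cnj G\<close>. Let
  \<open>R\<close> and \<open>R'\<close> be the parts of \<open>M\<close> of the bidegrees \<open>(a, b)\<close> with \<open>a + b = - m\<close> and \<open>a \<ge> 0\<close> or
  \<open>b \<ge> 0\<close>, respectively, which are to be removed. For \<open>G = 1 + Z\<close> with \<open>Z\<close> of total degree \<open>- m\<close>,
  the part of \<open>M\<close> of this degree changes by \<open>- Z M0 + M0 cnj Z\<close>. Take \<open>Z = R M0\<^sup>-\<^sup>1\<close>, so that the
  first term is \<open>- R\<close>; as \<open>Z\<close> has \<open>a \<ge> 0\<close>, this preserves the Hodge filtration. The second term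
  is then \<open>- R'\<close>, by the equation \<open>M cnj M = 1\<close>.
\<close>

lemma straighten_step:
  assumes M: "has_supp n t (swap_types t) (\<lambda>a b. same_type a b \<or> both_neg a b \<or> a + b \<le> - m) M"
    and MM: "M * cnj_mat M = 1\<^sub>m n" and m: "m > 0"
  shows "\<exists>G G'. inverse_mats n G G' \<and> has_supp n t t (\<lambda>a b. a \<ge> 0 \<and> a + b \<le> 0) G \<and> has_supp n t t (\<lambda>a b. a \<ge> 0 \<and> a + b \<le> 0) G'
    \<and> has_supp n t (swap_types t) (\<lambda>a b. same_type a b \<or> both_neg a b \<or> a + b \<le> - (m + 1)) (G' * M * cnj_mat G)"
proof -
  let ?s = "swap_types t"
  have Mc: "M \<in> carrier_mat n n" using M by simp
  define C1 :: "int \<Rightarrow> int \<Rightarrow> bool" where "C1 = (\<lambda>a b. both_neg a b \<or> a + b \<le> - (m + 1))"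
  define M0 where "M0 = bidegree_part t ?s same_type M"
  define Mr where "Mr = bidegree_part t ?s (\<lambda>a b. both_neg a b \<or> a + b \<le> - m) M"
  define R where "R = bidegree_part t ?s (\<lambda>a b. a \<ge> 0 \<and> a + b = - m) Mr"
  define S where "S = bidegree_part t ?s (\<lambda>a b. (b \<ge> 0 \<and> a + b = - m) \<or> C1 a b) Mr"
  define R' where "R' = bidegree_part t ?s (\<lambda>a b. b \<ge> 0 \<and> a + b = - m) S"
  define Q where "Q = bidegree_part t ?s C1 S"
  have Mr: "has_supp n t ?s (\<lambda>a b. both_neg a b \<or> a + b \<le> - m) Mr"
    unfolding Mr_def by (rule has_supp_bidegree_part[OF Mc])
  have S: "has_supp n t ?s (\<lambda>a b. (b \<ge> 0 \<and> a + b = - m) \<or> C1 a b) S"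
    unfolding S_def by (rule has_supp_bidegree_part[OF conjunct1[OF Mr]])
  have s: "has_supp n t ?s same_type M0" "has_supp n t ?s (\<lambda>a b. a \<ge> 0 \<and> a + b = - m) R"
    "has_supp n t ?s (\<lambda>a b. b \<ge> 0 \<and> a + b = - m) R'" "has_supp n t ?s C1 Q"
    unfolding M0_def R_def R'_def Q_def
    by (rule has_supp_bidegree_part[OF Mc] has_supp_bidegree_part[OF conjunct1[OF Mr]] has_supp_bidegree_part[OF conjunct1[OF S]])+
  then have c: "M0 \<in> carrier_mat n n" "R \<in> carrier_mat n n" "R' \<in> carrier_mat n n" "Q \<in> carrier_mat n n" by auto
  have dims: "dim_row M0 = n" "dim_col M0 = n" "dim_row R = n" "dim_col R = n" "dim_row R' = n" "dim_col R' = n"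
    "dim_row Q = n" "dim_col Q = n" "dim_row M = n" "dim_col M = n" using c Mc by auto
  have Mrd: "dim_row Mr = n" "dim_col Mr = n" using Mr by auto
  have M_eq: "M = M0 + Mr"
    unfolding M0_def Mr_def by (rule bidegree_part_split[OF M]) (use m in auto)
  have Mr_eq: "Mr = R + (R' + Q)"
  proof -
    have "Mr = R + S" unfolding R_def S_def
    proof (rule bidegree_part_split[where n = n])
      show "has_supp n t ?s (\<lambda>a b. (a \<ge> 0 \<and> a + b = - m) \<or> (b \<ge> 0 \<and> a + b = - m) \<or> C1 a b) Mr"
        by (rule has_supp_mono[OF Mr]) (auto simp: C1_def)
    qed (use m in \<open>auto simp: C1_def\<close>)
    moreover have "S = R' + Q" unfolding R'_def Q_def by (rule bidegree_part_split[OF S]) (auto simp: C1_def)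
    ultimately show ?thesis by simp
  qed
  let ?c = cnj_mat
  have cnj_add: "?c (A + B) = ?c A + ?c B" if "dim_row A = n" "dim_col A = n" "dim_row B = n" "dim_col B = n" for A B
    using that by (intro eq_matI) auto
  note cs = s[THEN has_supp_cnj'] and cMr = Mr[THEN has_supp_cnj']
  have Mr': "has_supp n t ?s (\<lambda>a b. a + b < 0) Mr" by (rule has_supp_mono[OF Mr]) (use m in auto)
  note lead = conj_leading_part[OF s(1) Mr' MM[unfolded M_eq]]
  note M01 = inverse_matsD(3)[OF lead(1)] and M02 = inverse_matsD(4)[OF lead(1)]
  define Y where "Y = M0 * ?c Mr + Mr * ?c M0 + Mr * ?c Mr"
  have Y0: "Y = 0\<^sub>m n n" unfolding Y_def by (rule lead(2))
  (* In degree - m, with a >= 0 and with b >= 0, respectively, the equation M cnj M = 1 becomes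
     S1 = 0 and S2 = 0; the terms in Y' have other bidegrees. *)
  define S1 where "S1 = M0 * ?c R' + R * ?c M0"
  define S2 where "S2 = M0 * ?c R + R' * ?c M0"
  have S1: "has_supp n t t (\<lambda>a b. a \<ge> 0 \<and> a + b = - m) S1"
    unfolding S1_def by (intro has_supp_add has_supp_mult[OF s(1) cs(3)] has_supp_mult[OF s(2) cs(1)]) auto
  have S2: "has_supp n t t (\<lambda>a b. b \<ge> 0 \<and> a + b = - m) S2"
    unfolding S2_def by (intro has_supp_add has_supp_mult[OF s(1) cs(2)] has_supp_mult[OF s(3) cs(1)]) auto
  define Y' where "Y' = M0 * ?c Q + Q * ?c M0 + Mr * ?c Mr"
  have Y': "has_supp n t t C1 Y'"
    unfolding Y'_def C1_def
    by (intro has_supp_add has_supp_mult[OF s(1) cs(4)] has_supp_mult[OF s(4) cs(1)] has_supp_mult[OF Mr cMr]) (use m in \<open>auto simp: C1_def\<close>)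
  have "Y = S1 + S2 + Y'"
  proof -
    have "?c Mr = ?c R + (?c R' + ?c Q)" unfolding Mr_eq using dims by (simp add: cnj_add)
    then have "Y = M0 * ?c R + (M0 * ?c R' + M0 * ?c Q) + (R * ?c M0 + (R' * ?c M0 + Q * ?c M0)) + Mr * ?c Mr"
      unfolding Y_def using dims by (simp add: mult_add_dims) (simp add: Mr_eq mult_add_dims)
    also have "\<dots> = S1 + S2 + Y'"
      unfolding S1_def S2_def Y'_def using dims Mrd by (intro eq_matI) (auto simp del: index_mult_mat(1))
    finally show ?thesis .
  qed
  have "S2 = 0\<^sub>m n n"
  proof (rule eq_matI)
    fix i j assume "i < dim_row (0\<^sub>m n n)" "j < dim_col (0\<^sub>m n n)"
    then have ij: "i < n" "j < n" by auto
    have "S2 $$ (i, j) = 0"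
    proof (rule ccontr)
      assume ne: "S2 $$ (i, j) \<noteq> 0"
      note b = has_suppD[OF S2 ij ne]
      have "S1 $$ (i, j) = 0" using has_suppD[OF S1 ij] b m by force
      moreover have "Y' $$ (i, j) = 0" using has_suppD[OF Y' ij] b unfolding C1_def by force
      ultimately have "Y $$ (i, j) = S2 $$ (i, j)" unfolding \<open>Y = S1 + S2 + Y'\<close> using ij carrier_matD[OF conjunct1[OF S1]] carrier_matD[OF conjunct1[OF S2]] carrier_matD[OF conjunct1[OF Y']] by simp
      then show False using Y0 ij ne by simp
    qed
    then show "S2 $$ (i, j) = 0\<^sub>m n n $$ (i, j)" using ij by simp
  qed (use S2 in auto)
  then have "S2 * M0 = 0\<^sub>m n n" using c by simp
  moreover have "S2 * M0 = M0 * ?c R * M0 + R'"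
    unfolding S2_def using dims M02 c by (simp add: mult_add_dims mult_assoc_dims right_mult_one_mat[of _ n n])
  ultimately have R'_eq: "M0 * ?c R * M0 + R' = 0\<^sub>m n n" by simp
  define Z where "Z = R * ?c M0"
  have Z: "has_supp n t t (\<lambda>a b. a \<ge> 0 \<and> a + b \<le> - m) Z"
    unfolding Z_def by (rule has_supp_mult[OF s(2) cs(1)]) auto
  have "\<exists>G'. inverse_mats n (1\<^sub>m n + Z) G' \<and> has_supp n t t (\<lambda>a b. a \<ge> 0 \<and> a + b \<le> - m) (G' - 1\<^sub>m n)"
    by (rule unipotent_inverse[OF Z]) (use m in auto)
  then obtain G' where GG: "inverse_mats n (1\<^sub>m n + Z) G'" and N: "has_supp n t t (\<lambda>a b. a \<ge> 0 \<and> a + b \<le> - m) (G' - 1\<^sub>m n)" by blast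
  define N' where "N' = G' - 1\<^sub>m n"
  note N = N[folded N'_def] and GGc = inverse_matsD[OF GG]
  have nd: "dim_row N' = n" "dim_col N' = n" "dim_row Z = n" "dim_col Z = n" using N Z by auto
  have G'_eq: "G' = 1\<^sub>m n + N'" unfolding N'_def using GGc by (intro eq_matI) auto
  have cZ: "has_supp n ?s ?s (\<lambda>a b. b \<ge> 0 \<and> b + a \<le> - m) (?c Z)" using has_supp_cnj[OF Z] by simp
  have pos: "has_supp n t t (\<lambda>a b. a \<ge> 0 \<and> a + b \<le> 0) (1\<^sub>m n + X)" if "has_supp n t t (\<lambda>a b. a \<ge> 0 \<and> a + b \<le> - m) X" for X
    by (intro has_supp_add has_supp_one has_supp_mono[OF that]) (use m in auto)
  have new: "G' * M * ?c (1\<^sub>m n + Z) = M0 + (Q - Z * N' * M0 + N' * Mr + Mr * ?c Z + N' * M * ?c Z)"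
  proof -
    have n1: "N' = 0\<^sub>m n n - Z - Z * N'"
    proof -
      have "(1\<^sub>m n + Z) * (1\<^sub>m n + N') = 1\<^sub>m n" using GGc(3) G'_eq by simp
      moreover have "(1\<^sub>m n + Z) * (1\<^sub>m n + N') = 1\<^sub>m n * (1\<^sub>m n + N') + Z * (1\<^sub>m n + N')"
        by (rule mult_add_dims(2)) (use nd in auto)
      moreover have "1\<^sub>m n * (1\<^sub>m n + N') = 1\<^sub>m n + N'"
        by (rule left_mult_one_mat[of _ n n]) (use conjunct1[OF N] in simp)
      moreover have "Z * (1\<^sub>m n + N') = Z * 1\<^sub>m n + Z * N'"
        by (rule mult_add_dims(1)) (use nd in auto)
      moreover have "Z * 1\<^sub>m n = Z" by (rule right_mult_one_mat[OF conjunct1[OF Z]])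
      ultimately have e: "(1\<^sub>m n + N' + (Z + Z * N')) $$ (i, j) = 1\<^sub>m n $$ (i, j)" for i j by simp
      show ?thesis
      proof (rule eq_matI)
        fix i j assume "i < dim_row (0\<^sub>m n n - Z - Z * N')" "j < dim_col (0\<^sub>m n n - Z - Z * N')"
        then have ij: "i < n" "j < n" using nd by auto
        have "N' $$ (i, j) + (Z $$ (i, j) + (Z * N') $$ (i, j)) = 0"
          using e[of i j] ij nd by (simp del: index_mult_mat(1))
        then have "N' $$ (i, j) = - (Z $$ (i, j) + (Z * N') $$ (i, j))" by (rule eq_neg_iff_add_eq_0[THEN iffD2])
        then show "N' $$ (i, j) = (0\<^sub>m n n - Z - Z * N') $$ (i, j)" using ij nd by (simp del: index_mult_mat(1))
      qed (use nd in auto)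
    qed
    have ZM: "Z * M0 = R" unfolding Z_def using dims M02 c by (simp add: mult_assoc_dims right_mult_one_mat[of _ n n])
    have MZ: "M0 * ?c Z = M0 * ?c R * M0"
      unfolding Z_def using dims by (simp add: cnj_mat_mult cnj_mat_cnj_mat mult_assoc_dims)
    have cZ1: "?c (1\<^sub>m n + Z) = 1\<^sub>m n + ?c Z" using nd by (simp add: cnj_add cnj_mat_one)
    have NM0: "N' * M0 = 0\<^sub>m n n - R - Z * N' * M0"
    proof -
      have "N' * M0 = (0\<^sub>m n n - Z - Z * N') * M0" using n1 by simp
      also have "\<dots> = (0\<^sub>m n n - Z) * M0 - Z * N' * M0"
        by (rule minus_mult_distrib_mat[of _ n n _ _ n]) (use Z N c in auto)
      also have "(0\<^sub>m n n - Z) * M0 = 0\<^sub>m n n * M0 - Z * M0"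
        by (rule minus_mult_distrib_mat[of _ n n _ _ n]) (use Z c in auto)
      finally show ?thesis unfolding ZM using c by simp
    qed
    have "G' * M * ?c (1\<^sub>m n + Z) = M + N' * M + M * ?c Z + N' * M * ?c Z"
      unfolding G'_eq cZ1 using dims nd Mc N Z
      by (simp add: mult_add_dims left_mult_one_mat[of _ n n] right_mult_one_mat[of _ n n])
         (intro eq_matI, simp_all add: right_mult_one_mat[of _ n n] del: index_mult_mat(1))
    moreover have "N' * M = N' * M0 + N' * Mr" "M * ?c Z = M0 * ?c Z + Mr * ?c Z"
      unfolding M_eq using dims nd Mrd by (simp_all add: mult_add_dims)
    ultimately have e: "G' * M * ?c (1\<^sub>m n + Z)
      = M0 + (R + (R' + Q)) + (0\<^sub>m n n - R - Z * N' * M0 + N' * Mr) + (M0 * ?c R * M0 + Mr * ?c Z) + N' * M * ?c Z"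
      using M_eq Mr_eq MZ NM0 by simp
    show ?thesis
    proof (rule eq_matI)
      fix i j assume "i < dim_row (M0 + (Q - Z * N' * M0 + N' * Mr + Mr * ?c Z + N' * M * ?c Z))"
        "j < dim_col (M0 + (Q - Z * N' * M0 + N' * Mr + Mr * ?c Z + N' * M * ?c Z))"
      then have ij: "i < n" "j < n" using dims nd Mrd by auto
      have r: "(M0 * ?c R * M0) $$ (i, j) + R' $$ (i, j) = 0"
        using arg_cong[OF R'_eq, of "\<lambda>A. A $$ (i, j)"] ij dims by (simp del: index_mult_mat(1))
      show "(G' * M * ?c (1\<^sub>m n + Z)) $$ (i, j) = (M0 + (Q - Z * N' * M0 + N' * Mr + Mr * ?c Z + N' * M * ?c Z)) $$ (i, j)"
        unfolding e using ij dims nd Mrd r by (simp del: index_mult_mat(1)) (metis add.assoc add.commute add.left_neutral)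
    qed (use GGc dims nd Mrd in auto)
  qed
  have "has_supp n t ?s C1 (Q - Z * N' * M0 + N' * Mr + Mr * ?c Z + N' * M * ?c Z)"
  proof (intro has_supp_add has_supp_diff s(4))
    have "has_supp n t t (\<lambda>a b. a + b \<le> - (m + 1)) (Z * N')" by (rule has_supp_mult[OF Z N]) (use m in auto)
    then show "has_supp n t ?s C1 (Z * N' * M0)" by (rule has_supp_mult[OF _ s(1)]) (auto simp: C1_def)
    show "has_supp n t ?s C1 (N' * Mr)" by (rule has_supp_mult[OF N Mr]) (use m in \<open>auto simp: C1_def\<close>)
    show "has_supp n t ?s C1 (Mr * ?c Z)" by (rule has_supp_mult[OF Mr cZ]) (use m in \<open>auto simp: C1_def\<close>)
    have "has_supp n t ?s (\<lambda>a b. a + b \<le> - m) (N' * M)" by (rule has_supp_mult[OF N M]) (use m in auto)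
    then show "has_supp n t ?s C1 (N' * M * ?c Z)" by (rule has_supp_mult[OF _ cZ]) (use m in \<open>auto simp: C1_def\<close>)
  qed
  then have "has_supp n t ?s (\<lambda>a b. same_type a b \<or> both_neg a b \<or> a + b \<le> - (m + 1)) (Q - Z * N' * M0 + N' * Mr + Mr * ?c Z + N' * M * ?c Z)"
    by (rule has_supp_mono) (auto simp: C1_def)
  moreover have "has_supp n t ?s (\<lambda>a b. same_type a b \<or> both_neg a b \<or> a + b \<le> - (m + 1)) M0"
    by (rule has_supp_mono[OF s(1)]) auto
  ultimately have "has_supp n t ?s (\<lambda>a b. same_type a b \<or> both_neg a b \<or> a + b \<le> - (m + 1)) (G' * M * ?c (1\<^sub>m n + Z))"
    unfolding new by (rule has_supp_add[rotated])
  then show ?thesis using GG pos[OF Z] pos[OF N] G'_eq by blast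
qed

text \<open>
  The total degrees of the entries are bounded, so that finitely many steps suffice.
\<close>

lemma straighten:
  assumes M: "has_supp n t (swap_types t) (\<lambda>a b. same_type a b \<or> a + b < 0) M"
    and MM: "M * cnj_mat M = 1\<^sub>m n"
  shows "\<exists>G G'. inverse_mats n G G' \<and> has_supp n t t (\<lambda>a b. a \<ge> 0 \<and> a + b \<le> 0) G \<and> has_supp n t t (\<lambda>a b. a \<ge> 0 \<and> a + b \<le> 0) G'
    \<and> has_supp n t (swap_types t) (\<lambda>a b. same_type a b \<or> both_neg a b) (G' * M * cnj_mat G)"
proof -
  let ?pos = "\<lambda>a b :: int. a \<ge> 0 \<and> a + b \<le> 0"
  have Mc: "M \<in> carrier_mat n n" using M by simp
  have ind: "\<exists>G G'. inverse_mats n G G' \<and> has_supp n t t ?pos G \<and> has_supp n t t ?pos G'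
    \<and> has_supp n t (swap_types t) (\<lambda>a b. same_type a b \<or> both_neg a b \<or> a + b \<le> - (int m + 1)) (G' * M * cnj_mat G)" for m
  proof (induction m)
    case 0
    have "inverse_mats n (1\<^sub>m n) (1\<^sub>m n :: complex mat)" by (rule inverse_matsI) auto
    moreover have "has_supp n t t ?pos (1\<^sub>m n)" by (rule has_supp_one) simp
    moreover have "has_supp n t (swap_types t) (\<lambda>a b. same_type a b \<or> both_neg a b \<or> a + b \<le> - (int 0 + 1)) (1\<^sub>m n * M * cnj_mat (1\<^sub>m n))"
    proof -
      have "has_supp n t (swap_types t) (\<lambda>a b. same_type a b \<or> both_neg a b \<or> a + b \<le> - (int 0 + 1)) M"
        by (rule has_supp_mono[OF M]) auto
      then show ?thesis using Mc by (simp add: cnj_mat_one)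
    qed
    ultimately show ?case by blast
  next
    case (Suc m)
    then obtain G G' where G: "inverse_mats n G G'" "has_supp n t t ?pos G" "has_supp n t t ?pos G'"
      and s: "has_supp n t (swap_types t) (\<lambda>a b. same_type a b \<or> both_neg a b \<or> a + b \<le> - (int m + 1)) (G' * M * cnj_mat G)" by blast
    note Gc = inverse_matsD[OF G(1)]
    have dims: "dim_row G = n" "dim_col G = n" "dim_row G' = n" "dim_col G' = n" "dim_row M = n" "dim_col M = n" using Gc Mc by auto
    have "(G' * M * cnj_mat G) * cnj_mat (G' * M * cnj_mat G) = G' * (M * (cnj_mat G * (cnj_mat G' * (cnj_mat M * G))))"
      using dims by (simp add: cnj_mat_mult cnj_mat_cnj_mat mult_assoc_dims)
    also have "cnj_mat G * (cnj_mat G' * (cnj_mat M * G)) = cnj_mat M * G"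
      using inverse_mats_cancel(1)[OF cnj_mat_inverse[OF G(1)]] dims by simp
    also have "M * (cnj_mat M * G) = G" using MM Gc Mc dims by (simp flip: mult_assoc_dims)
    also have "G' * G = 1\<^sub>m n" using Gc by simp
    finally have one: "(G' * M * cnj_mat G) * cnj_mat (G' * M * cnj_mat G) = 1\<^sub>m n" .
    have "0 < int m + 1" by simp
    from straighten_step[OF s one this]
    obtain H H' where H: "inverse_mats n H H'" "has_supp n t t ?pos H" "has_supp n t t ?pos H'"
      and s': "has_supp n t (swap_types t) (\<lambda>a b. same_type a b \<or> both_neg a b \<or> a + b \<le> - (int m + 1 + 1)) (H' * (G' * M * cnj_mat G) * cnj_mat H)"
      by blast
    note Hc = inverse_matsD[OF H(1)]
    have hd: "dim_row H = n" "dim_col H = n" "dim_row H' = n" "dim_col H' = n" using Hc by auto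
    have "H' * (G' * M * cnj_mat G) * cnj_mat H = H' * G' * M * cnj_mat (G * H)"
      using dims hd by (simp add: cnj_mat_mult mult_assoc_dims)
    moreover have "has_supp n t t ?pos (G * H)" by (rule has_supp_mult[OF G(2) H(2)]) auto
    moreover have "has_supp n t t ?pos (H' * G')" by (rule has_supp_mult[OF H(3) G(3)]) auto
    ultimately show ?case
      using inverse_mats_mult[OF G(1) H(1)] s' by (intro exI[of _ "G * H"] exI[of _ "H' * G'"]) (simp add: algebra_simps)
  qed
  define N where "N = (\<Sum>i<n. \<bar>wt (t i)\<bar>)"
  have N: "\<bar>wt (t i)\<bar> \<le> N" if "i < n" for i
    unfolding N_def by (rule member_le_sum) (use that in auto)
  obtain G G' where G: "inverse_mats n G G'" "has_supp n t t ?pos G" "has_supp n t t ?pos G'"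
    and s: "has_supp n t (swap_types t) (\<lambda>a b. same_type a b \<or> both_neg a b \<or> a + b \<le> - (int (nat (2 * N)) + 1)) (G' * M * cnj_mat G)"
    using ind[of "nat (2 * N)"] by blast
  have "has_supp n t (swap_types t) (\<lambda>a b. same_type a b \<or> both_neg a b) (G' * M * cnj_mat G)"
  proof (rule has_suppI)
    show "G' * M * cnj_mat G \<in> carrier_mat n n" using s by simp
    fix i j assume ij: "i < n" "j < n" and ne: "(G' * M * cnj_mat G) $$ (i, j) \<noteq> 0"
    have "\<not> fst (t i) - fst (swap_types t j) + (snd (t i) - snd (swap_types t j)) \<le> - (int (nat (2 * N)) + 1)"
      using N[OF ij(1)] N[OF ij(2)] by auto
    then show "same_type (fst (t i) - fst (swap_types t j)) (snd (t i) - snd (swap_types t j)) \<or>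
      both_neg (fst (t i) - fst (swap_types t j)) (snd (t i) - snd (swap_types t j))"
      using has_suppD[OF s ij ne] by blast
  qed
  then show ?thesis using G by blast
qed

lemma colspan_change_subset:
  assumes E: "inverse_mats n E E'" and G: "G \<in> carrier_mat n n"
    and P: "\<And>i j. i < n \<Longrightarrow> j < n \<Longrightarrow> G $$ (i, j) \<noteq> 0 \<Longrightarrow> P j \<Longrightarrow> P i"
  shows "colspan (E * G) P \<subseteq> colspan (E :: 'a :: field mat) P"
proof (rule colspan_least)
  note Ec = inverse_matsD[OF E]
  show "E * G \<in> carrier_mat n n" using Ec G by auto
  show "is_subspace n (colspan E P)" by (rule colspan_subspace[OF Ec(1)])
  fix j assume j: "j < n" "P j"
  have "col (E * G) j = E *\<^sub>v col G j" using j by (intro col_mult2[of _ n n _ n] Ec(1) G) auto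
  moreover have "col G j \<in> carrier_vec n" using G by auto
  moreover have "\<forall>i<n. col G j $ i \<noteq> 0 \<longrightarrow> P i" using P j G by simp
  ultimately show "col (E * G) j \<in> colspan E P" using Ec(1) unfolding colspan_def by auto
qed

text \<open>
  A change of basis preserves a span of basis vectors if it and its inverse are block triangular.
\<close>

lemma colspan_change:
  assumes E: "inverse_mats n E E'" and G: "inverse_mats n G G'"
    and P: "\<And>i j. i < n \<Longrightarrow> j < n \<Longrightarrow> G $$ (i, j) \<noteq> 0 \<Longrightarrow> P j \<Longrightarrow> P i" "\<And>i j. i < n \<Longrightarrow> j < n \<Longrightarrow> G' $$ (i, j) \<noteq> 0 \<Longrightarrow> P j \<Longrightarrow> P i"
  shows "colspan (E * G) P = colspan (E :: 'a :: field mat) P"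
proof
  note Ec = inverse_matsD[OF E] and Gc = inverse_matsD[OF G]
  show "colspan (E * G) P \<subseteq> colspan E P" by (rule colspan_change_subset[OF E Gc(1) P(1)])
  have "colspan (E * G * G') P \<subseteq> colspan (E * G) P"
    by (rule colspan_change_subset[OF inverse_mats_mult[OF E G] Gc(2) P(2)])
  moreover have "E * G * G' = E" using Ec Gc by (simp add: assoc_mult_mat[of _ n n _ n _ n])
  ultimately show "colspan E P \<subseteq> colspan (E * G) P" by simp
qed

text \<open>
  If the entries of the matrix \<open>M\<close> of the complex conjugation are of bidegree \<open>(0, 0)\<close> or
  negative in both degrees, with \<open>M0\<close> the former part, then \<open>K = M M0\<^sup>-\<^sup>1\<close> is unipotent
  with a logarithm \<open>L\<close> that conjugation takes to \<open>- L\<close>. Half of \<open>L\<close> moves the basis to one in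
  which the conjugation is \<open>M0\<close>, and \<open>L = - 2 \<i> D\<close> for a real \<open>D\<close>.
\<close>

lemma datum_of_straight:
  assumes E: "inverse_mats n E E'" and M: "has_supp n t (swap_types t) (\<lambda>a b. same_type a b \<or> both_neg a b) (E' * cnj_mat E)"
  shows "\<exists>T T' D. datum n T T' t D \<and> E = mexp n \<i> (cm D) * T \<and> (\<forall>k. colspan T (\<lambda>i. wt (t i) \<le> k) = colspan E (\<lambda>i. wt (t i) \<le> k))"
proof -
  let ?s = "swap_types t" and ?c = cnj_mat
  define M where "M = E' * cnj_mat E"
  note M = M[folded M_def] and Ec = inverse_matsD[OF E]
  have Mc: "M \<in> carrier_mat n n" using M by simp
  define M0 where "M0 = bidegree_part t ?s same_type M"
  define M1 where "M1 = bidegree_part t ?s both_neg M"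
  have s: "has_supp n t ?s same_type M0" "has_supp n t ?s both_neg M1"
    unfolding M0_def M1_def by (rule has_supp_bidegree_part[OF Mc])+
  have dims: "dim_row M0 = n" "dim_col M0 = n" "dim_row M1 = n" "dim_col M1 = n" "dim_row M = n" "dim_col M = n"
    "dim_row E = n" "dim_col E = n" "dim_row E' = n" "dim_col E' = n" using s Mc Ec by auto
  have M_eq: "M = M0 + M1" unfolding M0_def M1_def by (rule bidegree_part_split[OF M]) auto
  note cs = s[THEN has_supp_cnj']
  have Minv: "inverse_mats n M (?c M)"
  proof -
    have "inverse_mats n (E' * ?c E) (?c E' * E)"
      by (rule inverse_mats_mult[OF inverse_mats_sym[OF E] cnj_mat_inverse[OF E]])
    moreover have "?c E' * E = ?c M" unfolding M_def using dims by (simp add: cnj_mat_mult cnj_mat_cnj_mat)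
    ultimately show ?thesis unfolding M_def by simp
  qed
  note MI = inverse_matsD[OF Minv]
  have M0inv: "inverse_mats n M0 (?c M0)"
  proof (rule conj_leading_part(1)[OF s(1)])
    show "has_supp n t ?s (\<lambda>a b. a + b < 0) M1" by (rule has_supp_mono[OF s(2)]) auto
    show "(M0 + M1) * ?c (M0 + M1) = 1\<^sub>m n" using MI unfolding M_eq by simp
  qed
  note M01 = inverse_matsD(3)[OF M0inv]
  note M0I = inverse_matsD[OF M0inv]
  define K where "K = M * ?c M0"
  have Kd: "dim_row K = n" "dim_col K = n" unfolding K_def using dims by auto
  have KM: "K * M0 = M" unfolding K_def using dims M0I Mc by (simp add: mult_assoc_dims)
  have K1: "K - 1\<^sub>m n = M1 * ?c M0"
  proof -
    have "K = M0 * ?c M0 + M1 * ?c M0" unfolding K_def M_eq using dims by (simp add: mult_add_dims)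
    then show ?thesis unfolding M01 using dims by (intro eq_matI) (auto simp del: index_mult_mat(1))
  qed
  have Ks: "has_supp n t t both_neg (K - 1\<^sub>m n)" unfolding K1 by (rule has_supp_mult[OF s(2) cs(1)]) auto
  have nilK: "nilpotent_mat n (K - 1\<^sub>m n)" by (rule supp_in_nilpotent[OF conjunct1[OF Ks] conjunct2[OF Ks]]) auto
  have Kc: "K \<in> carrier_mat n n" using Kd by auto
  define L where "L = fps_mat n log_series (K - 1\<^sub>m n)"
  have nilL: "nilpotent_mat n L" and expL: "mexp n 1 L = K" unfolding L_def using exp_log[OF nilK Kc] by auto
  have L: "has_supp n t t both_neg L"
  proof -
    have "L \<in> {B. has_supp n t t both_neg B}" unfolding L_def
    proof (rule fps_mat_closed[OF nilK])
      show "K - 1\<^sub>m n \<in> {B. has_supp n t t both_neg B}" using Ks by simp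
      show "0\<^sub>m n n \<in> {B. has_supp n t t both_neg B}" using supp_in_zero[of t t both_neg n n] by simp
      show "fps_nth log_series 0 = (0 :: complex)" by (rule log_series_0)
      fix A B assume "A \<in> {B. has_supp n t t both_neg B}" "B \<in> {B. has_supp n t t both_neg B}"
      then have AB: "has_supp n t t both_neg A" "has_supp n t t both_neg B" by auto
      show "A + B \<in> {B. has_supp n t t both_neg B}" using has_supp_add[OF AB] by simp
      show "A * B \<in> {B. has_supp n t t both_neg B}" unfolding mem_Collect_eq by (rule has_supp_mult[OF AB]) auto
    next
      fix c B assume "B \<in> {B. has_supp n t t both_neg B}"
      then show "c \<cdot>\<^sub>m B \<in> {B. has_supp n t t both_neg B}" using supp_in_smult[of t t both_neg B c] by simp
    qed
    then show ?thesis by simp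
  qed
  have Ld: "dim_row L = n" "dim_col L = n" and Lc: "L \<in> carrier_mat n n" using L by auto
  have nilcL: "nilpotent_mat n (?c L)" by (rule fps_mat_cnj(1)[OF nilL])
  have ed: "dim_row (mexp n c L) = n" "dim_col (mexp n c L) = n" "dim_row (mexp n c (?c L)) = n" "dim_col (mexp n c (?c L)) = n" for c
    using carrier_matD[OF mexp_carrier[OF nilL, of c]] carrier_matD[OF mexp_carrier[OF nilcL, of c]] by auto
  \<comment> \<open>conjugation takes \<open>L\<close> to \<open>- L\<close>\<close>
  have nL: "((- 1) \<cdot>\<^sub>m L) * M0 = M0 * ?c L"
  proof (rule mexp_intertwine_imp[OF nilpotent_smult[OF nilL] nilcL])
    show "M0 \<in> carrier_mat n n" using s by simp
    have "M0 * ?c K = M0 * ?c M * M0" unfolding K_def using dims by (simp add: cnj_mat_mult cnj_mat_cnj_mat mult_assoc_dims)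
    moreover have "mexp n (- 1) L = M0 * ?c M"
    proof (rule inverse_mats_unique)
      show "inverse_mats n K (M0 * ?c M)" unfolding K_def by (rule inverse_mats_mult[OF Minv inverse_mats_sym[OF M0inv]])
      show "inverse_mats n K (mexp n (- 1) L)" using mexp_inverse[OF nilL, of 1] expL by simp
    qed
    moreover have "mexp n 1 (?c L) = ?c K" using mexp_cnj[OF nilL, of 1] expL by simp
    ultimately show "mexp n 1 ((- 1) \<cdot>\<^sub>m L) * M0 = M0 * mexp n 1 (?c L)"
      using mexp_smult[OF nilL, of 1 "- 1"] by simp
  qed
  have me: "mexp n (- c) L * M0 = M0 * mexp n c (?c L)" for c
    using fps_mat_intertwine[OF nilpotent_smult[OF nilL] nilcL _ nL, of "fps_exp c"] s mexp_smult[OF nilL, of c "- 1"]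
    unfolding mexp_def by simp
  define T where "T = E * mexp n (1 / 2) L"
  define T' where "T' = mexp n (- (1 / 2)) L * E'"
  have T: "inverse_mats n T T'" unfolding T_def T'_def by (rule inverse_mats_mult[OF E mexp_inverse[OF nilL]])
  note Tc = inverse_matsD[OF T]
  have Td: "dim_row T = n" "dim_col T = n" "dim_row T' = n" "dim_col T' = n" using Tc by auto
  have TT: "T' * ?c T = M0"
  proof -
    have "T' * ?c T = mexp n (- (1 / 2)) L * (M * mexp n (1 / 2) (?c L))"
      unfolding T_def T'_def M_def using dims ed by (simp add: cnj_mat_mult mexp_cnj[OF nilL] mult_assoc_dims)
    also have "M * mexp n (1 / 2) (?c L) = K * (mexp n (- (1 / 2)) L * M0)"
      unfolding me KM[symmetric] using dims ed Kd by (simp add: mult_assoc_dims)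
    also have "mexp n (- (1 / 2)) L * (K * (mexp n (- (1 / 2)) L * M0)) = mexp n (- (1 / 2) + 1 + - (1 / 2)) L * M0"
      unfolding expL[symmetric] mexp_add[OF nilL] using dims ed by (simp add: mult_assoc_dims)
    also have "\<dots> = M0" using mexp_0[OF nilL] left_mult_one_mat[OF conjunct1[OF s(1)]] by simp
    finally show ?thesis .
  qed
  define DC where "DC = T * ((\<i> / 2) \<cdot>\<^sub>m L) * T'"
  have DCd: "dim_row DC = n" "dim_col DC = n" unfolding DC_def using Td by auto
  have "?c DC = DC"
  proof -
    have cT: "?c T = T * M0" unfolding TT[symmetric] using inverse_mats_cancel(1)[OF T] Td by simp
    have cT': "?c T' = ?c M0 * T'"
    proof (rule inverse_mats_unique)
      show "inverse_mats n (?c T) (?c M0 * T')" unfolding cT by (rule inverse_mats_mult[OF T M0inv])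
      show "inverse_mats n (?c T) (?c T')" by (rule cnj_mat_inverse[OF T])
    qed
    have sm: "?c ((\<i> / 2) \<cdot>\<^sub>m L) = (- (\<i> / 2)) \<cdot>\<^sub>m ?c L" by (rule eq_matI) auto
    have "?c DC = ?c T * ?c ((\<i> / 2) \<cdot>\<^sub>m L) * ?c T'" unfolding DC_def using Td Ld by (simp add: cnj_mat_mult)
    also have "\<dots> = T * ((- (\<i> / 2)) \<cdot>\<^sub>m ((M0 * ?c L) * ?c M0)) * T'"
      unfolding cT cT' sm using Td dims Ld by (simp add: smult_mult_dims mult_assoc_dims)
    also have "(M0 * ?c L) * ?c M0 = (- 1) \<cdot>\<^sub>m L"
      unfolding nL[symmetric] using dims Ld Lc M01 by (simp add: smult_mult_dims mult_assoc_dims)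
    also have "(- (\<i> / 2)) \<cdot>\<^sub>m ((- 1) \<cdot>\<^sub>m L) = (\<i> / 2) \<cdot>\<^sub>m L" by (rule eq_matI) auto
    finally show ?thesis unfolding DC_def .
  qed
  define D where "D = map_mat Re DC"
  have D: "cm D = DC" unfolding D_def by (rule cm_map_Re) fact
  have Dc: "D \<in> carrier_mat n n" unfolding D_def using DCd by auto
  have TDT: "T' * cm D * T = (\<i> / 2) \<cdot>\<^sub>m L"
  proof -
    have "T' * cm D * T = T' * (T * (((\<i> / 2) \<cdot>\<^sub>m L) * (T' * T)))"
      unfolding D DC_def using Td Ld by (simp add: mult_assoc_dims)
    also have "((\<i> / 2) \<cdot>\<^sub>m L) * (T' * T) = (\<i> / 2) \<cdot>\<^sub>m L" using Tc Lc by simp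
    finally show ?thesis using inverse_mats_cancel(2)[OF T] Ld by simp
  qed
  have dat: "datum n T T' t D"
    unfolding datum_def hodge_datum_def TT TDT
    using T s(1) Dc supp_in_smult[OF conjunct2[OF L], of "\<i> / 2"] by simp
  interpret datum n T T' t D by (rule dat)
  have "E = mexp n \<i> (cm D) * T"
  proof -
    have "mexp n \<i> (cm D) * T = T * mexp n \<i> ((\<i> / 2) \<cdot>\<^sub>m L)" unfolding mexp_mult_T \<Delta>_def TDT ..
    also have "\<dots> = T * mexp n (- (1 / 2)) L" using mexp_smult[OF nilL, of \<i> "\<i> / 2"] by simp
    also have "\<dots> = E * (mexp n (1 / 2) L * mexp n (- (1 / 2)) L)" unfolding T_def using dims ed by (simp add: mult_assoc_dims)
    also have "\<dots> = E"
      unfolding inverse_matsD(3)[OF mexp_inverse[OF nilL]] by (rule right_mult_one_mat[OF Ec(1)])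
    finally show ?thesis by simp
  qed
  moreover have "colspan T (\<lambda>i. wt (t i) \<le> k) = colspan E (\<lambda>i. wt (t i) \<le> k)" for k
    unfolding T_def
  proof (rule colspan_change[OF E mexp_inverse[OF nilL]])
    have "wt (t i) \<le> k" if ij: "i < n" "j < n" and ne: "mexp n c L $$ (i, j) \<noteq> 0" and j: "wt (t j) \<le> k" for c i j
    proof (cases "i = j")
      case False
      have "has_supp n t t both_neg (mexp n c L - 1\<^sub>m n)"
        using supp_in_mexp[of L n t both_neg c] L mexp_carrier[OF nilL, of c] by (simp add: minus_carrier_mat)
      then show ?thesis using has_suppD[of "mexp n c L - 1\<^sub>m n" n t t both_neg i j] ij ne False j ed(1,2)[of c] by auto
    qed (use j in simp)
    then show "\<And>i j. i < n \<Longrightarrow> j < n \<Longrightarrow> mexp n (1 / 2) L $$ (i, j) \<noteq> 0 \<Longrightarrow> wt (t j) \<le> k \<Longrightarrow> wt (t i) \<le> k"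
      "\<And>i j. i < n \<Longrightarrow> j < n \<Longrightarrow> mexp n (- (1 / 2)) L $$ (i, j) \<noteq> 0 \<Longrightarrow> wt (t j) \<le> k \<Longrightarrow> wt (t i) \<le> k" by blast+
  qed
  ultimately show ?thesis using dat by blast
qed

section \<open>Every mixed Hodge structure comes from a Hodge datum\<close>

text \<open>
  The decomposition of a vector into its real and imaginary part exhibits it as a combination of
  real vectors.
\<close>

lemma complexification_eq:
  assumes U: "is_subspace n U"
  shows "subspace_complexification n U = {z \<in> carrier_vec n. map_vec Re z \<in> U \<and> map_vec Im z \<in> U}"
proof
  note Us = is_subspaceD[OF U]
  have c: "cv ` U \<subseteq> carrier_vec n" using Us(1) by auto
  note S = lin_span_superset[OF c] and L = is_subspaceD[OF lin_span_subspace[OF c]]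
  show "subspace_complexification n U \<subseteq> {z \<in> carrier_vec n. map_vec Re z \<in> U \<and> map_vec Im z \<in> U}"
  proof (rule lin_span_least[OF complex_of_real_subspace[OF U]], rule subsetI)
    fix z assume "z \<in> cv ` U"
    then obtain u where u: "u \<in> U" "z = cv u" by blast
    have uc: "u \<in> carrier_vec n" using u Us(1) by blast
    have "map_vec Re z = u" unfolding u(2) by (rule eq_vecI) auto
    moreover have "map_vec Im z = 0\<^sub>v n" unfolding u(2) using uc by (intro eq_vecI) auto
    ultimately show "z \<in> {z \<in> carrier_vec n. map_vec Re z \<in> U \<and> map_vec Im z \<in> U}" using u uc Us(2) by simp
  qed
  show "{z \<in> carrier_vec n. map_vec Re z \<in> U \<and> map_vec Im z \<in> U} \<subseteq> subspace_complexification n U"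
  proof
    fix z assume z: "z \<in> {z \<in> carrier_vec n. map_vec Re z \<in> U \<and> map_vec Im z \<in> U}"
    have "cv (map_vec Re z) \<in> lin_span n (cv ` U)" using z by (intro subsetD[OF S]) simp
    moreover have "cv (map_vec Im z) \<in> lin_span n (cv ` U)" using z by (intro subsetD[OF S]) simp
    ultimately have "cv (map_vec Re z) + \<i> \<cdot>\<^sub>v cv (map_vec Im z) \<in> lin_span n (cv ` U)" by (intro L(3,4))
    then show "z \<in> subspace_complexification n U" using vec_Re_Im[of z n] z by simp
  qed
qed

lemma colspan_split:
  fixes E :: "'a :: field mat"
  assumes E: "inverse_mats n E E'" and v: "v \<in> carrier_vec n"
  shows "\<exists>y \<in> carrier_vec n. \<forall>i<n. (E' *\<^sub>v y) $ i = (if Q i then (E' *\<^sub>v v) $ i else 0)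
    \<and> (E' *\<^sub>v (v - y)) $ i = (if Q i then 0 else (E' *\<^sub>v v) $ i)"
proof -
  note Ec = inverse_matsD[OF E]
  define x where "x = vec n (\<lambda>i. if Q i then (E' *\<^sub>v v) $ i else 0)"
  have x: "x \<in> carrier_vec n" by (simp add: x_def)
  have y: "E *\<^sub>v x \<in> carrier_vec n" using Ec x by auto
  have e: "E' *\<^sub>v (E *\<^sub>v x) = x" by (rule inverse_mats_vec(2)[OF E x])
  have "E' *\<^sub>v (v - E *\<^sub>v x) = E' *\<^sub>v v - x" using Ec v y e by (simp add: mult_minus_distrib_mat_vec[of _ n n])
  then show ?thesis using y e Ec by (intro bexI[of _ "E *\<^sub>v x"]) (auto simp: x_def simp del: index_mult_mat_vec)
qed

lemma is_subspace_Int: "is_subspace n U \<Longrightarrow> is_subspace n V \<Longrightarrow> is_subspace n (U \<inter> V)"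
  unfolding is_subspace_iff by blast

lemma map_vec_cnj_cnj: "map_vec cnj (map_vec cnj v) = v"
  by (rule eq_vecI) auto

lemma map_vec_cnj_add: "u \<in> carrier_vec n \<Longrightarrow> v \<in> carrier_vec n \<Longrightarrow> map_vec cnj (u + v) = map_vec cnj u + map_vec cnj v"
  by (rule eq_vecI) auto

locale mixed_hodge =
  fixes X :: mhs
  assumes mhs: "is_mhs X"
begin

abbreviation "n \<equiv> mhs_dim X"

definition W :: "int \<Rightarrow> complex vec set" where
  "W k = subspace_complexification n (weight_fil X k)"

abbreviation "F \<equiv> hodge_fil X"

abbreviation "F' \<equiv> conj_fil (hodge_fil X)"

text \<open>
  The preimage in \<open>W k\<close> of the step \<open>j\<close> of the conjugate filtration of the graded piece of weight
  \<open>k\<close>; the elements of \<open>H k i j\<close> represent the intersection of this step with the step \<open>i\<close> of the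
  Hodge filtration, by elements of \<open>F i\<close>.
\<close>

definition A :: "int \<Rightarrow> int \<Rightarrow> complex vec set" where
  "A k j = lin_span n ((F' j \<inter> W k) \<union> W (k - 1))"

definition H :: "int \<Rightarrow> int \<Rightarrow> int \<Rightarrow> complex vec set" where
  "H k i j = F i \<inter> A k j"

lemma weight: "is_subspace n (weight_fil X k)" "k \<le> l \<Longrightarrow> weight_fil X k \<subseteq> weight_fil X l"
    "(\<Union>k. weight_fil X k) = carrier_vec n" "(\<Inter>k. weight_fil X k) = {0\<^sub>v n}"
  and hodge: "is_subspace n (F p)" "p \<le> q \<Longrightarrow> F q \<subseteq> F p" "(\<Union>p. F p) = carrier_vec n" "(\<Inter>p. F p) = {0\<^sub>v n}"
proof -
  note f = mhs[unfolded is_mhs_def Let_def]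
  note g = f[THEN conjunct2, THEN conjunct2, THEN conjunct2, THEN conjunct2]
  show "is_subspace n (weight_fil X k)" by (rule f[THEN conjunct1, rule_format])
  show "k \<le> l \<Longrightarrow> weight_fil X k \<subseteq> weight_fil X l" by (rule f[THEN conjunct2, THEN conjunct1, rule_format])
  show "(\<Union>k. weight_fil X k) = carrier_vec n" by (rule f[THEN conjunct2, THEN conjunct2, THEN conjunct1])
  show "(\<Inter>k. weight_fil X k) = {0\<^sub>v n}" by (rule f[THEN conjunct2, THEN conjunct2, THEN conjunct2, THEN conjunct1])
  show "is_subspace n (F p)" by (rule g[THEN conjunct1, rule_format])
  show "p \<le> q \<Longrightarrow> F q \<subseteq> F p" by (rule g[THEN conjunct2, THEN conjunct1, rule_format])
  show "(\<Union>p. F p) = carrier_vec n" by (rule g[THEN conjunct2, THEN conjunct2, THEN conjunct1])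
  show "(\<Inter>p. F p) = {0\<^sub>v n}" by (rule g[THEN conjunct2, THEN conjunct2, THEN conjunct2, THEN conjunct1])
qed

lemma opposed:
  assumes "i + j \<noteq> k"
  shows "lin_span n ((F i \<inter> A k j) \<union> A k (j + 1)) = lin_span n ((F (i + 1) \<inter> A k j) \<union> A k (j + 1))"
proof -
  have "case gr_subquotient n F i (gr_subquotient n F' j (gr_weight n (weight_fil X) k)) of (P, Q) \<Rightarrow> P = Q"
    by (rule mhs[unfolded is_mhs_def Let_def, THEN conjunct2, THEN conjunct2, THEN conjunct2, THEN conjunct2, THEN conjunct2, THEN conjunct2, THEN conjunct2, THEN conjunct2, rule_format, OF assms])
  then show ?thesis unfolding gr_weight_def gr_subquotient_def A_def W_def by simp
qed

lemma W_eq: "W k = {z \<in> carrier_vec n. map_vec Re z \<in> weight_fil X k \<and> map_vec Im z \<in> weight_fil X k}"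
  unfolding W_def by (rule complexification_eq[OF weight(1)])

lemma W_sub: "is_subspace n (W k)"
  unfolding W_eq by (rule complex_of_real_subspace[OF weight(1)])

lemma W_mono: "k \<le> l \<Longrightarrow> W k \<subseteq> W l"
  unfolding W_eq using weight(2)[of k l] by blast

lemma W_cnj: "z \<in> W k \<Longrightarrow> map_vec cnj z \<in> W k"
proof -
  assume z: "z \<in> W k"
  have "map_vec Re (map_vec cnj z) = map_vec Re z" "map_vec Im (map_vec cnj z) = (- 1) \<cdot>\<^sub>v map_vec Im z"
    by (intro eq_vecI; simp)+
  then show ?thesis using z is_subspaceD(4)[OF weight(1)] unfolding W_eq by simp
qed

lemma W_real: "v \<in> carrier_vec n \<Longrightarrow> cv v \<in> W k \<longleftrightarrow> v \<in> weight_fil X k"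
proof -
  assume v: "v \<in> carrier_vec n"
  have "map_vec Re (cv v) = v" "map_vec Im (cv v) = 0\<^sub>v n" using v by (intro eq_vecI; auto)+
  then show ?thesis using v is_subspaceD(2)[OF weight(1)] unfolding W_eq by simp
qed

lemma W_lo: "\<exists>k. W k = {0\<^sub>v n}"
proof -
  have "\<exists>k. weight_fil X (- k) = {0\<^sub>v n}"
  proof (rule decreasing_subspaces_zero)
    show "(\<Inter>k. weight_fil X (- k)) = {0\<^sub>v n}"
    proof -
      have "(\<Inter>k. weight_fil X (- k)) = (\<Inter>k. weight_fil X k)"
      proof
        show "(\<Inter>k. weight_fil X (- k)) \<subseteq> (\<Inter>k. weight_fil X k)"
        proof (rule INT_greatest)
          fix k show "(\<Inter>k. weight_fil X (- k)) \<subseteq> weight_fil X k"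
            using INT_lower[of "- k" UNIV "\<lambda>k. weight_fil X (- k)"] by simp
        qed
      qed blast
      then show ?thesis using weight(4) by simp
    qed
    show "k \<le> l \<Longrightarrow> weight_fil X (- l) \<subseteq> weight_fil X (- k)" for k l by (rule weight(2)) simp
  qed (rule weight(1))
  then obtain k where k: "weight_fil X k = {0\<^sub>v n}" by blast
  have "W k \<subseteq> {0\<^sub>v n}"
  proof
    fix z assume "z \<in> W k"
    then have z: "z \<in> carrier_vec n" "map_vec Re z = 0\<^sub>v n" "map_vec Im z = 0\<^sub>v n" unfolding W_eq k by auto
    have "z = cv (0\<^sub>v n) + \<i> \<cdot>\<^sub>v cv (0\<^sub>v n)" using vec_Re_Im[OF z(1)] z(2,3) by simp
    also have "\<dots> = 0\<^sub>v n" by (rule eq_vecI) auto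
    finally show "z \<in> {0\<^sub>v n}" by simp
  qed
  then show ?thesis using is_subspaceD(2)[OF W_sub] by blast
qed

lemma W_hi: "\<exists>k. W k = carrier_vec n"
proof -
  obtain k where k: "weight_fil X k = carrier_vec n"
    using increasing_subspaces_exhaust[of "weight_fil X" n, OF weight(1-3)] by blast
  show ?thesis by (intro exI[of _ k]) (auto simp: W_eq k)
qed

lemma F'_iff: "z \<in> F' j \<longleftrightarrow> map_vec cnj z \<in> F j"
proof -
  have c: "conjugate v = map_vec cnj v" for v :: "complex vec" by (rule eq_vecI) auto
  show ?thesis unfolding conj_fil_def c by (metis image_iff map_vec_cnj_cnj)
qed

lemma F'_sub: "is_subspace n (F' j)"
proof (rule is_subspaceI)
  note S = is_subspaceD[OF hodge(1)[of j]]
  show "F' j \<subseteq> carrier_vec n"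
  proof
    fix z assume "z \<in> F' j"
    then have "map_vec cnj z \<in> carrier_vec n" unfolding F'_iff using S(1) by blast
    then show "z \<in> carrier_vec n" by simp
  qed
  then have c: "z \<in> F' j \<Longrightarrow> z \<in> carrier_vec n" for z by blast
  have "map_vec cnj (0\<^sub>v n) = 0\<^sub>v n" by (rule eq_vecI) auto
  then show "0\<^sub>v n \<in> F' j" unfolding F'_iff using S(2) by simp
  show "u + v \<in> F' j" if "u \<in> F' j" "v \<in> F' j" for u v
    unfolding F'_iff map_vec_cnj_add[OF c[OF that(1)] c[OF that(2)]] using that unfolding F'_iff by (rule S(3))
  show "a \<cdot>\<^sub>v v \<in> F' j" if "v \<in> F' j" for a v
  proof -
    have "map_vec cnj (a \<cdot>\<^sub>v v) = cnj a \<cdot>\<^sub>v map_vec cnj v" by (rule eq_vecI) auto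
    then show ?thesis unfolding F'_iff using S(4)[OF that[unfolded F'_iff]] by simp
  qed
qed

lemma F'_anti: "p \<le> q \<Longrightarrow> F' q \<subseteq> F' p"
  using hodge(2)[of p q] unfolding subset_iff F'_iff by blast

lemma F_lo: "\<exists>p. F p = carrier_vec n"
proof -
  have "\<exists>k. F (- k) = carrier_vec n"
  proof (rule increasing_subspaces_exhaust)
    show "(\<Union>k. F (- k)) = carrier_vec n"
    proof -
      have "(\<Union>p. F p) \<subseteq> (\<Union>k. F (- k))"
      proof (rule UN_least)
        show "F p \<subseteq> (\<Union>k. F (- k))" for p using UN_upper[of "- p" UNIV "\<lambda>k. F (- k)"] by simp
      qed
      moreover have "(\<Union>k. F (- k)) \<subseteq> (\<Union>p. F p)" by blast
      ultimately show ?thesis unfolding hodge(3) by (rule subset_antisym[rotated])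
    qed
    show "k \<le> l \<Longrightarrow> F (- k) \<subseteq> F (- l)" for k l by (rule hodge(2)) simp
  qed (rule hodge(1))
  then show ?thesis by blast
qed

lemma F_hi: "\<exists>p. F p = {0\<^sub>v n}"
  using decreasing_subspaces_zero[of F n, OF hodge(1,2,4)] .

lemma A_gen: "(F' j \<inter> W k) \<union> W (k - 1) \<subseteq> carrier_vec n"
  using is_subspaceD(1)[OF W_sub] by blast

lemma A_sub: "is_subspace n (A k j)"
  unfolding A_def by (rule lin_span_subspace[OF A_gen])

lemma A_mem: "v \<in> F' j \<Longrightarrow> v \<in> W k \<Longrightarrow> v \<in> A k j" "v \<in> W (k - 1) \<Longrightarrow> v \<in> A k j"
  unfolding A_def using lin_span_superset[OF A_gen] by blast+

lemma A_le: "A k j \<subseteq> W k"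
  unfolding A_def by (rule lin_span_least[OF W_sub]) (use W_mono[of "k - 1" k] in auto)

lemma A_anti: "j \<le> j' \<Longrightarrow> A k j' \<subseteq> A k j"
  unfolding A_def[of k j'] by (rule lin_span_least[OF A_sub]) (use A_mem F'_anti[of j j'] in blast)

lemma A_dest: "v \<in> A k j \<Longrightarrow> \<exists>a b. v = a + b \<and> a \<in> F' j \<and> a \<in> W k \<and> b \<in> W (k - 1)"
  unfolding A_def lin_span_Un_mem[OF is_subspace_Int[OF F'_sub W_sub] W_sub] by blast

lemma H_sub: "is_subspace n (H k i j)"
  unfolding H_def by (rule is_subspace_Int[OF hodge(1) A_sub])

lemma H_split:
  assumes ijk: "i + j \<noteq> k" and x: "x \<in> H k i j"
  shows "\<exists>y z. x = y + z \<and> y \<in> H k (i + 1) j \<and> z \<in> H k i (j + 1)"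
proof -
  have c: "(F i \<inter> A k j) \<union> A k (j + 1) \<subseteq> carrier_vec n" using is_subspaceD(1)[OF A_sub] by blast
  have "x \<in> lin_span n ((F i \<inter> A k j) \<union> A k (j + 1))" using x lin_span_superset[OF c] unfolding H_def by blast
  then have "x \<in> lin_span n ((F (i + 1) \<inter> A k j) \<union> A k (j + 1))" unfolding opposed[OF ijk] .
  then obtain y z where yz: "y \<in> F (i + 1) \<inter> A k j" "z \<in> A k (j + 1)" "x = y + z"
    unfolding lin_span_Un_mem[OF is_subspace_Int[OF hodge(1) A_sub] A_sub] by blast
  have yF: "y \<in> F i" using yz(1) hodge(2)[of i "i + 1"] by auto
  have cc: "x \<in> carrier_vec n" "y \<in> carrier_vec n" "z \<in> carrier_vec n"
    using yz x is_subspaceD(1)[OF A_sub] unfolding H_def by blast+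
  have "x - y \<in> F i" using is_subspaceD(5)[OF hodge(1)] x yF unfolding H_def by blast
  moreover have "x - y = z" unfolding yz(3) using cc by (intro eq_vecI) auto
  ultimately show ?thesis using yz unfolding H_def by blast
qed

text \<open>
  Above the diagonal, opposedness keeps moving the elements of \<open>H k i j\<close> to larger \<open>i\<close> or \<open>j\<close>,
  until they vanish modulo lower weights.
\<close>

lemma H_above:
  assumes "i + j > k"
  shows "H k i j \<subseteq> W (k - 1)"
proof -
  obtain p where p: "F p = {0\<^sub>v n}" using F_hi by blast
  show ?thesis using assms
  proof (induction "nat (p - i) + nat (p - j)" arbitrary: i j rule: less_induct)
    case less
    show ?case
    proof
      fix x assume x: "x \<in> H k i j"
      have "p \<le> i \<or> p \<le> j \<or> i < p \<and> j < p" by auto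
      then show "x \<in> W (k - 1)"
      proof (elim disjE)
        assume "p \<le> i"
        then have "x = 0\<^sub>v n" using x hodge(2)[of p i] p unfolding H_def by blast
        then show ?thesis using is_subspaceD(2)[OF W_sub] by simp
      next
        assume j: "p \<le> j"
        have "F' j \<subseteq> {0\<^sub>v n}"
        proof
          fix z assume "z \<in> F' j"
          then have "map_vec cnj z = 0\<^sub>v n" unfolding F'_iff using hodge(2)[OF j] p by blast
          then have "map_vec cnj (map_vec cnj z) = map_vec cnj (0\<^sub>v n)" by simp
          also have "\<dots> = 0\<^sub>v n" by (rule eq_vecI) auto
          finally show "z \<in> {0\<^sub>v n}" unfolding map_vec_cnj_cnj by simp
        qed
        then have "A k j \<subseteq> W (k - 1)" unfolding A_def
          using is_subspaceD(2)[OF W_sub[of "k - 1"]] by (intro lin_span_least[OF W_sub]) blast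
        then show ?thesis using x unfolding H_def by blast
      next
        assume ij: "i < p \<and> j < p"
        obtain y z where yz: "x = y + z" "y \<in> H k (i + 1) j" "z \<in> H k i (j + 1)"
          using H_split[OF _ x] less.prems by auto
        have "H k (i + 1) j \<subseteq> W (k - 1)" by (rule less.hyps) (use ij less.prems in auto)
        moreover have "H k i (j + 1) \<subseteq> W (k - 1)" by (rule less.hyps) (use ij less.prems in auto)
        ultimately show ?thesis unfolding yz(1) using yz(2,3) by (intro is_subspaceD(3)[OF W_sub]) auto
      qed
    qed
  qed
qed

text \<open>
  For small \<open>i\<close> and \<open>j\<close> the set \<open>H k i j\<close> is all of \<open>W k\<close>, and splitting moves its elements to the
  diagonal \<open>i + j = k\<close> or above, where they are of lower weight.
\<close>

lemma W_generated: "W k \<subseteq> lin_span n ((\<Union>p. H k p (k - p)) \<union> W (k - 1))" (is "_ \<subseteq> ?S")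
proof -
  have c: "(\<Union>p. H k p (k - p)) \<union> W (k - 1) \<subseteq> carrier_vec n"
    using is_subspaceD(1)[OF W_sub] is_subspaceD(1)[OF H_sub] by blast
  note sup = lin_span_superset[OF c] and S = lin_span_subspace[OF c]
  have 1: "H k i j \<subseteq> ?S" if "i + j \<ge> k" for i j
  proof (cases "i + j = k")
    case True
    then have "j = k - i" by simp
    then show ?thesis using sup by blast
  next
    case False
    then show ?thesis using H_above[of k i j] that sup by force
  qed
  have 2: "H k i j \<subseteq> ?S" for i j
  proof (induction "nat (k - i - j)" arbitrary: i j)
    case 0
    then show ?case using 1[of i j] by simp
  next
    case (Suc m)
    have ne: "i + j \<noteq> k" using Suc.hyps(2) by auto
    show ?case
    proof
      fix x assume x: "x \<in> H k i j"
      obtain y z where yz: "x = y + z" "y \<in> H k (i + 1) j" "z \<in> H k i (j + 1)"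
        using H_split[OF _ x] ne by blast
      have "H k (i + 1) j \<subseteq> ?S" by (rule Suc.hyps(1)) (use Suc.hyps(2) in auto)
      moreover have "H k i (j + 1) \<subseteq> ?S" by (rule Suc.hyps(1)) (use Suc.hyps(2) in auto)
      ultimately show "x \<in> ?S" unfolding yz(1) using yz(2,3) by (intro is_subspaceD(3)[OF S]) auto
    qed
  qed
  obtain p where p: "F p = carrier_vec n" using F_lo by blast
  have "W k \<subseteq> H k p p"
  proof
    fix z assume z: "z \<in> W k"
    then have zc: "z \<in> carrier_vec n" using is_subspaceD(1)[OF W_sub] by blast
    then have "z \<in> F' p" unfolding F'_iff p by simp
    then show "z \<in> H k p p" unfolding H_def using A_mem(1) z zc p by blast
  qed
  then show ?thesis using 2 by blast
qed

text \<open>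
  The elements of the \<open>H k p (k - p)\<close> span \<open>W k\<close> modulo \<open>W (k - 1)\<close>, and thus contain a basis that
  splits the weight filtration. Choosing them in \<open>F p\<close> lets them split the Hodge filtration, too.
\<close>

lemma basis_exists:
  "\<exists>E E' t. inverse_mats n E E' \<and> (\<forall>k. W k = colspan E (\<lambda>j. wt (t j) \<le> k))
    \<and> (\<forall>j<n. col E j \<in> H (wt (t j)) (fst (t j)) (snd (t j)))"
proof -
  obtain lo hi where lo: "W lo = {0\<^sub>v n}" and hi: "W hi = carrier_vec n" using W_lo W_hi by blast
  have HW: "(\<Union>p. H k p (k - p)) \<subseteq> W k" for k using A_le unfolding H_def by blast
  obtain E E' w where E: "inverse_mats n E E'" "\<forall>j<n. col E j \<in> (\<Union>p. H (w j) p (w j - p))" "\<forall>k. W k = colspan E (\<lambda>j. w j \<le> k)"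
    using filtered_basis[OF W_sub W_mono lo hi HW W_generated] by blast
  have "\<forall>j. \<exists>p. j < n \<longrightarrow> col E j \<in> H (w j) p (w j - p)" using E(2) by blast
  then obtain p where p: "\<And>j. j < n \<Longrightarrow> col E j \<in> H (w j) (p j) (w j - p j)" by metis
  define t where "t j = (p j, w j - p j)" for j
  have w: "wt (t j) = w j" "fst (t j) = p j" "snd (t j) = w j - p j" for j by (simp_all add: t_def)
  show ?thesis
  proof (intro exI conjI allI impI)
    show "inverse_mats n E E'" by (rule E(1))
    show "W k = colspan E (\<lambda>j. wt (t j) \<le> k)" for k unfolding w(1) using E(3) by blast
    show "col E j \<in> H (wt (t j)) (fst (t j)) (snd (t j))" if "j < n" for j using p[OF that] by (simp add: t_def)
  qed
qed

end

locale mixed_hodge_basis = mixed_hodge +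
  fixes E E' :: "complex mat" and t :: "nat \<Rightarrow> int \<times> int"
  assumes inv: "inverse_mats n E E'" and W_basis: "W k = colspan E (\<lambda>j. wt (t j) \<le> k)"
    and basis: "j < n \<Longrightarrow> col E j \<in> H (wt (t j)) (fst (t j)) (snd (t j))"
begin

lemmas E = inverse_matsD[OF inv]

lemma col_A: "j < n \<Longrightarrow> wt (t j) \<le> k \<Longrightarrow> (wt (t j) = k \<Longrightarrow> l \<le> snd (t j)) \<Longrightarrow> col E j \<in> A k l"
proof -
  assume j: "j < n" "wt (t j) \<le> k" "wt (t j) = k \<Longrightarrow> l \<le> snd (t j)"
  show ?thesis
  proof (cases "wt (t j) = k")
    case True
    then show ?thesis using basis[OF j(1)] A_anti[OF j(3)[OF True], of k] unfolding H_def by blast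
  next
    case False
    then have "col E j \<in> W (k - 1)" unfolding W_basis using j by (intro col_in_colspan[OF E(1)]) auto
    then show ?thesis by (rule A_mem(2))
  qed
qed

text \<open>
  If \<open>v\<close> has weight \<open>k\<close>, then it lies in \<open>A k (k - p + 1)\<close>, since the second degrees of its components
  of weight \<open>k\<close> are larger than \<open>k - p\<close>. So \<open>v\<close> lies in \<open>H k p (k - p + 1)\<close> and has lower weight.
  Repeating this, \<open>v\<close> has arbitrarily low weight.
\<close>

lemma F_low_zero:
  assumes vF: "v \<in> F p" and v: "v \<in> colspan E (\<lambda>j. fst (t j) < p)"
  shows "v = 0\<^sub>v n"
proof -
  have step: "v \<in> W (k - 1)" if k: "v \<in> W k" for k
  proof -
    have "v \<in> colspan E (\<lambda>j. fst (t j) < p \<and> wt (t j) \<le> k)"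
      using v k unfolding W_basis colspan_iff[OF inv] by blast
    moreover have "colspan E (\<lambda>j. fst (t j) < p \<and> wt (t j) \<le> k) \<subseteq> A k (k - p + 1)"
      by (rule colspan_least[OF E(1) A_sub], rule col_A) auto
    ultimately have "v \<in> H k p (k - p + 1)" unfolding H_def using vF by blast
    then show ?thesis using H_above[of k p "k - p + 1"] by auto
  qed
  obtain lo hi where lo: "W lo = {0\<^sub>v n}" and hi: "W hi = carrier_vec n" using W_lo W_hi by blast
  have "v \<in> W (hi - int m)" for m
  proof (induction m)
    case 0
    then show ?case using vF is_subspaceD(1)[OF hodge(1)] hi by auto
  next
    case (Suc m)
    from step[OF this] show ?case by (simp add: algebra_simps)
  qed
  from this[of "nat (hi - lo)"] have "v \<in> W (hi - int (nat (hi - lo)))" .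
  moreover have "hi - int (nat (hi - lo)) \<le> lo" by linarith
  ultimately have "v \<in> W lo" using W_mono by blast
  then show ?thesis using lo by simp
qed

lemma F_basis: "F p = colspan E (\<lambda>j. p \<le> fst (t j))"
proof
  show sub: "colspan E (\<lambda>j. p \<le> fst (t j)) \<subseteq> F p"
    by (rule colspan_least[OF E(1) hodge(1)]) (use basis hodge(2) in \<open>unfold H_def, blast\<close>)
  show "F p \<subseteq> colspan E (\<lambda>j. p \<le> fst (t j))"
  proof
    fix v assume v: "v \<in> F p"
    then have vc: "v \<in> carrier_vec n" using is_subspaceD(1)[OF hodge(1)] by blast
    obtain y where y: "y \<in> carrier_vec n" "\<forall>i<n. (E' *\<^sub>v y) $ i = (if p \<le> fst (t i) then (E' *\<^sub>v v) $ i else 0)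
        \<and> (E' *\<^sub>v (v - y)) $ i = (if p \<le> fst (t i) then 0 else (E' *\<^sub>v v) $ i)"
      using colspan_split[OF inv vc, of "\<lambda>i. p \<le> fst (t i)"] by blast
    have 1: "y \<in> colspan E (\<lambda>j. p \<le> fst (t j))" unfolding colspan_iff[OF inv] using y by (auto split: if_splits)
    have vyc: "v - y \<in> carrier_vec n" using vc y by simp
    have "v - y \<in> colspan E (\<lambda>j. fst (t j) < p)" unfolding colspan_iff[OF inv]
    proof (intro conjI allI impI vyc)
      fix i assume "i < n" "(E' *\<^sub>v (v - y)) $ i \<noteq> 0"
      then show "fst (t i) < p" using y(2) by (metis linorder_not_le)
    qed
    moreover have "v - y \<in> F p" using v 1 sub by (intro is_subspaceD(5)[OF hodge(1)]) auto
    ultimately have "v - y = 0\<^sub>v n" using F_low_zero by blast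
    then have "(v - y) $ i = 0" if "i < n" for i using that by simp
    then have "v = y" using vc y(1) by (intro eq_vecI) auto
    then show "v \<in> colspan E (\<lambda>j. p \<le> fst (t j))" using 1 by simp
  qed
qed

text \<open>
  Modulo lower weights, conjugation exchanges the types \<open>(p, q)\<close> and \<open>(q, p)\<close>: it takes an
  element of type \<open>(p, q)\<close> to \<open>F q\<close>, and a component in \<open>F (q + 1)\<close> would lie in
  \<open>H k (q + 1) p\<close>, which vanishes modulo lower weights.
\<close>

lemma conj_basis: "has_supp n t (swap_types t) (\<lambda>a b. same_type a b \<or> a + b < 0) (E' * cnj_mat E)"
proof (rule has_suppI)
  show Mc: "E' * cnj_mat E \<in> carrier_mat n n" using E by auto
  fix i j assume ij: "i < n" "j < n" and ne: "(E' * cnj_mat E) $$ (i, j) \<noteq> 0"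
  define k p q where "k = wt (t j)" and "p = fst (t j)" and "q = snd (t j)"
  have kpq: "k = p + q" by (simp add: k_def p_def q_def)
  define e where "e = map_vec cnj (col E j)"
  have ecol: "e = col (cnj_mat E) j" unfolding e_def using ij E by (intro eq_vecI) auto
  have Ei: "(E' *\<^sub>v e) $ i \<noteq> 0" using ne ij E unfolding ecol by simp
  have Hj: "col E j \<in> F p" "col E j \<in> A k q" using basis[OF ij(2)] unfolding H_def k_def p_def q_def by auto
  have eW: "e \<in> W k" unfolding e_def using W_cnj A_le Hj(2) by blast
  have wi: "wt (t i) \<le> k" using eW Ei ij(1) unfolding W_basis colspan_iff[OF inv] by blast
  have eF: "e \<in> F' p" unfolding F'_iff e_def map_vec_cnj_cnj by (rule Hj(1))
  have "fst (t i) = q" if wk: "wt (t i) = k"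
  proof -
    obtain a b where ab: "col E j = a + b" "a \<in> F' q" "a \<in> W k" "b \<in> W (k - 1)" using A_dest[OF Hj(2)] by blast
    have abc: "a \<in> carrier_vec n" "b \<in> carrier_vec n" using ab is_subspaceD(1)[OF W_sub] by blast+
    define u v where "u = map_vec cnj a" and "v = map_vec cnj b"
    have e_uv: "e = u + v" unfolding e_def ab(1) u_def v_def by (rule map_vec_cnj_add[OF abc])
    have uc: "u \<in> carrier_vec n" "v \<in> carrier_vec n" unfolding u_def v_def using abc by auto
    have uF: "u \<in> F q" using ab(2) unfolding F'_iff u_def .
    have uW: "u \<in> W k" unfolding u_def using W_cnj ab(3) .
    have vW: "v \<in> W (k - 1)" unfolding v_def using W_cnj ab(4) .
    have vi: "(E' *\<^sub>v v) $ l = 0" if "l < n" "wt (t l) = k" for l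
      using vW that unfolding W_basis colspan_iff[OF inv] by force
    have "E' *\<^sub>v e = E' *\<^sub>v u + E' *\<^sub>v v" unfolding e_uv using E uc by (intro mult_add_distrib_mat_vec) auto
    then have "(E' *\<^sub>v e) $ i = (E' *\<^sub>v u) $ i + (E' *\<^sub>v v) $ i" using E ij by (simp del: index_mult_mat_vec)
    then have ui: "(E' *\<^sub>v u) $ i \<noteq> 0" using Ei vi[OF ij(1) wk] by simp
    have ge: "q \<le> fst (t l)" if "l < n" "(E' *\<^sub>v u) $ l \<noteq> 0" for l
      using uF that unfolding F_basis colspan_iff[OF inv] by blast
    have le: "wt (t l) \<le> k" if "l < n" "(E' *\<^sub>v u) $ l \<noteq> 0" for l
      using uW that unfolding W_basis colspan_iff[OF inv] by blast
    have "\<not> q + 1 \<le> fst (t i)"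
    proof
      assume h: "q + 1 \<le> fst (t i)"
      obtain y where y: "y \<in> carrier_vec n" "\<forall>i<n. (E' *\<^sub>v y) $ i = (if q + 1 \<le> fst (t i) then (E' *\<^sub>v u) $ i else 0)
          \<and> (E' *\<^sub>v (u - y)) $ i = (if q + 1 \<le> fst (t i) then 0 else (E' *\<^sub>v u) $ i)"
        using colspan_split[OF inv uc(1), of "\<lambda>i. q + 1 \<le> fst (t i)"] by blast
      have yF: "y \<in> F (q + 1)" unfolding F_basis colspan_iff[OF inv] using y by (auto split: if_splits)
      have uyc: "u - y \<in> carrier_vec n" using uc y by simp
      have "u - y \<in> colspan E (\<lambda>l. fst (t l) = q \<and> wt (t l) \<le> k)" unfolding colspan_iff[OF inv]
      proof (intro conjI allI impI uyc)
        fix l assume l: "l < n" "(E' *\<^sub>v (u - y)) $ l \<noteq> 0"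
        then have "\<not> q + 1 \<le> fst (t l)" "(E' *\<^sub>v u) $ l \<noteq> 0" using y(2) by (metis)+
        then show "fst (t l) = q" "wt (t l) \<le> k" using ge[OF l(1)] le[OF l(1)] by auto
      qed
      moreover have "colspan E (\<lambda>l. fst (t l) = q \<and> wt (t l) \<le> k) \<subseteq> A k p"
        by (rule colspan_least[OF E(1) A_sub], rule col_A) (use kpq in auto)
      ultimately have uy: "u - y \<in> A k p" by blast
      have uA: "u \<in> A k p"
      proof -
        have "e - v \<in> A k p" using A_mem(1)[OF eF eW] A_mem(2)[OF vW] by (rule is_subspaceD(5)[OF A_sub])
        moreover have "e - v = u" unfolding e_uv using uc by (intro eq_vecI) auto
        ultimately show ?thesis by simp
      qed
      have "u - (u - y) \<in> A k p" by (rule is_subspaceD(5)[OF A_sub uA uy])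
      moreover have "u - (u - y) = y" using uc y(1) by (intro eq_vecI) auto
      ultimately have "y \<in> H k (q + 1) p" unfolding H_def using yF by simp
      then have "y \<in> W (k - 1)" using H_above[of k "q + 1" p] kpq by auto
      moreover have "(E' *\<^sub>v y) $ i \<noteq> 0" using y(2) ij(1) h ui by simp
      ultimately have "wt (t i) \<le> k - 1" using ij(1) unfolding W_basis colspan_iff[OF inv] by blast
      then show False using wk by simp
    qed
    then show ?thesis using ge[OF ij(1) ui] by simp
  qed
  then show "same_type (fst (t i) - fst (swap_types t j)) (snd (t i) - snd (swap_types t j)) \<or>
      fst (t i) - fst (swap_types t j) + (snd (t i) - snd (swap_types t j)) < 0"
    using wi kpq unfolding p_def[symmetric] q_def[symmetric] by (auto simp: p_def q_def k_def)
qed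

lemma datum_exists: "\<exists>T T' s D. datum n T T' s D \<and> X = mhs_of n T s D"
proof -
  let ?M = "E' * cnj_mat E"
  have MM: "?M * cnj_mat ?M = 1\<^sub>m n"
  proof -
    have dims: "dim_row E = n" "dim_col E = n" "dim_row E' = n" "dim_col E' = n" using E by auto
    have "?M * cnj_mat ?M = E' * (cnj_mat E * (cnj_mat E' * E))"
      using dims by (simp add: cnj_mat_mult cnj_mat_cnj_mat mult_assoc_dims)
    also have "cnj_mat E * (cnj_mat E' * E) = E" using inverse_mats_cancel(1)[OF cnj_mat_inverse[OF inv]] dims by simp
    finally show ?thesis using E by simp
  qed
  obtain G G' where G: "inverse_mats n G G'" and Gs: "has_supp n t t (\<lambda>a b. a \<ge> 0 \<and> a + b \<le> 0) G" "has_supp n t t (\<lambda>a b. a \<ge> 0 \<and> a + b \<le> 0) G'"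
    and S: "has_supp n t (swap_types t) (\<lambda>a b. same_type a b \<or> both_neg a b) (G' * ?M * cnj_mat G)"
    using straighten[OF conj_basis MM] by blast
  note Gc = inverse_matsD[OF G]
  have EG: "inverse_mats n (E * G) (G' * E')" by (rule inverse_mats_mult[OF inv G])
  have "G' * ?M * cnj_mat G = G' * E' * cnj_mat (E * G)"
    using E Gc by (simp add: cnj_mat_mult mult_assoc_dims)
  then have S': "has_supp n t (swap_types t) (\<lambda>a b. same_type a b \<or> both_neg a b) (G' * E' * cnj_mat (E * G))" using S by simp
  have change: "colspan (E * G) P = colspan E P"
    if P: "\<And>i j. fst (t i) \<ge> fst (t j) \<Longrightarrow> wt (t i) \<le> wt (t j) \<Longrightarrow> P j \<Longrightarrow> P i" for P
  proof (rule colspan_change[OF inv G])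
    show "P i" if "i < n" "j < n" "G $$ (i, j) \<noteq> 0" "P j" for i j
      using has_suppD[OF Gs(1) that(1-3)] that(4) by (intro P[of j i]) auto
    show "P i" if "i < n" "j < n" "G' $$ (i, j) \<noteq> 0" "P j" for i j
      using has_suppD[OF Gs(2) that(1-3)] that(4) by (intro P[of j i]) auto
  qed
  obtain T T' D where d: "datum n T T' t D" "E * G = mexp n \<i> (cm D) * T" "\<And>k. colspan T (\<lambda>i. wt (t i) \<le> k) = colspan (E * G) (\<lambda>i. wt (t i) \<le> k)"
    using datum_of_straight[OF EG S'] by blast
  have F: "hodge_fil X p = hodge_fil (mhs_of n T t D) p" for p
    using change[of "\<lambda>i. p \<le> fst (t i)"] unfolding F_basis mhs_of_def mhs.simps d(2)[symmetric] by auto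
  have Wf: "weight_fil X k = weight_fil (mhs_of n T t D) k" for k
  proof -
    have "colspan T (\<lambda>i. wt (t i) \<le> k) = W k" unfolding d(3) W_basis by (rule change) auto
    then show ?thesis using W_real[of _ k] is_subspaceD(1)[OF weight(1)[of k]] by (auto simp: mhs_of_def)
  qed
  have "X = mhs_of n T t D"
    by (rule mhs.equality) (use F Wf in \<open>auto simp: mhs_of_def\<close>)
  then show ?thesis using d(1) by blast
qed

end

text \<open>
  Deligne's splitting: a bigrading that is invariant under conjugation splits the weight filtration,
  and it splits the Hodge filtration up to \<open>exp (\<i> D)\<close>.
\<close>

lemma mhs_has_datum: "is_mhs X \<Longrightarrow> \<exists>T T' t D. datum (mhs_dim X) T T' t D \<and> X = mhs_of (mhs_dim X) T t D"
proof -
  assume X: "is_mhs X"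
  interpret mixed_hodge X by unfold_locales (rule X)
  obtain E E' t where "inverse_mats n E E'" "\<forall>k. W k = colspan E (\<lambda>j. wt (t j) \<le> k)"
    "\<forall>j<n. col E j \<in> H (wt (t j)) (fst (t j)) (snd (t j))" using basis_exists by blast
  then interpret mixed_hodge_basis X E E' t by unfold_locales blast+
  show ?thesis by (rule datum_exists)
qed

lemma corresponds_total:
  "is_shs A \<Longrightarrow> \<exists>X. corresponds A X" "is_mhs X \<Longrightarrow> \<exists>A. corresponds A X"
proof -
  show "\<exists>X. corresponds A X" if A: "is_shs A"
  proof -
    have "S_representation (shs_dim A) (shs_rep A)" using A unfolding is_shs_iff by blast
    then obtain T T' t where "adapted (shs_dim A) (shs_rep A) T T' t" using S_representation_adapted by blast
    then show ?thesis unfolding corresponds_def using A by blast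
  qed
  show "\<exists>A. corresponds A X" if X: "is_mhs X"
  proof -
    obtain T T' t D where d: "datum (mhs_dim X) T T' t D" and e: "X = mhs_of (mhs_dim X) T t D" using mhs_has_datum[OF X] by blast
    obtain A where A: "is_shs A" "shs_dim A = mhs_dim X" "adapted (mhs_dim X) (shs_rep A) T T' t" "shs_D A = D"
      using datum_shs[OF d] by blast
    have "adapted (shs_dim A) (shs_rep A) T T' t" using A(2,3) by simp
    moreover have "X = mhs_of (shs_dim A) T t (shs_D A)" using e A(2,4) by simp
    ultimately show ?thesis unfolding corresponds_def using A(1) by blast
  qed
qed

lemma corresponds_obj:
  assumes "corresponds A X"
  shows "is_shs A" "is_mhs X" "shs_dim A = mhs_dim X"
proof -
  obtain T T' t where A: "is_shs A" and a: "adapted (shs_dim A) (shs_rep A) T T' t" and X: "X = mhs_of (shs_dim A) T t (shs_D A)"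
    by (rule correspondsE[OF assms])
  show "is_shs A" by (rule A)
  show "is_mhs X" unfolding X by (rule datum.is_mhs[OF shs_datum[OF A a]])
  show "shs_dim A = mhs_dim X" by (simp add: X mhs_of_def)
qed

section \<open>The equivalence\<close>

lemma MHS_matrix_category_data: "matrix_category_data MHS mhs_dim"
  by unfold_locales (auto simp: MHS_def mhs_tensor_def mhs_unit_def mhs_dual_def mhs_hom_def Let_def)

lemma matrix_correspondence: "matrix_correspondence MHS mhs_dim SHS shs_dim corresponds"
proof (intro matrix_correspondence.intro matrix_correspondence_axioms.intro MHS_matrix_category_data SHS_matrix_tensor_category)
  fix A X B Y
  show "corresponds A X \<Longrightarrow> A \<in> Obj SHS" "corresponds A X \<Longrightarrow> X \<in> Obj MHS" "corresponds A X \<Longrightarrow> shs_dim A = mhs_dim X"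
    using corresponds_obj[of A X] by (simp_all add: SHS_def MHS_def)
  show "A \<in> Obj SHS \<Longrightarrow> \<exists>X. corresponds A X" "X \<in> Obj MHS \<Longrightarrow> \<exists>A. corresponds A X"
    using corresponds_total by (simp_all add: SHS_def MHS_def)
  show "corresponds A X \<Longrightarrow> corresponds B Y \<Longrightarrow> Hom SHS A B = Hom MHS X Y"
    using corresponds_hom by (simp add: SHS_def MHS_def)
  show "corresponds (UnitO SHS) (UnitO MHS)" using corresponds_unit by (simp add: SHS_def MHS_def)
  show "corresponds A X \<Longrightarrow> corresponds B Y \<Longrightarrow> corresponds (TensO SHS A B) (TensO MHS X Y)"
    using corresponds_tensor by (simp add: SHS_def MHS_def)
  show "corresponds A X \<Longrightarrow> corresponds (DualO SHS A) (DualO MHS X)"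
    using corresponds_dual by (simp add: SHS_def MHS_def)
qed

theorem theorem13p5:
  shows "\<exists>F G \<eta> \<epsilon> \<mu> \<iota> \<nu>.
    equivalence_of_categories MHS SHS F G \<eta> \<epsilon>
    \<and> additive_functor MHS SHS F
    \<and> tensor_functor MHS SHS F \<mu> \<iota>
    \<and> dual_preserving_functor MHS SHS F \<mu> \<iota> \<nu>"
proof -
  interpret matrix_correspondence MHS mhs_dim SHS shs_dim corresponds by (rule matrix_correspondence)
  show ?thesis using equivalence additive tensor dual_preserving by blast
qed

end
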